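(* Let $s\ge\frac12$. There exists $\varepsilon>0$ such that, for all $T_1\in(0,1]$ and all sequences of functions $\{v_j^n\}_{n\in\mathbb{Z}}$ $(j=1,\dots,5)$ on $\mathbb{T}$ supported on the time grid $n\tau\in[-2T_1,2T_1]$, the following estimates hold, with implicit constants independent of $\tau\in(0,1]$: $$\|\Pi_\tau(\Pi_\tau v_1^n\,\Pi_\tau v_2^n\,\partial_x\Pi_\tau\overline v_3^n)\|_{Z_\tau^{s,-\frac12}}\lesssim T_1^\varepsilon\sum_{k=1}^3\|v_k^n\|_{X_\tau^{s,\frac12}}\prod_{j=1,\,j\ne k}^3\|v_j^n\|_{X_\tau^{\frac12,\frac12}},$$ $$\Big\|\Pi_\tau\Big(\Pi_\tau\overline v_1^n\,\Pi_\tau\overline v_2^n\prod_{j=3}^5\Pi_\tau v_j^n\Big)\Big\|_{X_\tau^{s,-\frac38}}\lesssim T_1^\varepsilon\sum_{k=1}^5\|v_k^n\|_{X_\tau^{s,\frac12}}\prod_{j=1,\,j\ne k}^5\|v_j^n\|_{X_\tau^{\frac12,\frac12}},$$ $$\|\Pi_\tau(\Pi_\tau\overline v_3^n\,\Pi_\tau v_4^n\,\Pi_\tau v_5^n)\|_{X_\tau^{s,-\frac38}}\lesssim T_1^\varepsilon\sum_{k=3}^5\|v_k^n\|_{X_\tau^{s,\frac12}}\prod_{j=3,\,j\ne k}^5\|v_j^n\|_{X_\tau^{\frac12,\frac12}},$$ $$\|(\psi(\Pi_\tau v_1^n)-\psi(\Pi_\tau v_2^n))\Pi_\tau v_3^n\|_{X_\tau^{s,0}}\lesssim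 T_1^\varepsilon\Big(1+\|v_1^n\|_{X_\tau^{\frac12,\frac12}\cap Z_\tau^{0,\frac12}}+\|v_2^n\|_{X_\tau^{\frac12,\frac12}\cap Z_\tau^{0,\frac12}}\Big)^3\|v_1^n-v_2^n\|_{X_\tau^{\frac12,\frac12}\cap Z_\tau^{0,\frac12}}\|v_3^n\|_{X_\tau^{s,\frac12}}.$$
   Context: $\mathbb{T}=\mathbb{R}/2\pi\mathbb{Z}$, $\tau\in(0,1]$, $\langle y\rangle=(1+|y|^2)^{1/2}$. $A\lesssim B$ means $A\le CB$ with $C$ independent of $\tau\in(0,1]$ (and of $T_1$ and the sequences). "Supported on $n\tau\in[-2T_1,2T_1]$" means $v_j^n=0$ whenever $|n\tau|>2T_1$. For a sequence $\{v^n\}_{n\in\mathbb{Z}}$ of functions on $\mathbb{T}$ define $$\widetilde{v^n}(\sigma,k)=\tau\sum_{m\in\mathbb{Z}}\widehat{v^m}(k)e^{-im\tau\sigma},\qquad\widehat{v^m}(k)=\frac1{2\pi}\int_{-\pi}^{\pi}v^m(x)e^{-ikx}dx,$$ and $d_\tau(\sigma)=\frac{e^{i\tau\sigma}-1}{\tau}$. The discrete Bourgain norms are $$\|v^n\|_{X_\tau^{s,b}}^2=\sum_{k\in\mathbb{Z}}\int_{-\pi/\tau}^{\pi/\tau}\langle k\rangle^{2s}\langle d_\tau(\sigma+k^2)\rangle^{2b}|\widetilde{v^n}(\sigma,k)|^2d\sigma,$$ $$\|v^n\|_{Y_\tau^{s,b}}^2=\sum_{k\in\mathbb{Z}}\Big(\int_{-\pi/\tau}^{\pi/\tau}\langle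 k\rangle^{s}\langle d_\tau(\sigma+k^2)\rangle^{b}|\widetilde{v^n}(\sigma,k)|d\sigma\Big)^2,$$ $$\|v^n\|_{Z_\tau^{s,b}}=\|v^n\|_{X_\tau^{s,b}}+\|v^n\|_{Y_\tau^{s,b-\frac12}},$$ and the norm of an intersection is the sum of the norms. $\Pi_\tau$ is the Fourier projection onto frequencies $|k|\le\tau^{-1/2}$. By convention $\Pi_\tau f\,\Pi_\tau g=(\Pi_\tau f)(\Pi_\tau g)$. For a sequence $w=\{w^n\}_{n\in\mathbb{Z}}$, $$\psi(w^n)=\frac1{2\pi}\int_0^{2\pi}\Big(2\,\mathrm{Im}(\overline{\partial_xw^n}\,w^n)-\frac12|w^n|^4\Big)(\theta)\,d\theta+\Big(\frac1{2\pi}\|w^0\|_{L^2}^2\Big)^2 .$$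
   Formalization: The estimates are stated under the extra condition τ ≤ 2T_1; otherwise only n=0 lies in the time window and, with constants independent of T_1, the printed bounds fail as T_1→0 (e.g. τ=1, v_j^0=e^{ix}, other terms zero). *)

theory Defs
  imports "HOL-Analysis.Analysis"
begin

(* A function on T = R/(2 pi Z) is a 2 pi-periodic function on the reals. Integrability over
   one period is exactly what the Fourier coefficients require. *)

definition torus_fun :: "(real \<Rightarrow> complex) \<Rightarrow> bool" where
  "torus_fun f \<longleftrightarrow> (\<forall>x. f (x + 2 * pi) = f x) \<and> set_integrable lborel {-pi..pi} f"

definition fourier_coeff :: "(real \<Rightarrow> complex) \<Rightarrow> int \<Rightarrow> complex" where
  "fourier_coeff f k =
     1 / (2 * pi) * (LINT x:{-pi..pi}|lborel. f x * cis (- (real_of_int k * x)))"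

definition Proj :: "real \<Rightarrow> (real \<Rightarrow> complex) \<Rightarrow> real \<Rightarrow> complex" where
  "Proj \<tau> f x =
     (\<Sum>k | \<bar>real_of_int k\<bar> \<le> \<tau> powr (-1/2). fourier_coeff f k * cis (real_of_int k * x))"

definition ddx :: "(real \<Rightarrow> complex) \<Rightarrow> real \<Rightarrow> complex" where
  "ddx f x = vector_derivative f (at x)"

definition conj_fun :: "(real \<Rightarrow> complex) \<Rightarrow> real \<Rightarrow> complex" where
  "conj_fun f x = cnj (f x)"

definition japanese :: "'a::real_normed_vector \<Rightarrow> real" where
  "japanese y = sqrt (1 + (norm y)\<^sup>2)"

definition d_tau :: "real \<Rightarrow> real \<Rightarrow> complex" where
  "d_tau \<tau> \<sigma> = (cis (\<tau> * \<sigma>) - 1) / of_real \<tau>"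

definition tilde :: "real \<Rightarrow> (int \<Rightarrow> real \<Rightarrow> complex) \<Rightarrow> real \<Rightarrow> int \<Rightarrow> complex" where
  "tilde \<tau> v \<sigma> k =
     of_real \<tau> * (\<Sum>\<^sub>\<infinity>m. fourier_coeff (v m) k * cis (- (real_of_int m * \<tau> * \<sigma>)))"

(* The norms take values in [0, infinity], being infinite for sequences outside the space. *)

definition ennsqrt :: "ennreal \<Rightarrow> ennreal" where
  "ennsqrt a = (if a = \<infinity> then \<infinity> else ennreal (sqrt (enn2real a)))"

definition X_norm :: "real \<Rightarrow> real \<Rightarrow> real \<Rightarrow> (int \<Rightarrow> real \<Rightarrow> complex) \<Rightarrow> ennreal" where
  "X_norm \<tau> s b v = ennsqrt (\<integral>\<^sup>+k.
     (\<integral>\<^sup>+\<sigma>\<in>{-pi/\<tau>..pi/\<tau>}. ennreal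
        (japanese (real_of_int k) powr (2 * s)
         * japanese (d_tau \<tau> (\<sigma> + (real_of_int k)\<^sup>2)) powr (2 * b)
         * (norm (tilde \<tau> v \<sigma> k))\<^sup>2) \<partial>lborel) \<partial>count_space UNIV)"

definition Y_norm :: "real \<Rightarrow> real \<Rightarrow> real \<Rightarrow> (int \<Rightarrow> real \<Rightarrow> complex) \<Rightarrow> ennreal" where
  "Y_norm \<tau> s b v = ennsqrt (\<integral>\<^sup>+k.
     (\<integral>\<^sup>+\<sigma>\<in>{-pi/\<tau>..pi/\<tau>}. ennreal
        (japanese (real_of_int k) powr s
         * japanese (d_tau \<tau> (\<sigma> + (real_of_int k)\<^sup>2)) powr b
         * norm (tilde \<tau> v \<sigma> k)) \<partial>lborel)\<^sup>2 \<partial>count_space UNIV)"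

definition Z_norm :: "real \<Rightarrow> real \<Rightarrow> real \<Rightarrow> (int \<Rightarrow> real \<Rightarrow> complex) \<Rightarrow> ennreal" where
  "Z_norm \<tau> s b v = X_norm \<tau> s b v + Y_norm \<tau> s (b - 1/2) v"

(* The norm of the intersection of X^{1/2,1/2} and Z^{0,1/2}. *)

definition XZ_norm :: "real \<Rightarrow> (int \<Rightarrow> real \<Rightarrow> complex) \<Rightarrow> ennreal" where
  "XZ_norm \<tau> v = X_norm \<tau> (1/2) (1/2) v + Z_norm \<tau> 0 (1/2) v"

definition L2_norm :: "(real \<Rightarrow> complex) \<Rightarrow> real" where
  "L2_norm f = sqrt (LINT x:{-pi..pi}|lborel. (norm (f x))\<^sup>2)"

(* psi depends on the whole sequence: besides w n it involves the initial term w 0. *)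

definition psi :: "(int \<Rightarrow> real \<Rightarrow> complex) \<Rightarrow> int \<Rightarrow> real" where
  "psi w n =
     1 / (2 * pi) * (LINT \<theta>:{0..2 * pi}|lborel.
        2 * Im (cnj (ddx (w n) \<theta>) * w n \<theta>) - 1/2 * (norm (w n \<theta>)) ^ 4)
     + (1 / (2 * pi) * (L2_norm (w 0))\<^sup>2)\<^sup>2"

definition supported_on_grid :: "real \<Rightarrow> real \<Rightarrow> (int \<Rightarrow> real \<Rightarrow> complex) \<Rightarrow> bool" where
  "supported_on_grid \<tau> T1 v \<longleftrightarrow>
     (\<forall>n. \<bar>real_of_int n * \<tau>\<bar> > 2 * T1 \<longrightarrow> (\<forall>x. v n x = 0))"

end

theory Submission
  imports Defs
begin

text \<open>
  Below \<open>dt\<close> is the time step \<open>\<tau>\<close>, and \<open>SI k. f k\<close> is the sum over the integers, as a nonnegative integral.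

  On the space-time frequency group \<open>int \<times> circ\<close> every estimate becomes a weighted bound for
  convolutions of nonnegative functions, proved by Cauchy-Schwarz, duality and the symmetries of
  the multilinear form. For the derivative nonlinearity with output frequency \<open>k = p + q - r\<close> one has
  \<open>k r = p q - (k - p) (k - q)\<close>, and twice \<open>(k - p) (k - q)\<close> is the resonance function. Since the
  projection keeps it below \<open>2 / \<tau>\<close>, it is controlled by the largest discrete modulation weight,
  which absorbs the derivative. The power of \<open>T1\<close> comes from the uncertainty principle: the
  transform of a sequence supported on \<open>O(T1 / \<tau>)\<close> times cannot concentrate at low modulation. For the
  functional \<open>\<psi>\<close> the estimate is done pointwise in time, in terms of the squared \<open>H\<^sup>1\<^sup>/\<^sup>2\<close> norms, whose time
  transforms are controlled by convolutions over the circle; the \<open>Y\<close> norm bounds the mass at time 0.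
\<close>

text \<open>The weights see a modulation only modulo \<open>2 * pi / dt\<close>, so a large phase
  and its aliases look alike. The estimates survive because frequencies up to
  \<open>dt powr (-1/2)\<close> have squares at most \<open>1 / dt\<close>: every phase that occurs
  stays below \<open>2 / dt\<close>, less than the half period \<open>pi / dt\<close>, and a bounded
  number of translates suffices. The multilinear bounds use modulation exponent 12/25 in place of
  1/2. The slack 1/50 is what time localisation turns into \<open>T1 powr (1/200)\<close>. An input
  that pays for the derivative spends its whole exponent 1/2 and keeps no slack, so the gain is then
  taken from another input. All quantities take values in [0, infinity], so that sums and integrals
  may be exchanged without integrability conditions. The condition \<open>dt <= 2 * T1\<close>
  enters the count of time steps: if \<open>dt\<close> were larger, time 0 would still be on the
  grid and the count times \<open>dt\<close> would be \<open>dt\<close> itself, which is not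
  \<open>O(T1)\<close>.\<close>

section \<open>Square roots, L2 norms and duality in [0, infinity]\<close>

lemma ennsqrt_sq [simp]: "(ennsqrt x)\<^sup>2 = x"
 by (cases x) (auto simp: ennsqrt_def ennreal_power)

lemma ennsqrt_ennreal: "0 <= x ==> ennsqrt (ennreal x) = ennreal (sqrt x)"
 by (simp add: ennsqrt_def)

lemma ennsqrt_mono: "x <= y ==> ennsqrt x <= ennsqrt y"
 by (cases x; cases y) (auto simp: ennsqrt_def top_unique)

lemma ennsqrt_of_sq [simp]: "ennsqrt (x\<^sup>2) = x"
 by (cases x) (auto simp: ennreal_power ennsqrt_ennreal, simp add: ennsqrt_def)

lemma ennsqrt_mult: "ennsqrt (x * y) = ennsqrt x * ennsqrt y"
proof -
 have "ennsqrt (x * y) = ennsqrt ((ennsqrt x * ennsqrt y)\<^sup>2)"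
  by (simp add: power_mult_distrib del: ennsqrt_of_sq)
 then show ?thesis by simp
qed

lemma ennsqrt_add: "ennsqrt (x + y) <= ennsqrt x + ennsqrt y"
proof -
 have "x + y <= (ennsqrt x + ennsqrt y)\<^sup>2"
  by (simp add: power2_sum del: ennsqrt_of_sq)
 from ennsqrt_mono[OF this] show ?thesis by simp
qed

lemma le_of_sq_le: fixes x y :: ennreal assumes "x\<^sup>2 <= y\<^sup>2" shows "x <= y"
 using ennsqrt_mono[OF assms] by simp

text \<open>Replacing the smaller summand by the larger one suffices. The constant 4 is a perfect
  square, which leaves the factor 2 in \<open>nrm_add\<close>.\<close>

lemma ennreal_sq_add_le: fixes x y :: ennreal shows "(x + y)\<^sup>2 <= 4 * (x\<^sup>2 + y\<^sup>2)"
proof -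
 have *: "(a + b)\<^sup>2 <= 4 * (a\<^sup>2 + b\<^sup>2)" if "a <= b" for a b :: ennreal
 proof -
  have "(a + b)\<^sup>2 <= (b + b)\<^sup>2"
   using that by (intro power_mono add_right_mono) auto
  also have "\<dots> = 4 * b\<^sup>2"
   by (simp add: power_mult_distrib flip: mult_2)
  also have "\<dots> <= 4 * (a\<^sup>2 + b\<^sup>2)" by (intro mult_left_mono) auto
  finally show ?thesis .
 qed
 show ?thesis
  using *[of x y] *[of y x] by (cases "x <= y") (auto simp: add.commute)
qed

text \<open>An infinite norm is an ordinary value, so no estimate has to assume membership in
  L2.\<close>

definition nrm :: "'a measure => ('a => ennreal) => ennreal" where
 "nrm M f = ennsqrt (\<integral>\<^sup>+x. (f x)\<^sup>2 \<partial>M)"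

lemma nrm_sq: "(nrm M f)\<^sup>2 = (\<integral>\<^sup>+x. (f x)\<^sup>2 \<partial>M)"
 by (simp add: nrm_def)

lemma nrm_mono: "(\<And>x. x \<in> space M ==> f x <= g x) ==> nrm M f <= nrm M g"
 unfolding nrm_def by (intro ennsqrt_mono nn_integral_mono power_mono) auto

lemma nrm_cmult: "f \<in> borel_measurable M ==> nrm M (%x. c * f x) = c * nrm M f"
 by (simp add: nrm_def power_mult_distrib nn_integral_cmult ennsqrt_mult)

lemma nrm_add:
 assumes [measurable]: "f \<in> borel_measurable M" "g \<in> borel_measurable M"
 shows "nrm M (%x. f x + g x) <= 2 * (nrm M f + nrm M g)"
proof -
 have "nrm M (%x. f x + g x) <= ennsqrt (\<integral>\<^sup>+x. 4 * ((f x)\<^sup>2 + (g x)\<^sup>2) \<partial>M)"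
  unfolding nrm_def by (intro ennsqrt_mono nn_integral_mono ennreal_sq_add_le)
 also have "\<dots> = ennsqrt (2\<^sup>2 * ((\<integral>\<^sup>+x. (f x)\<^sup>2 \<partial>M) + (\<integral>\<^sup>+x. (g x)\<^sup>2 \<partial>M)))"
  by (simp add: nn_integral_cmult nn_integral_add)
 also have "\<dots> <= 2 * (nrm M f + nrm M g)"
  unfolding ennsqrt_mult ennsqrt_of_sq nrm_def by (intro mult_left_mono ennsqrt_add) auto
 finally show ?thesis .
qed

lemma Cauchy_Schwarz_nrm:
 assumes [measurable]: "f \<in> borel_measurable M" "g \<in> borel_measurable M"
 shows "(\<integral>\<^sup>+x. f x * g x \<partial>M) <= nrm M f * nrm M g"
 by (rule le_of_sq_le) (use Cauchy_Schwarz_nn_integral[of f M g] in \<open>simp add: power_mult_distrib nrm_sq\<close>)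

text \<open>Duality: truncation of the function itself provides the test functions.\<close>

lemma (in sigma_finite_measure) nrm_le_dual:
 assumes [measurable]: "G \<in> borel_measurable M"
  and *: "\<And>F. F \<in> borel_measurable M ==> (\<integral>\<^sup>+x. F x * G x \<partial>M) <= A * nrm M F"
 shows "nrm M G <= A"
proof -
 obtain B :: "nat => 'a set" where B: "range B \<subseteq> sets M" "(\<Union>i. B i) = space M"
  "\<And>i. emeasure M (B i) \<noteq> \<infinity>" "incseq B"
  using sigma_finite_incseq by blast
 have [measurable]: "B i \<in> sets M" for i using B by auto
 define F where "F n x = min (G x) (of_nat n) * indicator (B n) x" for n :: nat and x
 have [measurable]: "F n \<in> borel_measurable M" for n unfolding F_def by measurable
 have le: "F n x <= G x" for n x by (auto simp: F_def split: split_indicator)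
 \<comment> \<open>Truncation in height and to a set of finite measure makes the norm finite, so
   that one factor of it can be cancelled in \<open>bd\<close>.\<close>
 have fin: "(nrm M (F n))\<^sup>2 < \<infinity>" for n
 proof -
  have "(nrm M (F n))\<^sup>2 <= (\<integral>\<^sup>+x. of_nat n ^ 2 * indicator (B n) x \<partial>M)"
   unfolding nrm_sq F_def
   by (intro nn_integral_mono) (auto split: split_indicator intro!: power_mono)
  also have "\<dots> < \<infinity>"
   using B(3)[of n] by (auto simp: nn_integral_cmult_indicator ennreal_mult_less_top less_top power_less_top_ennreal of_nat_less_top)
  finally show ?thesis .
 qed
 have bd: "(\<integral>\<^sup>+x. (F n x)\<^sup>2 \<partial>M) <= A\<^sup>2" for n
 proof (cases "nrm M (F n) = 0")
  case True
  then show ?thesis by (simp flip: nrm_sq)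
 next
  case False
  have "nrm M (F n) * nrm M (F n) <= (\<integral>\<^sup>+x. F n x * G x \<partial>M)"
   unfolding power2_eq_square[symmetric] nrm_sq
   by (intro nn_integral_mono) (auto simp: power2_eq_square intro!: mult_left_mono le)
  also have "\<dots> <= nrm M (F n) * A" using *[of "F n"] by (simp add: mult.commute)
  finally have "nrm M (F n) <= A"
   using False fin[of n] by (subst (asm) ennreal_mult_le_mult_iff) (auto simp: power_less_top_ennreal)
  then have "(nrm M (F n))\<^sup>2 <= A\<^sup>2" by (intro power_mono) auto
  then show ?thesis by (simp add: nrm_sq)
 qed
 have inc: "incseq (%n x. (F n x)\<^sup>2)"
  unfolding incseq_def le_fun_def F_def
 proof (intro allI impI power_mono mult_mono)
  fix m n x assume "m <= (n::nat)"
  then show "min (G x) (of_nat m) <= min (G x) (of_nat n)" by (intro min.mono) auto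
  show "indicator (B m) x <= (indicator (B n) x :: ennreal)"
   using \<open>m <= n\<close> \<open>incseq B\<close> by (auto simp: incseq_def split: split_indicator)
 qed auto
 have "(\<integral>\<^sup>+x. (G x)\<^sup>2 \<partial>M) = (\<integral>\<^sup>+x. (SUP n. (F n x)\<^sup>2) \<partial>M)"
 proof (rule nn_integral_cong)
  fix x assume "x \<in> space M"
  then obtain i where i: "x \<in> B i" using B(2) by blast
  have "(SUP n. (F n x)\<^sup>2) = (G x)\<^sup>2"
  proof (cases "G x")
   case (real r)
   obtain n0 where n0: "r <= real n0" using real_arch_simple by blast
   define n where "n = max n0 i"
   have "x \<in> B n" using i incseqD[OF \<open>incseq B\<close>, of i n] by (auto simp: n_def)
   have "r <= real n" using n0 by (auto simp: n_def)
   then have "ennreal r <= ennreal (real n)" by (rule ennreal_leI)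
   then have "ennreal r <= of_nat n" by (simp add: ennreal_of_nat_eq_real_of_nat)
   then have "F n x = G x"
    using \<open>x \<in> B n\<close> real by (auto simp: F_def min_def)
   then show ?thesis
    by (intro antisym SUP_least SUP_upper2[of n]) (auto intro!: power_mono le)
  next
   case top
   have "of_nat n <= (SUP n. (F n x)\<^sup>2)" for n
   proof -
    define m where "m = Suc (max n i)"
    have "x \<in> B m" using i incseqD[OF \<open>incseq B\<close>, of i m] by (auto simp: m_def le_SucI)
    then have "F m x = of_nat m" using top by (simp add: F_def min_def top_unique)
    moreover have "n <= m\<^sup>2" unfolding m_def power2_eq_square by simp
    then have "of_nat n <= (of_nat m :: ennreal)\<^sup>2" by (metis of_nat_mono of_nat_power)
    ultimately show ?thesis by (intro SUP_upper2[of m]) auto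
   qed
   then have "(SUP n. (F n x)\<^sup>2) = top"
    by (metis SUP_least ennreal_SUP_of_nat_eq_top top_unique)
   then show ?thesis using top by simp
  qed
  then show "(G x)\<^sup>2 = (SUP n. (F n x)\<^sup>2)" by simp
 qed
 also have "\<dots> = (SUP n. \<integral>\<^sup>+x. (F n x)\<^sup>2 \<partial>M)"
  by (rule nn_integral_monotone_convergence_SUP[OF inc]) measurable
 also have "\<dots> <= A\<^sup>2" by (intro SUP_least bd)
 finally have "(nrm M G)\<^sup>2 <= A\<^sup>2" by (simp add: nrm_sq)
 then show ?thesis by (rule le_of_sq_le)
qed

section \<open>Convolution and four-fold forms on an abelian group with invariant measure\<close>

text \<open>What the convolution calculus requires of a Haar measure. The circle of modulations, the
  integers and their product are the instances, so each identity is proved once for three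
  groups.\<close>

locale inv_measure = sigma_finite_measure M for M :: "'a::ab_group_add measure" +
 assumes space_M: "space M = UNIV"
  and measurable_plus: "(%p. fst p + snd p) \<in> M \<Otimes>\<^sub>M M \<rightarrow>\<^sub>M M"
  and measurable_minus: "uminus \<in> M \<rightarrow>\<^sub>M M"
  and nn_integral_shift: "f \<in> borel_measurable M ==> (\<integral>\<^sup>+x. f (x + c) \<partial>M) = (\<integral>\<^sup>+x. f x \<partial>M)"
  and nn_integral_refl: "f \<in> borel_measurable M ==> (\<integral>\<^sup>+x. f (- x) \<partial>M) = (\<integral>\<^sup>+x. f x \<partial>M)"
begin

lemma plus_M [measurable (raw)]:
 assumes [measurable]: "f \<in> N \<rightarrow>\<^sub>M M" "g \<in> N \<rightarrow>\<^sub>M M"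
 shows "(%x. f x + g x) \<in> N \<rightarrow>\<^sub>M M"
 using measurable_compose[OF _ measurable_plus, of "%x. (f x, g x)" N] by simp

lemma uminus_M [measurable (raw)]: "f \<in> N \<rightarrow>\<^sub>M M ==> (%x. - f x) \<in> N \<rightarrow>\<^sub>M M"
 by (rule measurable_compose[OF _ measurable_minus])

lemma minus_M [measurable (raw)]:
 assumes [measurable]: "f \<in> N \<rightarrow>\<^sub>M M" "g \<in> N \<rightarrow>\<^sub>M M"
 shows "(%x. f x - g x) \<in> N \<rightarrow>\<^sub>M M"
 unfolding diff_conv_add_uminus by measurable

lemma const_M [measurable]: "(%x. c) \<in> N \<rightarrow>\<^sub>M M"
 using space_M by simp

lemma nn_integral_swap:
 assumes "case_prod f \<in> borel_measurable (M \<Otimes>\<^sub>M M)"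
 shows "(\<integral>\<^sup>+x. (\<integral>\<^sup>+y. f x y \<partial>M) \<partial>M) = (\<integral>\<^sup>+y. (\<integral>\<^sup>+x. f x y \<partial>M) \<partial>M)"
proof -
 interpret pair_sigma_finite M M ..
 show ?thesis using Fubini'[of f] assms by simp
qed

lemma nn_integral_shift':
 assumes [measurable]: "f \<in> borel_measurable M"
 shows "(\<integral>\<^sup>+x. f (c + x) \<partial>M) = (\<integral>\<^sup>+x. f x \<partial>M)" "(\<integral>\<^sup>+x. f (x - c) \<partial>M) = (\<integral>\<^sup>+x. f x \<partial>M)"
  "(\<integral>\<^sup>+x. f (c - x) \<partial>M) = (\<integral>\<^sup>+x. f x \<partial>M)"
proof -
 show "(\<integral>\<^sup>+x. f (c + x) \<partial>M) = (\<integral>\<^sup>+x. f x \<partial>M)" using nn_integral_shift[of f c] by (simp add: add.commute)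
 show "(\<integral>\<^sup>+x. f (x - c) \<partial>M) = (\<integral>\<^sup>+x. f x \<partial>M)" using nn_integral_shift[of f "-c"] by simp
 have "(\<integral>\<^sup>+x. f (c - x) \<partial>M) = (\<integral>\<^sup>+x. f (c + x) \<partial>M)"
  using nn_integral_refl[of "%x. f (c + x)"] by simp
 then show "(\<integral>\<^sup>+x. f (c - x) \<partial>M) = (\<integral>\<^sup>+x. f x \<partial>M)"
  using nn_integral_shift[of f c] by (simp add: add.commute)
qed

definition conv :: "('a => ennreal) => ('a => ennreal) => 'a => ennreal" where
 "conv f g x = (\<integral>\<^sup>+y. f y * g (x - y) \<partial>M)"

lemma conv_measurable [measurable (raw)]:
 assumes [measurable]: "f \<in> borel_measurable M" "g \<in> borel_measurable M"
 shows "conv f g \<in> borel_measurable M"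
 unfolding conv_def by measurable

lemma conv_mono: "(\<And>x. f x <= f' x) ==> (\<And>x. g x <= g' x) ==> conv f g x <= conv f' g' x"
 unfolding conv_def by (intro nn_integral_mono mult_mono) auto

lemma conv_commute:
 assumes [measurable]: "f \<in> borel_measurable M" "g \<in> borel_measurable M"
 shows "conv f g x = conv g f x"
 unfolding conv_def using nn_integral_shift'(3)[of "%y. f y * g (x - y)" x] by (simp add: mult.commute)

lemma nn_integral_conv:
 assumes [measurable]: "f \<in> borel_measurable M" "g \<in> borel_measurable M" "h \<in> borel_measurable M"
 shows "(\<integral>\<^sup>+x. h x * conv f g x \<partial>M) = (\<integral>\<^sup>+y. (\<integral>\<^sup>+z. f y * g z * h (y + z) \<partial>M) \<partial>M)"
proof -
 have "(\<integral>\<^sup>+x. h x * conv f g x \<partial>M) = (\<integral>\<^sup>+x. (\<integral>\<^sup>+y. h x * (f y * g (x - y)) \<partial>M) \<partial>M)"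
  unfolding conv_def by (subst nn_integral_cmult) auto
 also have "\<dots> = (\<integral>\<^sup>+y. (\<integral>\<^sup>+x. h x * (f y * g (x - y)) \<partial>M) \<partial>M)"
  by (rule nn_integral_swap) measurable
 also have "\<dots> = (\<integral>\<^sup>+y. (\<integral>\<^sup>+z. f y * g z * h (y + z) \<partial>M) \<partial>M)"
 proof (rule nn_integral_cong)
  fix y show "(\<integral>\<^sup>+x. h x * (f y * g (x - y)) \<partial>M) = (\<integral>\<^sup>+z. f y * g z * h (y + z) \<partial>M)"
   using nn_integral_shift'(1)[of "%x. h x * (f y * g (x - y))" y] by (simp add: ac_simps)
 qed
 finally show ?thesis .
qed

lemma nn_integral_conv_1:
 assumes [measurable]: "f \<in> borel_measurable M" "g \<in> borel_measurable M"
 shows "(\<integral>\<^sup>+x. conv f g x \<partial>M) = (\<integral>\<^sup>+x. f x \<partial>M) * (\<integral>\<^sup>+x. g x \<partial>M)"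
 using nn_integral_conv[of f g "%_. 1"] by (simp add: nn_integral_cmult nn_integral_multc)

lemma conv_assoc:
 assumes [measurable]: "f \<in> borel_measurable M" "g \<in> borel_measurable M" "h \<in> borel_measurable M"
 shows "conv (conv f g) h x = conv f (conv g h) x"
proof -
 have "conv (conv f g) h x = (\<integral>\<^sup>+y. h (x - y) * conv f g y \<partial>M)"
  unfolding conv_def[of "conv f g"] by (simp add: mult.commute)
 also have "\<dots> = (\<integral>\<^sup>+y. (\<integral>\<^sup>+z. f y * g z * h (x - (y + z)) \<partial>M) \<partial>M)"
  by (subst nn_integral_conv) auto
 also have "\<dots> = (\<integral>\<^sup>+y. f y * (\<integral>\<^sup>+z. g z * h ((x - y) - z) \<partial>M) \<partial>M)"
  by (subst nn_integral_cmult[symmetric]) (auto simp: algebra_simps)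
 finally show ?thesis unfolding conv_def .
qed

lemma nn_integral_conv_conv:
 assumes [measurable]: "f \<in> borel_measurable M" "g \<in> borel_measurable M" "h \<in> borel_measurable M" "k \<in> borel_measurable M"
 shows "(\<integral>\<^sup>+u. conv f g u * conv h k u \<partial>M) =
  (\<integral>\<^sup>+y. (\<integral>\<^sup>+v. (\<integral>\<^sup>+u. f y * h v * g (u - y) * k (u - v) \<partial>M) \<partial>M) \<partial>M)"
proof -
 have "(\<integral>\<^sup>+u. conv f g u * conv h k u \<partial>M) = (\<integral>\<^sup>+u. (\<integral>\<^sup>+y. (\<integral>\<^sup>+v. f y * g (u - y) * (h v * k (u - v)) \<partial>M) \<partial>M) \<partial>M)"
  unfolding conv_def by (simp add: nn_integral_cmult nn_integral_multc)
 also have "\<dots> = (\<integral>\<^sup>+y. (\<integral>\<^sup>+u. (\<integral>\<^sup>+v. f y * g (u - y) * (h v * k (u - v)) \<partial>M) \<partial>M) \<partial>M)"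
  by (rule nn_integral_swap) measurable
 also have "\<dots> = (\<integral>\<^sup>+y. (\<integral>\<^sup>+v. (\<integral>\<^sup>+u. f y * g (u - y) * (h v * k (u - v)) \<partial>M) \<partial>M) \<partial>M)"
  by (intro nn_integral_cong nn_integral_swap) measurable
 finally show ?thesis by (simp add: ac_simps)
qed

definition rfl :: "('a => ennreal) => 'a => ennreal" where "rfl f x = f (- x)"

lemma rfl_measurable [measurable (raw)]:
 assumes [measurable]: "f \<in> borel_measurable M" shows "rfl f \<in> borel_measurable M"
 unfolding rfl_def by measurable

lemma rfl_rfl [simp]: "rfl (rfl f) = f" by (simp add: rfl_def fun_eq_iff)

lemma nrm_rfl: "f \<in> borel_measurable M ==> nrm M (rfl f) = nrm M f"
 unfolding nrm_def rfl_def by (simp add: nn_integral_refl[of "%x. (f x)\<^sup>2"])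

text \<open>Both sides integrate \<open>f y * g b * h v * k c\<close> over the surface
  \<open>y + b = v + c\<close>; on the right this surface is read as
  \<open>y - v = c - b\<close>.\<close>

lemma conv_exchange:
 assumes [measurable]: "f \<in> borel_measurable M" "g \<in> borel_measurable M" "h \<in> borel_measurable M" "k \<in> borel_measurable M"
 shows "(\<integral>\<^sup>+u. conv f g u * conv h k u \<partial>M) = (\<integral>\<^sup>+u. conv f (rfl h) u * conv k (rfl g) u \<partial>M)"
proof -
 have "(\<integral>\<^sup>+u. conv f (rfl h) u * conv k (rfl g) u \<partial>M) =
  (\<integral>\<^sup>+y. (\<integral>\<^sup>+v. (\<integral>\<^sup>+u. f y * k v * h (y - u) * g (v - u) \<partial>M) \<partial>M) \<partial>M)"
  by (subst nn_integral_conv_conv) (auto simp: rfl_def)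
 also have "\<dots> = (\<integral>\<^sup>+y. (\<integral>\<^sup>+u. (\<integral>\<^sup>+v. f y * k v * h (y - u) * g (v - u) \<partial>M) \<partial>M) \<partial>M)"
  by (intro nn_integral_cong nn_integral_swap) measurable
 also have "\<dots> = (\<integral>\<^sup>+y. (\<integral>\<^sup>+u. (\<integral>\<^sup>+v. f y * k v * h u * g (v - (y - u)) \<partial>M) \<partial>M) \<partial>M)"
  (is "(\<integral>\<^sup>+y. ?L y \<partial>M) = (\<integral>\<^sup>+y. ?R y \<partial>M)")
 proof (rule nn_integral_cong)
  fix y show "?L y = ?R y"
   using nn_integral_shift'(3)[of "%u. \<integral>\<^sup>+v. f y * k v * h u * g (v - (y - u)) \<partial>M" y] by simp
 qed
 also have "\<dots> = (\<integral>\<^sup>+y. (\<integral>\<^sup>+u. (\<integral>\<^sup>+v. f y * h u * g (v - y) * k (v - u) \<partial>M) \<partial>M) \<partial>M)"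
  (is "(\<integral>\<^sup>+y. (\<integral>\<^sup>+u. ?L y u \<partial>M) \<partial>M) = (\<integral>\<^sup>+y. (\<integral>\<^sup>+u. ?R y u \<partial>M) \<partial>M)")
 proof (rule nn_integral_cong, rule nn_integral_cong)
  fix y u show "?L y u = ?R y u"
   using nn_integral_shift'(2)[of "%v. f y * k v * h u * g (v - (y - u))" u]
   by (simp add: ac_simps)
 qed
 finally show ?thesis by (subst nn_integral_conv_conv) auto
qed

text \<open>Both squared norms equal the pairing of the autocorrelations of \<open>f\<close> and
  \<open>g\<close>, and an autocorrelation does not change when its function is reflected. It plays
  the role of the fact that conjugating one factor leaves the L2 norm of a product
  unchanged.\<close>

lemma nrm_conv_rfl:
 assumes [measurable]: "f \<in> borel_measurable M" "g \<in> borel_measurable M"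
 shows "nrm M (conv f (rfl g)) = nrm M (conv f g)"
proof -
 have "(\<integral>\<^sup>+u. conv f g u * conv f g u \<partial>M) = (\<integral>\<^sup>+u. conv f (rfl f) u * conv g (rfl g) u \<partial>M)"
  by (rule conv_exchange) measurable
 also have "\<dots> = (\<integral>\<^sup>+u. conv f (rfl f) u * conv (rfl g) (rfl (rfl g)) u \<partial>M)"
  by (subst conv_commute[of g]) auto
 also have "\<dots> = (\<integral>\<^sup>+u. conv f (rfl g) u * conv f (rfl g) u \<partial>M)"
  by (rule conv_exchange[symmetric]) measurable
 finally show ?thesis by (simp add: nrm_def power2_eq_square)
qed

text \<open>Cauchy-Schwarz on each fibre separates the weights from \<open>F\<close> and
  \<open>G\<close>; the weights are bounded uniformly in the output \<open>x\<close>, and the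
  convolution of the squares integrates to a product. Weighted bilinear estimates thus reduce to a
  supremum over \<open>x\<close>.\<close>

lemma nrm_conv_le:
 assumes [measurable]: "a \<in> borel_measurable M" "b \<in> borel_measurable M" "F \<in> borel_measurable M" "G \<in> borel_measurable M"
  "\<rho> \<in> borel_measurable M"
  and le: "\<And>x. (\<rho> x)\<^sup>2 * (\<integral>\<^sup>+y. (a y)\<^sup>2 * (b (x - y))\<^sup>2 \<partial>M) <= C"
 shows "nrm M (%x. \<rho> x * conv (%y. a y * F y) (%y. b y * G y) x) <= ennsqrt C * nrm M F * nrm M G"
proof -
 have "(\<rho> x * conv (%y. a y * F y) (%y. b y * G y) x)\<^sup>2 <= C * conv (%y. (F y)\<^sup>2) (%y. (G y)\<^sup>2) x" for x
 proof -
  have "(conv (%y. a y * F y) (%y. b y * G y) x)\<^sup>2 = (\<integral>\<^sup>+y. (a y * b (x - y)) * (F y * G (x - y)) \<partial>M)\<^sup>2"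
   unfolding conv_def by (simp add: ac_simps)
  also have "\<dots> <= (\<integral>\<^sup>+y. (a y * b (x - y))\<^sup>2 \<partial>M) * (\<integral>\<^sup>+y. (F y * G (x - y))\<^sup>2 \<partial>M)"
   by (rule Cauchy_Schwarz_nn_integral) measurable
  finally have "(\<rho> x)\<^sup>2 * (conv (%y. a y * F y) (%y. b y * G y) x)\<^sup>2 <=
   (\<rho> x)\<^sup>2 * ((\<integral>\<^sup>+y. (a y)\<^sup>2 * (b (x - y))\<^sup>2 \<partial>M) * (\<integral>\<^sup>+y. (F y)\<^sup>2 * (G (x - y))\<^sup>2 \<partial>M))"
   by (intro mult_left_mono) (auto simp: power_mult_distrib)
  also have "\<dots> <= C * (\<integral>\<^sup>+y. (F y)\<^sup>2 * (G (x - y))\<^sup>2 \<partial>M)"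
   unfolding mult.assoc[symmetric] by (intro mult_right_mono le) auto
  finally show ?thesis unfolding conv_def power_mult_distrib .
 qed
 then have "nrm M (%x. \<rho> x * conv (%y. a y * F y) (%y. b y * G y) x) <=
   ennsqrt (\<integral>\<^sup>+x. C * conv (%y. (F y)\<^sup>2) (%y. (G y)\<^sup>2) x \<partial>M)"
  unfolding nrm_def by (intro ennsqrt_mono nn_integral_mono)
 also have "\<dots> = ennsqrt C * nrm M F * nrm M G"
  by (simp add: nn_integral_cmult nn_integral_conv_1 ennsqrt_mult nrm_def mult.assoc)
 finally show ?thesis .
qed

lemmas nrm_conv_le1 = nrm_conv_le[where \<rho> = "%_. 1", simplified]

lemma nrm_conv_Young:
 assumes [measurable]: "f \<in> borel_measurable M" "g \<in> borel_measurable M"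
 shows "nrm M (conv f g) <= (\<integral>\<^sup>+x. f x \<partial>M) * nrm M g"
proof -
 define s where "s x = ennsqrt (f x)" for x
 have [measurable]: "s \<in> borel_measurable M"
  unfolding s_def ennsqrt_def by measurable
 have s2: "f x = s x * s x" "(s x)\<^sup>2 = f x" for x by (simp_all add: s_def flip: power2_eq_square)
 have "(conv f g x)\<^sup>2 <= (\<integral>\<^sup>+x. f x \<partial>M) * conv f (%y. (g y)\<^sup>2) x" for x
 proof -
  have "(conv f g x)\<^sup>2 = (\<integral>\<^sup>+y. s y * (s y * g (x - y)) \<partial>M)\<^sup>2"
   unfolding conv_def by (simp add: s2(1) ac_simps)
  also have "\<dots> <= (\<integral>\<^sup>+y. (s y)\<^sup>2 \<partial>M) * (\<integral>\<^sup>+y. (s y * g (x - y))\<^sup>2 \<partial>M)"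
   by (rule Cauchy_Schwarz_nn_integral) measurable
  finally show ?thesis by (simp add: power_mult_distrib s2(2) conv_def)
 qed
 then have "nrm M (conv f g) <= ennsqrt (\<integral>\<^sup>+x. (\<integral>\<^sup>+x. f x \<partial>M) * conv f (%y. (g y)\<^sup>2) x \<partial>M)"
  unfolding nrm_def by (intro ennsqrt_mono nn_integral_mono)
 also have "\<dots> = ennsqrt ((\<integral>\<^sup>+x. f x \<partial>M)\<^sup>2 * (\<integral>\<^sup>+x. (g x)\<^sup>2 \<partial>M))"
  by (simp add: nn_integral_cmult nn_integral_conv_1 power2_eq_square mult.assoc)
 finally show ?thesis by (simp add: ennsqrt_mult nrm_def)
qed

text \<open>The form lives on the surface \<open>x + u = y + z\<close>: \<open>x\<close> is the
  output or dual variable, \<open>y\<close> and \<open>z\<close> belong to unconjugated factors and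
  \<open>u\<close> to the conjugated one.\<close>

definition Lam :: "('a => 'a => 'a => 'a => ennreal) => ennreal" where
 "Lam \<Phi> = (\<integral>\<^sup>+x. (\<integral>\<^sup>+y. (\<integral>\<^sup>+z. \<Phi> x y z (y + z - x) \<partial>M) \<partial>M) \<partial>M)"

abbreviation meas4 :: "('a => 'a => 'a => 'a => ennreal) => bool" where
 "meas4 \<Phi> \<equiv> (%(x, y, z, u). \<Phi> x y z u) \<in> borel_measurable (M \<Otimes>\<^sub>M M \<Otimes>\<^sub>M M \<Otimes>\<^sub>M M)"

lemma meas4_compose:
 assumes "meas4 \<Phi>" and [measurable]: "a \<in> N \<rightarrow>\<^sub>M M" "b \<in> N \<rightarrow>\<^sub>M M" "c \<in> N \<rightarrow>\<^sub>M M" "d \<in> N \<rightarrow>\<^sub>M M"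
 shows "(%x. \<Phi> (a x) (b x) (c x) (d x)) \<in> borel_measurable N"
 using measurable_compose[OF _ assms(1), of "%x. (a x, b x, c x, d x)" N] by simp

lemma Lam_mono: "(\<And>x y z u. \<Phi> x y z u <= \<Psi> x y z u) ==> Lam \<Phi> <= Lam \<Psi>"
 unfolding Lam_def by (intro nn_integral_mono)

lemma Lam_add:
 assumes [measurable]: "meas4 \<Phi>" "meas4 \<Psi>"
 shows "Lam (%x y z u. \<Phi> x y z u + \<Psi> x y z u) = Lam \<Phi> + Lam \<Psi>"
 supply meas4_compose[OF assms(1), measurable (raw)] meas4_compose[OF assms(2), measurable (raw)]
 unfolding Lam_def by (simp add: nn_integral_add)

lemma Lam_cmult:
 assumes [measurable]: "meas4 \<Phi>"
 shows "Lam (%x y z u. c * \<Phi> x y z u) = c * Lam \<Phi>"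
 supply meas4_compose[OF assms(1), measurable (raw)]
 unfolding Lam_def by (simp add: nn_integral_cmult)

lemma Lam_swap12:
 assumes [measurable]: "meas4 \<Phi>"
 shows "Lam \<Phi> = Lam (%x y z u. \<Phi> x z y u)"
 supply meas4_compose[OF assms(1), measurable (raw)]
 unfolding Lam_def by (rule nn_integral_cong, subst nn_integral_swap) (measurable, simp add: add.commute)

text \<open>For fixed \<open>y\<close> and \<open>z\<close> the reflection of \<open>x\<close> at
  \<open>y + z\<close> exchanges \<open>x\<close> and \<open>u\<close>. It needs the integral over
  \<open>x\<close> innermost, which \<open>rot\<close> arranges.\<close>

lemma Lam_swap03:
 assumes [measurable]: "meas4 \<Phi>"
 shows "Lam \<Phi> = Lam (%x y z u. \<Phi> u y z x)"
proof -
 note meas4_compose[OF assms(1), measurable (raw)]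
 have rot: "Lam \<Psi> = (\<integral>\<^sup>+y. (\<integral>\<^sup>+z. (\<integral>\<^sup>+x. \<Psi> x y z (y + z - x) \<partial>M) \<partial>M) \<partial>M)" if m: "meas4 \<Psi>" for \<Psi>
 proof -
  note meas4_compose[OF m, measurable (raw)]
  have "Lam \<Psi> = (\<integral>\<^sup>+y. (\<integral>\<^sup>+x. (\<integral>\<^sup>+z. \<Psi> x y z (y + z - x) \<partial>M) \<partial>M) \<partial>M)"
   unfolding Lam_def by (rule nn_integral_swap) measurable
  also have "\<dots> = (\<integral>\<^sup>+y. (\<integral>\<^sup>+z. (\<integral>\<^sup>+x. \<Psi> x y z (y + z - x) \<partial>M) \<partial>M) \<partial>M)"
   by (intro nn_integral_cong nn_integral_swap) measurable
  finally show ?thesis .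
 qed
 have "Lam (%x y z u. \<Phi> u y z x) = (\<integral>\<^sup>+y. (\<integral>\<^sup>+z. (\<integral>\<^sup>+x. \<Phi> (y + z - x) y z x \<partial>M) \<partial>M) \<partial>M)"
  by (rule rot) measurable
 also have "\<dots> = (\<integral>\<^sup>+y. (\<integral>\<^sup>+z. (\<integral>\<^sup>+x. \<Phi> x y z (y + z - x) \<partial>M) \<partial>M) \<partial>M)"
  (is "(\<integral>\<^sup>+y. (\<integral>\<^sup>+z. ?L y z \<partial>M) \<partial>M) = (\<integral>\<^sup>+y. (\<integral>\<^sup>+z. ?R y z \<partial>M) \<partial>M)")
 proof (rule nn_integral_cong, rule nn_integral_cong)
  fix y z show "?L y z = ?R y z"
   using nn_integral_shift'(3)[of "%x. \<Phi> x y z (y + z - x)" "y + z"] by simp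
 qed
 finally show ?thesis using rot[of \<Phi>] by simp
qed

lemma Lam_swap01:
 assumes [measurable]: "meas4 \<Phi>"
 shows "Lam \<Phi> = Lam (%x y z u. \<Phi> y x u z)"
proof -
 note meas4_compose[OF assms(1), measurable (raw)]
 have "Lam (%x y z u. \<Phi> y x u z) = (\<integral>\<^sup>+x. (\<integral>\<^sup>+y. (\<integral>\<^sup>+z. \<Phi> y x z (x + z - y) \<partial>M) \<partial>M) \<partial>M)"
  (is "_ = (\<integral>\<^sup>+x. (\<integral>\<^sup>+y. ?R x y \<partial>M) \<partial>M)")
  unfolding Lam_def
 proof (rule nn_integral_cong, rule nn_integral_cong)
  fix x y show "(\<integral>\<^sup>+z. \<Phi> y x (y + z - x) z \<partial>M) = ?R x y"
   using nn_integral_shift'(1)[of "%z. \<Phi> y x z (x + z - y)" "y - x"] by (simp add: algebra_simps)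
 qed
 also have "\<dots> = Lam \<Phi>"
  unfolding Lam_def by (rule nn_integral_swap) measurable
 finally show ?thesis by simp
qed

lemma Lam_conv:
 assumes [measurable]: "f \<in> borel_measurable M" "g \<in> borel_measurable M" "h \<in> borel_measurable M" "k \<in> borel_measurable M"
 shows "Lam (%x y z u. f x * g y * h z * k u) = (\<integral>\<^sup>+u. conv f k u * conv g h u \<partial>M)"
proof -
 have "(\<integral>\<^sup>+u. conv f k u * conv g h u \<partial>M) =
  (\<integral>\<^sup>+x. (\<integral>\<^sup>+y. (\<integral>\<^sup>+u. f x * g y * k (u - x) * h (u - y) \<partial>M) \<partial>M) \<partial>M)"
  by (rule nn_integral_conv_conv) measurable
 also have "\<dots> = (\<integral>\<^sup>+x. (\<integral>\<^sup>+y. (\<integral>\<^sup>+z. f x * g y * h z * k (y + z - x) \<partial>M) \<partial>M) \<partial>M)"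
  (is "(\<integral>\<^sup>+x. (\<integral>\<^sup>+y. ?L x y \<partial>M) \<partial>M) = (\<integral>\<^sup>+x. (\<integral>\<^sup>+y. ?R x y \<partial>M) \<partial>M)")
 proof (rule nn_integral_cong, rule nn_integral_cong)
  fix x y show "?L x y = ?R x y"
   using nn_integral_shift'(1)[of "%u. f x * g y * k (u - x) * h (u - y)" y] by (simp add: ac_simps)
 qed
 finally show ?thesis unfolding Lam_def by simp
qed

text \<open>The surface read as \<open>x - y = z - u\<close> instead of
  \<open>x + u = y + z\<close>. Having both readings allows the pairing of factors to be chosen to
  suit their weights.\<close>

lemma Lam_conv':
 assumes [measurable]: "f \<in> borel_measurable M" "g \<in> borel_measurable M" "h \<in> borel_measurable M" "k \<in> borel_measurable M"
 shows "Lam (%x y z u. f x * g y * h z * k u) = (\<integral>\<^sup>+u. conv f (rfl g) u * conv h (rfl k) u \<partial>M)"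
 unfolding Lam_conv[OF assms] by (rule conv_exchange) measurable

text \<open>For each \<open>x\<close> Cauchy-Schwarz in \<open>y\<close> and \<open>z\<close> splits
  off the squared kernel, whose integral is bounded uniformly in \<open>x\<close>; what remains
  factorises.\<close>

lemma Lam_Cauchy_Schwarz:
 assumes [measurable]: "meas4 K" "F \<in> borel_measurable M" "G \<in> borel_measurable M" "H \<in> borel_measurable M" "I \<in> borel_measurable M"
  and le: "\<And>x. (\<integral>\<^sup>+y. (\<integral>\<^sup>+z. (K x y z (y + z - x))\<^sup>2 \<partial>M) \<partial>M) <= C"
 shows "Lam (%x y z u. K x y z u * F x * G y * H z * I u) <= ennsqrt C * nrm M F * nrm M G * nrm M H * nrm M I"
proof -
 have fst: "(\<integral>\<^sup>+y. (\<integral>\<^sup>+z. \<phi> y z \<partial>M) \<partial>M) = (\<integral>\<^sup>+p. case_prod \<phi> p \<partial>(M \<Otimes>\<^sub>M M))"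
  if "case_prod \<phi> \<in> borel_measurable (M \<Otimes>\<^sub>M M)" for \<phi>
  using nn_integral_fst[OF that] by simp
 note meas4_compose[OF assms(1), measurable (raw)]
 define T where "T x = (\<integral>\<^sup>+y. (\<integral>\<^sup>+z. K x y z (y + z - x) * G y * H z * I (y + z - x) \<partial>M) \<partial>M)" for x
 have [measurable]: "T \<in> borel_measurable M" unfolding T_def by measurable
 define S where "S x = (\<integral>\<^sup>+y. (\<integral>\<^sup>+z. (G y)\<^sup>2 * (H z)\<^sup>2 * (I (y + z - x))\<^sup>2 \<partial>M) \<partial>M)" for x
 have [measurable]: "S \<in> borel_measurable M" unfolding S_def by measurable
 have "Lam (%x y z u. K x y z u * F x * G y * H z * I u) = (\<integral>\<^sup>+x. F x * T x \<partial>M)"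
  unfolding Lam_def T_def
  by (intro nn_integral_cong) (simp add: mult.assoc mult.left_commute[of _ "F _"] nn_integral_cmult)
 also have "\<dots> <= nrm M F * nrm M T"
  by (rule Cauchy_Schwarz_nrm) measurable
 finally have 1: "Lam (%x y z u. K x y z u * F x * G y * H z * I u) <= nrm M F * nrm M T" .
 have "nrm M T <= ennsqrt (\<integral>\<^sup>+x. C * S x \<partial>M)"
  unfolding nrm_def
 proof (intro ennsqrt_mono nn_integral_mono)
  fix x
  have "T x = (\<integral>\<^sup>+p. (case p of (y, z) => K x y z (y + z - x)) *
    (case p of (y, z) => G y * H z * I (y + z - x)) \<partial>(M \<Otimes>\<^sub>M M))"
   unfolding T_def by (subst fst, measurable, rule nn_integral_cong) (auto simp: ac_simps)
  then have "(T x)\<^sup>2 = (\<integral>\<^sup>+p. (case p of (y, z) => K x y z (y + z - x)) *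
    (case p of (y, z) => G y * H z * I (y + z - x)) \<partial>(M \<Otimes>\<^sub>M M))\<^sup>2"
   by simp
  also have "\<dots> <= (\<integral>\<^sup>+p. (case p of (y, z) => K x y z (y + z - x))\<^sup>2 \<partial>(M \<Otimes>\<^sub>M M)) *
    (\<integral>\<^sup>+p. (case p of (y, z) => G y * H z * I (y + z - x))\<^sup>2 \<partial>(M \<Otimes>\<^sub>M M))"
   by (rule Cauchy_Schwarz_nn_integral) measurable
  also have "(\<integral>\<^sup>+p. (case p of (y, z) => K x y z (y + z - x))\<^sup>2 \<partial>(M \<Otimes>\<^sub>M M)) <= C"
   by (rule order_trans[OF _ le[of x]], subst fst, measurable, rule nn_integral_mono) auto
  also have "(\<integral>\<^sup>+p. (case p of (y, z) => G y * H z * I (y + z - x))\<^sup>2 \<partial>(M \<Otimes>\<^sub>M M)) = S x"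
   unfolding S_def by (subst fst, measurable, rule nn_integral_cong) (auto simp: power_mult_distrib)
  finally show "(T x)\<^sup>2 <= C * S x" by (simp add: mult_right_mono)
 qed
 \<comment> \<open>With 1 in the slot of \<open>x\<close> the three squares are integrated over
   independent variables.\<close>
 also have "(\<integral>\<^sup>+x. C * S x \<partial>M) = C * (\<integral>\<^sup>+x. (G x)\<^sup>2 \<partial>M) * (\<integral>\<^sup>+x. (H x)\<^sup>2 \<partial>M) * (\<integral>\<^sup>+x. (I x)\<^sup>2 \<partial>M)"
 proof -
  have "(\<integral>\<^sup>+x. S x \<partial>M) = Lam (%x y z u. 1 * (G y)\<^sup>2 * (H z)\<^sup>2 * (I u)\<^sup>2)"
   by (simp add: Lam_def S_def)
  also have "\<dots> = (\<integral>\<^sup>+u. conv (%_. 1) (%x. (I x)\<^sup>2) u * conv (%x. (G x)\<^sup>2) (%x. (H x)\<^sup>2) u \<partial>M)"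
   by (rule Lam_conv) measurable
  also have "conv (%_. 1) (%x. (I x)\<^sup>2) = (%_. \<integral>\<^sup>+x. (I x)\<^sup>2 \<partial>M)"
   using nn_integral_shift'(3)[of "%x. (I x)\<^sup>2"] by (auto simp: conv_def fun_eq_iff)
  finally show ?thesis by (simp add: nn_integral_cmult nn_integral_conv_1 ac_simps)
 qed
 finally have "nrm M T <= ennsqrt C * nrm M G * nrm M H * nrm M I"
  by (simp add: ennsqrt_mult nrm_def)
 from order_trans[OF 1 mult_left_mono[OF this]] show ?thesis by (simp add: ac_simps)
qed

end

section \<open>The circle of modulations and the space-time frequency group\<close>

text \<open>The circle of length \<open>2 * pi / dt\<close> without a quotient type: its points are
  all reals, and the sigma-algebra is pulled back along \<open>cis (dt * \<sigma>)\<close>, so that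
  measurable functions are periodic and the group operation is addition of reals. Only one period
  carries mass.\<close>

definition circ :: "real => real measure" where
 "circ dt = distr (restrict_space lborel {-pi/dt..pi/dt}) (vimage_algebra UNIV (%\<sigma>. cis (dt * \<sigma>)) borel) (%x. x)"

lemma space_circ [simp]: "space (circ dt) = UNIV"
 by (simp add: circ_def)

lemma sets_circ: "sets (circ dt) = sets (vimage_algebra UNIV (%\<sigma>. cis (dt * \<sigma>)) borel)"
 by (simp add: circ_def)

lemma cis_borel: "cis \<in> borel_measurable borel"
 by (rule borel_measurable_continuous_onI) (rule continuous_on_cis[OF continuous_on_id])

lemma cnj_borel [measurable]: "cnj \<in> borel_measurable borel"
 by (rule borel_measurable_continuous_onI) (rule continuous_on_cnj[OF continuous_on_id])

lemma cis_circ0: "(%\<sigma>. cis (dt * \<sigma>)) \<in> borel_measurable (circ dt)"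
 unfolding measurable_cong_sets[OF sets_circ refl] by (rule measurable_vimage_algebra1) auto

lemma cis_circ [measurable (raw)]: "f \<in> N \<rightarrow>\<^sub>M circ dt ==> (%x. cis (dt * f x)) \<in> borel_measurable N"
 by (rule measurable_compose[OF _ cis_circ0])

lemma measurable_into_circ:
 assumes "(%x. cis (dt * f x)) \<in> borel_measurable N"
 shows "f \<in> N \<rightarrow>\<^sub>M circ dt"
 unfolding measurable_cong_sets[OF refl sets_circ]
 by (rule measurable_vimage_algebra2) (use assms in auto)

lemma id_circ: "(%x. x) \<in> borel \<rightarrow>\<^sub>M circ dt"
 by (rule measurable_into_circ, rule measurable_compose[OF _ cis_borel]) simp

lemma borel_of_circ: "f \<in> borel_measurable (circ dt) ==> f \<in> borel_measurable borel"
 by (drule measurable_compose[OF id_circ])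

lemma nn_integral_circ:
 assumes f: "f \<in> borel_measurable (circ dt)"
 shows "(\<integral>\<^sup>+x. f x \<partial>circ dt) = (\<integral>\<^sup>+x\<in>{-pi/dt..pi/dt}. f x \<partial>lborel)"
proof -
 have "(%x. x) \<in> restrict_space lborel {-pi/dt..pi/dt} \<rightarrow>\<^sub>M vimage_algebra UNIV (%\<sigma>. cis (dt * \<sigma>)) borel"
  by (rule measurable_vimage_algebra2) (auto intro!: measurable_restrict_space1 measurable_compose[OF _ cis_borel])
 from nn_integral_distr[OF this, of f] have "(\<integral>\<^sup>+x. f x \<partial>circ dt) = (\<integral>\<^sup>+x. f x \<partial>restrict_space lborel {-pi/dt..pi/dt})"
  using f unfolding circ_def by simp
 then show ?thesis by (simp add: nn_integral_restrict_space)
qed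

text \<open>Every measurable set is a preimage under \<open>cis (dt * \<sigma>)\<close>, in
  particular the level set of the value at \<open>x\<close>.\<close>

lemma circ_periodic:
 fixes f :: "real => ennreal"
 assumes "f \<in> borel_measurable (circ dt)" "cis (dt * x) = cis (dt * y)"
 shows "f x = f y"
proof -
 have "f -` {f x} \<inter> space (circ dt) \<in> sets (circ dt)"
  by (rule measurable_sets[OF assms(1)]) simp
 then have "f -` {f x} \<in> sets (vimage_algebra UNIV (%\<sigma>. cis (dt * \<sigma>)) borel)"
  using sets_circ[of dt] by simp
 then obtain A where A: "f -` {f x} = (%\<sigma>. cis (dt * \<sigma>)) -` A"
  by (subst (asm) sets_vimage_algebra2) auto
 have "x \<in> f -` {f x}" by simp
 then have "y \<in> f -` {f x}" using assms(2) unfolding A by simp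
 then show ?thesis by simp
qed

lemma nn_integral_lborel_shift:
 fixes f :: "real => ennreal"
 assumes "f \<in> borel_measurable borel"
 shows "(\<integral>\<^sup>+x. f (x + c) \<partial>lborel) = (\<integral>\<^sup>+x. f x \<partial>lborel)"
 using nn_integral_real_affine[of f 1 c] assms by (simp add: add.commute)

lemma nn_integral_lborel_refl:
 fixes f :: "real => ennreal"
 assumes "f \<in> borel_measurable borel"
 shows "(\<integral>\<^sup>+x. f (- x) \<partial>lborel) = (\<integral>\<^sup>+x. f x \<partial>lborel)"
 using nn_integral_real_affine[of f "-1" 0] assms by simp

text \<open>Modulo whole periods the shift lies between 0 and \<open>L\<close>, and the part of the
  window that sticks out on the right is moved back by one period.\<close>

lemma nn_integral_period_shift:
 fixes f :: "real => ennreal"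
 assumes [measurable]: "f \<in> borel_measurable borel" and L: "L > 0"
  and per: "\<And>x n. f (x + of_int n * L) = f x"
 shows "(\<integral>\<^sup>+x\<in>{a..<a+L}. f (x + c) \<partial>lborel) = (\<integral>\<^sup>+x\<in>{a..<a+L}. f x \<partial>lborel)"
proof -
 define n where "n = \<lfloor>c / L\<rfloor>"
 define d where "d = c - of_int n * L"
 have "of_int n <= c / L" "c / L < of_int n + 1" unfolding n_def by linarith+
 then have d: "0 <= d" "d < L" using L by (auto simp: d_def field_simps)
 have "f (x + c) = f (x + d)" for x
  using per[of "x + d" n] by (simp add: d_def add.assoc)
 then have "(\<integral>\<^sup>+x\<in>{a..<a+L}. f (x + c) \<partial>lborel) = (\<integral>\<^sup>+x. f (x + d) * indicator {a+d..<a+L+d} (x + d) \<partial>lborel)"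
  by (auto intro!: nn_integral_cong split: split_indicator)
 also have "\<dots> = (\<integral>\<^sup>+x. f x * indicator {a+d..<a+L+d} x \<partial>lborel)"
  by (rule nn_integral_lborel_shift[of "%x. f x * indicator {a+d..<a+L+d} x"]) measurable
 also have "\<dots> = (\<integral>\<^sup>+x. f x * indicator {a+d..<a+L} x + f x * indicator {a+L..<a+L+d} x \<partial>lborel)"
  using d by (auto intro!: nn_integral_cong split: split_indicator)
 also have "\<dots> = (\<integral>\<^sup>+x. f x * indicator {a+d..<a+L} x \<partial>lborel) + (\<integral>\<^sup>+x. f x * indicator {a+L..<a+L+d} x \<partial>lborel)"
  by (rule nn_integral_add) measurable
 also have "(\<integral>\<^sup>+x. f x * indicator {a+L..<a+L+d} x \<partial>lborel) =
   (\<integral>\<^sup>+x. f (x + L) * indicator {a+L..<a+L+d} (x + L) \<partial>lborel)"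
  by (rule nn_integral_lborel_shift[of "%x. f x * indicator {a+L..<a+L+d} x", symmetric]) measurable
 also have "\<dots> = (\<integral>\<^sup>+x. f x * indicator {a..<a+d} x \<partial>lborel)"
  using per[of _ 1] by (auto intro!: nn_integral_cong split: split_indicator)
 also have "(\<integral>\<^sup>+x. f x * indicator {a+d..<a+L} x \<partial>lborel) + (\<integral>\<^sup>+x. f x * indicator {a..<a+d} x \<partial>lborel) =
   (\<integral>\<^sup>+x. f x * indicator {a+d..<a+L} x + f x * indicator {a..<a+d} x \<partial>lborel)"
  by (rule nn_integral_add[symmetric]) measurable
 also have "\<dots> = (\<integral>\<^sup>+x\<in>{a..<a+L}. f x \<partial>lborel)"
  using d by (auto intro!: nn_integral_cong split: split_indicator)
 finally show ?thesis .
qed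

lemma nn_integral_Icc_Ico:
 fixes f :: "real => ennreal"
 shows "(\<integral>\<^sup>+x\<in>{a..b}. f x \<partial>lborel) = (\<integral>\<^sup>+x\<in>{a..<b}. f x \<partial>lborel)"
proof (rule nn_integral_cong_AE)
 have "AE x in lborel. x \<noteq> b" by (rule AE_lborel_singleton)
 then show "AE x in lborel. f x * indicator {a..b} x = f x * indicator {a..<b} x"
  by eventually_elim (auto split: split_indicator)
qed

lemma cis_period: "dt \<noteq> 0 ==> cis (dt * (x + of_int n * (2 * pi / dt))) = cis (dt * x)"
proof -
 assume "dt \<noteq> 0"
 then have "dt * (x + of_int n * (2 * pi / dt)) = dt * x + 2 * pi * of_int n"
  by (simp add: field_simps)
 then show ?thesis by (simp flip: cis_mult)
qed

lemma nn_integral_circ_Ico: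
 assumes "f \<in> borel_measurable (circ dt)"
 shows "(\<integral>\<^sup>+x. f x \<partial>circ dt) = (\<integral>\<^sup>+x\<in>{-pi/dt..<-pi/dt + 2*pi/dt}. f x \<partial>lborel)"
proof -
 have "-pi/dt + 2*pi/dt = pi/dt" by (simp add: add_divide_distrib[symmetric])
 then show ?thesis using nn_integral_circ[OF assms] by (simp only: nn_integral_Icc_Ico)
qed

lemma finite_measure_circ: assumes "0 < dt" shows "finite_measure (circ dt)"
proof
 have "emeasure (circ dt) UNIV = (\<integral>\<^sup>+x. 1 \<partial>circ dt)" by simp
 also have "\<dots> = (\<integral>\<^sup>+x\<in>{-pi/dt..pi/dt}. 1 \<partial>lborel)" by (rule nn_integral_circ) simp
 also have "\<dots> = emeasure lborel {-pi/dt..pi/dt}" by simp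
 also have "\<dots> < \<infinity>" using assms by (simp add: emeasure_lborel_Icc_eq)
 finally show "emeasure (circ dt) (space (circ dt)) \<noteq> \<infinity>" by simp
qed

lemma inv_measure_circ: assumes dt: "0 < dt" shows "inv_measure (circ dt)"
proof -
 interpret finite_measure "circ dt" by (rule finite_measure_circ[OF dt])
 show ?thesis
 proof
  have "(%p. cis (dt * (fst p + snd p))) = (%p. cis (dt * fst p) * cis (dt * snd p))"
   by (simp only: cis_mult distrib_left)
  also have "\<dots> \<in> borel_measurable (circ dt \<Otimes>\<^sub>M circ dt)" by measurable
  finally show pl: "(%p. fst p + snd p) \<in> circ dt \<Otimes>\<^sub>M circ dt \<rightarrow>\<^sub>M circ dt"
   by (rule measurable_into_circ)
  have [measurable]: "(%x. x + c) \<in> circ dt \<rightarrow>\<^sub>M circ dt" for c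
  proof -
   have "(%x. (x, c)) \<in> circ dt \<rightarrow>\<^sub>M circ dt \<Otimes>\<^sub>M circ dt"
    by (rule measurable_Pair) simp_all
   from measurable_compose[OF this pl] show ?thesis by (simp only: fst_conv snd_conv)
  qed
  have "(%x. cis (dt * - x)) = (%x. cnj (cis (dt * x)))" by (simp add: cis_cnj)
  also have "\<dots> \<in> borel_measurable (circ dt)" by measurable
  finally show um[measurable]: "uminus \<in> circ dt \<rightarrow>\<^sub>M circ dt"
   by (rule measurable_into_circ)
  fix f :: "real => ennreal" assume [measurable]: "f \<in> borel_measurable (circ dt)"
  then have [measurable]: "f \<in> borel_measurable borel" by (rule borel_of_circ)
  show "(\<integral>\<^sup>+x. f (x + c) \<partial>circ dt) = (\<integral>\<^sup>+x. f x \<partial>circ dt)" for c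
  proof -
   have "(%x. f (x + c)) \<in> borel_measurable (circ dt)"
    by (rule measurable_compose[OF _ \<open>f \<in> borel_measurable (circ dt)\<close>]) measurable
   moreover have "f (x + of_int n * (2 * pi / dt)) = f x" for x n
    by (rule circ_periodic[OF \<open>f \<in> borel_measurable (circ dt)\<close>]) (use dt in \<open>simp only: cis_period\<close>)
   ultimately show ?thesis
    using nn_integral_period_shift[of f "2 * pi / dt" c "- pi / dt"] dt \<open>f \<in> borel_measurable borel\<close>
     nn_integral_circ_Ico[of f dt] nn_integral_circ_Ico[of "%x. f (x + c)" dt]
     \<open>f \<in> borel_measurable (circ dt)\<close> by simp
  qed
  show "(\<integral>\<^sup>+x. f (- x) \<partial>circ dt) = (\<integral>\<^sup>+x. f x \<partial>circ dt)"
  proof -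
   have "(\<integral>\<^sup>+x\<in>{-pi/dt..pi/dt}. f (- x) \<partial>lborel) = (\<integral>\<^sup>+x. f (- x) * indicator {-pi/dt..pi/dt} (- x) \<partial>lborel)"
    by (intro nn_integral_cong) (auto split: split_indicator)
   also have "\<dots> = (\<integral>\<^sup>+x\<in>{-pi/dt..pi/dt}. f x \<partial>lborel)"
    by (rule nn_integral_lborel_refl[of "%x. f x * indicator {-pi/dt..pi/dt} x"]) measurable
   finally show ?thesis
    using nn_integral_circ[OF measurable_compose[OF um \<open>f \<in> borel_measurable (circ dt)\<close>]]
     nn_integral_circ[OF \<open>f \<in> borel_measurable (circ dt)\<close>] by simp
  qed
 qed auto
qed

lemma inv_measure_int: "inv_measure (count_space (UNIV :: int set))"
proof -
 interpret sigma_finite_measure "count_space (UNIV :: int set)"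
  by (rule sigma_finite_measure_count_space)
 show ?thesis
 proof
  show "(%p. fst p + snd p) \<in> count_space UNIV \<Otimes>\<^sub>M count_space UNIV \<rightarrow>\<^sub>M count_space (UNIV :: int set)"
   by (simp add: pair_measure_countable)
  fix f :: "int => ennreal"
  show "(\<integral>\<^sup>+x. f (x + c) \<partial>count_space UNIV) = (\<integral>\<^sup>+x. f x \<partial>count_space UNIV)" for c
   by (rule nn_integral_bij_count_space, rule bij_betw_byWitness[of _ "%x. x - c"]) auto
  show "(\<integral>\<^sup>+x. f (- x) \<partial>count_space UNIV) = (\<integral>\<^sup>+x. f x \<partial>count_space UNIV)"
   by (rule nn_integral_bij_count_space, rule bij_betw_byWitness[of _ uminus]) auto
 qed auto
qed

text \<open>The dual group of the torus times the time grid: integer frequencies and modulations on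
  the circle.\<close>

definition Gam :: "real => (int \<times> real) measure" where
 "Gam dt = count_space UNIV \<Otimes>\<^sub>M circ dt"

lemma inv_measure_Gam: assumes dt: "0 < dt" shows "inv_measure (Gam dt)"
proof -
 interpret C: inv_measure "circ dt" by (rule inv_measure_circ[OF dt])
 interpret I: inv_measure "count_space (UNIV :: int set)" by (rule inv_measure_int)
 interpret P: pair_sigma_finite "count_space (UNIV :: int set)" "circ dt" ..
 let ?P = "count_space (UNIV :: int set) \<Otimes>\<^sub>M circ dt"
 have pl: "(%p. fst p + snd p) \<in> ?P \<Otimes>\<^sub>M ?P \<rightarrow>\<^sub>M ?P"
  unfolding plus_prod_def
  by (intro measurable_Pair I.plus_M C.plus_M measurable_compose[OF measurable_fst] measurable_compose[OF measurable_snd]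
    measurable_fst measurable_snd)
 have [measurable]: "(%x. x + c) \<in> ?P \<rightarrow>\<^sub>M ?P" for c
  using measurable_compose[OF measurable_Pair[OF measurable_ident measurable_const] pl, of c] by (simp add: space_pair_measure)
 have um[measurable]: "uminus \<in> ?P \<rightarrow>\<^sub>M ?P"
  unfolding uminus_prod_def
  by (intro measurable_Pair I.uminus_M C.uminus_M measurable_fst measurable_snd)
 show ?thesis unfolding Gam_def
 proof
  show "(%p. fst p + snd p) \<in> ?P \<Otimes>\<^sub>M ?P \<rightarrow>\<^sub>M ?P" "uminus \<in> ?P \<rightarrow>\<^sub>M ?P" by (fact pl um)+
  fix f :: "int \<times> real => ennreal" assume [measurable]: "f \<in> borel_measurable (count_space UNIV \<Otimes>\<^sub>M circ dt)"
  show "(\<integral>\<^sup>+x. f (x + c) \<partial>(count_space UNIV \<Otimes>\<^sub>M circ dt)) = (\<integral>\<^sup>+x. f x \<partial>(count_space UNIV \<Otimes>\<^sub>M circ dt))" for c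
  proof -
   have "(\<integral>\<^sup>+x. f (x + c) \<partial>(count_space UNIV \<Otimes>\<^sub>M circ dt)) =
    (\<integral>\<^sup>+k. (\<integral>\<^sup>+s. f (k + fst c, s + snd c) \<partial>circ dt) \<partial>count_space UNIV)"
    using C.nn_integral_fst[of "%x. f (x + c)" "count_space UNIV"] by (cases c) simp
   also have "\<dots> = (\<integral>\<^sup>+k. (\<integral>\<^sup>+s. f (k + fst c, s) \<partial>circ dt) \<partial>count_space UNIV)"
    by (intro nn_integral_cong C.nn_integral_shift) measurable
   also have "\<dots> = (\<integral>\<^sup>+k. (\<integral>\<^sup>+s. f (k, s) \<partial>circ dt) \<partial>count_space UNIV)"
    by (rule I.nn_integral_shift) simp
   also have "\<dots> = (\<integral>\<^sup>+x. f x \<partial>(count_space UNIV \<Otimes>\<^sub>M circ dt))"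
    by (rule C.nn_integral_fst) measurable
   finally show ?thesis .
  qed
  show "(\<integral>\<^sup>+x. f (- x) \<partial>(count_space UNIV \<Otimes>\<^sub>M circ dt)) = (\<integral>\<^sup>+x. f x \<partial>(count_space UNIV \<Otimes>\<^sub>M circ dt))"
  proof -
   have "(\<integral>\<^sup>+x. f (- x) \<partial>(count_space UNIV \<Otimes>\<^sub>M circ dt)) =
    (\<integral>\<^sup>+k. (\<integral>\<^sup>+s. f (- k, - s) \<partial>circ dt) \<partial>count_space UNIV)"
    using C.nn_integral_fst[OF measurable_compose[OF um \<open>f \<in> borel_measurable ?P\<close>]] by simp
   also have "\<dots> = (\<integral>\<^sup>+k. (\<integral>\<^sup>+s. f (- k, s) \<partial>circ dt) \<partial>count_space UNIV)"
    by (intro nn_integral_cong C.nn_integral_refl) measurable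
   also have "\<dots> = (\<integral>\<^sup>+k. (\<integral>\<^sup>+s. f (k, s) \<partial>circ dt) \<partial>count_space UNIV)"
    by (rule I.nn_integral_refl) simp
   also have "\<dots> = (\<integral>\<^sup>+x. f x \<partial>(count_space UNIV \<Otimes>\<^sub>M circ dt))"
    by (rule C.nn_integral_fst) measurable
   finally show ?thesis .
  qed
 qed (simp add: space_pair_measure)
qed

lemma nn_integral_Gam:
 assumes "0 < dt" "f \<in> borel_measurable (Gam dt)"
 shows "(\<integral>\<^sup>+x. f x \<partial>Gam dt) = (\<integral>\<^sup>+k. (\<integral>\<^sup>+s. f (k, s) \<partial>circ dt) \<partial>count_space UNIV)"
proof -
 interpret C: inv_measure "circ dt" by (rule inv_measure_circ[OF assms(1)])
 show ?thesis using C.nn_integral_fst[OF assms(2)[unfolded Gam_def]] by (simp add: Gam_def)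
qed

section \<open>Notation for norms, sums and mixed products\<close>

abbreviation en where "en \<equiv> ennreal"
type_synonym gf = "int \<times> real => ennreal"
abbreviation bG where "bG dt \<equiv> borel_measurable (Gam dt)"
abbreviation bC where "bC dt \<equiv> borel_measurable (circ dt)"
abbreviation nG where "nG dt \<equiv> nrm (Gam dt)"
abbreviation nC where "nC dt \<equiv> nrm (circ dt)"
abbreviation cZ where "cZ \<equiv> count_space (UNIV :: int set)"
abbreviation cG where "cG dt \<equiv> inv_measure.conv (Gam dt)"
abbreviation sum_Z (binder "SI " 10) where "sum_Z f \<equiv> nn_integral cZ f"
abbreviation fc where "fc \<equiv> fourier_coeff"
abbreviation Xs where "Xs dt s \<equiv> X_norm dt s (1/2)"
abbreviation Xh where "Xh dt \<equiv> X_norm dt (1/2) (1/2)"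
abbreviation Tg where "Tg T1 \<equiv> ennreal (T1 powr (1/200))"
text \<open>One factor carries the norm \<open>X\<close>, the others the norm \<open>Y\<close>,
  summed over the choice of that factor. The three variants are bracketed the way the estimates
  produce them.\<close>

abbreviation mixt where "mixt X Y a b c \<equiv> X a * Y b * Y c + (Y a * X b * Y c + Y a * Y b * (X c :: ennreal))"
abbreviation mix3 where "mix3 X Y a b c \<equiv> X a * (Y b * Y c) + (X b * (Y a * Y c) + X c * (Y a * (Y b :: ennreal)))"
abbreviation mix5 where "mix5 X Y a b c d e \<equiv> X a * (Y b * Y c * (Y d * Y e)) + (X b * (Y a * Y c * (Y d * Y e)) +
 (X c * (Y a * Y b * (Y d * Y e)) + (X d * (Y a * Y b * (Y c * Y e)) + X e * (Y a * Y b * (Y c * (Y d :: ennreal))))))"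

section \<open>The Japanese bracket and lattice sums\<close>

abbreviation J :: "real => real" where "J \<equiv> japanese"

lemma J_eq: "J x = sqrt (1 + x\<^sup>2)" by (simp add: japanese_def)

lemma J_sq: "(J x)\<^sup>2 = 1 + x\<^sup>2" by (simp add: J_eq)

lemma japanese_ge_1: "japanese x \<ge> 1" by (simp add: japanese_def)

lemma japanese_pos [simp]: "japanese x > 0" "japanese x \<noteq> 0" "japanese x \<ge> 0"
 using japanese_ge_1[of x] by linarith+

lemma norm_le_japanese: "norm x <= japanese x"
 unfolding japanese_def by (rule real_le_rsqrt) simp

lemma japanese_minus: "japanese (- x) = japanese x" by (simp add: japanese_def)

lemma japanese_add: "japanese (x + y) <= japanese x + japanese y"
proof -
 have "(norm (x + y))\<^sup>2 <= (norm x + norm y)\<^sup>2"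
  by (intro power_mono norm_triangle_ineq) auto
 moreover have "norm x * norm y <= japanese x * japanese y"
  by (intro mult_mono norm_le_japanese) auto
 ultimately have "1 + (norm (x + y))\<^sup>2 <= (japanese x + japanese y)\<^sup>2"
  by (simp add: power2_sum japanese_def)
 then show ?thesis unfolding japanese_def[of "x + y"] by (intro real_le_lsqrt) auto
qed

lemma J_le_mult: assumes "c \<ge> 1" "\<bar>x\<bar> <= c * \<bar>y\<bar>" shows "J x <= c * J y"
proof -
 have "x\<^sup>2 <= (c * \<bar>y\<bar>)\<^sup>2" using assms by (intro abs_le_square_iff[THEN iffD1]) auto
 moreover have "1 <= c\<^sup>2" using assms by simp
 ultimately have "1 + x\<^sup>2 <= (c * J y)\<^sup>2" by (simp add: power_mult_distrib J_sq algebra_simps)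
 then show ?thesis unfolding J_eq[of x] using assms by (intro real_le_lsqrt) auto
qed

lemma powr_neg_mono: assumes "0 < y" "y <= c * x" "0 < c" "0 <= a" shows "x powr - a <= c powr a * y powr - (a::real)"
proof -
 have "x > 0" using assms by (smt (verit) zero_less_mult_pos)
 have "y powr a <= (c * x) powr a" using assms by (intro powr_mono2) auto
 then show ?thesis using assms \<open>x > 0\<close> by (simp add: powr_minus powr_mult field_simps)
qed

lemma powr_neg_le1: assumes "1 <= x" "0 <= a" shows "x powr - a <= (1::real)"
 using powr_mono2'[of "- a" 1 x] assms by simp

text \<open>The smaller of the two numbers has the larger negative powers and can take over the
  power of the other.\<close>

lemma powr_neg_prod_le:
 fixes x y :: real
 assumes "x \<ge> 1" "y \<ge> 1" "a \<ge> 0" "b \<ge> 0"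
 shows "x powr - a * y powr - b <= x powr - (a + b) + y powr - (a + b)"
proof (cases "x <= y")
 case True
 then have "y powr - b <= x powr - b" using assms by (intro powr_mono2') auto
 then have "x powr - a * y powr - b <= x powr - a * x powr - b" by (intro mult_left_mono) auto
 also have "\<dots> = x powr - (a + b)" by (simp flip: powr_add)
 finally show ?thesis by (smt (verit) powr_ge_zero)
next
 case False
 then have "x powr - a <= y powr - a" using assms by (intro powr_mono2') auto
 then have "x powr - a * y powr - b <= y powr - a * y powr - b" by (intro mult_right_mono) auto
 also have "\<dots> = y powr - (a + b)" by (simp flip: powr_add)
 finally show ?thesis by (smt (verit) powr_ge_zero)
qed

lemma sum_J0_finite:
 assumes "\<alpha> > 1" shows "(\<integral>\<^sup>+k. ennreal (J (of_int k) powr - \<alpha>) \<partial>count_space UNIV) < \<infinity>"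
proof -
 have *: "summable (%n. J (real n) powr - \<alpha>)"
 proof (rule summable_comparison_test_ev)
  show "summable (%n. real n powr - \<alpha>)" using assms by (simp add: summable_real_powr_iff)
  have "norm (J (real n) powr - \<alpha>) <= real n powr - \<alpha>" if "n \<ge> 1" for n :: nat
   using that assms norm_le_japanese[of "real n"] by (auto intro!: powr_mono2')
  then show "\<forall>\<^sub>F n in sequentially. norm (J (real n) powr - \<alpha>) <= real n powr - \<alpha>"
   by (rule eventually_sequentiallyI[where c = 1])
 qed
 let ?f = "%k::int. ennreal (J (of_int k) powr - \<alpha>)"
 have nat: "(\<integral>\<^sup>+n. ennreal (J (real n) powr - \<alpha>) \<partial>count_space UNIV) < \<infinity>"
  using * by (subst nn_integral_count_space_nat) (auto simp: suminf_ennreal2 less_top[symmetric] ennreal_suminf_neq_top)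
 have 1: "(\<integral>\<^sup>+k. ?f k \<partial>count_space (range int)) = (\<integral>\<^sup>+n. ennreal (J (real n) powr - \<alpha>) \<partial>count_space UNIV)"
  by (subst nn_integral_bij_count_space[symmetric, of int UNIV "range int"]) (auto simp: bij_betw_def inj_on_def)
 have 2: "(\<integral>\<^sup>+k. ?f k \<partial>count_space (range (%n. - int n))) = (\<integral>\<^sup>+n. ennreal (J (real n) powr - \<alpha>) \<partial>count_space UNIV)"
  by (subst nn_integral_bij_count_space[symmetric, of "%n. - int n" UNIV "range (%n. - int n)"])
   (auto simp: bij_betw_def inj_on_def japanese_minus)
 have "(\<integral>\<^sup>+k. ?f k \<partial>count_space UNIV) <= (\<integral>\<^sup>+k. ?f k * indicator (range int) k + ?f k * indicator (range (%n. - int n)) k \<partial>count_space UNIV)"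
 proof (rule nn_integral_mono)
  fix k :: int
  have "k \<in> range int \<or> k \<in> range (%n. - int n)"
   by (metis int_cases2 rangeI)
  then show "?f k <= ?f k * indicator (range int) k + ?f k * indicator (range (%n. - int n)) k"
   by (auto split: split_indicator)
 qed
 also have "\<dots> = (\<integral>\<^sup>+k. ?f k \<partial>count_space (range int)) + (\<integral>\<^sup>+k. ?f k \<partial>count_space (range (%n. - int n)))"
  by (subst nn_integral_add) (auto simp: nn_integral_count_space_indicator)
 also have "\<dots> < \<infinity>" unfolding 1 2 using nat by simp
 finally show ?thesis .
qed

text \<open>An integer translation brings \<open>x\<close> into the unit interval, where the
  brackets of \<open>k\<close> and of \<open>k - x\<close> are comparable.\<close>

lemma sum_J_bound:
 assumes "\<alpha> > 1"
 shows "\<exists>C<\<infinity>. \<forall>x. (SI k. en (J (of_int k - x) powr - \<alpha>)) <= C"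
proof (intro exI[of _ "en (2 powr \<alpha>) * (SI k. en (J (of_int k) powr - \<alpha>))"] conjI allI)
 interpret I: inv_measure "cZ" by (rule inv_measure_int)
 show "en (2 powr \<alpha>) * (SI k. en (J (of_int k) powr - \<alpha>)) < \<infinity>"
  using sum_J0_finite[OF assms] by (simp add: ennreal_mult_less_top)
 fix x :: real
 define f where "f = frac x"
 have f: "0 <= f" "f < 1" by (auto simp: f_def frac_lt_1)
 have "(SI k. en (J (of_int k - x) powr - \<alpha>)) =
   (SI k. en (J (of_int (k + \<lfloor>x\<rfloor>) - x) powr - \<alpha>))"
  by (rule I.nn_integral_shift[symmetric]) simp
 also have "\<dots> = (SI k. en (J (of_int k - f) powr - \<alpha>))"
  by (simp add: f_def frac_def algebra_simps)
 also have "\<dots> <= (SI k. en (2 powr \<alpha>) * en (J (of_int k) powr - \<alpha>))"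
 proof (rule nn_integral_mono)
  fix k :: int
  have "1 + (of_int k)\<^sup>2 <= (2 * J (of_int k - f))\<^sup>2"
  proof -
   have "0 <= (of_int k - 2 * f)\<^sup>2" by simp
   then have "(of_int k)\<^sup>2 <= 2 * (of_int k - f)\<^sup>2 + 2 * f\<^sup>2" by (simp add: power2_eq_square algebra_simps)
   moreover have "f\<^sup>2 <= 1" using f by (simp add: power_le_one)
   ultimately show ?thesis by (simp add: power_mult_distrib J_sq) (smt (verit) zero_le_power2)
  qed
  then have "J (of_int k) <= 2 * J (of_int k - f)" unfolding J_eq[of "of_int k"] by (intro real_le_lsqrt) auto
  then have "J (of_int k - f) powr - \<alpha> <= 2 powr \<alpha> * J (of_int k) powr - \<alpha>"
   using assms by (intro powr_neg_mono) auto
  then show "en (J (of_int k - f) powr - \<alpha>) <= en (2 powr \<alpha>) * en (J (of_int k) powr - \<alpha>)"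
   by (simp add: ennreal_leI flip: ennreal_mult)
 qed
 finally show "(SI k. en (J (of_int k - x) powr - \<alpha>)) <=
  en (2 powr \<alpha>) * (SI k. en (J (of_int k) powr - \<alpha>))"
  by (simp add: nn_integral_cmult)
qed

lemma sum_J_J_bound:
 assumes "\<alpha> + \<beta> > 1" "\<alpha> \<ge> 0" "\<beta> \<ge> 0"
 shows "\<exists>C<\<infinity>. \<forall>x y. (SI k. en (J (of_int k - x) powr - \<alpha> * J (of_int k - y) powr - \<beta>)) <= C"
proof -
 obtain C where C: "C < \<infinity>" "\<And>x. (SI k. en (J (of_int k - x) powr - (\<alpha> + \<beta>))) <= C"
  using sum_J_bound[OF assms(1)] by auto
 have "(SI k. en (J (of_int k - x) powr - \<alpha> * J (of_int k - y) powr - \<beta>)) <= C + C" for x y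
 proof -
  have "(SI k. en (J (of_int k - x) powr - \<alpha> * J (of_int k - y) powr - \<beta>)) <=
   (SI k. en (J (of_int k - x) powr - (\<alpha> + \<beta>)) + en (J (of_int k - y) powr - (\<alpha> + \<beta>)))"
   using assms by (intro nn_integral_mono, subst ennreal_plus[symmetric])
    (simp_all only: powr_ge_zero ennreal_leI powr_neg_prod_le japanese_ge_1)
  also have "\<dots> <= C + C" by (subst nn_integral_add, simp, simp, intro add_mono C(2))
  finally show ?thesis .
 qed
 then show ?thesis using C(1) by (intro exI[of _ "C + C"]) auto
qed

text \<open>The phase is a quadratic polynomial, so it takes values near \<open>c\<close> only close to its two roots.\<close>

lemma sum_J_quadratic:
 assumes "\<gamma> > 1/2"
 shows "\<exists>C<\<infinity>. \<forall>c z. (SI k. en (J (c - 2 * (of_int k - z)\<^sup>2) powr - \<gamma>)) <= C"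
proof -
 obtain C where C: "C < \<infinity>" "\<And>x. (SI k. en (J (of_int k - x) powr - (2 * \<gamma>))) <= C"
  using sum_J_bound[of "2 * \<gamma>"] assms by auto
 \<comment> \<open>\<open>u\<close> is the nonnegative root of \<open>2 * y\<^sup>2 = c\<close>, or
   0 when there is none. The squared distance from \<open>y\<close> to the nearer of
   \<open>u\<close> and \<open>- u\<close> is at most \<open>\<bar>c - 2 * y\<^sup>2\<bar>\<close>,
   which doubles the exponent to \<open>2 * \<gamma> > 1\<close>.\<close>
 have key: "J (c - 2 * y\<^sup>2) powr - \<gamma> <= 2 powr \<gamma> * (J (y - u) powr - (2 * \<gamma>) + J (y + u) powr - (2 * \<gamma>))"
  if u: "u = sqrt (max c 0 / 2)" for c y u
 proof -
  have "\<exists>v\<in>{u, -u}. (y - v)\<^sup>2 <= \<bar>c - 2 * y\<^sup>2\<bar>"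
  proof (cases "c <= 0")
   case True
   then show ?thesis using u by (intro bexI[of _ u]) auto
  next
   case False
   then have c: "c = 2 * u\<^sup>2" and u0: "u \<ge> 0" using u by auto
   have e: "\<bar>c - 2 * y\<^sup>2\<bar> = 2 * (\<bar>y - u\<bar> * \<bar>y + u\<bar>)"
   proof -
    have "c - 2 * y\<^sup>2 = - 2 * ((y - u) * (y + u))" unfolding c by (simp add: power2_eq_square algebra_simps)
    then show ?thesis by (simp only: abs_mult)
   qed
   have nn: "\<bar>y - u\<bar> * \<bar>y + u\<bar> <= 2 * (\<bar>y - u\<bar> * \<bar>y + u\<bar>)"
    using mult_nonneg_nonneg[OF abs_ge_zero abs_ge_zero, of "y - u" "y + u"] by linarith
   show ?thesis
   proof (cases "\<bar>y - u\<bar> <= \<bar>y + u\<bar>")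
    case True
    then have "\<bar>y - u\<bar> * \<bar>y - u\<bar> <= \<bar>y - u\<bar> * \<bar>y + u\<bar>" by (intro mult_left_mono) auto
    then have "(y - u)\<^sup>2 <= \<bar>y - u\<bar> * \<bar>y + u\<bar>" by (simp add: power2_eq_square)
     then have "(y - u)\<^sup>2 <= \<bar>c - 2 * y\<^sup>2\<bar>" unfolding e using nn by linarith
     then show ?thesis by (intro bexI[of _ u]) auto
   next
    case False
    then have "\<bar>y + u\<bar> * \<bar>y + u\<bar> <= \<bar>y - u\<bar> * \<bar>y + u\<bar>" by (intro mult_right_mono) auto
    then have "(y + u)\<^sup>2 <= \<bar>y - u\<bar> * \<bar>y + u\<bar>" by (simp add: power2_eq_square)
     then have "(y + u)\<^sup>2 <= \<bar>c - 2 * y\<^sup>2\<bar>" unfolding e using nn by linarith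
     then show ?thesis by (intro bexI[of _ "-u"]) auto
   qed
  qed
  then obtain v where v: "v \<in> {u, -u}" "(y - v)\<^sup>2 <= \<bar>c - 2 * y\<^sup>2\<bar>" by blast
  have "(J (y - v))\<^sup>2 <= 2 * J (c - 2 * y\<^sup>2)"
  proof -
   have "(J (y - v))\<^sup>2 <= 1 + \<bar>c - 2 * y\<^sup>2\<bar>" using v(2) by (simp add: J_sq)
   also have "\<dots> <= 2 * J (c - 2 * y\<^sup>2)"
    using japanese_ge_1[of "c - 2 * y\<^sup>2"] norm_le_japanese[of "c - 2 * y\<^sup>2"] by simp
   finally show ?thesis .
  qed
  then have "J (c - 2 * y\<^sup>2) powr - \<gamma> <= 2 powr \<gamma> * ((J (y - v))\<^sup>2) powr - \<gamma>"
   using assms by (intro powr_neg_mono) auto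
  also have "((J (y - v))\<^sup>2) powr - \<gamma> = J (y - v) powr - (2 * \<gamma>)"
   by (simp add: powr_powr flip: powr_numeral)
  also have "J (y - v) powr - (2 * \<gamma>) <= J (y - u) powr - (2 * \<gamma>) + J (y + u) powr - (2 * \<gamma>)"
   using v(1) by auto
  finally show ?thesis by simp
 qed
 have "(SI k. en (J (c - 2 * (of_int k - z)\<^sup>2) powr - \<gamma>)) <= en (2 powr \<gamma>) * (C + C)" for c z
 proof -
  define u where "u = sqrt (max c 0 / 2)"
  have "(SI k. en (J (c - 2 * (of_int k - z)\<^sup>2) powr - \<gamma>)) <=
   (SI k. en (2 powr \<gamma>) * (en (J (of_int k - (z + u)) powr - (2 * \<gamma>)) + en (J (of_int k - (z - u)) powr - (2 * \<gamma>))))"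
  proof (rule nn_integral_mono)
   fix k :: int
   show "en (J (c - 2 * (of_int k - z)\<^sup>2) powr - \<gamma>) <=
    en (2 powr \<gamma>) * (en (J (of_int k - (z + u)) powr - (2 * \<gamma>)) + en (J (of_int k - (z - u)) powr - (2 * \<gamma>)))"
    using key[OF u_def, of "of_int k - z"]
    by (auto simp: diff_diff_eq diff_add_eq simp flip: ennreal_plus ennreal_mult diff_diff_eq2 intro!: ennreal_leI)
  qed
  also have "\<dots> <= en (2 powr \<gamma>) * (C + C)"
   by (subst nn_integral_cmult, simp, subst nn_integral_add) (auto intro!: mult_left_mono add_mono C(2))
  finally show ?thesis .
 qed
 then show ?thesis using C(1) by (intro exI[of _ "en (2 powr \<gamma>) * (C + C)"]) (auto simp: ennreal_mult_less_top)
qed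

text \<open>For fixed \<open>b\<close> the progression \<open>c - 2 a b\<close> has step \<open>2 b\<close>, which gains \<open>\<bar>b\<bar>\<^sup>-\<^sup>\<gamma>\<close> except for the
 single \<open>a\<close> nearest to \<open>c / (2 b)\<close>; the larger of the two weights pays for that one.\<close>

lemma sum_J_hyperbolic_half:
 assumes "\<gamma> > 0"
 shows "\<exists>C<\<infinity>. \<forall>x y c. (SI b. (SI a. en (if a \<noteq> 0 \<and> b \<noteq> 0 \<and> J (of_int a - x) \<ge> J (of_int b - y) then
  J (of_int a - x) powr - 1 * J (of_int b - y) powr - 1 * J (c - 2 * of_int a * of_int b) powr - \<gamma> else 0))) <= C"
proof -
 obtain A where A: "A < \<infinity>" "\<And>x. (SI k. en (J (of_int k - x) powr - 2)) <= A"
  using sum_J_bound[of 2] by auto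
 obtain B where B: "B < \<infinity>" "\<And>x y. (SI k. en (J (of_int k - x) powr - 1 * J (of_int k - y) powr - \<gamma>)) <= B"
  using sum_J_J_bound[of 1 \<gamma>] assms by auto
 \<comment> \<open>\<open>D\<close> has to dominate 4, the price for the \<open>a\<close> nearest to
   the zero, and \<open>3 powr \<gamma>\<close>, the price for all others.\<close>
 define D :: real where "D = 4 * 3 powr \<gamma>"
 have D: "D \<ge> 0" by (simp add: D_def)
 have key: "(if a \<noteq> 0 \<and> b \<noteq> 0 \<and> J (of_int a - x) \<ge> J (of_int b - y) then
  J (of_int a - x) powr - 1 * J (of_int b - y) powr - 1 * J (c - 2 * of_int a * of_int b) powr - \<gamma> else 0) <=
  D * (J (of_int b - y) powr - 2 * J (of_int a - c / (2 * of_int b)) powr - 2 +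
   J (of_int b - y) powr - 1 * J (of_int b) powr - \<gamma> * (J (of_int a - x) powr - 1 * J (of_int a - c / (2 * of_int b)) powr - \<gamma>))"
  (is "?L <= D * (?R1 + ?R2)") for a b :: int and x y c
 proof (cases "a \<noteq> 0 \<and> b \<noteq> 0 \<and> J (of_int a - x) \<ge> J (of_int b - y)")
  case False
  then show ?thesis using D by (auto intro!: mult_nonneg_nonneg add_nonneg_nonneg)
 next
  case True
  then have b: "\<bar>of_int b :: real\<bar> \<ge> 1" by linarith
  \<comment> \<open>Signed distance of \<open>a\<close> from the zero of the linear function
    \<open>c - 2 * a * b\<close> of \<open>a\<close>.\<close>
  define u where "u = of_int a - c / (2 * of_int b)"
  have cu: "c - 2 * of_int a * of_int b = - (2 * of_int b * u)" using b by (simp add: u_def field_simps)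
  have D1: "D \<ge> 4" "D \<ge> 3 powr \<gamma>"
   unfolding D_def using assms ge_one_powr_ge_zero[of 3 \<gamma>] by auto
  have nn: "?R1 \<ge> 0" "?R2 \<ge> 0" by auto
  show ?thesis
  proof (cases "\<bar>u\<bar> < 1/2")
   \<comment> \<open>The factor \<open>J u powr - 2\<close> is bounded below here; inserting it
     expresses by a summable weight that few \<open>a\<close> qualify. The larger weight, that of
     \<open>a\<close>, is replaced by the one of \<open>b\<close>, whose square is summable.\<close>
   case u: True
   have "(J u)\<^sup>2 <= 4"
   proof -
    have "u\<^sup>2 <= 1" using u by (simp add: abs_square_le_1)
    then show ?thesis by (simp add: J_sq)
   qed
   then have Ju: "1 <= 4 * J u powr - 2" by (simp add: powr_minus powr_numeral field_simps)
   have "?L <= J (of_int b - y) powr - 1 * J (of_int b - y) powr - 1 * 1"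
   proof -
    have "J (of_int a - x) powr - 1 <= J (of_int b - y) powr - 1" using True by (intro powr_mono2') auto
    moreover have "J (c - 2 * of_int a * of_int b) powr - \<gamma> <= 1"
     using assms by (intro powr_neg_le1 japanese_ge_1) auto
    ultimately have "J (of_int a - x) powr - 1 * J (of_int b - y) powr - 1 * J (c - 2 * of_int a * of_int b) powr - \<gamma>
     <= J (of_int b - y) powr - 1 * J (of_int b - y) powr - 1 * 1"
     by (intro mult_mono mult_nonneg_nonneg powr_ge_zero) auto
    then show ?thesis by (subst if_P[OF True])
   qed
   also have "\<dots> = J (of_int b - y) powr - 2" by (simp only: powr_add[symmetric]) simp
   also have "\<dots> <= J (of_int b - y) powr - 2 * (4 * J u powr - 2)"
    using Ju mult_left_mono[of 1 "4 * J u powr - 2" "J (of_int b - y) powr - 2"] by simp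
   also have "\<dots> = 4 * ?R1" by (simp add: u_def)
   also have "\<dots> <= D * (?R1 + ?R2)" using D1 nn by (intro mult_mono) auto
   finally show ?thesis .
  next
   \<comment> \<open>Away from the zero \<open>\<bar>b\<bar> \<ge> 1\<close> and
     \<open>\<bar>u\<bar> \<ge> 1/2\<close>, so the bracket of \<open>2 * b * u\<close> dominates
     the product of the brackets of \<open>b\<close> and \<open>u\<close>.\<close>
   case u: False
   have "J (of_int b) * J u <= 3 * J (c - 2 * of_int a * of_int b)"
   proof (rule power2_le_imp_le)
    have b2: "1 <= (of_int b :: real)\<^sup>2" using b by (simp add: abs_le_square_iff[of 1, simplified])
    have u2: "1 / 4 <= u\<^sup>2" using u abs_le_square_iff[of "1/2" u] by (simp add: power2_eq_square)
    have "(1 + (of_int b)\<^sup>2) * (1 + u\<^sup>2) <= (2 * (of_int b)\<^sup>2) * (5 * u\<^sup>2)"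
     using b2 u2 by (intro mult_mono) auto
    also have "\<dots> <= 9 * (1 + (2 * of_int b * u)\<^sup>2)" by (simp add: power_mult_distrib)
    finally show "(J (of_int b) * J u)\<^sup>2 <= (3 * J (c - 2 * of_int a * of_int b))\<^sup>2"
     unfolding cu by (simp add: power_mult_distrib J_sq)
   qed simp
   then have "J (c - 2 * of_int a * of_int b) powr - \<gamma> <= 3 powr \<gamma> * (J (of_int b) * J u) powr - \<gamma>"
    using assms by (intro powr_neg_mono) auto
   then have "?L <= J (of_int a - x) powr - 1 * J (of_int b - y) powr - 1 * (3 powr \<gamma> * (J (of_int b) * J u) powr - \<gamma>)"
    by (subst if_P[OF True]) (intro mult_left_mono mult_nonneg_nonneg powr_ge_zero)
   also have "\<dots> = 3 powr \<gamma> * ?R2" by (simp add: u_def powr_mult)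
   also have "\<dots> <= D * (?R1 + ?R2)" using D1 nn by (intro mult_mono) auto
   finally show ?thesis .
  qed
 qed
 have "(SI b. (SI a. en (if a \<noteq> 0 \<and> b \<noteq> 0 \<and> J (of_int a - x) \<ge> J (of_int b - y) then
  J (of_int a - x) powr - 1 * J (of_int b - y) powr - 1 * J (c - 2 * of_int a * of_int b) powr - \<gamma> else 0))) <= en D * (A * A + B * B)" for x y c
 proof -
  have "(SI b. (SI a. en (if a \<noteq> 0 \<and> b \<noteq> 0 \<and> J (of_int a - x) \<ge> J (of_int b - y) then
  J (of_int a - x) powr - 1 * J (of_int b - y) powr - 1 * J (c - 2 * of_int a * of_int b) powr - \<gamma> else 0))) <=
  (SI b. en D * (en (J (of_int b - y) powr - 2) * A + en (J (of_int b - y) powr - 1 * J (of_int b - 0) powr - \<gamma>) * B))"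
  proof (rule nn_integral_mono)
   fix b :: int
   have "(SI a. en (if a \<noteq> 0 \<and> b \<noteq> 0 \<and> J (of_int a - x) \<ge> J (of_int b - y) then
  J (of_int a - x) powr - 1 * J (of_int b - y) powr - 1 * J (c - 2 * of_int a * of_int b) powr - \<gamma> else 0)) <=
    (SI a. en D * (en (J (of_int b - y) powr - 2) * en (J (of_int a - c / (2 * of_int b)) powr - 2) +
   en (J (of_int b - y) powr - 1 * J (of_int b) powr - \<gamma>) * en (J (of_int a - x) powr - 1 * J (of_int a - c / (2 * of_int b)) powr - \<gamma>)))"
    using key D by (intro nn_integral_mono) (simp only: ennreal_mult[symmetric] ennreal_plus[symmetric]
     powr_ge_zero mult_nonneg_nonneg add_nonneg_nonneg ennreal_leI)
   also have "\<dots> <= en D * (en (J (of_int b - y) powr - 2) * A + en (J (of_int b - y) powr - 1 * J (of_int b) powr - \<gamma>) * B)"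
    by (subst nn_integral_cmult, simp, subst nn_integral_add, simp, simp, subst (1 2) nn_integral_cmult)
     (simp, simp, intro mult_left_mono add_mono A(2) B(2) zero_le)
   finally show "(SI a. en (if a \<noteq> 0 \<and> b \<noteq> 0 \<and> J (of_int a - x) \<ge> J (of_int b - y) then
  J (of_int a - x) powr - 1 * J (of_int b - y) powr - 1 * J (c - 2 * of_int a * of_int b) powr - \<gamma> else 0)) <=
   en D * (en (J (of_int b - y) powr - 2) * A + en (J (of_int b - y) powr - 1 * J (of_int b - 0) powr - \<gamma>) * B)"
    by simp
  qed
  also have "\<dots> <= en D * (A * A + B * B)"
   by (subst nn_integral_cmult, simp, subst nn_integral_add, simp, simp, subst (1 2) nn_integral_multc)
    (simp, simp, intro mult_left_mono mult_right_mono add_mono A(2) B(2) zero_le)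
  finally show ?thesis .
 qed
 then show ?thesis using A(1) B(1)
  by (intro exI[of _ "en D * (A * A + B * B)"]) (auto simp: ennreal_mult_less_top)
qed

text \<open>One of the two bracketed weights is the larger; exchanging \<open>a\<close> and
  \<open>b\<close> reduces the second case to the first.\<close>

lemma sum_J_hyperbolic:
 assumes "\<gamma> > 0"
 shows "\<exists>C<\<infinity>. \<forall>x y c. (SI a. (SI b. en (if a \<noteq> 0 \<and> b \<noteq> 0 then
  J (of_int a - x) powr - 1 * J (of_int b - y) powr - 1 * J (c - 2 * of_int a * of_int b) powr - \<gamma> else 0))) <= C"
proof -
 interpret I: inv_measure "cZ" by (rule inv_measure_int)
 define h where "h x y c a b = (if a \<noteq> 0 \<and> b \<noteq> 0 \<and> J (of_int a - x) \<ge> J (of_int b - y) then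
  J (of_int a - x) powr - 1 * J (of_int b - y) powr - 1 * J (c - 2 * of_int a * of_int b) powr - \<gamma> else 0)" for x y c and a b :: int
 obtain C where C: "C < \<infinity>" "\<And>x y c. (SI b. (SI a. en (h x y c a b))) <= C"
  using sum_J_hyperbolic_half[OF assms] unfolding h_def by auto
 have "(SI a. (SI b. en (if a \<noteq> 0 \<and> b \<noteq> 0 then
  J (of_int a - x) powr - 1 * J (of_int b - y) powr - 1 * J (c - 2 * of_int a * of_int b) powr - \<gamma> else 0))) <= C + C" (is "?I <= _") for x y c
 proof -
  have "?I <= (SI a. (SI b. en (h x y c a b) + en (h y x c b a)))"
   by (intro nn_integral_mono) (auto simp: h_def mult_ac)
  also have "\<dots> = (SI a. (SI b. en (h x y c a b))) +
    (SI a. (SI b. en (h y x c b a)))"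
   by (simp add: nn_integral_add)
  also have "(SI a. (SI b. en (h x y c a b))) =
   (SI b. (SI a. en (h x y c a b)))"
   by (rule I.nn_integral_swap) (simp add: pair_measure_countable)
  also have "\<dots> + (SI a. (SI b. en (h y x c b a))) <= C + C"
   by (intro add_mono C(2))
  finally show ?thesis .
 qed
 then show ?thesis using C(1) by (intro exI[of _ "C + C"]) auto
qed

section \<open>The discrete modulation weight\<close>

text \<open>Periodic with period \<open>2 * pi / dt\<close>, and comparable to the bracket of
  \<open>x\<close> within half a period of 0.\<close>

definition W :: "real => real => real" where "W dt x = japanese (d_tau dt x)"

lemma W_pos [simp]: "W dt x > 0" "W dt x \<noteq> 0" "W dt x \<ge> 0" by (simp_all add: W_def)

lemma W_ge_1: "W dt x \<ge> 1" by (simp add: W_def japanese_ge_1)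

lemma W_cong_cis: "cis (dt * x) = cis (dt * y) ==> W dt x = W dt y"
 by (simp add: W_def d_tau_def)

lemma norm_d_tau_minus: "norm (d_tau dt (- x)) = norm (d_tau dt x)"
proof -
 have "d_tau dt (- x) = cnj (d_tau dt x)" by (simp add: d_tau_def cis_cnj)
 then show ?thesis by simp
qed

lemma W_minus: "W dt (- x) = W dt x"
 by (simp add: W_def japanese_def norm_d_tau_minus)

lemma W_diff_commute: "W dt (x - y) = W dt (y - x)"
 using W_minus[of dt "x - y"] by simp

text \<open>\<open>d_tau\<close> is a cocycle: \<open>d_tau (x + y)\<close> is
  \<open>d_tau x\<close> plus \<open>d_tau y\<close> times a phase of modulus 1. Hence the triangle
  inequality of the bracket survives discretisation.\<close>

lemma W_add: "W dt (x + y) <= W dt x + W dt y"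
proof -
 have "d_tau dt (x + y) = d_tau dt x + cis (dt * x) * d_tau dt y"
  by (simp add: d_tau_def cis_mult right_diff_distrib distrib_left flip: add_divide_distrib)
 moreover have "japanese (cis (dt * x) * d_tau dt y) = W dt y"
  by (simp add: W_def japanese_def norm_mult)
 ultimately show ?thesis using japanese_add[of "d_tau dt x" "cis (dt * x) * d_tau dt y"] by (simp add: W_def)
qed

text \<open>Jordan's inequality: a concave function lies above its chord.\<close>

lemma sin_lower_bound: assumes "0 <= x" "x <= pi / 2" shows "sin x \<ge> 2 / pi * x"
proof -
 have "concave_on {0..pi/2} sin"
 proof (rule f''_le0_imp_concave)
  show "convex {0..pi/2}" by simp
  show "(sin has_real_derivative cos x) (at x)" for x :: real by (auto intro!: derivative_eq_intros)
  show "(cos has_real_derivative - sin x) (at x)" for x :: real by (auto intro!: derivative_eq_intros)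
  show "- sin x <= 0" if "x \<in> {0..pi/2}" for x :: real using that by (auto intro!: sin_ge_zero)
 qed
 then have "(1 - 2 / pi * x) * sin 0 + (2 / pi * x) * sin (pi / 2) <= sin ((1 - 2 / pi * x) *\<^sub>R 0 + (2 / pi * x) *\<^sub>R (pi / 2))"
  using assms by (intro concave_onD[of _ sin "2 / pi * x" 0 "pi/2"]) (auto simp: field_simps)
 then show ?thesis by simp
qed

text \<open>The modulus of \<open>d_tau dt x\<close> is
  \<open>2 * \<bar>sin (dt * x / 2)\<bar> / dt\<close>, which Jordan's inequality bounds below by
  \<open>2 / pi * \<bar>x\<bar>\<close>. Staying within one period is essential, since
  \<open>W\<close> is periodic.\<close>

lemma W_lower:
 assumes "0 < dt" "\<bar>x\<bar> <= pi / dt"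
 shows "J x <= (pi / 2) * W dt x" "\<bar>x\<bar> <= (pi / 2) * W dt x"
proof -
 have "norm (cis (dt * x) - 1) = 2 * \<bar>sin (dt * x / 2)\<bar>"
 proof -
  have e: "cos (dt * x) = 1 - 2 * (sin (dt * x / 2))\<^sup>2"
   using cos_double_sin[of "dt * x / 2"] by simp
  have "(norm (cis (dt * x) - 1))\<^sup>2 = (cos (dt * x) - 1)\<^sup>2 + (sin (dt * x))\<^sup>2"
   by (simp add: cmod_power2)
  also have "\<dots> = 2 - 2 * cos (dt * x)"
   using sin_cos_squared_add[of "dt * x"] by (simp add: power2_eq_square algebra_simps)
  also have "\<dots> = (2 * \<bar>sin (dt * x / 2)\<bar>)\<^sup>2" unfolding e by (simp add: power_mult_distrib)
  finally show ?thesis by (rule power2_eq_imp_eq) auto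
 qed
 moreover have "2 / pi * (dt * \<bar>x\<bar> / 2) <= \<bar>sin (dt * x / 2)\<bar>"
 proof -
  have "dt * \<bar>x\<bar> <= pi" using assms by (simp add: field_simps)
  then have "2 / pi * (dt * \<bar>x\<bar> / 2) <= sin (dt * \<bar>x\<bar> / 2)" using assms by (intro sin_lower_bound) auto
  also have "\<dots> <= \<bar>sin (dt * x / 2)\<bar>" by (cases "x \<ge> 0") auto
  finally show ?thesis .
 qed
 ultimately have n: "2 / pi * \<bar>x\<bar> <= norm (d_tau dt x)"
  using assms unfolding d_tau_def norm_divide by (simp add: field_simps)
 then have "\<bar>x\<bar> <= pi / 2 * norm (d_tau dt x)" by (simp add: field_simps)
 then show "\<bar>x\<bar> <= (pi / 2) * W dt x"
  unfolding W_def using norm_le_japanese[of "d_tau dt x"] by (smt (verit) mult_left_mono pi_gt_zero divide_pos_pos)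
 have "J x <= pi / 2 * J (norm (d_tau dt x))"
  using \<open>\<bar>x\<bar> <= pi / 2 * norm (d_tau dt x)\<close> pi_gt3 by (intro J_le_mult) auto
 then show "J x <= (pi / 2) * W dt x" by (simp add: W_def japanese_def)
qed

locale time_step =
 fixes dt :: real
 assumes tau_pos: "0 < dt" and tau_le_1: "dt <= 1"
begin

sublocale C: inv_measure "circ dt" by (rule inv_measure_circ[OF tau_pos])
sublocale I: inv_measure "cZ" by (rule inv_measure_int)
sublocale G: inv_measure "Gam dt" by (rule inv_measure_Gam[OF tau_pos])

lemma W_measurable [measurable (raw)]:
 assumes [measurable]: "f \<in> N \<rightarrow>\<^sub>M circ dt"
 shows "(%x. W dt (f x)) \<in> borel_measurable N"
 unfolding W_def japanese_def d_tau_def by measurable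

lemma circ_const [measurable]: "(%x. c) \<in> N \<rightarrow>\<^sub>M circ dt" by simp

lemma W_period: "W dt (x + of_int n * (2 * pi / dt)) = W dt x"
 using tau_pos by (intro W_cong_cis cis_period) auto

lemma period_reduce: obtains n where "\<bar>x + of_int n * (2 * pi / dt)\<bar> <= pi / dt"
proof -
 let ?L = "2 * pi / dt"
 have L: "?L > 0" using tau_pos by simp
 define n where "n = - round (x / ?L)"
 have "\<bar>x / ?L + of_int n\<bar> <= 1 / 2"
  using of_int_round_abs_le[of "x / ?L"] by (simp add: n_def abs_minus_commute)
 then have "\<bar>x / ?L + of_int n\<bar> * ?L <= 1 / 2 * ?L" using L by (intro mult_right_mono) auto
 also have "\<bar>x / ?L + of_int n\<bar> * ?L = \<bar>(x / ?L + of_int n) * ?L\<bar>" by (simp only: abs_mult abs_of_pos[OF L])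
 also have "(x / ?L + of_int n) * ?L = x + of_int n * ?L" using tau_pos by (simp only: distrib_right) simp
 finally show ?thesis using that[of n] by simp
qed

text \<open>A bounded phase shift moves a point of the period interval into at most one of the
 neighbouring periods.\<close>

lemma W_unwrap:
 assumes "\<gamma> \<ge> 0"
 obtains c where "\<And>\<phi>. \<bar>\<phi>\<bar> <= 2 / dt ==> W dt (x - \<phi>) powr - \<gamma> <=
  (pi / 2) powr \<gamma> * (J (c - \<phi>) powr - \<gamma> + (J (c + 2 * pi / dt - \<phi>) powr - \<gamma> + J (c - 2 * pi / dt - \<phi>) powr - \<gamma>))"
proof -
 obtain n where n: "\<bar>x + of_int n * (2 * pi / dt)\<bar> <= pi / dt" by (rule period_reduce)
 define c where "c = x + of_int n * (2 * pi / dt)"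
 have "W dt (x - \<phi>) powr - \<gamma> <= (pi / 2) powr \<gamma> * (J (c - \<phi>) powr - \<gamma> + (J (c + 2 * pi / dt - \<phi>) powr - \<gamma> + J (c - 2 * pi / dt - \<phi>) powr - \<gamma>))"
  if \<phi>: "\<bar>\<phi>\<bar> <= 2 / dt" for \<phi>
 proof -
  have "2 / dt <= 2 * pi / dt" using tau_pos pi_gt3 by (simp add: divide_right_mono)
  then have b: "\<bar>c - \<phi>\<bar> <= 3 * (pi / dt)" using n \<phi> unfolding c_def[symmetric] by (simp add: abs_le_iff)
  have "\<exists>y\<in>{c - \<phi>, c + 2 * pi / dt - \<phi>, c - 2 * pi / dt - \<phi>}. \<bar>y\<bar> <= pi / dt \<and> W dt (x - \<phi>) = W dt y"
  proof -
   have e: "W dt (c - \<phi>) = W dt (x - \<phi>)" using W_period[of "x - \<phi>" n] by (simp add: c_def algebra_simps)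
   have e1: "W dt (c + 2 * pi / dt - \<phi>) = W dt (c - \<phi>)" using W_period[of "c - \<phi>" 1] by (simp add: algebra_simps)
   have e2: "W dt (c - 2 * pi / dt - \<phi>) = W dt (c - \<phi>)" using W_period[of "c - \<phi>" "-1"] by (simp add: algebra_simps)
   have p: "2 * pi / dt = 2 * (pi / dt)" by simp
   consider "\<bar>c - \<phi>\<bar> <= pi / dt" | "c - \<phi> > pi / dt" | "c - \<phi> < - (pi / dt)" by linarith
   then show ?thesis
   proof cases
    case 1 then show ?thesis using e by auto
   next
    case 2
    then have "\<bar>c - 2 * pi / dt - \<phi>\<bar> <= pi / dt" using b unfolding p by linarith
    then show ?thesis using e e2 by auto
   next
    case 3
    then have "\<bar>c + 2 * pi / dt - \<phi>\<bar> <= pi / dt" using b unfolding p by linarith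
    then show ?thesis using e e1 by auto
   qed
  qed
  then obtain y where y: "y \<in> {c - \<phi>, c + 2 * pi / dt - \<phi>, c - 2 * pi / dt - \<phi>}" "\<bar>y\<bar> <= pi / dt" "W dt (x - \<phi>) = W dt y" by blast
  have "W dt y powr - \<gamma> <= (pi / 2) powr \<gamma> * J y powr - \<gamma>"
   using W_lower(1)[OF tau_pos y(2)] assms by (intro powr_neg_mono) auto
  moreover have "J y powr - \<gamma> <= J (c - \<phi>) powr - \<gamma> + (J (c + 2 * pi / dt - \<phi>) powr - \<gamma> + J (c - 2 * pi / dt - \<phi>) powr - \<gamma>)"
  proof -
   consider "y = c - \<phi>" | "y = c + 2 * pi / dt - \<phi>" | "y = c - 2 * pi / dt - \<phi>" using y(1) by blast
   then show ?thesis by cases simp_all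
  qed
  ultimately show ?thesis unfolding y(3) by (meson mult_left_mono order_trans powr_ge_zero)
 qed
 then show ?thesis using that by blast
qed

end

section \<open>Integrals of modulation weights over the circle\<close>

lemma ennreal_le_mult_add:
 "x <= c * (a + b) ==> 0 <= c ==> 0 <= a ==> 0 <= b ==> en x <= en c * (en a + en b)"
 by (simp add: ennreal_leI flip: ennreal_plus ennreal_mult)

text \<open>On one period \<open>W\<close> dominates the bracket, which is comparable to its value
  at the integer below; the integral is bounded by a lattice sum, whatever the length of the
  period.\<close>

lemma circ_W_bound:
 assumes \<alpha>: "\<alpha> > 1"
 shows "\<exists>C<\<infinity>. \<forall>dt c. time_step dt --> (\<integral>\<^sup>+x. en (W dt (x + c) powr - \<alpha>) \<partial>circ dt) <= C"
proof -
 obtain A where A: "A < \<infinity>" "\<And>x. (SI k. en (J (of_int k - x) powr - \<alpha>)) <= A"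
  using sum_J_bound[OF \<alpha>] by auto
 define D where "D = (pi / 2) powr \<alpha> * 2 powr \<alpha>"
 have "(\<integral>\<^sup>+x. en (W dt (x + c) powr - \<alpha>) \<partial>circ dt) <= en D * A" if "time_step dt" for dt c
 proof -
  interpret time_step dt by fact
  interpret LI: pair_sigma_finite lborel "cZ" ..
  have "(\<integral>\<^sup>+x. en (W dt (x + c) powr - \<alpha>) \<partial>circ dt) = (\<integral>\<^sup>+x. en (W dt x powr - \<alpha>) \<partial>circ dt)"
   by (rule C.nn_integral_shift) measurable
  also have "\<dots> = (\<integral>\<^sup>+x\<in>{-pi/dt..pi/dt}. en (W dt x powr - \<alpha>) \<partial>lborel)"
   by (rule nn_integral_circ) measurable
  also have "\<dots> <= (\<integral>\<^sup>+x. (SI k. en D * en (J (of_int k) powr - \<alpha>) * indicator {real_of_int k..<real_of_int k + 1} x) \<partial>lborel)"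
  proof (rule nn_integral_mono)
   fix x :: real
   let ?k = "\<lfloor>x\<rfloor>"
   have "en (W dt x powr - \<alpha>) * indicator {-pi/dt..pi/dt} x <= en D * en (J (of_int ?k) powr - \<alpha>)"
   proof (cases "x \<in> {-pi/dt..pi/dt}")
    case True
    then have "J x <= (pi / 2) * W dt x" by (intro W_lower(1) tau_pos) (auto simp: abs_le_iff)
    moreover have "J (of_int ?k) <= 2 * J x"
    proof -
      have "(of_int ?k)\<^sup>2 <= 2 * x\<^sup>2 + 2 * (frac x)\<^sup>2"
      proof -
       have "0 <= (x + frac x)\<^sup>2" by simp
       moreover have e: "of_int ?k = x - frac x" by (simp add: frac_def)
       ultimately show ?thesis unfolding e power2_sum power2_diff by linarith
      qed
      moreover have "(frac x)\<^sup>2 <= 1" using frac_lt_1[of x] by (simp add: power_le_one less_imp_le)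
      ultimately have "1 + (of_int ?k)\<^sup>2 <= (2 * J x)\<^sup>2"
       by (simp add: power_mult_distrib J_sq) (smt (verit) zero_le_power2)
      then show ?thesis unfolding J_eq[of "of_int ?k"] by (intro real_le_lsqrt) auto
    qed
    ultimately have "J (of_int ?k) <= (pi / 2 * 2) * W dt x" by simp
    then have "W dt x powr - \<alpha> <= (pi / 2 * 2) powr \<alpha> * J (of_int ?k) powr - \<alpha>"
     using \<alpha> by (intro powr_neg_mono) auto
    then have "W dt x powr - \<alpha> <= D * J (of_int ?k) powr - \<alpha>"
     unfolding D_def by (subst (asm) powr_mult) auto
    then show ?thesis using True by (simp add: ennreal_leI D_def flip: ennreal_mult)
   qed simp
   also have "\<dots> = (SI k. en D * en (J (of_int k) powr - \<alpha>) * indicator {?k} k)"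
    by (simp add: nn_integral_count_space_indicator[symmetric] nn_integral_count_space_finite)
   also have "\<dots> <= (SI k. en D * en (J (of_int k) powr - \<alpha>) * indicator {real_of_int k..<real_of_int k + 1} x)"
    by (intro nn_integral_mono) (auto split: split_indicator)
   finally show "en (W dt x powr - \<alpha>) * indicator {-pi/dt..pi/dt} x <=
    (SI k. en D * en (J (of_int k) powr - \<alpha>) * indicator {real_of_int k..<real_of_int k + 1} x)" .
  qed
  also have "\<dots> = (SI k. (\<integral>\<^sup>+x. en D * en (J (of_int k) powr - \<alpha>) * indicator {real_of_int k..<real_of_int k + 1} x \<partial>lborel))"
  proof -
   have "(%p. en D * en (J (of_int (snd p)) powr - \<alpha>) * indicator {real_of_int (snd p)..<real_of_int (snd p) + 1} (fst p))
    \<in> borel_measurable (lborel \<Otimes>\<^sub>M cZ)"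
    by (rule measurable_compose_countable[where g = snd and
     f = "%k p. en D * en (J (of_int k) powr - \<alpha>) * indicator {real_of_int k..<real_of_int k + 1} (fst p)"]) auto
   then show ?thesis by (intro LI.Fubini'[symmetric]) (simp add: split_beta')
  qed
  also have "\<dots> = (SI k. en D * en (J (of_int k - 0) powr - \<alpha>))"
   by (intro nn_integral_cong) (simp add: nn_integral_cmult_indicator)
  also have "\<dots> = en D * (SI k. en (J (of_int k - 0) powr - \<alpha>))"
   by (rule nn_integral_cmult) simp
  also have "\<dots> <= en D * A" by (intro mult_left_mono A(2)) simp
  finally show ?thesis .
 qed
 then show ?thesis using A(1) by (intro exI[of _ "en D * A"]) (auto simp: ennreal_mult_less_top)
qed

lemma circ_WW_bound:
 assumes "\<alpha> + \<beta> > 1" "\<alpha> \<ge> 0" "\<beta> \<ge> 0"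
 shows "\<exists>C<\<infinity>. \<forall>dt a b. time_step dt --> (\<integral>\<^sup>+x. en (W dt (x + a) powr - \<alpha> * W dt (x + b) powr - \<beta>) \<partial>circ dt) <= C"
proof -
 obtain A where A: "A < \<infinity>" "\<And>dt c. time_step dt ==> (\<integral>\<^sup>+x. en (W dt (x + c) powr - (\<alpha> + \<beta>)) \<partial>circ dt) <= A"
  using circ_W_bound[OF assms(1)] by auto
 have "(\<integral>\<^sup>+x. en (W dt (x + a) powr - \<alpha> * W dt (x + b) powr - \<beta>) \<partial>circ dt) <= A + A" if t: "time_step dt" for dt a b
 proof -
  interpret time_step dt by fact
  have "(\<integral>\<^sup>+x. en (W dt (x + a) powr - \<alpha> * W dt (x + b) powr - \<beta>) \<partial>circ dt) <=
   (\<integral>\<^sup>+x. en (W dt (x + a) powr - (\<alpha> + \<beta>)) + en (W dt (x + b) powr - (\<alpha> + \<beta>)) \<partial>circ dt)"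
   using assms by (intro nn_integral_mono, subst ennreal_plus[symmetric])
    (simp_all only: powr_ge_zero ennreal_leI powr_neg_prod_le W_ge_1)
  also have "\<dots> <= A + A" by (subst nn_integral_add, measurable) (intro add_mono A(2) t)
  finally show ?thesis .
 qed
 then show ?thesis using A(1) by (intro exI[of _ "A + A"]) auto
qed

text \<open>By subadditivity \<open>W dt (a - b)\<close> is at most twice one of the two weights at
  every \<open>x\<close>. That weight gives up \<open>\<gamma>\<close> of its exponent, and the
  remaining exponents still add up to more than 1.\<close>

lemma circ_WW_decay:
 assumes "\<alpha> + \<beta> - \<gamma> > 1" "0 <= \<gamma>" "\<gamma> <= \<alpha>" "\<gamma> <= \<beta>"
 shows "\<exists>C\<ge>0. \<forall>dt a b. time_step dt -->
  (\<integral>\<^sup>+x. en (W dt (x + a) powr - \<alpha> * W dt (x + b) powr - \<beta>) \<partial>circ dt) <= en (C * W dt (a - b) powr - \<gamma>)"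
proof -
 obtain A where A: "A < \<infinity>" "\<And>dt a b. time_step dt ==>
  (\<integral>\<^sup>+x. en (W dt (x + a) powr - (\<alpha> - \<gamma>) * W dt (x + b) powr - \<beta>) \<partial>circ dt) <= A"
  using circ_WW_bound[of "\<alpha> - \<gamma>" \<beta>] assms by auto
 obtain B where B: "B < \<infinity>" "\<And>dt a b. time_step dt ==>
  (\<integral>\<^sup>+x. en (W dt (x + a) powr - \<alpha> * W dt (x + b) powr - (\<beta> - \<gamma>)) \<partial>circ dt) <= B"
  using circ_WW_bound[of \<alpha> "\<beta> - \<gamma>"] assms by auto
 define C where "C = 2 powr \<gamma> * (enn2real A + enn2real B)"
 have "(\<integral>\<^sup>+x. en (W dt (x + a) powr - \<alpha> * W dt (x + b) powr - \<beta>) \<partial>circ dt) <= en (C * W dt (a - b) powr - \<gamma>)"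
  if t: "time_step dt" for dt a b
 proof -
  interpret time_step dt by fact
  define w where "w = W dt (a - b)"
  have pt: "W dt (x + a) powr - \<alpha> * W dt (x + b) powr - \<beta> <=
   (2 powr \<gamma> * w powr - \<gamma>) * (W dt (x + a) powr - (\<alpha> - \<gamma>) * W dt (x + b) powr - \<beta> + W dt (x + a) powr - \<alpha> * W dt (x + b) powr - (\<beta> - \<gamma>))" (is "?L <= ?c * (?R1 + ?R2)") for x
  proof -
   have "w <= W dt (x + a) + W dt (x + b)"
    using W_add[of dt "x + a" "- (x + b)"] W_minus[of dt "x + b"] by (simp add: w_def)
   then consider "w <= 2 * W dt (x + a)" | "w <= 2 * W dt (x + b)" by linarith
   then have "?L <= ?c * ?R1 \<or> ?L <= ?c * ?R2"
   proof cases
    case 1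
    then have "W dt (x + a) powr - \<gamma> <= ?c" using assms by (intro powr_neg_mono) (auto simp: w_def)
    then have "W dt (x + a) powr - \<gamma> * ?R1 <= ?c * ?R1" by (intro mult_right_mono) auto
    moreover have "W dt (x + a) powr - \<gamma> * ?R1 = ?L" by (simp only: mult.assoc[symmetric] powr_add[symmetric]) simp
    ultimately show ?thesis by (simp only: simp_thms)
   next
    case 2
    then have "W dt (x + b) powr - \<gamma> <= ?c" using assms by (intro powr_neg_mono) (auto simp: w_def)
    then have "W dt (x + b) powr - \<gamma> * ?R2 <= ?c * ?R2" by (intro mult_right_mono) auto
    moreover have "W dt (x + b) powr - \<gamma> * ?R2 = ?L" by (simp only: mult.left_commute[of "W dt (x + b) powr - \<gamma>" "W dt (x + a) powr - \<alpha>"] powr_add[symmetric]) simp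
    ultimately show ?thesis by (simp only: simp_thms)
   qed
   moreover have "?c * ?R1 <= ?c * (?R1 + ?R2)" "?c * ?R2 <= ?c * (?R1 + ?R2)" by (intro mult_left_mono, auto)+
   ultimately show ?thesis by linarith
  qed
  have "(\<integral>\<^sup>+x. en (W dt (x + a) powr - \<alpha> * W dt (x + b) powr - \<beta>) \<partial>circ dt) <=
   (\<integral>\<^sup>+x. en (2 powr \<gamma> * w powr - \<gamma>) * (en (W dt (x + a) powr - (\<alpha> - \<gamma>) * W dt (x + b) powr - \<beta>)
    + en (W dt (x + a) powr - \<alpha> * W dt (x + b) powr - (\<beta> - \<gamma>))) \<partial>circ dt)"
   by (intro nn_integral_mono ennreal_le_mult_add pt) auto
  also have "\<dots> = en (2 powr \<gamma> * w powr - \<gamma>) * ((\<integral>\<^sup>+x. en (W dt (x + a) powr - (\<alpha> - \<gamma>) * W dt (x + b) powr - \<beta>) \<partial>circ dt) +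
    (\<integral>\<^sup>+x. en (W dt (x + a) powr - \<alpha> * W dt (x + b) powr - (\<beta> - \<gamma>)) \<partial>circ dt))"
  proof -
   have [measurable]: "(%x. en (W dt (x + a) powr - (\<alpha> - \<gamma>) * W dt (x + b) powr - \<beta>)) \<in> bC dt"
    "(%x. en (W dt (x + a) powr - \<alpha> * W dt (x + b) powr - (\<beta> - \<gamma>))) \<in> bC dt" by measurable
   show ?thesis by (subst nn_integral_cmult[OF borel_measurable_add], measurable, subst nn_integral_add, measurable)
  qed
  also have "\<dots> <= en (2 powr \<gamma> * w powr - \<gamma>) * (A + B)"
   by (intro mult_left_mono add_mono A(2) B(2) t) simp
  also have "A + B = en (enn2real A + enn2real B)"
   using A(1) B(1) by (simp add: ennreal_plus)
  also have "en (2 powr \<gamma> * w powr - \<gamma>) * \<dots> = en (C * w powr - \<gamma>)"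
   by (subst ennreal_mult[symmetric]) (auto simp: C_def mult_ac)
  finally show ?thesis unfolding w_def .
 qed
 then show ?thesis by (intro exI[of _ C]) (auto simp: C_def)
qed

section \<open>Weights on the frequency group and bilinear estimates\<close>

lemma japanese_measurable [measurable]: "J \<in> borel_measurable borel"
 unfolding japanese_def by measurable

lemma real_of_int_measurable [measurable]: "real_of_int \<in> borel_measurable (cZ)"
 by simp

definition Kf :: "real => int set" where "Kf dt = {k. \<bar>real_of_int k\<bar> <= dt powr (-1/2)}"

definition sq :: "int => real" where "sq k = (real_of_int k)\<^sup>2"

text \<open>Positive \<open>a\<close> and \<open>b\<close> mean decay, so negative ones give the
  weights of the norms. The phase \<open>\<theta>\<close> is a parameter because conjugation turns
  \<open>k\<^sup>2\<close> into its negative.\<close>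

definition wgt :: "real => real => real => (int => real) => gf" where
 "wgt dt a b \<theta> p = en (J (of_int (fst p)) powr - a * W dt (snd p + \<theta> (fst p)) powr - b)"

lemma wgt_mult: "wgt dt a b \<theta> p * wgt dt a' b' \<theta> p = wgt dt (a + a') (b + b') \<theta> p"
proof -
 have "- (a + a') = - a + - a'" "- (b + b') = - b + - b'" by auto
 then show ?thesis
  unfolding wgt_def by (subst ennreal_mult[symmetric]) (simp_all only: powr_add mult_ac powr_ge_zero mult_nonneg_nonneg)
qed

lemma wgt_0 [simp]: "wgt dt 0 0 \<theta> p = 1" by (simp add: wgt_def)

lemma wgt_cancel: "wgt dt a b \<theta> p * (wgt dt (- a) (- b) \<theta> p * f) = f"
 by (simp add: mult.assoc[symmetric] wgt_mult)

lemma wgt_sq: "(wgt dt a b \<theta> p)\<^sup>2 = wgt dt (2 * a) (2 * b) \<theta> p"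
 by (simp only: power2_eq_square wgt_mult mult_2)

lemma wgt_mono: "a' <= a ==> b' <= b ==> wgt dt a b \<theta> p <= wgt dt a' b' \<theta> p"
 unfolding wgt_def by (intro ennreal_leI mult_mono powr_mono) (auto simp: japanese_ge_1 W_ge_1)

lemma wgt_le_1: "0 <= a ==> 0 <= b ==> wgt dt a b \<theta> p <= 1"
 using wgt_mono[of 0 a 0 b] by simp

lemma W_shift_refl: "W dt (x - s + c) = W dt (s + (- x - c))"
 using W_minus[of dt "x - s + c"] by (simp add: algebra_simps)

context time_step begin

lemma sum_const_M: "(SI y. c * f y) = c * (SI y. f y)"
 by (rule nn_integral_cmult) simp

text \<open>The cutoff of the projection is chosen for this bound: it keeps phases shorter than half
  a period.\<close>

lemma Kf_sq_le: assumes "k \<in> Kf dt" shows "(real_of_int k)\<^sup>2 <= 1 / dt"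
proof -
 have "\<bar>real_of_int k\<bar>\<^sup>2 <= (dt powr (-1/2))\<^sup>2" using assms by (intro power_mono) (auto simp: Kf_def)
 also have "\<dots> = dt powr - 1" by (simp add: power2_eq_square flip: powr_add)
 also have "\<dots> = 1 / dt" using tau_pos by (simp add: powr_minus divide_inverse)
 finally show ?thesis by simp
qed

lemma finite_Kf: "finite (Kf dt)"
proof (rule finite_subset)
 show "Kf dt \<subseteq> {-\<lceil>dt powr (-1/2)\<rceil>..\<lceil>dt powr (-1/2)\<rceil>}" by (auto simp: Kf_def) linarith+
qed simp

lemma Kf_minus: "- k \<in> Kf dt \<longleftrightarrow> k \<in> Kf dt" by (simp add: Kf_def)

lemma fst_Gam [measurable (raw)]: "f \<in> N \<rightarrow>\<^sub>M Gam dt ==> (%x. fst (f x)) \<in> N \<rightarrow>\<^sub>M cZ"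
 unfolding Gam_def by (rule measurable_compose[OF _ measurable_fst])

lemma snd_Gam [measurable (raw)]: "f \<in> N \<rightarrow>\<^sub>M Gam dt ==> (%x. snd (f x)) \<in> N \<rightarrow>\<^sub>M circ dt"
 unfolding Gam_def by (rule measurable_compose[OF _ measurable_snd])

lemma Gam_Pair: "f \<in> bG dt ==> (%s. f (k, s)) \<in> bC dt"
 unfolding Gam_def by (rule measurable_compose[OF measurable_Pair1']) auto

lemma Gam_measurableI:
 assumes "\<And>k. (%s. f (k, s)) \<in> bC dt"
 shows "f \<in> bG dt"
proof -
 have "(%x. f (fst x, snd x)) \<in> bG dt"
  by (rule measurable_compose_countable[where g = fst and f = "%k x. f (k, snd x)"])
   (auto intro: measurable_compose[OF _ assms])
 then show ?thesis by simp
qed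

lemma wgt_measurable [measurable (raw)]:
 assumes [measurable]: "f \<in> N \<rightarrow>\<^sub>M Gam dt"
 shows "(%x. wgt dt a b \<theta> (f x)) \<in> borel_measurable N"
proof -
 have [measurable]: "(%x. W dt (snd (f x) + \<theta> (fst (f x)))) \<in> borel_measurable N"
  by (rule measurable_compose_countable[where g = "%x. fst (f x)" and f = "%k x. W dt (snd (f x) + \<theta> k)"]) measurable
 show ?thesis unfolding wgt_def by measurable
qed

lemma int4_measurable:
 assumes [measurable]: "a \<in> N \<rightarrow>\<^sub>M Gam dt" "b \<in> N \<rightarrow>\<^sub>M Gam dt" "c \<in> N \<rightarrow>\<^sub>M Gam dt" "d \<in> N \<rightarrow>\<^sub>M Gam dt"
 shows "(%x. g (fst (a x)) (fst (b x)) (fst (c x)) (fst (d x)) :: ennreal) \<in> borel_measurable N"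
 apply (rule measurable_compose_countable[where g = "%x. fst (a x)" and f = "%k x. g k (fst (b x)) (fst (c x)) (fst (d x))"])
 apply (rule measurable_compose_countable[where g = "%x. fst (b x)" and f = "%k x. g _ k (fst (c x)) (fst (d x))"])
  apply (rule measurable_compose_countable[where g = "%x. fst (c x)" and f = "%k x. g _ _ k (fst (d x))"])
  apply (rule measurable_compose[OF fst_Gam[OF assms(4)]])
  apply simp
  apply (rule fst_Gam[OF assms(3)])
 apply (rule fst_Gam[OF assms(2)])
 apply (rule fst_Gam[OF assms(1)])
 done

lemma int1_measurable: "a \<in> N \<rightarrow>\<^sub>M Gam dt ==> (%x. g (fst (a x)) :: ennreal) \<in> borel_measurable N"
 using int4_measurable[of a N a a a "%k _ _ _. g k"] by simp

lemma nn_integral_circ_sum: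
 fixes f :: "int => real => ennreal"
 assumes "\<And>k. f k \<in> bC dt"
 shows "(\<integral>\<^sup>+s. (SI k. f k s) \<partial>circ dt) = (SI k. (\<integral>\<^sup>+s. f k s \<partial>circ dt))"
proof -
 interpret P: pair_sigma_finite "cZ" "circ dt" ..
 have "case_prod f \<in> bG dt" using assms by (intro Gam_measurableI) auto
 then show ?thesis by (intro P.Fubini') (simp add: Gam_def)
qed

lemma rfl_wgt: "G.rfl (wgt dt a b \<theta>) = wgt dt a b (%k. - \<theta> (- k))"
proof
 fix p :: "int \<times> real"
 have "W dt (- snd p + \<theta> (- fst p)) = W dt (snd p - \<theta> (- fst p))"
  using W_minus[of dt "snd p - \<theta> (- fst p)"] by (simp add: algebra_simps)
 then show "G.rfl (wgt dt a b \<theta>) p = wgt dt a b (%k. - \<theta> (- k)) p"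
  by (simp add: G.rfl_def wgt_def japanese_minus)
qed

end

text \<open>Integrability in the modulation and summability in the frequency are used separately.
  Dispersion plays no part, hence the arbitrary phases \<open>\<theta>\<close> and
  \<open>\<theta>'\<close>.\<close>

lemma wgt_pair_bound:
 assumes "2 * a + 2 * a' > 1" "2 * b + 2 * b' > 1" "a \<ge> 0" "a' \<ge> 0" "b \<ge> 0" "b' \<ge> 0"
 shows "\<exists>C<\<infinity>. \<forall>dt \<theta> \<theta>' F G. time_step dt --> F \<in> bG dt --> G \<in> bG dt -->
  nG dt (cG dt (%p. wgt dt a b \<theta> p * F p) (%p. wgt dt a' b' \<theta>' p * G p)) <= C * nG dt F * nG dt G"
proof -
 obtain A where A: "A < \<infinity>" "\<And>x y. (SI k. en (J (of_int k - x) powr - (2*a) * J (of_int k - y) powr - (2*a'))) <= A"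
  using sum_J_J_bound[of "2*a" "2*a'"] assms by auto
 obtain B where B: "B < \<infinity>" "\<And>dt c d. time_step dt ==>
  (\<integral>\<^sup>+x. en (W dt (x + c) powr - (2*b) * W dt (x + d) powr - (2*b')) \<partial>circ dt) <= B"
  using circ_WW_bound[of "2*b" "2*b'"] assms by auto
 have "nG dt (cG dt (%p. wgt dt a b \<theta> p * F p) (%p. wgt dt a' b' \<theta>' p * G p)) <= ennsqrt (A * B) * nG dt F * nG dt G"
  if t: "time_step dt" and m: "F \<in> bG dt" "G \<in> bG dt" for dt \<theta> \<theta>' F G
 proof -
  interpret time_step dt by fact
  show ?thesis
  proof (rule G.nrm_conv_le1)
   fix x :: "int \<times> real"
   have [measurable]: "(%p. wgt dt a b \<theta> p * wgt dt a' b' \<theta>' (x - p)) \<in> bG dt" by measurable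
   have "(\<integral>\<^sup>+p. (wgt dt a b \<theta> p)\<^sup>2 * (wgt dt a' b' \<theta>' (x - p))\<^sup>2 \<partial>Gam dt) =
    (SI k. (\<integral>\<^sup>+s. (wgt dt a b \<theta> (k, s))\<^sup>2 * (wgt dt a' b' \<theta>' (x - (k, s)))\<^sup>2 \<partial>circ dt))"
    by (rule nn_integral_Gam[OF tau_pos]) measurable
   also have "\<dots> = (SI k. (\<integral>\<^sup>+s. en (J (of_int k - 0) powr - (2*a) * J (of_int k - of_int (fst x)) powr - (2*a')) *
     en (W dt (s + \<theta> k) powr - (2*b) * W dt (s + (- snd x - \<theta>' (fst x - k))) powr - (2*b')) \<partial>circ dt))"
   proof (intro nn_integral_cong)
    fix k s
    have "J (real_of_int (fst x) - real_of_int k) = J (real_of_int k - real_of_int (fst x))"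
     using japanese_minus[of "real_of_int (fst x) - real_of_int k"] by simp
    then show "(wgt dt a b \<theta> (k, s))\<^sup>2 * (wgt dt a' b' \<theta>' (x - (k, s)))\<^sup>2 =
     en (J (of_int k - 0) powr - (2*a) * J (of_int k - of_int (fst x)) powr - (2*a')) *
     en (W dt (s + \<theta> k) powr - (2*b) * W dt (s + (- snd x - \<theta>' (fst x - k))) powr - (2*b'))"
     unfolding wgt_sq unfolding wgt_def fst_diff snd_diff fst_conv snd_conv W_shift_refl
     by (subst (1 2) ennreal_mult[symmetric]) (simp_all add: mult_ac)
   qed
   also have "\<dots> = (SI k. en (J (of_int k - 0) powr - (2*a) * J (of_int k - of_int (fst x)) powr - (2*a')) *
     (\<integral>\<^sup>+s. en (W dt (s + \<theta> k) powr - (2*b) * W dt (s + (- snd x - \<theta>' (fst x - k))) powr - (2*b')) \<partial>circ dt))"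
    by (intro nn_integral_cong nn_integral_cmult) measurable
   also have "\<dots> <= (SI k. en (J (of_int k - 0) powr - (2*a) * J (of_int k - of_int (fst x)) powr - (2*a')) * B)"
    by (intro nn_integral_mono mult_left_mono B(2) t) simp
   also have "\<dots> = (SI k. en (J (of_int k - 0) powr - (2*a) * J (of_int k - of_int (fst x)) powr - (2*a'))) * B"
    by (rule nn_integral_multc) simp
   also have "\<dots> <= A * B" by (intro mult_right_mono A(2)) simp
   finally show "(\<integral>\<^sup>+p. (wgt dt a b \<theta> p)\<^sup>2 * (wgt dt a' b' \<theta>' (x - p))\<^sup>2 \<partial>Gam dt) <= A * B" .
  qed (use m in measurable)
 qed
 moreover have "ennsqrt (A * B) < \<infinity>" using A(1) B(1) by (cases A; cases B) (auto simp: ennsqrt_def ennreal_mult[symmetric])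
 ultimately show ?thesis by blast
qed

text \<open>The weight itself is square integrable. In physical space this bounds the
  supremum.\<close>

lemma wgt_L1_bound:
 assumes "2 * a > 1" "2 * b > 1"
 shows "\<exists>C<\<infinity>. \<forall>dt \<theta> F. time_step dt --> F \<in> bG dt -->
  (\<integral>\<^sup>+p. wgt dt a b \<theta> p * F p \<partial>Gam dt) <= C * nG dt F"
proof -
 obtain A where A: "A < \<infinity>" "\<And>x. (SI k. en (J (of_int k - x) powr - (2*a))) <= A"
  using sum_J_bound[of "2*a"] assms by auto
 obtain B where B: "B < \<infinity>" "\<And>dt c. time_step dt ==> (\<integral>\<^sup>+x. en (W dt (x + c) powr - (2*b)) \<partial>circ dt) <= B"
  using circ_W_bound[of "2*b"] assms by auto
 have "(\<integral>\<^sup>+p. wgt dt a b \<theta> p * F p \<partial>Gam dt) <= ennsqrt (A * B) * nG dt F"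
  if t: "time_step dt" and [measurable]: "F \<in> bG dt" for dt \<theta> F
 proof -
  interpret time_step dt by fact
  have "(\<integral>\<^sup>+p. wgt dt a b \<theta> p * F p \<partial>Gam dt) <= nG dt (wgt dt a b \<theta>) * nG dt F"
   by (rule Cauchy_Schwarz_nrm) measurable
  also have "nG dt (wgt dt a b \<theta>) <= ennsqrt (A * B)"
   unfolding nrm_def
  proof (rule ennsqrt_mono)
   have "(\<integral>\<^sup>+p. (wgt dt a b \<theta> p)\<^sup>2 \<partial>Gam dt) = (SI k. (\<integral>\<^sup>+s. (wgt dt a b \<theta> (k, s))\<^sup>2 \<partial>circ dt))"
    by (rule nn_integral_Gam[OF tau_pos]) measurable
   also have "\<dots> = (SI k. (\<integral>\<^sup>+s. en (J (of_int k - 0) powr - (2*a)) * en (W dt (s + \<theta> k) powr - (2*b)) \<partial>circ dt))"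
    unfolding wgt_sq unfolding wgt_def by (simp add: ennreal_mult)
   also have "\<dots> = (SI k. en (J (of_int k - 0) powr - (2*a)) * (\<integral>\<^sup>+s. en (W dt (s + \<theta> k) powr - (2*b)) \<partial>circ dt))"
    by (intro nn_integral_cong nn_integral_cmult) measurable
   also have "\<dots> <= (SI k. en (J (of_int k - 0) powr - (2*a)) * B)"
    by (intro nn_integral_mono mult_left_mono B(2) t) simp
   also have "\<dots> = (SI k. en (J (of_int k - 0) powr - (2*a))) * B"
    by (rule nn_integral_multc) simp
   also have "\<dots> <= A * B" by (intro mult_right_mono A(2)) simp
   finally show "(\<integral>\<^sup>+p. (wgt dt a b \<theta> p)\<^sup>2 \<partial>Gam dt) <= A * B" .
  qed
  finally show ?thesis by (simp add: mult_right_mono)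
 qed
 moreover have "ennsqrt (A * B) < \<infinity>" using A(1) B(1) by (cases A; cases B) (auto simp: ennsqrt_def ennreal_mult[symmetric])
 ultimately show ?thesis by blast
qed

definition chi :: "real => gf" where "chi dt p = (if fst p \<in> Kf dt then 1 else 0)"

lemma (in time_step) chi_measurable [measurable (raw)]: "f \<in> N \<rightarrow>\<^sub>M Gam dt ==> (%x. chi dt (f x)) \<in> borel_measurable N"
 unfolding chi_def by (rule int1_measurable)

text \<open>The bilinear form of the discrete L4 Strichartz estimate. For a fixed output,
  integrating the modulation leaves \<open>W\<close> to the power -11/20 at a phase that is
  quadratic in the summed frequency. The number 11/20 only has to exceed 1/2 for
  \<open>sum_J_quadratic\<close>, and the projection keeps the phase in the range of
  \<open>W_unwrap\<close>.\<close>

lemma L4_bound: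
 assumes ab: "2 * a + 2 * b - 11/20 > 1" "11/20 <= 2 * a" "11/20 <= 2 * b"
 shows "\<exists>C<\<infinity>. \<forall>dt F G. time_step dt --> F \<in> bG dt --> G \<in> bG dt -->
  nG dt (cG dt (%p. chi dt p * wgt dt 0 a sq p * F p) (%p. chi dt p * wgt dt 0 b sq p * G p))
   <= C * nG dt F * nG dt G"
proof -
 obtain B where B: "B \<ge> 0" "\<And>dt c d. time_step dt ==>
  (\<integral>\<^sup>+x. en (W dt (x + c) powr - (2*a) * W dt (x + d) powr - (2*b)) \<partial>circ dt) <= en (B * W dt (c - d) powr - (11/20))"
  using circ_WW_decay[of "2*a" "2*b" "11/20"] ab by auto
 obtain A where A: "A < \<infinity>" "\<And>c z. (SI k. en (J (c - 2 * (of_int k - z)\<^sup>2) powr - (11/20))) <= A"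
  using sum_J_quadratic[of "11/20"] by auto
 define C where "C = en (B * (pi / 2) powr (11/20)) * (A + (A + A))"
 have "nG dt (cG dt (%p. chi dt p * wgt dt 0 a sq p * F p) (%p. chi dt p * wgt dt 0 b sq p * G p)) <= ennsqrt C * nG dt F * nG dt G"
  if t: "time_step dt" and m: "F \<in> bG dt" "G \<in> bG dt" for dt F G
 proof -
  interpret time_step dt by fact
  show ?thesis
  proof (rule G.nrm_conv_le1)
   fix x :: "int \<times> real"
   obtain c where c: "\<And>\<phi>. \<bar>\<phi>\<bar> <= 2 / dt ==> W dt (snd x - \<phi>) powr - (11/20) <=
    (pi / 2) powr (11/20) * (J (c - \<phi>) powr - (11/20) + (J (c + 2 * pi / dt - \<phi>) powr - (11/20) + J (c - 2 * pi / dt - \<phi>) powr - (11/20)))"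
    using W_unwrap[of "11/20" "snd x"] by auto
   \<comment> \<open>Half the output frequency: \<open>k\<^sup>2 + (fst x - k)\<^sup>2\<close>
     equals \<open>2 * z\<^sup>2 + 2 * (k - z)\<^sup>2\<close>.\<close>
   define z where "z = real_of_int (fst x) / 2"
   define h where "h d k = en (J (- d - 2 * z\<^sup>2 - 2 * (real_of_int k - z)\<^sup>2) powr - (11/20))" for d k
   have inner: "(\<integral>\<^sup>+s. (chi dt (k, s) * wgt dt 0 a sq (k, s))\<^sup>2 * (chi dt (x - (k, s)) * wgt dt 0 b sq (x - (k, s)))\<^sup>2 \<partial>circ dt) <=
    en (B * (pi / 2) powr (11/20)) * (h c k + (h (c + 2 * pi / dt) k + h (c - 2 * pi / dt) k))" for k
   proof (cases "k \<in> Kf dt \<and> fst x - k \<in> Kf dt")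
    case False
    then have z: "(chi dt (k, s) * wgt dt 0 a sq (k, s))\<^sup>2 * (chi dt (x - (k, s)) * wgt dt 0 b sq (x - (k, s)))\<^sup>2 = 0" for s
     by (auto simp: chi_def)
    show ?thesis unfolding z by simp
   next
    case True
    define \<phi> where "\<phi> = - (sq k + sq (fst x - k))"
    have \<phi>: "\<bar>\<phi>\<bar> <= 2 / dt"
     using Kf_sq_le[of k] Kf_sq_le[of "fst x - k"] True by (simp add: \<phi>_def sq_def add_divide_distrib[symmetric])
    have "(\<integral>\<^sup>+s. (chi dt (k, s) * wgt dt 0 a sq (k, s))\<^sup>2 * (chi dt (x - (k, s)) * wgt dt 0 b sq (x - (k, s)))\<^sup>2 \<partial>circ dt) =
     (\<integral>\<^sup>+s. en (W dt (s + sq k) powr - (2*a) * W dt (s + (- snd x - sq (fst x - k))) powr - (2*b)) \<partial>circ dt)"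
    proof (rule nn_integral_cong)
     fix s
     show "(chi dt (k, s) * wgt dt 0 a sq (k, s))\<^sup>2 * (chi dt (x - (k, s)) * wgt dt 0 b sq (x - (k, s)))\<^sup>2 =
      en (W dt (s + sq k) powr - (2*a) * W dt (s + (- snd x - sq (fst x - k))) powr - (2*b))"
      using True unfolding power_mult_distrib wgt_sq unfolding wgt_def chi_def fst_diff snd_diff fst_conv snd_conv W_shift_refl
      by (simp add: ennreal_mult)
    qed
    also have "\<dots> <= en (B * W dt (sq k - (- snd x - sq (fst x - k))) powr - (11/20))"
     by (rule B(2)[OF t])
    also have "sq k - (- snd x - sq (fst x - k)) = snd x - \<phi>" by (simp add: \<phi>_def)
    also have "en (B * W dt (snd x - \<phi>) powr - (11/20)) <=
     en (B * ((pi / 2) powr (11/20) * (J (c - \<phi>) powr - (11/20) + (J (c + 2 * pi / dt - \<phi>) powr - (11/20) + J (c - 2 * pi / dt - \<phi>) powr - (11/20)))))"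
     by (intro ennreal_leI mult_left_mono c \<phi> B(1))
    also have "\<dots> = en (B * (pi / 2) powr (11/20)) * (h c k + (h (c + 2 * pi / dt) k + h (c - 2 * pi / dt) k))"
    proof -
     have "\<phi> = - (2 * z\<^sup>2 + 2 * (real_of_int k - z)\<^sup>2)"
      by (simp add: \<phi>_def sq_def z_def power2_eq_square field_simps)
     then have "- (d - \<phi>) = - d - 2 * z\<^sup>2 - 2 * (real_of_int k - z)\<^sup>2" for d by linarith
     then have "J (d - \<phi>) = J (- d - 2 * z\<^sup>2 - 2 * (real_of_int k - z)\<^sup>2)" for d
      by (metis japanese_minus)
     then show ?thesis
      unfolding h_def using B(1) by (simp add: mult.assoc[symmetric] ennreal_mult ennreal_plus[symmetric] del: ennreal_plus)
    qed
    finally show ?thesis .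
   qed
   have "(\<integral>\<^sup>+p. (chi dt p * wgt dt 0 a sq p)\<^sup>2 * (chi dt (x - p) * wgt dt 0 b sq (x - p))\<^sup>2 \<partial>Gam dt) =
    (SI k. (\<integral>\<^sup>+s. (chi dt (k, s) * wgt dt 0 a sq (k, s))\<^sup>2 * (chi dt (x - (k, s)) * wgt dt 0 b sq (x - (k, s)))\<^sup>2 \<partial>circ dt))"
    by (rule nn_integral_Gam[OF tau_pos]) measurable
   also have "\<dots> <= (SI k. en (B * (pi / 2) powr (11/20)) * (h c k + (h (c + 2 * pi / dt) k + h (c - 2 * pi / dt) k)))"
    by (intro nn_integral_mono inner)
   also have "\<dots> = en (B * (pi / 2) powr (11/20)) * ((SI k. h c k) +
     ((SI k. h (c + 2 * pi / dt) k) + (SI k. h (c - 2 * pi / dt) k)))"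
    by (simp add: sum_const_M nn_integral_add)
   also have "\<dots> <= C" unfolding C_def h_def by (intro mult_left_mono add_mono A(2)) simp
   finally show "(\<integral>\<^sup>+p. (chi dt p * wgt dt 0 a sq p)\<^sup>2 * (chi dt (x - p) * wgt dt 0 b sq (x - p))\<^sup>2 \<partial>Gam dt) <= C" .
  qed (use m in measurable)
 qed
 moreover have "C < \<infinity>" using A(1) by (auto simp: C_def ennreal_mult_less_top)
 then have "ennsqrt C < \<infinity>" by (auto simp: ennsqrt_def)
 ultimately show ?thesis by blast
qed

section \<open>The four-fold form with resonance kernels\<close>

lemma ennsqrt_less_top: "x < \<infinity> ==> ennsqrt x < \<infinity>"
 by (simp add: ennsqrt_def)

text \<open>Two applications of \<open>circ_WW_decay\<close>. The exponent 24/25 is twice the 12/25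
  of the functions; dropping to 9/10 and then to 1/2 is affordable, because the hyperbolic lattice
  sum accepts any positive exponent.\<close>

lemma circ_WWW_decay:
 "\<exists>C\<ge>0. \<forall>dt c1 c2 c3. time_step dt -->
  (\<integral>\<^sup>+s. (\<integral>\<^sup>+t. en (W dt (s + c1) powr - (24/25) * W dt (t + c2) powr - (24/25) * W dt (s + t + c3) powr - (24/25)) \<partial>circ dt) \<partial>circ dt)
   <= en (C * W dt (c1 + c2 - c3) powr - (1/2))"
proof -
 obtain A where A: "A \<ge> 0" "\<And>dt a b. time_step dt ==>
  (\<integral>\<^sup>+x. en (W dt (x + a) powr - (24/25) * W dt (x + b) powr - (24/25)) \<partial>circ dt) <= en (A * W dt (a - b) powr - (9/10))"
  using circ_WW_decay[of "24/25" "24/25" "9/10"] by auto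
 obtain B where B: "B \<ge> 0" "\<And>dt a b. time_step dt ==>
  (\<integral>\<^sup>+x. en (W dt (x + a) powr - (24/25) * W dt (x + b) powr - (9/10)) \<partial>circ dt) <= en (B * W dt (a - b) powr - (1/2))"
  using circ_WW_decay[of "24/25" "9/10" "1/2"] by auto
 have "(\<integral>\<^sup>+s. (\<integral>\<^sup>+t. en (W dt (s + c1) powr - (24/25) * W dt (t + c2) powr - (24/25) * W dt (s + t + c3) powr - (24/25)) \<partial>circ dt) \<partial>circ dt)
   <= en ((A * B) * W dt (c1 + c2 - c3) powr - (1/2))" (is "?I <= _") if t: "time_step dt" for dt c1 c2 c3
 proof -
  interpret time_step dt by fact
  have "?I <= (\<integral>\<^sup>+s. en A * en (W dt (s + c1) powr - (24/25) * W dt (s + (c3 - c2)) powr - (9/10)) \<partial>circ dt)"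
  proof (rule nn_integral_mono)
   fix s
   have "(\<integral>\<^sup>+t. en (W dt (s + c1) powr - (24/25) * W dt (t + c2) powr - (24/25) * W dt (s + t + c3) powr - (24/25)) \<partial>circ dt) =
    (\<integral>\<^sup>+t. en (W dt (s + c1) powr - (24/25)) * en (W dt (t + c2) powr - (24/25) * W dt (t + (s + c3)) powr - (24/25)) \<partial>circ dt)"
    by (rule nn_integral_cong, subst ennreal_mult[symmetric]) (simp_all add: ac_simps)
   also have "\<dots> = en (W dt (s + c1) powr - (24/25)) * (\<integral>\<^sup>+t. en (W dt (t + c2) powr - (24/25) * W dt (t + (s + c3)) powr - (24/25)) \<partial>circ dt)"
    by (rule nn_integral_cmult) measurable
   also have "\<dots> <= en (W dt (s + c1) powr - (24/25)) * en (A * W dt (c2 - (s + c3)) powr - (9/10))"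
    by (intro mult_left_mono A(2) t) simp
   also have "W dt (c2 - (s + c3)) = W dt (s + (c3 - c2))"
    using W_diff_commute[of dt c2 "s + c3"] by (simp add: algebra_simps)
   also have "en (W dt (s + c1) powr - (24/25)) * en (A * W dt (s + (c3 - c2)) powr - (9/10)) =
    en A * en (W dt (s + c1) powr - (24/25) * W dt (s + (c3 - c2)) powr - (9/10))"
    using A(1) by (subst (1 2) ennreal_mult[symmetric]) (simp_all add: mult_ac)
   finally show "(\<integral>\<^sup>+t. en (W dt (s + c1) powr - (24/25) * W dt (t + c2) powr - (24/25) * W dt (s + t + c3) powr - (24/25)) \<partial>circ dt)
    <= en A * en (W dt (s + c1) powr - (24/25) * W dt (s + (c3 - c2)) powr - (9/10))" .
  qed
  also have "\<dots> = en A * (\<integral>\<^sup>+s. en (W dt (s + c1) powr - (24/25) * W dt (s + (c3 - c2)) powr - (9/10)) \<partial>circ dt)"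
   by (rule nn_integral_cmult) measurable
  also have "\<dots> <= en A * en (B * W dt (c1 - (c3 - c2)) powr - (1/2))"
   by (intro mult_left_mono B(2) t) simp
  also have "\<dots> = en ((A * B) * W dt (c1 + c2 - c3) powr - (1/2))"
   using A(1) B(1) by (subst ennreal_mult[symmetric]) (simp_all add: algebra_simps)
  finally show ?thesis .
 qed
 then show ?thesis using A(1) B(1) by (intro exI[of _ "A * B"]) auto
qed

text \<open>In \<open>a = k - p\<close> and \<open>b = k - q\<close> the squared kernel is bounded
  by a product of two brackets and the phase is hyperbolic. The bound \<open>2 / dt\<close> lets
  \<open>W_unwrap\<close> replace the periodic weight by three ordinary ones, each covered by
  \<open>sum_J_hyperbolic\<close>.\<close>

lemma lattice_count_bound:
 "\<exists>C<\<infinity>. \<forall>dt N x y z k. time_step dt -->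
  (\<forall>p q. N p q \<noteq> 0 --> p \<noteq> k \<and> q \<noteq> k \<and> \<bar>2 * of_int (k - p) * of_int (k - q)\<bar> <= 2 / dt \<and>
   (N p q)\<^sup>2 <= 4 * (J (of_int (k - p) - y) powr - 1 * J (of_int (k - q) - z) powr - 1)) -->
  (SI p. (SI q. en ((N p q)\<^sup>2 * W dt (x - 2 * of_int (k - p) * of_int (k - q)) powr - (1/2)))) <= C"
proof -
 define S where "S y z c a b = en (if a \<noteq> 0 \<and> b \<noteq> 0 then
  J (of_int a - y) powr - 1 * J (of_int b - z) powr - 1 * J (c - 2 * of_int a * of_int b) powr - (1/2) else 0)" for y z c and a b :: int
 obtain A where A: "A < \<infinity>" "\<And>y z c. (SI a. (SI b. S y z c a b)) <= A"
  using sum_J_hyperbolic[of "1/2"] unfolding S_def by auto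
 define D where "D = 4 * (pi / 2) powr (1/2)"
 have "(SI p. (SI q. en ((N p q)\<^sup>2 * W dt (x - 2 * of_int (k - p) * of_int (k - q)) powr - (1/2)))) <= en D * (A + (A + A))"
  if t: "time_step dt" and N: "\<And>p q. N p q \<noteq> 0 ==> p \<noteq> k \<and> q \<noteq> k \<and> \<bar>2 * of_int (k - p) * of_int (k - q)\<bar> <= 2 / dt \<and>
   (N p q)\<^sup>2 <= 4 * (J (of_int (k - p) - y) powr - 1 * J (of_int (k - q) - z) powr - 1)"
  for dt N x y z k
 proof -
  interpret time_step dt by fact
  obtain c where c: "\<And>\<phi>. \<bar>\<phi>\<bar> <= 2 / dt ==> W dt (x - \<phi>) powr - (1/2) <=
    (pi / 2) powr (1/2) * (J (c - \<phi>) powr - (1/2) + (J (c + 2 * pi / dt - \<phi>) powr - (1/2) + J (c - 2 * pi / dt - \<phi>) powr - (1/2)))"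
    using W_unwrap[of "1/2" "x"] by auto
  let ?T = "%a b. S y z c a b + (S y z (c + 2 * pi / dt) a b + S y z (c - 2 * pi / dt) a b)"
  have tm: "en ((N p q)\<^sup>2 * W dt (x - 2 * of_int (k - p) * of_int (k - q)) powr - (1/2)) <= en D * ?T (k - p) (k - q)" for p q
  proof (cases "N p q = 0")
   case False
   define \<phi> where "\<phi> = 2 * real_of_int (k - p) * of_int (k - q)"
   define M where "M = J (of_int (k - p) - y) powr - 1 * J (of_int (k - q) - z) powr - 1"
   have M: "M \<ge> 0" by (simp add: M_def)
   have 1: "\<bar>\<phi>\<bar> <= 2 / dt" "(N p q)\<^sup>2 <= 4 * M" "k - p \<noteq> 0" "k - q \<noteq> 0" using N[OF False] by (auto simp: \<phi>_def M_def)
   have "(N p q)\<^sup>2 * W dt (x - \<phi>) powr - (1/2) <= (4 * M) *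
    ((pi / 2) powr (1/2) * (J (c - \<phi>) powr - (1/2) + (J (c + 2 * pi / dt - \<phi>) powr - (1/2) + J (c - 2 * pi / dt - \<phi>) powr - (1/2))))"
    using M by (intro mult_mono c 1) auto
   also have "\<dots> = D * (M * J (c - \<phi>) powr - (1/2) + (M * J (c + 2 * pi / dt - \<phi>) powr - (1/2) + M * J (c - 2 * pi / dt - \<phi>) powr - (1/2)))"
    by (simp add: D_def algebra_simps)
   finally have "en ((N p q)\<^sup>2 * W dt (x - \<phi>) powr - (1/2)) <= en \<dots>" by (rule ennreal_leI)
   also have "\<dots> = en D * ?T (k - p) (k - q)"
    using 1(3,4) M unfolding S_def M_def[symmetric] \<phi>_def[symmetric]
    by (subst ennreal_mult) (auto simp: D_def)
   finally show ?thesis by (simp add: \<phi>_def)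
  qed simp
  have "(SI p. (SI q. en ((N p q)\<^sup>2 * W dt (x - 2 * of_int (k - p) * of_int (k - q)) powr - (1/2)))) <=
   (SI p. (SI q. en D * ?T (k - p) (k - q)))"
   by (intro nn_integral_mono tm)
  also have "\<dots> = (SI p. (SI b. en D * ?T (k - p) b))"
   by (rule nn_integral_cong, rule I.nn_integral_shift'(3)[where f = "%b. en D * ?T _ b"]) simp
  also have "\<dots> = (SI a. (SI b. en D * ?T a b))"
   by (rule I.nn_integral_shift'(3)[where f = "%a. (SI b. en D * ?T a b)"]) simp
  also have "\<dots> = en D * ((SI a. (SI b. S y z c a b)) +
   ((SI a. (SI b. S y z (c + 2 * pi / dt) a b)) +
   (SI a. (SI b. S y z (c - 2 * pi / dt) a b))))"
   by (simp add: sum_const_M nn_integral_add)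
  also have "\<dots> <= en D * (A + (A + A))" by (intro mult_left_mono add_mono A(2)) simp
  finally show ?thesis .
 qed
 moreover have "en D * (A + (A + A)) < \<infinity>" using A(1) by (auto simp: ennreal_mult_less_top)
 ultimately show ?thesis by blast
qed

abbreviation om :: "real => gf" where "om dt \<equiv> wgt dt 0 (12/25) sq"

text \<open>Shift 0 gives brackets of \<open>k - p\<close> and \<open>k - q\<close>, shift
  \<open>k\<close> gives brackets of \<open>p\<close> and \<open>q\<close>. The factor 4 is the
  price of replacing two absolute values by brackets.\<close>

definition good_kernel :: "real => (int => int => int => int => real) => bool" where
 "good_kernel dt N \<longleftrightarrow> (\<exists>y z. \<forall>k p q r. p + q = k + r --> N k p q r \<ge> 0 \<and> (N k p q r \<noteq> 0 -->
  p \<noteq> k \<and> q \<noteq> k \<and> \<bar>2 * of_int (k - p) * of_int (k - q)\<bar> <= 2 / dt \<and>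
   (N k p q r)\<^sup>2 <= 4 * (J (of_int (k - p) - y k) powr - 1 * J (of_int (k - q) - z k) powr - 1)))"

text \<open>The resonance identity for the squares of \<open>p\<close>, \<open>q\<close>,
  \<open>k\<close> and \<open>p + q - k\<close>; \<open>x\<close> is the modulation variable of the
  output.\<close>

lemma quad_phase: "sq p + sq q - (sq (p + q - k) - x) = (x + sq k) - 2 * of_int (k - p) * of_int (k - q)"
 by (simp add: sq_def power2_eq_square algebra_simps)

text \<open>For a fixed output, Cauchy-Schwarz leaves the squared kernel. Its modulation integrals
  produce a power of \<open>W\<close> at the resonance phase, and the frequency sum is then a
  lattice count. The output itself carries no modulation weight.\<close>

lemma Lam_kernel_0:
 "\<exists>C<\<infinity>. \<forall>dt N F G H I. time_step dt --> good_kernel dt N -->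
  F \<in> bG dt --> G \<in> bG dt --> H \<in> bG dt --> I \<in> bG dt -->
  inv_measure.Lam (Gam dt) (%x y z u. en (N (fst x) (fst y) (fst z) (fst u)) * F x * (om dt y * G y) * (om dt z * H z) * (om dt u * I u))
   <= C * nG dt F * nG dt G * nG dt H * nG dt I"
proof -
 obtain A where A: "A \<ge> 0" "\<And>dt c1 c2 c3. time_step dt ==>
  (\<integral>\<^sup>+s. (\<integral>\<^sup>+t. en (W dt (s + c1) powr - (24/25) * W dt (t + c2) powr - (24/25) * W dt (s + t + c3) powr - (24/25)) \<partial>circ dt) \<partial>circ dt)
   <= en (A * W dt (c1 + c2 - c3) powr - (1/2))"
  using circ_WWW_decay by auto
 obtain B where B: "B < \<infinity>" "\<And>dt N x y z k. time_step dt ==>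
  (\<forall>p q. N p q \<noteq> 0 --> p \<noteq> k \<and> q \<noteq> k \<and> \<bar>2 * of_int (k - p) * of_int (k - q)\<bar> <= 2 / dt \<and>
   (N p q)\<^sup>2 <= 4 * (J (of_int (k - p) - y) powr - 1 * J (of_int (k - q) - z) powr - 1)) ==>
  (SI p. (SI q. en ((N p q)\<^sup>2 * W dt (x - 2 * of_int (k - p) * of_int (k - q)) powr - (1/2)))) <= B"
  using lattice_count_bound by blast
 have "inv_measure.Lam (Gam dt) (%x y z u. en (N (fst x) (fst y) (fst z) (fst u)) * F x * (om dt y * G y) * (om dt z * H z) * (om dt u * I u))
   <= ennsqrt (en A * B) * nG dt F * nG dt G * nG dt H * nG dt I"
  if t: "time_step dt" and gk: "good_kernel dt N" and m [measurable]: "F \<in> bG dt" "G \<in> bG dt" "H \<in> bG dt" "I \<in> bG dt"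
  for dt N F G H I
 proof -
  interpret time_step dt by fact
  define K where "K x y z u = en (N (fst x) (fst y) (fst z) (fst u)) * om dt y * om dt z * om dt u" for x y z u :: "int \<times> real"
  have Kint: "(%w. en (N (fst (a w)) (fst (b w)) (fst (c w)) (fst (d w)))) \<in> borel_measurable M"
   if "a \<in> M \<rightarrow>\<^sub>M Gam dt" "b \<in> M \<rightarrow>\<^sub>M Gam dt" "c \<in> M \<rightarrow>\<^sub>M Gam dt" "d \<in> M \<rightarrow>\<^sub>M Gam dt" for a b c d and M :: "'m measure"
   using int4_measurable[OF that, of "%k p q r. en (N k p q r)"] .
  have mK: "G.meas4 K"
  proof -
   have "(%w. en (N (fst (fst w)) (fst (fst (snd w))) (fst (fst (snd (snd w)))) (fst (snd (snd (snd w)))))) \<in> borel_measurable (Gam dt \<Otimes>\<^sub>M Gam dt \<Otimes>\<^sub>M Gam dt \<Otimes>\<^sub>M Gam dt)"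
    by (rule int4_measurable) measurable
   then show ?thesis unfolding K_def split_beta' by measurable
  qed
  note [measurable (raw)] = G.meas4_compose[OF mK]
  have bound: "(\<integral>\<^sup>+y. (\<integral>\<^sup>+z. (K x y z (y + z - x))\<^sup>2 \<partial>Gam dt) \<partial>Gam dt) <= en A * B" for x
  proof -
   obtain k s0 where x: "x = (k, s0)" by (cases x)
   define L where "L p q = N k p q (p + q - k)" for p q
   define \<Psi> where "\<Psi> p s q t = en (W dt (s + sq p) powr - (24/25) * W dt (t + sq q) powr - (24/25) * W dt (s + t + (sq (p + q - k) - s0)) powr - (24/25))" for p s q t
   have [measurable]: "(%t. \<Psi> p s q t) \<in> bC dt" "(%s. \<integral>\<^sup>+t. \<Psi> p s q t \<partial>circ dt) \<in> bC dt" for p s q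
    unfolding \<Psi>_def by measurable
   have sqK: "(K x (p, s) (q, t) ((p, s) + (q, t) - x))\<^sup>2 = en ((L p q)\<^sup>2) * \<Psi> p s q t" for p s q t
   proof -
    have "L p q \<ge> 0" using gk unfolding good_kernel_def L_def by auto
    then have n: "(en (L p q))\<^sup>2 = en ((L p q)\<^sup>2)" by (simp add: ennreal_power)
    have a: "s + t - s0 + sq (p + q - k) = s + t + (sq (p + q - k) - s0)" by simp
    show ?thesis
     unfolding K_def x power_mult_distrib wgt_sq unfolding add_Pair diff_Pair fst_conv snd_conv L_def[symmetric] n \<Psi>_def wgt_def a
     by (simp add: ennreal_mult mult.assoc)
   qed
   have "(\<integral>\<^sup>+y. (\<integral>\<^sup>+z. (K x y z (y + z - x))\<^sup>2 \<partial>Gam dt) \<partial>Gam dt) =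
    (SI p. (\<integral>\<^sup>+s. (\<integral>\<^sup>+z. (K x (p, s) z ((p, s) + z - x))\<^sup>2 \<partial>Gam dt) \<partial>circ dt))"
    by (rule nn_integral_Gam[OF tau_pos]) measurable
   also have "\<dots> = (SI p. (\<integral>\<^sup>+s. (SI q. (\<integral>\<^sup>+t. en ((L p q)\<^sup>2) * \<Psi> p s q t \<partial>circ dt)) \<partial>circ dt))"
   proof (rule nn_integral_cong, rule nn_integral_cong)
    fix p s
    have "(\<integral>\<^sup>+z. (K x (p, s) z ((p, s) + z - x))\<^sup>2 \<partial>Gam dt) = (SI q. (\<integral>\<^sup>+t. (K x (p, s) (q, t) ((p, s) + (q, t) - x))\<^sup>2 \<partial>circ dt))"
     by (rule nn_integral_Gam[OF tau_pos]) measurable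
    then show "(\<integral>\<^sup>+z. (K x (p, s) z ((p, s) + z - x))\<^sup>2 \<partial>Gam dt) = (SI q. (\<integral>\<^sup>+t. en ((L p q)\<^sup>2) * \<Psi> p s q t \<partial>circ dt))"
     unfolding sqK .
   qed
   also have "\<dots> = (SI p. (SI q. (\<integral>\<^sup>+s. (\<integral>\<^sup>+t. en ((L p q)\<^sup>2) * \<Psi> p s q t \<partial>circ dt) \<partial>circ dt)))"
    by (rule nn_integral_cong, rule nn_integral_circ_sum) (simp add: nn_integral_cmult)
   also have "\<dots> = (SI p. (SI q. en ((L p q)\<^sup>2) * (\<integral>\<^sup>+s. (\<integral>\<^sup>+t. \<Psi> p s q t \<partial>circ dt) \<partial>circ dt)))"
    by (simp add: nn_integral_cmult)
   also have "\<dots> <= (SI p. (SI q. en ((L p q)\<^sup>2) * en (A * W dt (sq p + sq q - (sq (p + q - k) - s0)) powr - (1/2))))"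
    unfolding \<Psi>_def by (intro nn_integral_mono mult_left_mono A(2) t) simp
   also have "\<dots> = (SI p. (SI q. en A * en ((L p q)\<^sup>2 * W dt (s0 + sq k - 2 * of_int (k - p) * of_int (k - q)) powr - (1/2))))"
    unfolding quad_phase using A(1) by (intro nn_integral_cong) (simp add: ennreal_mult mult_ac)
   also have "\<dots> = en A * (SI p. (SI q. en ((L p q)\<^sup>2 * W dt (s0 + sq k - 2 * of_int (k - p) * of_int (k - q)) powr - (1/2))))"
    by (simp only: sum_const_M)
   also have "\<dots> <= en A * B"
   proof -
    obtain y z where yz: "\<forall>k p q r. p + q = k + r --> N k p q r \<ge> 0 \<and> (N k p q r \<noteq> 0 -->
     p \<noteq> k \<and> q \<noteq> k \<and> \<bar>2 * of_int (k - p) * of_int (k - q)\<bar> <= 2 / dt \<and>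
     (N k p q r)\<^sup>2 <= 4 * (J (of_int (k - p) - y k) powr - 1 * J (of_int (k - q) - z k) powr - 1))"
     using gk unfolding good_kernel_def by (elim exE) (rule that)
    have "\<forall>p q. L p q \<noteq> 0 --> p \<noteq> k \<and> q \<noteq> k \<and> \<bar>2 * of_int (k - p) * of_int (k - q)\<bar> <= 2 / dt \<and>
     (L p q)\<^sup>2 <= 4 * (J (of_int (k - p) - y k) powr - 1 * J (of_int (k - q) - z k) powr - 1)"
    proof (intro allI impI)
     fix p q assume nz: "L p q \<noteq> 0"
     have "p + q = k + (p + q - k)" by simp
     from yz[THEN spec, THEN spec, THEN spec, THEN spec, THEN mp, OF this] nz
     show "p \<noteq> k \<and> q \<noteq> k \<and> \<bar>2 * of_int (k - p) * of_int (k - q)\<bar> <= 2 / dt \<and>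
      (L p q)\<^sup>2 <= 4 * (J (of_int (k - p) - y k) powr - 1 * J (of_int (k - q) - z k) powr - 1)"
      unfolding L_def by (elim conjE) (erule mp)
    qed
    from B(2)[OF t this] show ?thesis by (rule mult_left_mono) simp
   qed
   finally show ?thesis .
  qed
  have "G.Lam (%x y z u. en (N (fst x) (fst y) (fst z) (fst u)) * F x * (om dt y * G y) * (om dt z * H z) * (om dt u * I u)) =
   G.Lam (%x y z u. K x y z u * F x * G y * H z * I u)"
   by (simp add: K_def mult_ac)
  also have "\<dots> <= ennsqrt (en A * B) * nG dt F * nG dt G * nG dt H * nG dt I"
   by (rule G.Lam_Cauchy_Schwarz[OF mK m bound])
  finally show ?thesis .
 qed
 moreover have "ennsqrt (en A * B) < \<infinity>" using B(1) by (intro ennsqrt_less_top) (auto simp: ennreal_mult_less_top)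
 ultimately show ?thesis by blast
qed

definition inK :: "real => int => int => int => int => bool" where
 "inK dt k p q r \<longleftrightarrow> k \<in> Kf dt \<and> p \<in> Kf dt \<and> q \<in> Kf dt \<and> r \<in> Kf dt"

text \<open>Together with \<open>N2\<close> this bounds, up to a constant, what remains of the
  multiplier \<open>mult_m\<close> once the square root of the resonance function is absorbed. The
  indices with \<open>k = p\<close> or \<open>k = q\<close> are treated separately.\<close>

definition N1 :: "real => int => int => int => int => real" where
 "N1 dt k p q r = (if inK dt k p q r \<and> k \<noteq> p \<and> k \<noteq> q then \<bar>of_int ((k - p) * (k - q))\<bar> powr (-1/2) else 0)"

definition N2 :: "real => int => int => int => int => real" where
 "N2 dt k p q r = (if inK dt k p q r \<and> k \<noteq> p \<and> k \<noteq> q then (J (of_int p) * J (of_int q)) powr (-1/2) else 0)"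

text \<open>On the surface \<open>p + q = k + r\<close> the product \<open>(k - p) * (k - q)\<close>
  changes at most its sign under these exchanges. \<open>N2\<close> is not invariant when
  \<open>k\<close> or \<open>r\<close> trades places with \<open>p\<close> or \<open>q\<close>,
  which is why \<open>Q4_N2_1\<close> is needed.\<close>

lemma N1_sym:
 assumes "p + q = k + r"
 shows "N1 dt r p q k = N1 dt k p q r" "N1 dt p k r q = N1 dt k p q r" "N1 dt p r k q = N1 dt k p q r"
proof -
 have r: "r = p + q - k" using assms by simp
 have e: "(r - p) * (r - q) = (k - p) * (k - q)" "(p - k) * (p - r) = - ((k - p) * (k - q))" "(p - r) * (p - k) = - ((k - p) * (k - q))"
  unfolding r by (simp_all add: algebra_simps)
 have c: "(inK dt r p q k \<and> r \<noteq> p \<and> r \<noteq> q) = (inK dt k p q r \<and> k \<noteq> p \<and> k \<noteq> q)"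
  "(inK dt p k r q \<and> p \<noteq> k \<and> p \<noteq> r) = (inK dt k p q r \<and> k \<noteq> p \<and> k \<noteq> q)"
  "(inK dt p r k q \<and> p \<noteq> r \<and> p \<noteq> k) = (inK dt k p q r \<and> k \<noteq> p \<and> k \<noteq> q)"
  unfolding r inK_def by auto
 show "N1 dt r p q k = N1 dt k p q r" "N1 dt p k r q = N1 dt k p q r" "N1 dt p r k q = N1 dt k p q r"
  unfolding N1_def e c of_int_minus abs_minus_cancel by (rule refl)+
qed

lemma N2_sym:
 assumes "p + q = k + r"
 shows "N2 dt r p q k = N2 dt k p q r"
proof -
 have r: "r = p + q - k" using assms by simp
 have c: "(inK dt r p q k \<and> r \<noteq> p \<and> r \<noteq> q) = (inK dt k p q r \<and> k \<noteq> p \<and> k \<noteq> q)"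
  unfolding r inK_def by auto
 show ?thesis unfolding N2_def c by (rule refl)
qed

lemma powr_mhalf_sq: "x \<ge> 0 ==> (x powr (-1/2))\<^sup>2 = x powr - (1::real)"
 by (simp add: power2_eq_square flip: powr_add)

text \<open>The phase is a sum of four squares of projected frequencies, two with each sign, and
  each square lies between 0 and \<open>1 / dt\<close>.\<close>

lemma (in time_step) phase_bound:
 assumes "inK dt k p q r" "p + q = k + r"
 shows "\<bar>2 * of_int (k - p) * of_int (k - q)\<bar> <= 2 / dt"
proof -
 have r: "r = p + q - k" using assms by simp
 have "2 * of_int (k - p) * of_int (k - q) = sq k + sq r - sq p - sq q"
  unfolding r by (simp add: sq_def power2_eq_square algebra_simps)
 moreover have "0 <= sq k" "sq k <= 1/dt" "0 <= sq r" "sq r <= 1/dt" "0 <= sq p" "sq p <= 1/dt" "0 <= sq q" "sq q <= 1/dt"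
  using Kf_sq_le assms(1) by (auto simp: inK_def sq_def)
 moreover have "2 / dt = 1/dt + 1/dt" by simp
 ultimately show ?thesis by linarith
qed

lemma J_le_2_abs: "1 <= \<bar>x\<bar> ==> J x <= 2 * \<bar>x\<bar>"
proof -
 assume "1 <= \<bar>x\<bar>"
 then have "1 <= x\<^sup>2" by (simp add: abs_le_square_iff[of 1, simplified])
 then show ?thesis unfolding J_eq by (intro real_le_lsqrt) (auto simp: power_mult_distrib)
qed

lemma powr_m1: "0 < x ==> x powr - 1 = 1 / (x::real)"
 by (simp add: powr_minus_divide)

lemma good_kernel_N1: assumes "time_step dt" shows "good_kernel dt (N1 dt)"
 unfolding good_kernel_def
proof (rule exI[of _ "%_. 0"], rule exI[of _ "%_. 0"], intro allI impI conjI)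
 interpret time_step dt by fact
 fix k p q r :: int assume s: "p + q = k + r"
 show "0 <= N1 dt k p q r" by (simp add: N1_def)
 assume nz: "N1 dt k p q r \<noteq> 0"
 then have i: "inK dt k p q r" "k \<noteq> p" "k \<noteq> q" by (auto simp: N1_def split: if_splits)
 then show "p \<noteq> k" "q \<noteq> k" by auto
 show "\<bar>2 * of_int (k - p) * of_int (k - q)\<bar> <= 2 / dt" by (rule phase_bound[OF i(1) s])
 have inv: "1 / \<bar>real_of_int a\<bar> <= 2 * (1 / J (of_int a))" if "a \<noteq> 0" for a
 proof -
  have "1 <= \<bar>real_of_int a\<bar>" using that by linarith
  then show ?thesis using J_le_2_abs[of "of_int a"] by (simp add: field_simps)
 qed
 have "(N1 dt k p q r)\<^sup>2 = (1 / \<bar>real_of_int (k - p)\<bar>) * (1 / \<bar>real_of_int (k - q)\<bar>)"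
 proof -
  have "(N1 dt k p q r)\<^sup>2 = \<bar>of_int ((k - p) * (k - q))\<bar> powr - 1"
   using i by (simp only: N1_def simp_thms if_True powr_mhalf_sq abs_ge_zero)
  also have "\<dots> = 1 / \<bar>of_int ((k - p) * (k - q))\<bar>" using i by (intro powr_m1) auto
  finally show ?thesis by (simp only: of_int_mult abs_mult) simp
 qed
 also have "\<dots> <= (2 * (1 / J (of_int (k - p)))) * (2 * (1 / J (of_int (k - q))))"
  using i by (intro mult_mono inv) auto
 also have "\<dots> = 4 * (J (of_int (k - p) - 0) powr - 1 * J (of_int (k - q) - 0) powr - 1)"
  by (simp only: powr_m1 japanese_pos diff_0_right)
 finally show "(N1 dt k p q r)\<^sup>2 <= 4 * (J (of_int (k - p) - 0) powr - 1 * J (of_int (k - q) - 0) powr - 1)" .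
qed

lemma good_kernel_N2: assumes "time_step dt" shows "good_kernel dt (N2 dt)"
 unfolding good_kernel_def
proof (rule exI[of _ of_int], rule exI[of _ of_int], intro allI impI conjI)
 interpret time_step dt by fact
 fix k p q r :: int assume s: "p + q = k + r"
 show "0 <= N2 dt k p q r" by (simp add: N2_def)
 assume nz: "N2 dt k p q r \<noteq> 0"
 then have i: "inK dt k p q r" "k \<noteq> p" "k \<noteq> q" by (auto simp: N2_def split: if_splits)
 then show "p \<noteq> k" "q \<noteq> k" by auto
 show "\<bar>2 * of_int (k - p) * of_int (k - q)\<bar> <= 2 / dt" by (rule phase_bound[OF i(1) s])
 have "(N2 dt k p q r)\<^sup>2 = J (of_int p) powr - 1 * J (of_int q) powr - 1"
 proof -
  have "N2 dt k p q r = (J (of_int p) * J (of_int q)) powr (-1/2)" using i by (simp only: N2_def simp_thms if_True)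
  then have "(N2 dt k p q r)\<^sup>2 = (J (of_int p) * J (of_int q)) powr - 1" by (simp only: powr_mhalf_sq mult_nonneg_nonneg japanese_pos)
  then show ?thesis by (simp only: powr_mult japanese_pos)
 qed
 moreover have e: "J (of_int (k - p) - of_int k) = J (of_int p)" for p :: int
  using japanese_minus[of "real_of_int p"] by simp
 moreover have "0 <= J (of_int p) powr - 1 * J (of_int q) powr - 1" by (intro mult_nonneg_nonneg powr_ge_zero)
 ultimately show "(N2 dt k p q r)\<^sup>2 <= 4 * (J (of_int (k - p) - of_int k) powr - 1 * J (of_int (k - q) - of_int k) powr - 1)"
  unfolding e by linarith
qed

lemma good_kernel_cong:
 assumes "good_kernel dt N" "\<And>k p q r. p + q = k + r ==> N' k p q r = N k p q r"
 shows "good_kernel dt N'"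
proof -
 from assms(1) obtain y z where yz: "\<forall>k p q r. p + q = k + r --> N k p q r \<ge> 0 \<and> (N k p q r \<noteq> 0 -->
  p \<noteq> k \<and> q \<noteq> k \<and> \<bar>2 * of_int (k - p) * of_int (k - q)\<bar> <= 2 / dt \<and>
   (N k p q r)\<^sup>2 <= 4 * (J (of_int (k - p) - y k) powr - 1 * J (of_int (k - q) - z k) powr - 1))"
  unfolding good_kernel_def by (elim exE) (rule that)
 show ?thesis unfolding good_kernel_def
 proof (rule exI[of _ y], rule exI[of _ z], intro allI, rule impI)
  fix k p q r :: int assume s: "p + q = k + r"
  from yz[THEN spec, THEN spec, THEN spec, THEN spec, THEN mp, OF s]
  show "N' k p q r \<ge> 0 \<and> (N' k p q r \<noteq> 0 -->
  p \<noteq> k \<and> q \<noteq> k \<and> \<bar>2 * of_int (k - p) * of_int (k - q)\<bar> <= 2 / dt \<and>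
   (N' k p q r)\<^sup>2 <= 4 * (J (of_int (k - p) - y k) powr - 1 * J (of_int (k - q) - z k) powr - 1))"
   unfolding assms(2)[OF s] .
 qed
qed

abbreviation om1 where "om1 dt F \<equiv> (%p. om dt p * F p)"

text \<open>Cauchy-Schwarz with \<open>circ_WW_decay\<close>. It is the product rule for Sobolev
  functions of time: orders \<open>\<alpha>\<close> and \<open>\<beta>\<close> of the factors give
  order \<open>\<gamma>\<close> of the product, and the phases \<open>a\<close> and \<open>b\<close>
  add up.\<close>

lemma circ_pair_decay:
 assumes "2 * \<alpha> + 2 * \<beta> - 2 * \<gamma> > 1" "0 <= \<gamma>" "\<gamma> <= \<alpha>" "\<gamma> <= \<beta>"
 shows "\<exists>C<\<infinity>. \<forall>dt a b F G. time_step dt --> F \<in> bC dt --> G \<in> bC dt -->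
  nC dt (%x. en (W dt (x + a + b) powr \<gamma>) *
   inv_measure.conv (circ dt) (%y. en (W dt (y + a) powr - \<alpha>) * F y) (%y. en (W dt (y + b) powr - \<beta>) * G y) x)
   <= C * nC dt F * nC dt G"
proof -
 obtain A where A: "A \<ge> 0" "\<And>dt a b. time_step dt ==>
  (\<integral>\<^sup>+x. en (W dt (x + a) powr - (2*\<alpha>) * W dt (x + b) powr - (2*\<beta>)) \<partial>circ dt) <= en (A * W dt (a - b) powr - (2*\<gamma>))"
  using circ_WW_decay[of "2*\<alpha>" "2*\<beta>" "2*\<gamma>"] assms by auto
 have "nC dt (%x. en (W dt (x + a + b) powr \<gamma>) *
   inv_measure.conv (circ dt) (%y. en (W dt (y + a) powr - \<alpha>) * F y) (%y. en (W dt (y + b) powr - \<beta>) * G y) x)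
   <= ennsqrt (en A) * nC dt F * nC dt G"
  if t: "time_step dt" and m: "F \<in> bC dt" "G \<in> bC dt" for dt a b F G
 proof -
  interpret time_step dt by fact
  have p2: "(en (w powr c))\<^sup>2 = en (w powr (2 * c))" for w c :: real
   by (simp only: ennreal_power powr_ge_zero) (simp only: power2_eq_square mult_2 powr_add)
  show ?thesis
  proof (rule C.nrm_conv_le)
   fix x
   have "(\<integral>\<^sup>+y. (en (W dt (y + a) powr - \<alpha>))\<^sup>2 * (en (W dt (x - y + b) powr - \<beta>))\<^sup>2 \<partial>circ dt) =
    (\<integral>\<^sup>+y. en (W dt (y + a) powr - (2*\<alpha>) * W dt (y + (- x - b)) powr - (2*\<beta>)) \<partial>circ dt)"
    unfolding p2 W_shift_refl by (simp add: ennreal_mult)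
   also have "\<dots> <= en (A * W dt (a - (- x - b)) powr - (2*\<gamma>))" by (rule A(2)[OF t])
   finally have "(en (W dt (x + a + b) powr \<gamma>))\<^sup>2 * (\<integral>\<^sup>+y. (en (W dt (y + a) powr - \<alpha>))\<^sup>2 * (en (W dt (x - y + b) powr - \<beta>))\<^sup>2 \<partial>circ dt)
    <= en (W dt (x + a + b) powr (2 * \<gamma>)) * en (A * W dt (a - (- x - b)) powr - (2*\<gamma>))"
    unfolding p2[of _ \<gamma>] by (intro mult_left_mono) auto
   also have "a - (- x - b) = x + a + b" by simp
   also have "en (W dt (x + a + b) powr (2 * \<gamma>)) * en (A * W dt (x + a + b) powr - (2*\<gamma>)) = en A"
    using A(1) by (subst ennreal_mult[symmetric]) (auto simp: powr_minus)
   finally show "(en (W dt (x + a + b) powr \<gamma>))\<^sup>2 * (\<integral>\<^sup>+y. (en (W dt (y + a) powr - \<alpha>))\<^sup>2 * (en (W dt (x - y + b) powr - \<beta>))\<^sup>2 \<partial>circ dt) <= en A" .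
  qed (use m in measurable)
 qed
 moreover have "ennsqrt (en A) < \<infinity>" by (rule ennsqrt_less_top) simp
 ultimately show ?thesis by blast
qed

context time_step begin

definition Q4 :: "(int => int => int => int => real) => (gf) => (gf) => (gf) => (gf) => ennreal" where
 "Q4 N F G H I = G.Lam (%x y z u. en (N (fst x) (fst y) (fst z) (fst u)) * F x * G y * H z * I u)"

lemma meas4_Q4:
 assumes [measurable]: "F \<in> bG dt" "G \<in> bG dt" "H \<in> bG dt" "I \<in> bG dt"
 shows "G.meas4 (%x y z u. en (N (fst x) (fst y) (fst z) (fst u)) * F x * G y * H z * I u)"
proof -
 have "(%w. en (N (fst (fst w)) (fst (fst (snd w))) (fst (fst (snd (snd w)))) (fst (snd (snd (snd w)))))) \<in> borel_measurable (Gam dt \<Otimes>\<^sub>M Gam dt \<Otimes>\<^sub>M Gam dt \<Otimes>\<^sub>M Gam dt)"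
  by (rule int4_measurable) measurable
 then show ?thesis unfolding split_beta' by measurable
qed

lemma Q4_sym:
 assumes m: "F \<in> bG dt" "G \<in> bG dt" "H \<in> bG dt" "I \<in> bG dt"
 shows "Q4 N F G H I = Q4 (%k p q r. N r p q k) I G H F"
  "Q4 N F G H I = Q4 (%k p q r. N p k r q) G F I H"
  "Q4 N F G H I = Q4 (%k p q r. N k q p r) F H G I"
 unfolding Q4_def
  apply (subst G.Lam_swap03[OF meas4_Q4[OF m]], simp only: mult_ac)
 apply (subst G.Lam_swap01[OF meas4_Q4[OF m]], simp only: mult_ac)
 apply (subst G.Lam_swap12[OF meas4_Q4[OF m]], simp only: mult_ac)
 done

lemma rfl_mult: "G.rfl (%p. f p * g p) = (%p. G.rfl f p * G.rfl g p)"
 by (simp add: G.rfl_def fun_eq_iff)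

end

text \<open>The square of the left side is at most the product of the two terms on the right. Each
  of these splits into two bounded bilinear pairings; 49/100 and 51/100 are 1/2 moved to either
  side, so that the frequency exponents of the two terms still add up to 1.\<close>

lemma N2_split:
 fixes P Q w0 w2 w3 :: real
 assumes "P \<ge> 1" "Q \<ge> 1" "w0 \<ge> 1" "w2 \<ge> 1" "w3 \<ge> 1"
 shows "(P * Q) powr (-1/2) * w0 powr - (12/25) * w2 powr - (12/25) * w3 powr - (12/25) <=
  w0 powr - (2/5) * P powr - (49/100) * (Q powr - (49/100) * w2 powr - (51/100)) * w3 powr - (2/5) +
  w0 powr - (51/100) * P powr - (51/100) * Q powr - (51/100) * w3 powr - (51/100)" (is "?L <= ?A + ?B")
proof (rule power2_le_imp_le)
 have pos: "P > 0" "Q > 0" "w0 > 0" "w2 > 0" "w3 > 0" using assms by auto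
 have nn: "?A \<ge> 0" "?B \<ge> 0" by (intro mult_nonneg_nonneg powr_ge_zero)+
 have dbl: "(x powr c)\<^sup>2 = x powr (2 * c)" for x c :: real by (simp only: power2_eq_square mult_2 powr_add)
 have "?L\<^sup>2 = P powr - 1 * Q powr - 1 * w0 powr - (24/25) * w2 powr - (24/25) * w3 powr - (24/25)"
  using pos by (simp only: power_mult_distrib dbl powr_mult less_imp_le) simp
 also have "\<dots> <= P powr - 1 * Q powr - 1 * w0 powr - (91/100) * w2 powr - (51/100) * w3 powr - (91/100)"
  using assms by (intro mult_mono mult_nonneg_nonneg powr_ge_zero order_refl powr_mono) auto
 also have "\<dots> = ?A * ?B"
 proof -
  have e: "P powr - (49/100) * P powr - (51/100) = P powr - 1" "Q powr - (49/100) * Q powr - (51/100) = Q powr - 1"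
   "w0 powr - (2/5) * w0 powr - (51/100) = w0 powr - (91/100)" "w3 powr - (2/5) * w3 powr - (51/100) = w3 powr - (91/100)"
   by (simp_all add: powr_add[symmetric])
  have "?A * ?B = (P powr - (49/100) * P powr - (51/100)) * (Q powr - (49/100) * Q powr - (51/100)) *
   (w0 powr - (2/5) * w0 powr - (51/100)) * w2 powr - (51/100) * (w3 powr - (2/5) * w3 powr - (51/100))"
   by (simp only: mult_ac)
  then show ?thesis unfolding e by simp
 qed
 also have "\<dots> <= (?A + ?B)\<^sup>2"
 proof -
  have "a * b <= (a + b)\<^sup>2" if "a \<ge> 0" "b \<ge> 0" for a b :: real
   using mult_nonneg_nonneg[OF that] zero_le_power2[of a] zero_le_power2[of b] unfolding power2_sum by linarith
  then show ?thesis using nn by blast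
 qed
 finally show "?L\<^sup>2 <= (?A + ?B)\<^sup>2" .
 show "0 <= ?A + ?B" using nn by linarith
qed

text \<open>A function whose frequency enters the kernel has no modulation weight. One term of
  \<open>N2_split\<close> is paired along \<open>x + u = y + z\<close> with the L4 bound on one
  side, the other along \<open>x - y = z - u\<close> with no dispersion at all.\<close>

lemma Q4_N2_1:
 "\<exists>C<\<infinity>. \<forall>dt F G H I. time_step dt -->
  F \<in> bG dt --> G \<in> bG dt --> H \<in> bG dt --> I \<in> bG dt -->
  time_step.Q4 dt (N2 dt) (om1 dt F) G (om1 dt H) (om1 dt I)
   <= C * nG dt F * nG dt G * nG dt H * nG dt I"
proof -
 obtain A where A: "A < \<infinity>" "\<And>dt F G. time_step dt ==> F \<in> bG dt ==> G \<in> bG dt ==>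
  nG dt (cG dt (%p. chi dt p * wgt dt 0 (2/5) sq p * F p) (%p. chi dt p * wgt dt 0 (2/5) sq p * G p))
   <= A * nG dt F * nG dt G"
  using L4_bound[of "2/5" "2/5"] by auto
 obtain B where B: "B < \<infinity>" "\<And>dt \<theta> \<theta>' F G. time_step dt ==> F \<in> bG dt ==> G \<in> bG dt ==>
  nG dt (cG dt (%p. wgt dt (49/100) 0 \<theta> p * F p) (%p. wgt dt (49/100) (51/100) \<theta>' p * G p)) <= B * nG dt F * nG dt G"
  using wgt_pair_bound[of "49/100" "49/100" 0 "51/100"] by auto
 obtain D where D: "D < \<infinity>" "\<And>dt \<theta> \<theta>' F G. time_step dt ==> F \<in> bG dt ==> G \<in> bG dt ==>
  nG dt (cG dt (%p. wgt dt 0 (51/100) \<theta> p * F p) (%p. wgt dt (51/100) 0 \<theta>' p * G p)) <= D * nG dt F * nG dt G"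
  using wgt_pair_bound[of 0 "51/100" "51/100" 0] by auto
 obtain E where E: "E < \<infinity>" "\<And>dt \<theta> \<theta>' F G. time_step dt ==> F \<in> bG dt ==> G \<in> bG dt ==>
  nG dt (cG dt (%p. wgt dt (51/100) 0 \<theta> p * F p) (%p. wgt dt 0 (51/100) \<theta>' p * G p)) <= E * nG dt F * nG dt G"
  using wgt_pair_bound[of "51/100" 0 0 "51/100"] by auto
 have main: "time_step.Q4 dt (N2 dt) (om1 dt F) G (om1 dt H) (om1 dt I)
   <= (A * B + D * E) * nG dt F * nG dt G * nG dt H * nG dt I"
  if t: "time_step dt" and m [measurable]: "F \<in> bG dt" "G \<in> bG dt" "H \<in> bG dt" "I \<in> bG dt"
  for dt F G H I
 proof -
  interpret time_step dt by fact
  define f where "f p = chi dt p * wgt dt 0 (2/5) sq p * F p" for p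
  define i where "i p = chi dt p * wgt dt 0 (2/5) sq p * I p" for p
  define g where "g p = wgt dt (49/100) 0 sq p * G p" for p
  define h where "h p = wgt dt (49/100) (51/100) sq p * H p" for p
  define f' where "f' p = wgt dt 0 (51/100) sq p * F p" for p
  define g' where "g' p = wgt dt (51/100) 0 sq p * G p" for p
  define h' where "h' p = wgt dt (51/100) 0 sq p * H p" for p
  define i' where "i' p = wgt dt 0 (51/100) sq p * I p" for p
  have [measurable]: "f \<in> bG dt" "g \<in> bG dt" "h \<in> bG dt" "i \<in> bG dt"
   "f' \<in> bG dt" "g' \<in> bG dt" "h' \<in> bG dt" "i' \<in> bG dt"
   unfolding f_def g_def h_def i_def f'_def g'_def h'_def i'_def by measurable
  have pt: "en (N2 dt (fst x) (fst y) (fst z) (fst u)) * (om dt x * F x) * G y * (om dt z * H z) * (om dt u * I u) <=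
   f x * g y * h z * i u + f' x * g' y * h' z * i' u" for x y z u
  proof -
   let ?X = "F x * G y * H z * I u"
   define a where "a = en (N2 dt (fst x) (fst y) (fst z) (fst u)) * om dt x * om dt z * om dt u"
   define b where "b = chi dt x * wgt dt 0 (2/5) sq x * wgt dt (49/100) 0 sq y * wgt dt (49/100) (51/100) sq z * (chi dt u * wgt dt 0 (2/5) sq u)"
   define c where "c = wgt dt 0 (51/100) sq x * wgt dt (51/100) 0 sq y * wgt dt (51/100) 0 sq z * wgt dt 0 (51/100) sq u"
   have "a <= b + c"
   proof (cases "inK dt (fst x) (fst y) (fst z) (fst u) \<and> fst x \<noteq> fst y \<and> fst x \<noteq> fst z")
    case False
    then show ?thesis by (simp only: a_def N2_def if_False) simp
   next
    case True
    then have ch: "chi dt x = 1" "chi dt u = 1" by (auto simp: chi_def inK_def)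
    let ?P = "J (of_int (fst y))" and ?Q = "J (of_int (fst z))"
    let ?w0 = "W dt (snd x + sq (fst x))" and ?w2 = "W dt (snd z + sq (fst z))" and ?w3 = "W dt (snd u + sq (fst u))"
    have n: "N2 dt (fst x) (fst y) (fst z) (fst u) = (?P * ?Q) powr (-1/2)" using True by (simp only: N2_def simp_thms if_True)
    have "a = en ((?P * ?Q) powr (-1/2) * ?w0 powr - (12/25) * ?w2 powr - (12/25) * ?w3 powr - (12/25))"
     unfolding a_def n wgt_def by (simp add: ennreal_mult)
    also have "\<dots> <= en (?w0 powr - (2/5) * ?P powr - (49/100) * (?Q powr - (49/100) * ?w2 powr - (51/100)) * ?w3 powr - (2/5) +
      ?w0 powr - (51/100) * ?P powr - (51/100) * ?Q powr - (51/100) * ?w3 powr - (51/100))"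
     by (intro ennreal_leI N2_split japanese_ge_1 W_ge_1)
    also have "\<dots> = b + c"
     unfolding b_def c_def ch wgt_def by (simp add: ennreal_mult ennreal_plus)
    finally show ?thesis .
   qed
   then have "a * ?X <= (b + c) * ?X" by (rule mult_right_mono) simp
   then show ?thesis
    unfolding a_def b_def c_def f_def g_def h_def i_def f'_def g'_def h'_def i'_def distrib_right by (simp only: mult_ac)
  qed
  have "Q4 (N2 dt) (om1 dt F) G (om1 dt H) (om1 dt I) <=
   G.Lam (%x y z u. f x * g y * h z * i u + f' x * g' y * h' z * i' u)"
   unfolding Q4_def by (rule G.Lam_mono[OF pt])
  also have "\<dots> = G.Lam (%x y z u. f x * g y * h z * i u) + G.Lam (%x y z u. f' x * g' y * h' z * i' u)"
   by (rule G.Lam_add) measurable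
  also have "G.Lam (%x y z u. f x * g y * h z * i u) = (\<integral>\<^sup>+u. G.conv f i u * G.conv g h u \<partial>Gam dt)"
   by (rule G.Lam_conv) measurable
  also have "\<dots> <= nG dt (G.conv f i) * nG dt (G.conv g h)"
   by (rule Cauchy_Schwarz_nrm) measurable
  also have "\<dots> <= (A * nG dt F * nG dt I) * (B * nG dt G * nG dt H)"
   unfolding f_def g_def h_def i_def by (intro mult_mono A(2) B(2) t m) auto
  also have "G.Lam (%x y z u. f' x * g' y * h' z * i' u) = (\<integral>\<^sup>+u. G.conv f' (G.rfl g') u * G.conv h' (G.rfl i') u \<partial>Gam dt)"
   by (rule G.Lam_conv') measurable
  also have "\<dots> <= nG dt (G.conv f' (G.rfl g')) * nG dt (G.conv h' (G.rfl i'))"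
   by (rule Cauchy_Schwarz_nrm) measurable
  also have "\<dots> <= (D * nG dt F * nG dt (G.rfl G)) * (E * nG dt H * nG dt (G.rfl I))"
   unfolding f'_def g'_def h'_def i'_def rfl_mult rfl_wgt by (intro mult_mono D(2) E(2) t m G.rfl_measurable) auto
  also have "(D * nG dt F * nG dt (G.rfl G)) * (E * nG dt H * nG dt (G.rfl I)) =
   (D * nG dt F * nG dt G) * (E * nG dt H * nG dt I)"
   by (simp add: G.nrm_rfl)
  finally have "Q4 (N2 dt) (om1 dt F) G (om1 dt H) (om1 dt I) <=
   (A * nG dt F * nG dt I) * (B * nG dt G * nG dt H) +
   (D * nG dt F * nG dt G) * (E * nG dt H * nG dt I)"
   by (simp add: add_mono)
  then show ?thesis unfolding distrib_right by (simp only: mult_ac)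
 qed
 have "A * B + D * E < \<infinity>" using A(1) B(1) D(1) E(1) by (simp add: ennreal_mult_less_top)
 with main show ?thesis by blast
qed

text \<open>Wherever the function without modulation weight stands, a symmetry moves it to the
  output slot; for \<open>N2\<close> with that function at \<open>p\<close> or \<open>q\<close> the
  direct estimate \<open>Q4_N2_1\<close> takes over.\<close>

lemma Q4_bounds:
 "\<exists>C<\<infinity>. \<forall>dt N F G H I. time_step dt --> N \<in> {N1 dt, N2 dt} -->
  F \<in> bG dt --> G \<in> bG dt --> H \<in> bG dt --> I \<in> bG dt -->
  time_step.Q4 dt N F (om1 dt G) (om1 dt H) (om1 dt I)
   <= C * nG dt F * nG dt G * nG dt H * nG dt I \<and>
  time_step.Q4 dt N (om1 dt F) G (om1 dt H) (om1 dt I)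
   <= C * nG dt F * nG dt G * nG dt H * nG dt I \<and>
  time_step.Q4 dt N (om1 dt F) (om1 dt G) H (om1 dt I)
   <= C * nG dt F * nG dt G * nG dt H * nG dt I \<and>
  time_step.Q4 dt N (om1 dt F) (om1 dt G) (om1 dt H) I
   <= C * nG dt F * nG dt G * nG dt H * nG dt I"
proof -
 obtain A where A: "A < \<infinity>" "\<And>dt N F G H I. time_step dt ==> good_kernel dt N ==>
  F \<in> bG dt ==> G \<in> bG dt ==> H \<in> bG dt ==> I \<in> bG dt ==>
  time_step.Q4 dt N F (om1 dt G) (om1 dt H) (om1 dt I)
   <= A * nG dt F * nG dt G * nG dt H * nG dt I"
  using Lam_kernel_0 by (auto simp: time_step.Q4_def)
 obtain B where B: "B < \<infinity>" "\<And>dt F G H I. time_step dt ==>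
  F \<in> bG dt ==> G \<in> bG dt ==> H \<in> bG dt ==> I \<in> bG dt ==>
  time_step.Q4 dt (N2 dt) (om1 dt F) G (om1 dt H) (om1 dt I)
   <= B * nG dt F * nG dt G * nG dt H * nG dt I"
  using Q4_N2_1 by auto
 have le: "a * x * y * z * w <= (A + B) * x * y * z * w" if "a = A \<or> a = B" for a x y z w :: ennreal
  using that by (intro mult_right_mono) auto
 show ?thesis
 proof (intro exI[of _ "A + B"] conjI allI impI)
  show "A + B < \<infinity>" using A(1) B(1) by simp
  fix dt N and F G H I :: "gf"
  assume t: "time_step dt" and N: "N \<in> {N1 dt, N2 dt}" and m: "F \<in> bG dt" "G \<in> bG dt" "H \<in> bG dt" "I \<in> bG dt"
  interpret time_step dt by fact
  note m' = m[measurable]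
  have om: "(om1 dt F) \<in> bG dt" "(om1 dt G) \<in> bG dt"
   "(om1 dt H) \<in> bG dt" "(om1 dt I) \<in> bG dt" by measurable
  have gN: "good_kernel dt N" using N good_kernel_N1[OF t] good_kernel_N2[OF t] by auto
  show "Q4 N F (om1 dt G) (om1 dt H) (om1 dt I)
   <= (A + B) * nG dt F * nG dt G * nG dt H * nG dt I"
   by (rule order_trans[OF A(2)[OF t gN m] le]) simp
  have s3: "good_kernel dt (%k p q r. N r p q k)"
   using N by (intro good_kernel_cong[OF gN]) (auto simp: N1_sym N2_sym)
  have "Q4 N (om1 dt F) (om1 dt G) (om1 dt H) I <=
   A * nG dt I * nG dt G * nG dt H * nG dt F"
   unfolding Q4_sym(1)[OF om(1,2,3) m(4)] by (rule A(2)[OF t s3 m(4,2,3,1)])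
  also have "\<dots> = A * nG dt F * nG dt G * nG dt H * nG dt I" by (simp only: mult_ac)
  finally show "Q4 N (om1 dt F) (om1 dt G) (om1 dt H) I
   <= (A + B) * nG dt F * nG dt G * nG dt H * nG dt I"
   by (rule order_trans[OF _ le]) simp
  have one: "Q4 N (om1 dt F) G (om1 dt H) (om1 dt I)
   <= (A + B) * nG dt F * nG dt G * nG dt H * nG dt I"
   if m: "F \<in> bG dt" "G \<in> bG dt" "H \<in> bG dt" "I \<in> bG dt" for F G H I :: "gf"
  proof (cases "N = N2 dt")
   case True
   then show ?thesis using order_trans[OF B(2)[OF t m] le] by simp
  next
   case False
   then have N: "N = N1 dt" using N by simp
   note m' = m[measurable]
   have om: "(om1 dt F) \<in> bG dt"
    "(om1 dt H) \<in> bG dt" "(om1 dt I) \<in> bG dt" by measurable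
   have s1: "good_kernel dt (%k p q r. N p k r q)"
    unfolding N by (rule good_kernel_cong[OF good_kernel_N1[OF t]]) (rule N1_sym)
   have "Q4 N (om1 dt F) G (om1 dt H) (om1 dt I) <=
    A * nG dt G * nG dt F * nG dt I * nG dt H"
    unfolding Q4_sym(2)[OF om(1) m(2) om(2,3)] by (rule A(2)[OF t s1 m(2,1,4,3)])
   also have "\<dots> = A * nG dt F * nG dt G * nG dt H * nG dt I" by (simp only: mult_ac)
   finally show ?thesis by (rule order_trans[OF _ le]) simp
  qed
  show "Q4 N (om1 dt F) G (om1 dt H) (om1 dt I)
   <= (A + B) * nG dt F * nG dt G * nG dt H * nG dt I" by (rule one[OF m])
  have s12: "N k q p r = N k p q r" for k p q r
  proof -
   have c: "(inK dt k q p r \<and> k \<noteq> q \<and> k \<noteq> p) = (inK dt k p q r \<and> k \<noteq> p \<and> k \<noteq> q)" by (auto simp: inK_def)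
   have "N1 dt k q p r = N1 dt k p q r" unfolding N1_def c mult.commute[of "k - q" "k - p"] ..
   moreover have "N2 dt k q p r = N2 dt k p q r" unfolding N2_def c mult.commute[of "J (of_int q)" "J (of_int p)"] ..
   ultimately show ?thesis using N by (elim insertE) (simp_all only: empty_iff)
  qed
  have s12': "(%k p q r. N k q p r) = N" by (intro ext) (rule s12)
  have "Q4 N (om1 dt F) (om1 dt G) H (om1 dt I) =
   Q4 N (om1 dt F) H (om1 dt G) (om1 dt I)"
   using Q4_sym(3)[OF om(1,2) m(3) om(4), of N] unfolding s12' .
  also have "\<dots> <= (A + B) * nG dt F * nG dt H * nG dt G * nG dt I" by (rule one[OF m(1,3,2,4)])
  finally show "Q4 N (om1 dt F) (om1 dt G) H (om1 dt I)
   <= (A + B) * nG dt F * nG dt G * nG dt H * nG dt I" by (simp only: mult_ac)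
 qed
qed

context time_step begin

lemma borel_measurable_nn_integral_count:
 fixes f :: "int => 'b => ennreal"
 assumes [measurable]: "\<And>k. f k \<in> borel_measurable N"
 shows "(%x. \<integral>\<^sup>+k. f k x \<partial>cZ) \<in> borel_measurable N"
proof -
 have "(%p. f (snd p) (fst p)) \<in> borel_measurable (N \<Otimes>\<^sub>M cZ)"
  by (rule measurable_compose_countable[where g = snd and f = "%k p. f k (fst p)"]) measurable
 then show ?thesis by (intro I.borel_measurable_nn_integral) (simp add: split_beta')
qed

text \<open>Separates the frequency sums from the modulation integrals, leaving for fixed
  frequencies a form on the circle.\<close>

lemma Q4_unfold:
 assumes m [measurable]: "F \<in> bG dt" "G \<in> bG dt" "H \<in> bG dt" "I \<in> bG dt"
 shows "Q4 N F G H I = (SI k. (SI p. (SI q. en (N k p q (p + q - k)) *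
  C.Lam (%s t v w. F (k, s) * G (p, t) * H (q, v) * I (p + q - k, w)))))"
proof -
 define \<Psi> where "\<Psi> k s p t q v = en (N k p q (p + q - k)) * (F (k, s) * G (p, t) * H (q, v) * I (p + q - k, t + v - s))" for k s p t q v
 have [measurable]: "(%s. F (k, s)) \<in> bC dt" "(%s. G (k, s)) \<in> bC dt"
  "(%s. H (k, s)) \<in> bC dt" "(%s. I (k, s)) \<in> bC dt" for k
  by (rule Gam_Pair, fact)+
 have [measurable]: "(%v. \<Psi> k s p t q v) \<in> bC dt"
  "(%t. \<integral>\<^sup>+v. \<Psi> k s p t q v \<partial>circ dt) \<in> bC dt"
  "(%s. \<integral>\<^sup>+t. \<integral>\<^sup>+v. \<Psi> k s p t q v \<partial>circ dt \<partial>circ dt) \<in> bC dt" for k s p t q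
  unfolding \<Psi>_def by measurable
 note mQ = G.meas4_compose[OF meas4_Q4[OF m, of N], measurable (raw)]
 let ?\<Phi> = "%x y z u. en (N (fst x) (fst y) (fst z) (fst u)) * F x * G y * H z * I u"
 have "Q4 N F G H I = (SI k. (\<integral>\<^sup>+s. (\<integral>\<^sup>+y. (\<integral>\<^sup>+z. ?\<Phi> (k, s) y z (y + z - (k, s)) \<partial>Gam dt) \<partial>Gam dt) \<partial>circ dt))"
  unfolding Q4_def G.Lam_def by (rule nn_integral_Gam[OF tau_pos]) measurable
 also have "\<dots> = (SI k. (\<integral>\<^sup>+s. (SI p. (\<integral>\<^sup>+t. (\<integral>\<^sup>+z. ?\<Phi> (k, s) (p, t) z ((p, t) + z - (k, s)) \<partial>Gam dt) \<partial>circ dt)) \<partial>circ dt))"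
  by (rule nn_integral_cong, rule nn_integral_cong, rule nn_integral_Gam[OF tau_pos]) measurable
 also have "\<dots> = (SI k. (\<integral>\<^sup>+s. (SI p. (\<integral>\<^sup>+t. (SI q. (\<integral>\<^sup>+v. ?\<Phi> (k, s) (p, t) (q, v) ((p, t) + (q, v) - (k, s)) \<partial>circ dt)) \<partial>circ dt)) \<partial>circ dt))"
  by (rule nn_integral_cong, rule nn_integral_cong, rule nn_integral_cong, rule nn_integral_cong, rule nn_integral_Gam[OF tau_pos]) measurable
 also have "\<dots> = (SI k. (\<integral>\<^sup>+s. (SI p. (\<integral>\<^sup>+t. (SI q. (\<integral>\<^sup>+v. \<Psi> k s p t q v \<partial>circ dt)) \<partial>circ dt)) \<partial>circ dt))"
  unfolding \<Psi>_def add_Pair diff_Pair fst_conv by (simp only: mult.assoc)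
 also have "\<dots> = (SI k. (\<integral>\<^sup>+s. (SI p. (SI q. (\<integral>\<^sup>+t. (\<integral>\<^sup>+v. \<Psi> k s p t q v \<partial>circ dt) \<partial>circ dt))) \<partial>circ dt))"
  by (rule nn_integral_cong, rule nn_integral_cong, rule nn_integral_cong, rule nn_integral_circ_sum) measurable
 also have "\<dots> = (SI k. (SI p. (\<integral>\<^sup>+s. (SI q. (\<integral>\<^sup>+t. (\<integral>\<^sup>+v. \<Psi> k s p t q v \<partial>circ dt) \<partial>circ dt)) \<partial>circ dt)))"
  by (rule nn_integral_cong, rule nn_integral_circ_sum, rule borel_measurable_nn_integral_count) measurable
 also have "\<dots> = (SI k. (SI p. (SI q. (\<integral>\<^sup>+s. (\<integral>\<^sup>+t. (\<integral>\<^sup>+v. \<Psi> k s p t q v \<partial>circ dt) \<partial>circ dt) \<partial>circ dt))))"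
  by (rule nn_integral_cong, rule nn_integral_cong, rule nn_integral_circ_sum) measurable
 also have "\<dots> = (SI k. (SI p. (SI q. en (N k p q (p + q - k)) *
  C.Lam (%s t v w. F (k, s) * G (p, t) * H (q, v) * I (p + q - k, w)))))"
 proof (rule nn_integral_cong, rule nn_integral_cong, rule nn_integral_cong)
  fix k p q :: int
  have "C.meas4 (%s t v w. F (k, s) * G (p, t) * H (q, v) * I (p + q - k, w))" by measurable
  from C.Lam_cmult[OF this, of "en (N k p q (p + q - k))"]
  show "(\<integral>\<^sup>+s. (\<integral>\<^sup>+t. (\<integral>\<^sup>+v. \<Psi> k s p t q v \<partial>circ dt) \<partial>circ dt) \<partial>circ dt) = en (N k p q (p + q - k)) *
  C.Lam (%s t v w. F (k, s) * G (p, t) * H (q, v) * I (p + q - k, w))"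
   unfolding C.Lam_def \<Psi>_def .
 qed
 finally show ?thesis .
qed

lemma nrm_Gam:
 assumes "F \<in> bG dt"
 shows "nrm (cZ) (%k. nC dt (%s. F (k, s))) = nG dt F"
proof -
 have "(%p. (F p)\<^sup>2) \<in> bG dt" using assms by measurable
 from nn_integral_Gam[OF tau_pos this] show ?thesis
  unfolding nrm_def[of "Gam dt"] nrm_def[of "cZ"] nrm_sq by simp
qed

end

text \<open>For \<open>k = p\<close> the surface forces \<open>q = r\<close>, so the sum factorises
  into two l2 pairings, over \<open>k\<close> and over \<open>q\<close>. The modulation weights only
  have to control a form on the circle.\<close>

lemma Q4_resonant:
 "\<exists>C<\<infinity>. \<forall>dt F G H I. time_step dt -->
  F \<in> bG dt --> G \<in> bG dt --> H \<in> bG dt --> I \<in> bG dt -->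
  time_step.Q4 dt (%k p q r. if k = p then 1 else 0) (om1 dt F) (om1 dt G) (om1 dt H) (om1 dt I)
   <= C * nG dt F * nG dt G * nG dt H * nG dt I"
proof -
 obtain A where A: "A < \<infinity>" "\<And>dt a b F G. time_step dt ==> F \<in> bC dt ==> G \<in> bC dt ==>
  nC dt (inv_measure.conv (circ dt) (%y. en (W dt (y + a) powr - (12/25)) * F y) (%y. en (W dt (y + b) powr - (12/25)) * G y))
   <= A * nC dt F * nC dt G"
  using circ_pair_decay[of "12/25" "12/25" 0] by auto
 have main: "time_step.Q4 dt (%k p q r. if k = p then 1 else 0) (om1 dt F) (om1 dt G) (om1 dt H) (om1 dt I)
   <= (A * A) * nG dt F * nG dt G * nG dt H * nG dt I"
  if t: "time_step dt" and m [measurable]: "F \<in> bG dt" "G \<in> bG dt" "H \<in> bG dt" "I \<in> bG dt"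
  for dt F G H I
 proof -
  interpret time_step dt by fact
  let ?n = "%F k. nC dt (%s. F (k, s))"
  have mk [measurable]: "(%s. F (k, s)) \<in> bC dt" "(%s. G (k, s)) \<in> bC dt"
   "(%s. H (k, s)) \<in> bC dt" "(%s. I (k, s)) \<in> bC dt" for k
   by (rule Gam_Pair, fact)+
  have omk: "om dt (k, s) = en (W dt (s + sq k) powr - (12/25))" for k s by (simp add: wgt_def)
  have lam: "C.Lam (%s t v w. (om dt (k, s) * F (k, s)) * (om dt (k, t) * G (k, t)) * (om dt (q, v) * H (q, v)) * (om dt (q, w) * I (q, w)))
   <= (A * A) * (?n F k * ?n G k * (?n H q * ?n I q))" for k q
  proof -
   have "C.Lam (%s t v w. (om dt (k, s) * F (k, s)) * (om dt (k, t) * G (k, t)) * (om dt (q, v) * H (q, v)) * (om dt (q, w) * I (q, w))) =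
    (\<integral>\<^sup>+u. C.conv (%s. om dt (k, s) * F (k, s)) (%s. om dt (q, s) * I (q, s)) u * C.conv (%s. om dt (k, s) * G (k, s)) (%s. om dt (q, s) * H (q, s)) u \<partial>circ dt)"
    unfolding omk by (rule C.Lam_conv) measurable
   also have "\<dots> <= nC dt (C.conv (%s. om dt (k, s) * F (k, s)) (%s. om dt (q, s) * I (q, s))) * nC dt (C.conv (%s. om dt (k, s) * G (k, s)) (%s. om dt (q, s) * H (q, s)))"
    unfolding omk by (rule Cauchy_Schwarz_nrm) measurable
   also have "\<dots> <= (A * ?n F k * ?n I q) * (A * ?n G k * ?n H q)"
    unfolding omk by (intro mult_mono A(2) t mk) auto
   finally show ?thesis by (simp only: mult_ac)
  qed
  have "Q4 (%k p q r. if k = p then 1 else 0) (om1 dt F) (om1 dt G) (om1 dt H) (om1 dt I) =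
   (SI k. (SI p. (SI q. en (if k = p then 1 else 0) *
    C.Lam (%s t v w. (om dt (k, s) * F (k, s)) * (om dt (p, t) * G (p, t)) * (om dt (q, v) * H (q, v)) * (om dt (p + q - k, w) * I (p + q - k, w))))))"
   by (rule Q4_unfold) measurable
  also have "\<dots> = (SI k. (SI p. (SI q. C.Lam (%s t v w. (om dt (k, s) * F (k, s)) * (om dt (k, t) * G (k, t)) * (om dt (q, v) * H (q, v)) * (om dt (q, w) * I (q, w)))) * indicator {k} p))"
   by (rule nn_integral_cong, rule nn_integral_cong) (auto split: split_indicator)
  also have "\<dots> = (SI k. (SI q. C.Lam (%s t v w. (om dt (k, s) * F (k, s)) * (om dt (k, t) * G (k, t)) * (om dt (q, v) * H (q, v)) * (om dt (q, w) * I (q, w)))))"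
   by (rule nn_integral_cong) (simp only: nn_integral_indicator_singleton nn_integral_cmult_indicator sets_count_space Pow_UNIV UNIV_I emeasure_count_space_finite finite.intros subset_UNIV card.insert card.empty, simp)
  also have "\<dots> <= (SI k. (SI q. (A * A) * (?n F k * ?n G k * (?n H q * ?n I q))))"
   by (intro nn_integral_mono lam)
  also have "\<dots> = (A * A) * ((SI k. ?n F k * ?n G k) * (SI q. ?n H q * ?n I q))"
   by (simp only: sum_const_M) (subst nn_integral_multc, simp, simp)
  also have "\<dots> <= (A * A) * ((nrm (cZ) (?n F) * nrm (cZ) (?n G)) * (nrm (cZ) (?n H) * nrm (cZ) (?n I)))"
   by (intro mult_left_mono mult_mono Cauchy_Schwarz_nrm) auto
  also have "\<dots> = (A * A) * nG dt F * nG dt G * nG dt H * nG dt I"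
   unfolding nrm_Gam[OF m(1)] nrm_Gam[OF m(2)] nrm_Gam[OF m(3)] nrm_Gam[OF m(4)] by (simp only: mult_ac)
  finally show ?thesis .
 qed
 have "A * A < \<infinity>" using A(1) by (simp add: ennreal_mult_less_top)
 with main show ?thesis by blast
qed

section \<open>The frequency kernel for the \<open>Y\<close> norm\<close>

text \<open>Used when the output has the largest modulation. Its weight then has exponent 1, of
  which 22/25 is spent on the resonance function, and \<open>1/2 - 22/25 = -19/50\<close>.\<close>

definition NY :: "int => int => int => int => real" where
 "NY k p q r = (if k \<noteq> p \<and> k \<noteq> q then \<bar>of_int ((k - p) * (k - q))\<bar> powr (-19/50) *
  (\<bar>of_int ((k - p) * (k - q))\<bar> powr (-1/2) + (J (of_int p) * J (of_int q)) powr (-1/2)) else 0)"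

text \<open>Each negative power of the resonance function becomes brackets of \<open>k - p\<close>
  and \<open>k - q\<close> at a factor 16; squaring the sum costs 2, and 512 is
  \<open>2 * 16 * 16\<close>.\<close>

lemma NY_sq_le:
 "(NY k p q r)\<^sup>2 <= 512 * (J (of_int (k - p)) powr - (19/25) * J (of_int (k - p) - 0) powr - 1 * (J (of_int (k - q)) powr - (19/25) * J (of_int (k - q) - 0) powr - 1) +
  J (of_int (k - p)) powr - (19/25) * J (of_int (k - p) - of_int k) powr - 1 * (J (of_int (k - q)) powr - (19/25) * J (of_int (k - q) - of_int k) powr - 1))"
 (is "_ <= 512 * (?R1 + ?R2)")
proof (cases "k \<noteq> p \<and> k \<noteq> q")
 case False
 then have "NY k p q r = 0" unfolding NY_def by (simp only: if_False)
 moreover have "0 <= ?R1" "0 <= ?R2" by (intro mult_nonneg_nonneg powr_ge_zero)+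
 ultimately show ?thesis by simp
next
 case True
 define a where "a = real_of_int (k - p)"
 define b where "b = real_of_int (k - q)"
 have ab: "\<bar>a\<bar> \<ge> 1" "\<bar>b\<bar> \<ge> 1" using True unfolding a_def b_def by linarith+
 define m where "m = \<bar>a * b\<bar>"
 have "a \<noteq> 0" "b \<noteq> 0" using ab by auto
 then have m: "m > 0" by (simp add: m_def)
 define P where "P = J (of_int p) * J (of_int q)"
 have P: "P > 0" by (simp add: P_def)
 have dbl: "(x powr c)\<^sup>2 = x powr (2 * c)" for x c :: real by (simp only: power2_eq_square mult_2 powr_add)
 have sq2: "(x + y)\<^sup>2 <= 2 * (x\<^sup>2 + y\<^sup>2)" for x y :: real
 proof -
  have "2 * x * y <= x\<^sup>2 + y\<^sup>2" by (rule sum_squares_bound)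
  then show ?thesis by (simp add: power2_sum)
 qed
 have "NY k p q r = m powr (-19/50) * (m powr (-1/2) + P powr (-1/2))"
  unfolding NY_def if_P[OF True] m_def a_def b_def P_def by simp
 then have "(NY k p q r)\<^sup>2 = m powr - (19/25) * (m powr (-1/2) + P powr (-1/2))\<^sup>2"
  by (simp add: power_mult_distrib dbl)
 also have "\<dots> <= m powr - (19/25) * (2 * ((m powr (-1/2))\<^sup>2 + (P powr (-1/2))\<^sup>2))"
  by (intro mult_left_mono sq2) simp
 also have "\<dots> = 2 * (m powr - (19/25) * m powr - 1) + 2 * (m powr - (19/25) * P powr - 1)"
  unfolding powr_mhalf_sq[OF less_imp_le[OF m]] powr_mhalf_sq[OF less_imp_le[OF P]] by (simp only: distrib_left mult_ac)
 also have "\<dots> <= 512 * ?R1 + 512 * ?R2"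
 proof -
  have gen: "m powr - c <= 16 * (J a powr - c * J b powr - c)" if "0 <= c" "c <= 1" for c
  proof -
   have "J a * J b <= (2 * \<bar>a\<bar>) * (2 * \<bar>b\<bar>)" using ab by (intro mult_mono J_le_2_abs) auto
   then have "J a * J b <= 4 * m" by (simp add: m_def abs_mult)
   then have "m powr - c <= 4 powr c * (J a * J b) powr - c" using that by (intro powr_neg_mono) auto
   also have "\<dots> <= 16 * (J a * J b) powr - c"
   proof -
    have "4 powr c <= 4 powr (1::real)" using that by (intro powr_mono) auto
    then show ?thesis by (intro mult_right_mono) auto
   qed
   finally show ?thesis by (simp add: powr_mult)
  qed
  have "m powr - (19/25) * m powr - 1 <= (16 * (J a powr - (19/25) * J b powr - (19/25))) * (16 * (J a powr - 1 * J b powr - 1))"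
   by (intro mult_mono gen) (auto intro!: mult_nonneg_nonneg simp del: powr_one)
  also have "\<dots> = 256 * ?R1" unfolding a_def b_def by (simp only: diff_0_right) simp
  finally have 1: "m powr - (19/25) * m powr - 1 <= 256 * ?R1" .
  have PJ: "P powr - 1 = J (a - of_int k) powr - 1 * J (b - of_int k) powr - 1"
   unfolding P_def a_def b_def using japanese_minus[of "real_of_int p"] japanese_minus[of "real_of_int q"] by (simp add: powr_mult)
  have "m powr - (19/25) * P powr - 1 <= (16 * (J a powr - (19/25) * J b powr - (19/25))) * P powr - 1"
   by (intro mult_right_mono gen) auto
  also have "\<dots> = 16 * ?R2" unfolding PJ unfolding a_def b_def by (simp only: mult_ac)
  finally have 2: "m powr - (19/25) * P powr - 1 <= 16 * ?R2" .
  have "0 <= ?R2" by (intro mult_nonneg_nonneg powr_ge_zero)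
  with 1 2 show ?thesis by linarith
 qed
 finally show ?thesis by simp
qed

text \<open>With the modulations integrated out only frequencies are left. For fixed
  \<open>k\<close> the squared kernel is summable over \<open>p\<close> and \<open>q\<close>, the
  extra exponent 19/25 making both sums converge.\<close>

lemma Lam_NY:
 "\<exists>C<\<infinity>. \<forall>f g h i. inv_measure.Lam (cZ) (%k p q r. en (NY k p q r) * f k * g p * h q * i r)
   <= C * nrm (cZ) f * nrm (cZ) g * nrm (cZ) h * nrm (cZ) i"
proof -
 interpret I: inv_measure "cZ" by (rule inv_measure_int)
 obtain A where A: "A < \<infinity>" "\<And>x y. (SI k. en (J (of_int k - x) powr - (19/25) * J (of_int k - y) powr - 1)) <= A"
  using sum_J_J_bound[of "19/25" 1] by (auto simp del: powr_one)
 define g where "g y a = en (J (of_int a) powr - (19/25) * J (of_int a - y) powr - 1)" for y and a :: int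
 have gA: "(SI k. g y k) <= A" for y using A(2)[of 0 y] by (simp only: g_def diff_0_right)
 define C where "C = 512 * (A * A + A * A)"
 have bound: "(SI p. (SI q. (en (NY k p q (p + q - k)))\<^sup>2)) <= C" for k
 proof -
  have nn: "NY k p q r \<ge> 0" for p q r by (simp add: NY_def)
  have e: "en (512 * (a * b + c * d)) = 512 * (en a * en b + en c * en d)"
   if "a \<ge> 0" "b \<ge> 0" "c \<ge> 0" "d \<ge> 0" for a b c d
   using that by (simp add: ennreal_mult)
  have pt: "(en (NY k p q r))\<^sup>2 <= 512 * (g 0 (k - p) * g 0 (k - q) + g (of_int k) (k - p) * g (of_int k) (k - q))" for p q r
  proof -
   have "(en (NY k p q r))\<^sup>2 = en ((NY k p q r)\<^sup>2)" using nn by (simp add: ennreal_power)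
   also have "\<dots> <= en (512 * (J (of_int (k - p)) powr - (19/25) * J (of_int (k - p) - 0) powr - 1 * (J (of_int (k - q)) powr - (19/25) * J (of_int (k - q) - 0) powr - 1) +
  J (of_int (k - p)) powr - (19/25) * J (of_int (k - p) - of_int k) powr - 1 * (J (of_int (k - q)) powr - (19/25) * J (of_int (k - q) - of_int k) powr - 1)))"
    by (intro ennreal_leI NY_sq_le)
   also have "\<dots> = 512 * (g 0 (k - p) * g 0 (k - q) + g (of_int k) (k - p) * g (of_int k) (k - q))"
    unfolding g_def by (rule e) (intro mult_nonneg_nonneg powr_ge_zero)+
   finally show ?thesis .
  qed
  have "(SI p. (SI q. (en (NY k p q (p + q - k)))\<^sup>2)) <=
   (SI p. (SI q. 512 * (g 0 (k - p) * g 0 (k - q) + g (of_int k) (k - p) * g (of_int k) (k - q))))"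
   by (intro nn_integral_mono pt)
  also have "\<dots> = 512 * ((SI p. g 0 (k - p)) * (SI q. g 0 (k - q)) +
   (SI p. g (of_int k) (k - p)) * (SI q. g (of_int k) (k - q)))"
   by (simp add: nn_integral_cmult nn_integral_multc nn_integral_add)
  also have "\<dots> = 512 * ((SI p. g 0 p) * (SI q. g 0 q) +
   (SI p. g (of_int k) p) * (SI q. g (of_int k) q))"
   using I.nn_integral_shift'(3)[of "g 0" k] I.nn_integral_shift'(3)[of "g (of_int k)" k] by simp
  also have "\<dots> <= C" unfolding C_def by (intro mult_left_mono add_mono mult_mono gA) auto
  finally show ?thesis .
 qed
 have "I.Lam (%k p q r. en (NY k p q r) * f k * g p * h q * i r)
   <= ennsqrt C * nrm (cZ) f * nrm (cZ) g * nrm (cZ) h * nrm (cZ) i" for f g h i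
  by (rule I.Lam_Cauchy_Schwarz) (use bound in \<open>simp_all add: pair_measure_countable\<close>)
 moreover have "ennsqrt C < \<infinity>" using A(1) by (intro ennsqrt_less_top) (auto simp: C_def ennreal_mult_less_top)
 ultimately show ?thesis by blast
qed

text \<open>With \<open>a = k - p\<close>, \<open>b = k - q\<close> and \<open>r = p + q - k\<close> one has \<open>k r = p q - a b\<close>.\<close>

lemma J_product_bound:
 assumes "p + q = k + r" "k \<noteq> p" "k \<noteq> (q::int)"
 shows "J (of_int k) * J (of_int r) <= 4 * (J (of_int p) * J (of_int q) + \<bar>of_int ((k - p) * (k - q))\<bar>)"
proof -
 define p' q' a b where "p' = real_of_int p" "q' = real_of_int q" "a = real_of_int (k - p)" "b = real_of_int (k - q)"
 note d = this
 have ka: "real_of_int k = p' + a" "real_of_int r = q' - a"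
 proof -
  have "real_of_int p + real_of_int q = real_of_int k + real_of_int r" using assms(1) by (metis of_int_add)
  then show "real_of_int k = p' + a" "real_of_int r = q' - a" by (simp_all add: d)
 qed
 have kr: "real_of_int k * real_of_int r = p' * q' - a * b"
 proof -
  have r: "real_of_int r = p' + q' - real_of_int k" using ka by (simp add: d)
  show ?thesis unfolding r by (simp add: d algebra_simps)
 qed
 have ab: "1 <= \<bar>a\<bar>" "1 <= \<bar>b\<bar>" using assms(2,3) unfolding d by linarith+
 \<comment> \<open>Since \<open>\<bar>b\<bar> \<ge> 1\<close>, the product \<open>a * b\<close>
   dominates \<open>a\<close>; this absorbs the lower-order terms and uses
   \<open>k \<noteq> q\<close>.\<close>
 have a2: "a\<^sup>2 <= (a * b)\<^sup>2"
 proof -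
  have "\<bar>a\<bar> * 1 <= \<bar>a\<bar> * \<bar>b\<bar>" using ab by (intro mult_left_mono) auto
  then show ?thesis by (intro abs_le_square_iff[THEN iffD1]) (simp add: abs_mult)
 qed
 have sp: "(x + y)\<^sup>2 <= 2 * x\<^sup>2 + 2 * y\<^sup>2" "(x - y)\<^sup>2 <= 2 * x\<^sup>2 + 2 * y\<^sup>2" for x y :: real
  using sum_squares_bound[of x y] sum_squares_bound[of x "- y"] by (simp_all add: power2_sum power2_diff)
 have "(J (of_int k) * J (of_int r))\<^sup>2 = 1 + (p' + a)\<^sup>2 + (q' - a)\<^sup>2 + (p' * q' - a * b)\<^sup>2"
  unfolding power_mult_distrib J_sq kr[symmetric] ka[symmetric] by (simp add: power_mult_distrib algebra_simps)
 also have "\<dots> <= 1 + (2 * p'\<^sup>2 + 2 * a\<^sup>2) + (2 * q'\<^sup>2 + 2 * a\<^sup>2) + (2 * (p' * q')\<^sup>2 + 2 * (a * b)\<^sup>2)"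
  by (intro add_mono sp order_refl)
 also have "\<dots> <= 2 * ((1 + p'\<^sup>2) * (1 + q'\<^sup>2)) + 6 * (a * b)\<^sup>2"
  using a2 by (simp add: algebra_simps power_mult_distrib)
 also have "\<dots> <= (4 * (J p' * J q' + \<bar>a * b\<bar>))\<^sup>2"
 proof -
  have "(J p' * J q' + \<bar>a * b\<bar>)\<^sup>2 \<ge> (J p' * J q')\<^sup>2 + \<bar>a * b\<bar>\<^sup>2"
   unfolding power2_sum by simp
  then have "(J p' * J q' + \<bar>a * b\<bar>)\<^sup>2 \<ge> (1 + p'\<^sup>2) * (1 + q'\<^sup>2) + (a * b)\<^sup>2"
   by (simp add: power_mult_distrib J_sq)
  moreover have "0 <= (1 + p'\<^sup>2) * (1 + q'\<^sup>2)" "0 <= (a * b)\<^sup>2" by auto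
  moreover have "(4 * (J p' * J q' + \<bar>a * b\<bar>))\<^sup>2 = 16 * (J p' * J q' + \<bar>a * b\<bar>)\<^sup>2" by (simp only: power_mult_distrib) simp
  ultimately show ?thesis by linarith
 qed
 finally have "J (of_int k) * J (of_int r) <= 4 * (J p' * J q' + \<bar>a * b\<bar>)"
  by (rule power2_le_imp_le) auto
 then show ?thesis by (simp add: d)
qed

section \<open>Absorbing the derivative: multiplier, resonance function and pointwise bounds\<close>

text \<open>\<open>\<bar>of_int r\<bar>\<close> is the derivative on the conjugated input; the other
  factors are the order-1/2 weights of the output and, inverted, of the three inputs.\<close>

definition mult_m :: "int => int => int => int => real" where
 "mult_m k p q r = J (of_int k) powr (1/2) * \<bar>of_int r\<bar> * J (of_int p) powr - (1/2) * J (of_int q) powr - (1/2) * J (of_int r) powr - (1/2)"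

lemma mult_m_nonneg: "mult_m k p q r \<ge> 0" by (simp add: mult_m_def)

lemma mult_m_le:
 "mult_m k p q r <= (J (of_int k) * J (of_int r)) powr (1/2) * (J (of_int p) * J (of_int q)) powr - (1/2)"
proof -
 have "\<bar>real_of_int r\<bar> * J (of_int r) powr - (1/2) <= J (of_int r) * J (of_int r) powr - (1/2)"
  using norm_le_japanese[of "real_of_int r"] by (intro mult_right_mono) auto
 also have "\<dots> = J (of_int r) powr 1 * J (of_int r) powr - (1/2)" by simp
 also have "\<dots> = J (of_int r) powr (1/2)" by (simp only: powr_add[symmetric]) simp
 finally have "J (of_int k) powr (1/2) * (J (of_int p) powr - (1/2) * J (of_int q) powr - (1/2)) * (\<bar>real_of_int r\<bar> * J (of_int r) powr - (1/2))
  <= J (of_int k) powr (1/2) * (J (of_int p) powr - (1/2) * J (of_int q) powr - (1/2)) * J (of_int r) powr (1/2)"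
  by (intro mult_left_mono) auto
 then show ?thesis unfolding mult_m_def by (simp add: powr_mult mult_ac)
qed

text \<open>The surface gives \<open>{k, r} = {p, q}\<close>, so the weights cancel and nothing has
  to be absorbed.\<close>

lemma mult_m_res:
 assumes "p + q = k + r" "k = p \<or> k = q"
 shows "mult_m k p q r <= 1"
proof -
 have "J (of_int k) * J (of_int r) = J (of_int p) * J (of_int q)" using assms by (auto simp: mult.commute)
 then show ?thesis using mult_m_le[of k p q r] by (simp add: powr_minus)
qed

text \<open>\<open>J_product_bound\<close> gives the square root of \<open>4 * (P + m)\<close>,
  which splits. The part where \<open>P\<close> cancels is rewritten as
  \<open>m powr (1/2) * m powr (-1/2)\<close>, so that both parts carry the factor
  \<open>m powr (1/2)\<close>.\<close>

lemma mult_m_nonres: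
 assumes "p + q = k + r" "k \<noteq> p" "k \<noteq> q"
 defines "m \<equiv> \<bar>of_int ((k - p) * (k - q))\<bar>"
 shows "mult_m k p q r <= 2 * m powr (1/2) * (m powr (-1/2) + (J (of_int p) * J (of_int q)) powr (-1/2))"
proof -
 define P where "P = J (of_int p) * J (of_int q)"
 have P: "P > 0" by (simp add: P_def)
 have "(k - p) * (k - q) \<noteq> 0" using assms by simp
 then have m: "m > 0" unfolding m_def by linarith
 have sub: "(x + y) powr (1/2) <= x powr (1/2) + y powr (1/2)" if "x > 0" "y > 0" for x y :: real
  using that sqrt_add_le_add_sqrt[of x y] by (simp add: powr_half_sqrt)
 have f: "(4::real) powr (1/2) = 2" by (simp add: powr_half_sqrt)
 have "mult_m k p q r <= (J (of_int k) * J (of_int r)) powr (1/2) * P powr - (1/2)" unfolding P_def by (rule mult_m_le)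
 also have "\<dots> <= (4 * (P + m)) powr (1/2) * P powr - (1/2)"
  using J_product_bound[OF assms(1-3)] by (intro mult_right_mono powr_mono2) (auto simp: P_def m_def)
 also have "\<dots> = 2 * (P + m) powr (1/2) * P powr - (1/2)" using powr_mult[of 4 "P + m" "1/2"] P m f by simp
 also have "\<dots> <= 2 * (P powr (1/2) + m powr (1/2)) * P powr - (1/2)"
  by (intro mult_right_mono mult_left_mono sub P m) auto
 also have "\<dots> = 2 * (P powr (1/2) * P powr - (1/2)) + 2 * (m powr (1/2) * P powr - (1/2))" by (simp only: distrib_left distrib_right mult_ac)
 also have "P powr (1/2) * P powr - (1/2) = m powr (1/2) * m powr - (1/2)" using P m by (simp add: powr_minus)
 finally show ?thesis unfolding P_def[symmetric] by (simp add: algebra_simps)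
qed

text \<open>The largest of the four weights is at least \<open>m / 4\<close>, so its square root
  pays for \<open>m powr (1/2)\<close>. If it is the output weight \<open>w0\<close>, a second bound
  with exponent 1 is recorded for the \<open>Y\<close> norm.\<close>

lemma modulation_case:
 fixes N m w0 w1 w2 w3 M :: real
 assumes w: "w0 \<ge> 1" "w1 \<ge> 1" "w2 \<ge> 1" "w3 \<ge> 1" and m: "m > 0" "m <= w0 + w1 + w2 + w3"
  and M: "M <= 2 * m powr (1/2) * N" and N: "N \<ge> 0"
 shows "(\<exists>v\<in>{w1, w2, w3}. M * v powr - (1/2) <= 8 * N) \<or>
  (M * w0 powr - (1/2) <= 8 * N \<and> M * w0 powr - 1 <= 16 * (m powr (-19/50) * N) * w1 powr - (1/25) * w2 powr - (1/25) * w3 powr - (1/25))"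
proof -
 have half: "M * v powr - (1/2) <= 8 * N" if v: "v \<ge> 1" "m <= 4 * v" for v
 proof -
  have "m powr (1/2) <= (4 * v) powr (1/2)" using v m by (intro powr_mono2) auto
  also have "\<dots> = 2 * v powr (1/2)" using v by (simp add: powr_mult powr_half_sqrt)
  finally have "2 * m powr (1/2) * N <= 4 * v powr (1/2) * N" using N by (intro mult_right_mono) auto
  then have "M <= 4 * v powr (1/2) * N" by (rule order_trans[OF M])
  then have "M * v powr - (1/2) <= (4 * v powr (1/2) * N) * v powr - (1/2)" by (intro mult_right_mono) auto
  also have "\<dots> = 4 * N" using v by (simp add: powr_minus)
  finally show ?thesis using N by linarith
 qed
 show ?thesis
 proof (cases "w1 <= w0 \<and> w2 <= w0 \<and> w3 <= w0")
  case False
  have "\<exists>v\<in>{w1, w2, w3}. m <= 4 * v"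
  proof (rule ccontr)
   assume "\<not> ?thesis"
   then have "4 * w1 < m" "4 * w2 < m" "4 * w3 < m" by auto
   with False m(2) show False by linarith
  qed
  then show ?thesis using half w by blast
 next
  case True
  then have m4: "m <= 4 * w0" using m(2) by linarith
  \<comment> \<open>The exponent 1 is cut into 22/25 and three pieces of 1/25. The small pieces go
    to the inputs, whose weights are smaller, and raise their exponents to 27/50, enough for
    integrability in the modulation.\<close>
  have "w0 powr - (1::real) = w0 powr - (22/25) * (w0 powr - (1/25) * w0 powr - (1/25) * w0 powr - (1/25))"
   by (simp only: powr_add[symmetric]) simp
  also have "\<dots> <= (4 powr (22/25) * m powr - (22/25)) * (w1 powr - (1/25) * w2 powr - (1/25) * w3 powr - (1/25))"
   using True w m m4 by (intro mult_mono powr_neg_mono powr_mono2' mult_nonneg_nonneg powr_ge_zero) auto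
  also have "\<dots> <= (4 * m powr - (22/25)) * (w1 powr - (1/25) * w2 powr - (1/25) * w3 powr - (1/25))"
  proof -
   have "(4::real) powr (22/25) <= 4 powr 1" by (intro powr_mono) auto
   then show ?thesis by (intro mult_right_mono mult_nonneg_nonneg powr_ge_zero) auto
  qed
  finally have w0: "w0 powr - 1 <= (4 * m powr - (22/25)) * (w1 powr - (1/25) * w2 powr - (1/25) * w3 powr - (1/25))" .
  have "M * w0 powr - 1 <= (2 * m powr (1/2) * N) * w0 powr - 1" using M by (intro mult_right_mono) auto
  also have "\<dots> <= (2 * m powr (1/2) * N) * ((4 * m powr - (22/25)) * (w1 powr - (1/25) * w2 powr - (1/25) * w3 powr - (1/25)))"
   using N by (intro mult_left_mono w0 mult_nonneg_nonneg) auto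
  also have "\<dots> = 8 * ((m powr (1/2) * m powr - (22/25)) * N) * w1 powr - (1/25) * w2 powr - (1/25) * w3 powr - (1/25)" by (simp only: mult_ac)
  also have "m powr (1/2) * m powr - (22/25) = m powr (-19/50)" by (simp only: powr_add[symmetric]) simp
  also have "8 * (m powr (-19/50) * N) * w1 powr - (1/25) * w2 powr - (1/25) * w3 powr - (1/25) <=
   16 * (m powr (-19/50) * N) * w1 powr - (1/25) * w2 powr - (1/25) * w3 powr - (1/25)"
   using N by (intro mult_right_mono mult_nonneg_nonneg) auto
  finally show ?thesis using half[OF w(1) m4] by blast
 qed
qed

text \<open>The phase is a signed sum of the four modulations, and \<open>W\<close> is even and
  subadditive. Passing from the phase to its weight is possible because the phase is below half a
  period; \<open>pi / 2 <= 2\<close> is compensated by the factor 2 in the phase.\<close>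

lemma (in time_step) resonance_function:
 assumes "inK dt (fst x) (fst y) (fst z) (fst u)" "u = y + z - x"
 shows "\<bar>of_int ((fst x - fst y) * (fst x - fst z))\<bar> <=
  W dt (snd x + sq (fst x)) + W dt (snd y + sq (fst y)) + W dt (snd z + sq (fst z)) + W dt (snd u + sq (fst u))"
proof -
 define l where "l p = snd p + sq (fst p)" for p :: "int \<times> real"
 define \<phi> where "\<phi> = 2 * real_of_int (fst x - fst y) * of_int (fst x - fst z)"
 have s: "fst y + fst z = fst x + fst u" using assms(2) by simp
 have ph: "\<phi> = l x + l u - l y - l z"
  unfolding \<phi>_def l_def assms(2) by (simp add: sq_def power2_eq_square algebra_simps)
 have "\<bar>\<phi>\<bar> <= 2 / dt" unfolding \<phi>_def by (rule phase_bound[OF assms(1) s])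
 also have "\<dots> <= pi / dt" using tau_pos pi_gt3 by (intro divide_right_mono) auto
 finally have "\<bar>\<phi>\<bar> <= (pi / 2) * W dt \<phi>" by (intro W_lower(2) tau_pos)
 moreover have "W dt \<phi> <= W dt (l x) + W dt (l y) + W dt (l z) + W dt (l u)"
  unfolding ph using W_add[of dt "l x + l u - l y" "- l z"] W_add[of dt "l x + l u" "- l y"] W_add[of dt "l x" "l u"] by (simp add: W_minus)
 ultimately have "\<bar>\<phi>\<bar> <= (pi / 2) * (W dt (l x) + W dt (l y) + W dt (l z) + W dt (l u))"
  by (meson mult_left_mono order_trans pi_half_ge_zero)
 also have "\<dots> <= 2 * (W dt (l x) + W dt (l y) + W dt (l z) + W dt (l u))"
  using pi_less_4 by (intro mult_right_mono add_nonneg_nonneg) auto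
 finally have f: "\<bar>\<phi>\<bar> <= 2 * (W dt (l x) + W dt (l y) + W dt (l z) + W dt (l u))" .
 have "\<bar>\<phi>\<bar> = 2 * \<bar>of_int ((fst x - fst y) * (fst x - fst z))\<bar>"
  unfolding \<phi>_def abs_mult of_int_mult by simp
 with f have "2 * \<bar>real_of_int ((fst x - fst y) * (fst x - fst z))\<bar> <= 2 * (W dt (l x) + W dt (l y) + W dt (l z) + W dt (l u))" by (simp only:)
 then show ?thesis unfolding l_def by (rule mult_left_le_imp_le) simp
qed

context time_step begin

definition Tm :: "int \<times> real => int \<times> real => int \<times> real => gf" where
 "Tm x y z u = (if inK dt (fst x) (fst y) (fst z) (fst u) then en (mult_m (fst x) (fst y) (fst z) (fst u)) else 0)"

definition N12 :: "int \<times> real => int \<times> real => int \<times> real => gf" where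
 "N12 x y z u = en (N1 dt (fst x) (fst y) (fst z) (fst u)) + en (N2 dt (fst x) (fst y) (fst z) (fst u))"

definition Rs :: "int \<times> real => int \<times> real => int \<times> real => gf" where
 "Rs x y z u = en (if fst x = fst y then 1 else 0) + en (if fst x = fst z then 1 else 0)"

abbreviation v :: "real => gf" where "v b \<equiv> wgt dt 0 b sq"

lemma v_eq: "v b p = en (W dt (snd p + sq (fst p)) powr - b)" by (simp add: wgt_def)

text \<open>Either the frequencies are resonant, or an input has the largest modulation, or the
  output has it. The last case keeps two conclusions, one for each part of the output norm.\<close>

lemma pointwise_cases:
 assumes u: "u = y + z - x"
 shows "Tm x y z u <= Rs x y z u \<or>
  Tm x y z u * v (1/2) y <= 8 * N12 x y z u \<or> Tm x y z u * v (1/2) z <= 8 * N12 x y z u \<or> Tm x y z u * v (1/2) u <= 8 * N12 x y z u \<or>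
  (Tm x y z u * v (1/2) x <= 8 * N12 x y z u \<and>
  Tm x y z u * v 1 x <= 16 * en (NY (fst x) (fst y) (fst z) (fst u)) * v (1/25) y * v (1/25) z * v (1/25) u)"
proof (cases "inK dt (fst x) (fst y) (fst z) (fst u)")
 case False
 then have "Tm x y z u = 0" by (simp only: Tm_def if_False)
 then show ?thesis by simp
next
 case K: True
 have s: "fst y + fst z = fst x + fst u" using u by simp
 define M where "M = mult_m (fst x) (fst y) (fst z) (fst u)"
 have T: "Tm x y z u = en M" unfolding Tm_def M_def using K by (simp only: if_True)
 have M0: "M \<ge> 0" unfolding M_def by (rule mult_m_nonneg)
 show ?thesis
 proof (cases "fst x = fst y \<or> fst x = fst z")
  case True
  have "M <= 1" unfolding M_def by (rule mult_m_res[OF s True])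
  then have "en M <= 1" by simp
  also have "1 <= Rs x y z u" using True by (auto simp: Rs_def)
  finally show ?thesis unfolding T by blast
 next
  case False
  define m where "m = \<bar>real_of_int ((fst x - fst y) * (fst x - fst z))\<bar>"
  define N where "N = m powr (-1/2) + (J (of_int (fst y)) * J (of_int (fst z))) powr (-1/2)"
  have "(fst x - fst y) * (fst x - fst z) \<noteq> 0" using False by simp
  then have m: "m > 0" unfolding m_def by linarith
  have N0: "N \<ge> 0" by (simp add: N_def)
  have c: "inK dt (fst x) (fst y) (fst z) (fst u) \<and> fst x \<noteq> fst y \<and> fst x \<noteq> fst z" "fst x \<noteq> fst y \<and> fst x \<noteq> fst z"
   using K False by auto
  have N: "N12 x y z u = en N"
   unfolding N12_def N1_def N2_def N_def m_def if_P[OF c(1)] by (rule ennreal_plus[symmetric]) (rule powr_ge_zero)+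
  have Y: "NY (fst x) (fst y) (fst z) (fst u) = m powr (-19/50) * N"
   unfolding NY_def N_def m_def if_P[OF c(2)] ..
  define w where "w p = W dt (snd p + sq (fst p))" for p
  have v': "v b p = en (w p powr - b)" for b p by (simp only: v_eq w_def)
  have wn: "w p \<ge> 1" for p by (simp add: w_def W_ge_1)
  have MN: "M <= 2 * m powr (1/2) * N"
   unfolding M_def N_def m_def using False by (intro mult_m_nonres s) auto
  have mw: "m <= w x + w y + w z + w u" unfolding m_def w_def by (rule resonance_function[OF K u])
  have e8: "en M * v b p <= 8 * N12 x y z u" if "M * w p powr - b <= 8 * N" for b p
   using ennreal_leI[OF that] M0 N0 unfolding N v' by (simp add: ennreal_mult)
  have e16: "en M * v 1 x <= 16 * en (NY (fst x) (fst y) (fst z) (fst u)) * v (1/25) y * v (1/25) z * v (1/25) u"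
   if "M * w x powr - 1 <= 16 * (m powr (-19/50) * N) * w y powr - (1/25) * w z powr - (1/25) * w u powr - (1/25)"
  proof -
   have "en M * v 1 x = en (M * w x powr - 1)" unfolding v' by (rule ennreal_mult[symmetric, OF M0]) simp
   also have "\<dots> <= en (16 * (m powr (-19/50) * N) * w y powr - (1/25) * w z powr - (1/25) * w u powr - (1/25))"
    by (rule ennreal_leI[OF that])
   also have "\<dots> = 16 * en (NY (fst x) (fst y) (fst z) (fst u)) * v (1/25) y * v (1/25) z * v (1/25) u"
    unfolding Y v' using N0 by (simp add: ennreal_mult)
   finally show ?thesis .
  qed
  have "(\<exists>v\<in>{w y, w z, w u}. M * v powr - (1/2) <= 8 * N) \<or>
   (M * w x powr - (1/2) <= 8 * N \<and> M * w x powr - 1 <= 16 * (m powr (-19/50) * N) * w y powr - (1/25) * w z powr - (1/25) * w u powr - (1/25))"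
   by (rule modulation_case[OF wn wn wn wn m mw MN N0])
  then show ?thesis unfolding T using e8[of _ "1/2"] e16 by blast
 qed
qed

text \<open>The factor \<open>v (1/2)\<close> of the function carrying the largest modulation absorbs the derivative.\<close>

lemma pointwise_X:
 assumes u: "u = y + z - x"
 shows "Tm x y z u * (v (1/2) x * v (1/2) y * v (1/2) z * v (1/2) u) <=
  8 * N12 x y z u * (v (1/2) y * v (1/2) z * v (1/2) u + (v (1/2) x * v (1/2) z * v (1/2) u +
   (v (1/2) x * v (1/2) y * v (1/2) u + v (1/2) x * v (1/2) y * v (1/2) z))) +
  Rs x y z u * (v (1/2) x * v (1/2) y * v (1/2) z * v (1/2) u)"
proof -
 have step: "Tm x y z u * X <= 8 * N12 x y z u * c + d"
  if "Tm x y z u * a <= 8 * N12 x y z u" "X = a * b" "b <= c" for a b c d X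
 proof -
  have "Tm x y z u * X = (Tm x y z u * a) * b" by (simp only: that(2) mult.assoc)
  also have "\<dots> <= (8 * N12 x y z u) * b" by (rule mult_right_mono[OF that(1)]) simp
  also have "\<dots> <= 8 * N12 x y z u * c" by (intro mult_left_mono that(3)) auto
  finally show ?thesis by (meson add_increasing2 zero_le)
 qed
 have l1: "a <= a + b" and l2: "a <= b + a" for a b :: ennreal by simp_all
 from pointwise_cases[OF u] show ?thesis
 proof (elim disjE conjE)
  assume "Tm x y z u <= Rs x y z u"
  then show ?thesis by (meson add_increasing mult_right_mono zero_le)
 next
  assume a: "Tm x y z u * v (1/2) y <= 8 * N12 x y z u"
  show ?thesis by (rule step[OF a, where b = "v (1/2) x * v (1/2) z * v (1/2) u"]) (simp only: mult_ac, rule order_trans[OF l1 l2])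
 next
  assume a: "Tm x y z u * v (1/2) z <= 8 * N12 x y z u"
  show ?thesis by (rule step[OF a, where b = "v (1/2) x * v (1/2) y * v (1/2) u"]) (simp only: mult_ac, rule order_trans[OF order_trans[OF l1 l2] l2])
 next
  assume a: "Tm x y z u * v (1/2) u <= 8 * N12 x y z u"
  show ?thesis by (rule step[OF a, where b = "v (1/2) x * v (1/2) y * v (1/2) z"]) (simp only: mult_ac, rule order_trans[OF order_trans[OF l2 l2] l2])
 next
  assume a: "Tm x y z u * v (1/2) x <= 8 * N12 x y z u"
  show ?thesis by (rule step[OF a, where b = "v (1/2) y * v (1/2) z * v (1/2) u"]) (simp only: mult_ac, rule l1)
 qed
qed

text \<open>Here the output has exponent 1. An input with the largest modulation pays with its
  exponent 1/2; if the output has it, the kernel \<open>NY\<close> appears and each input exponent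
  rises to 27/50.\<close>

lemma pointwise_Y:
 assumes u: "u = y + z - x"
 shows "Tm x y z u * (v 1 x * v (1/2) y * v (1/2) z * v (1/2) u) <=
  8 * N12 x y z u * (v 1 x * v (1/2) z * v (1/2) u +
   (v 1 x * v (1/2) y * v (1/2) u + v 1 x * v (1/2) y * v (1/2) z)) +
  (Rs x y z u * (v 1 x * v (1/2) y * v (1/2) z * v (1/2) u) +
  16 * en (NY (fst x) (fst y) (fst z) (fst u)) * (v (27/50) y * v (27/50) z * v (27/50) u))"
proof -
 have step: "Tm x y z u * X <= 8 * N12 x y z u * c + d"
  if "Tm x y z u * a <= 8 * N12 x y z u" "X = a * b" "b <= c" for a b c d X
 proof -
  have "Tm x y z u * X = (Tm x y z u * a) * b" by (simp only: that(2) mult.assoc)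
  also have "\<dots> <= (8 * N12 x y z u) * b" by (rule mult_right_mono[OF that(1)]) simp
  also have "\<dots> <= 8 * N12 x y z u * c" by (intro mult_left_mono that(3)) auto
  finally show ?thesis by (meson add_increasing2 zero_le)
 qed
 have l1: "a <= a + b" and l2: "a <= b + a" for a b :: ennreal by simp_all
 from pointwise_cases[OF u] show ?thesis
 proof (elim disjE conjE)
  assume "Tm x y z u <= Rs x y z u"
  then have "Tm x y z u * (v 1 x * v (1/2) y * v (1/2) z * v (1/2) u) <= Rs x y z u * (v 1 x * v (1/2) y * v (1/2) z * v (1/2) u)"
   by (rule mult_right_mono) simp
  then show ?thesis by (meson add_increasing add_increasing2 zero_le)
 next
  assume a: "Tm x y z u * v (1/2) y <= 8 * N12 x y z u"
  show ?thesis by (rule step[OF a, where b = "v 1 x * v (1/2) z * v (1/2) u"]) (simp only: mult_ac, rule l1)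
 next
  assume a: "Tm x y z u * v (1/2) z <= 8 * N12 x y z u"
  show ?thesis by (rule step[OF a, where b = "v 1 x * v (1/2) y * v (1/2) u"]) (simp only: mult_ac, rule order_trans[OF l1 l2])
 next
  assume a: "Tm x y z u * v (1/2) u <= 8 * N12 x y z u"
  show ?thesis by (rule step[OF a, where b = "v 1 x * v (1/2) y * v (1/2) z"]) (simp only: mult_ac, rule order_trans[OF l2 l2])
 next
  assume a: "Tm x y z u * v 1 x <= 16 * en (NY (fst x) (fst y) (fst z) (fst u)) * v (1/25) y * v (1/25) z * v (1/25) u"
  have vv: "v (27/50) p = v (1/25) p * v (1/2) p" for p by (simp add: wgt_mult)
  have "Tm x y z u * (v 1 x * v (1/2) y * v (1/2) z * v (1/2) u) = (Tm x y z u * v 1 x) * (v (1/2) y * v (1/2) z * v (1/2) u)"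
   by (simp only: mult.assoc)
  also have "\<dots> <= (16 * en (NY (fst x) (fst y) (fst z) (fst u)) * v (1/25) y * v (1/25) z * v (1/25) u) * (v (1/2) y * v (1/2) z * v (1/2) u)"
   by (rule mult_right_mono[OF a]) simp
  also have "\<dots> = 16 * en (NY (fst x) (fst y) (fst z) (fst u)) * (v (27/50) y * v (27/50) z * v (27/50) u)"
   unfolding vv by (simp only: mult_ac)
  finally show ?thesis by (meson add_increasing add_increasing2 zero_le)
 qed
qed

end

section \<open>Bounds for the trilinear form with derivative\<close>

context time_step begin

text \<open>The pointwise bounds hold only for \<open>u = y + z - x\<close>, which is all that the
  form sees.\<close>

lemma Lam_mono_surface:
 assumes "\<And>x y z. \<Phi> x y z (y + z - x) <= \<Psi> x y z (y + z - x)"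
 shows "G.Lam \<Phi> <= G.Lam \<Psi>"
 unfolding G.Lam_def by (intro nn_integral_mono assms)

lemma meas4_add: "G.meas4 \<Phi> ==> G.meas4 \<Psi> ==> G.meas4 (%x y z u. \<Phi> x y z u + \<Psi> x y z u)"
 unfolding split_beta' by measurable

definition qf :: "(int => int => int => int => real) => (gf) => (gf) => (gf) => (gf)
  => int \<times> real => int \<times> real => int \<times> real => gf" where
 "qf N F G H I x y z u = en (N (fst x) (fst y) (fst z) (fst u)) * F x * G y * H z * I u"

lemma Lam_qf: "G.Lam (qf N F G H I) = Q4 N F G H I"
 unfolding Q4_def qf_def ..

lemma meas4_qf:
 "F \<in> bG dt ==> G \<in> bG dt ==> H \<in> bG dt ==> I \<in> bG dt ==> G.meas4 (qf N F G H I)"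
 unfolding qf_def by (rule meas4_Q4)

abbreviation R1 :: "int => int => int => int => real" where "R1 \<equiv> %k p q r. if k = p then 1 else 0"
abbreviation R2 :: "int => int => int => int => real" where "R2 \<equiv> %k p q r. if k = q then 1 else 0"

text \<open>The slack: \<open>v (1/2)\<close> is \<open>om dt\<close> times \<open>v (1/50)\<close>,
  and \<open>ez\<close> keeps the second factor. On a density of modulation order 1/2 its norm is
  the one of order 12/25.\<close>

definition ez :: "(gf) => gf" where "ez F p = v (1/50) p * F p"
definition oe :: "(gf) => gf" where "oe F p = om dt p * ez F p"
definition omf :: "(gf) => gf" where "omf F p = om dt p * F p"

lemma oe_eq: "v (1/2) p * F p = oe F p"
proof -
 have "v (1/2) p = om dt p * v (1/50) p" by (simp add: wgt_mult)
 then show ?thesis by (simp only: oe_def ez_def mult.assoc)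
qed

lemma ez_measurable [measurable (raw)]: assumes [measurable]: "F \<in> bG dt"
 shows "ez F \<in> bG dt" "oe F \<in> bG dt" "omf F \<in> bG dt"
 unfolding oe_def ez_def omf_def by measurable

lemma nrm_ez_le: "nG dt (ez F) <= nG dt F"
proof (rule nrm_mono)
 fix p show "ez F p <= F p" using mult_right_mono[OF wgt_le_1[of 0 "1/50" dt sq p], of "F p"] by (simp add: ez_def)
qed

text \<open>In each term one input has its full norm, the one that may have paid for the derivative;
  the two others keep the factor from which the power of \<open>T1\<close> is drawn.\<close>

definition Sn :: "(gf) => (gf) => (gf) => ennreal" where
 "Sn F G H = nG dt F * nG dt (ez G) * nG dt (ez H) +
  (nG dt (ez F) * nG dt G * nG dt (ez H) + nG dt (ez F) * nG dt (ez G) * nG dt H)"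

text \<open>The terms common to the \<open>X\<close> and \<open>Y\<close> estimates: each input in
  turn absorbs the derivative, with both kernels, and the two resonant cases. Only the case of a
  dominant output modulation differs between the norms.\<close>

definition main_sum :: "(gf) => (gf) => (gf) => (gf)
  => int \<times> real => int \<times> real => int \<times> real => gf" where
 "main_sum P F G H x y z u =
  (qf (N1 dt) (omf P) F (oe G) (oe H) x y z u + qf (N2 dt) (omf P) F (oe G) (oe H) x y z u) +
  ((qf (N1 dt) (omf P) (oe F) G (oe H) x y z u + qf (N2 dt) (omf P) (oe F) G (oe H) x y z u) +
  ((qf (N1 dt) (omf P) (oe F) (oe G) H x y z u + qf (N2 dt) (omf P) (oe F) (oe G) H x y z u) +
  (qf R1 (omf P) (oe F) (oe G) (oe H) x y z u + qf R2 (omf P) (oe F) (oe G) (oe H) x y z u)))"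

lemma meas4_main_sum:
 assumes [measurable]: "P \<in> bG dt" "F \<in> bG dt" "G \<in> bG dt" "H \<in> bG dt"
 shows "G.meas4 (main_sum P F G H)"
 unfolding main_sum_def by (intro meas4_add meas4_qf ez_measurable assms)

end

lemma main_sum_bound:
 "\<exists>C<\<infinity>. \<forall>dt P F G H. time_step dt -->
  P \<in> bG dt --> F \<in> bG dt --> G \<in> bG dt --> H \<in> bG dt -->
  inv_measure.Lam (Gam dt) (time_step.main_sum dt P F G H) <= C * (nG dt P * time_step.Sn dt F G H)"
proof -
 obtain A where A: "A < \<infinity>" "\<And>dt N F G H I. time_step dt ==> N \<in> {N1 dt, N2 dt} ==>
  F \<in> bG dt ==> G \<in> bG dt ==> H \<in> bG dt ==> I \<in> bG dt ==>
  time_step.Q4 dt N (om1 dt F) G (om1 dt H) (om1 dt I)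
   <= A * nG dt F * nG dt G * nG dt H * nG dt I \<and>
  time_step.Q4 dt N (om1 dt F) (om1 dt G) H (om1 dt I)
   <= A * nG dt F * nG dt G * nG dt H * nG dt I \<and>
  time_step.Q4 dt N (om1 dt F) (om1 dt G) (om1 dt H) I
   <= A * nG dt F * nG dt G * nG dt H * nG dt I"
  using Q4_bounds by blast
 obtain B where B: "B < \<infinity>" "\<And>dt F G H I. time_step dt ==>
  F \<in> bG dt ==> G \<in> bG dt ==> H \<in> bG dt ==> I \<in> bG dt ==>
  time_step.Q4 dt (%k p q r. if k = p then 1 else 0) (om1 dt F) (om1 dt G) (om1 dt H) (om1 dt I)
   <= B * nG dt F * nG dt G * nG dt H * nG dt I"
  using Q4_resonant by blast
 define C where "C = (A + A) + ((A + A) + ((A + A) + (B + B)))"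
 have main: "inv_measure.Lam (Gam dt) (time_step.main_sum dt P F G H) <= C * (nG dt P * time_step.Sn dt F G H)"
  if t: "time_step dt" and m: "P \<in> bG dt" "F \<in> bG dt" "G \<in> bG dt" "H \<in> bG dt"
  for dt P F G H
 proof -
  interpret time_step dt by fact
  let ?n = "nG dt"
  let ?S = "?n P * Sn F G H"
  note me = ez_measurable[OF m(1)] ez_measurable[OF m(2)] ez_measurable[OF m(3)] ez_measurable[OF m(4)]
  have l1: "a <= a + b" and l2: "a <= b + a" for a b :: ennreal by simp_all
  have s1: "c * ?n P * ?n F * ?n (ez G) * ?n (ez H) <= c * ?S" for c
   unfolding Sn_def mult.assoc by (intro mult_left_mono l1) auto
  have s2: "c * ?n P * ?n (ez F) * ?n G * ?n (ez H) <= c * ?S" for c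
   unfolding Sn_def mult.assoc by (intro mult_left_mono order_trans[OF l1 l2]) auto
  have s3: "c * ?n P * ?n (ez F) * ?n (ez G) * ?n H <= c * ?S" for c
   unfolding Sn_def mult.assoc by (intro mult_left_mono order_trans[OF l2 l2]) auto
  have s0: "c * ?n P * ?n (ez F) * ?n (ez G) * ?n (ez H) <= c * ?S" for c
   by (rule order_trans[OF _ s3]) (intro mult_left_mono nrm_ez_le, simp)
  have omf: "omf Q = (om1 dt Q)" "oe Q = (%p. om dt p * ez Q p)" for Q by (simp_all add: omf_def oe_def fun_eq_iff)
  have b1: "Q4 N (omf P) F (oe G) (oe H) <= A * ?S" if "N \<in> {N1 dt, N2 dt}" for N
   using A(2)[OF t that m(1,2) me(7,10)] s1[of A] unfolding omf by (elim conjE) (rule order_trans)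
  have b2: "Q4 N (omf P) (oe F) G (oe H) <= A * ?S" if "N \<in> {N1 dt, N2 dt}" for N
   using A(2)[OF t that m(1) me(4) m(3) me(10)] s2[of A] unfolding omf by (elim conjE) (rule order_trans)
  have b3: "Q4 N (omf P) (oe F) (oe G) H <= A * ?S" if "N \<in> {N1 dt, N2 dt}" for N
   using A(2)[OF t that m(1) me(4,7) m(4)] s3[of A] unfolding omf by (elim conjE) (rule order_trans)
  have b4: "Q4 R1 (omf P) (oe F) (oe G) (oe H) <= B * ?S"
   using B(2)[OF t m(1) me(4,7,10)] s0[of B] unfolding omf by (rule order_trans)
  have "Q4 R2 (omf P) (oe F) (oe G) (oe H) = Q4 R1 (omf P) (oe G) (oe F) (oe H)"
   using Q4_sym(3)[OF me(3,5,8,11), of R2] .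
  also have "\<dots> <= B * ?n P * ?n (ez G) * ?n (ez F) * ?n (ez H)"
   unfolding omf by (rule B(2)[OF t m(1) me(7,4,10)])
  also have "\<dots> = B * ?n P * ?n (ez F) * ?n (ez G) * ?n (ez H)" by (simp only: mult_ac)
  also have "\<dots> <= B * ?S" by (rule s0)
  finally have b5: "Q4 R2 (omf P) (oe F) (oe G) (oe H) <= B * ?S" .
  have "G.Lam (main_sum P F G H) =
   (Q4 (N1 dt) (omf P) F (oe G) (oe H) + Q4 (N2 dt) (omf P) F (oe G) (oe H)) +
   ((Q4 (N1 dt) (omf P) (oe F) G (oe H) + Q4 (N2 dt) (omf P) (oe F) G (oe H)) +
   ((Q4 (N1 dt) (omf P) (oe F) (oe G) H + Q4 (N2 dt) (omf P) (oe F) (oe G) H) +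
   (Q4 R1 (omf P) (oe F) (oe G) (oe H) + Q4 R2 (omf P) (oe F) (oe G) (oe H))))"
  proof -
   note mq = meas4_add meas4_qf m me
   show ?thesis unfolding main_sum_def Lam_qf[symmetric]
    apply (subst G.Lam_add, (intro mq)[1], (intro mq)[1])
    apply (subst G.Lam_add, (intro mq)[1], (intro mq)[1])
    apply (subst G.Lam_add, (intro mq)[1], (intro mq)[1])
    apply (subst G.Lam_add, (intro mq)[1], (intro mq)[1])
    apply (subst G.Lam_add, (intro mq)[1], (intro mq)[1])
    apply (subst G.Lam_add, (intro mq)[1], (intro mq)[1])
    apply (subst G.Lam_add, (intro mq)[1], (intro mq)[1])
    apply (rule refl)
    done
  qed
  also have "\<dots> <= (A * ?S + A * ?S) + ((A * ?S + A * ?S) + ((A * ?S + A * ?S) + (B * ?S + B * ?S)))"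
   by (intro add_mono b1 b2 b3 b4 b5) auto
  also have "\<dots> = C * ?S" unfolding C_def by (simp only: distrib_right)
  finally show ?thesis .
 qed
 have "C < \<infinity>" using A(1) B(1) by (simp add: C_def)
 with main show ?thesis by blast
qed

context time_step begin

definition tri :: "(gf) => (gf) => (gf) => gf" where
 "tri f g h x = (\<integral>\<^sup>+y. (\<integral>\<^sup>+z. f y * g z * h (y + z - x) \<partial>Gam dt) \<partial>Gam dt)"

text \<open>Undoes the weights of the norm: if \<open>F\<close> is the L2 density of a sequence with
  orders 1/2 and 1/2, the result is the transform of its projection in absolute value.\<close>

definition inn :: "(gf) => gf" where
 "inn F p = chi dt p * wgt dt (1/2) (1/2) sq p * F p"

definition dinn :: "(gf) => gf" where
 "dinn F p = en \<bar>of_int (fst p)\<bar> * inn F p"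

lemma inn_measurable [measurable (raw)]:
 assumes [measurable]: "F \<in> bG dt"
 shows "inn F \<in> bG dt" "dinn F \<in> bG dt"
 unfolding dinn_def inn_def by measurable

lemma tri_measurable [measurable (raw)]:
 assumes [measurable]: "f \<in> bG dt" "g \<in> bG dt" "h \<in> bG dt"
 shows "tri f g h \<in> bG dt"
 unfolding tri_def by measurable

lemma weights_Tm:
 "chi dt x * wgt dt (- 1/2) b sq x * inn F y * inn G z * dinn H u =
 Tm x y z u * (v b x * v (1/2) y * v (1/2) z * v (1/2) u) * (F y * G z * H u)"
proof (cases "inK dt (fst x) (fst y) (fst z) (fst u)")
 case False
 then have "Tm x y z u = 0" by (simp only: Tm_def if_False)
 moreover have "chi dt x = 0 \<or> chi dt y = 0 \<or> chi dt z = 0 \<or> chi dt u = 0" using False by (auto simp: inK_def chi_def)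
 ultimately show ?thesis by (auto simp: inn_def dinn_def)
next
 case True
 then have c: "chi dt x = 1" "chi dt y = 1" "chi dt z = 1" "chi dt u = 1" by (auto simp: inK_def chi_def)
 have w: "wgt dt a b sq p = wgt dt a 0 sq p * v b p" for a b p by (simp add: wgt_mult)
 have T: "Tm x y z u = wgt dt (- 1/2) 0 sq x * en \<bar>of_int (fst u)\<bar> * wgt dt (1/2) 0 sq y * wgt dt (1/2) 0 sq z * wgt dt (1/2) 0 sq u"
  unfolding Tm_def if_P[OF True] mult_m_def wgt_def by (simp add: ennreal_mult)
 show ?thesis
  unfolding inn_def dinn_def c T w[of "-1/2" b x] w[of "1/2" "1/2"] by (simp only: mult_ac mult_1_left mult_1_right)
qed

lemma Lam_tri:
 assumes [measurable]: "P \<in> bG dt" "F \<in> bG dt" "G \<in> bG dt" "H \<in> bG dt"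
 shows "(\<integral>\<^sup>+x. P x * (chi dt x * wgt dt (- 1/2) b sq x * tri (inn F) (inn G) (dinn H) x) \<partial>Gam dt) =
  G.Lam (%x y z u. Tm x y z u * (v b x * v (1/2) y * v (1/2) z * v (1/2) u) * (P x * F y * G z * H u))"
proof -
 define \<Phi> where "\<Phi> x y z u = Tm x y z u * (v b x * v (1/2) y * v (1/2) z * v (1/2) u) * (P x * F y * G z * H u)" for x y z u
 have pt: "P x * (chi dt x * wgt dt (- 1/2) b sq x) * (inn F y * inn G z * dinn H u) = \<Phi> x y z u" for x y z u
 proof -
  have "P x * (chi dt x * wgt dt (- 1/2) b sq x) * (inn F y * inn G z * dinn H u) =
   P x * (chi dt x * wgt dt (- 1/2) b sq x * inn F y * inn G z * dinn H u)" by (simp only: mult.assoc)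
  then show ?thesis unfolding weights_Tm \<Phi>_def by (simp only: mult_ac)
 qed
 have "(\<integral>\<^sup>+x. P x * (chi dt x * wgt dt (- 1/2) b sq x * tri (inn F) (inn G) (dinn H) x) \<partial>Gam dt) =
  (\<integral>\<^sup>+x. (\<integral>\<^sup>+y. (\<integral>\<^sup>+z. P x * (chi dt x * wgt dt (- 1/2) b sq x) * (inn F y * inn G z * dinn H (y + z - x)) \<partial>Gam dt) \<partial>Gam dt) \<partial>Gam dt)"
 proof (rule nn_integral_cong)
  fix x
  have [measurable]: "inn F \<in> bG dt" "inn G \<in> bG dt" "dinn H \<in> bG dt"
   by (intro inn_measurable assms)+
  show "P x * (chi dt x * wgt dt (- 1/2) b sq x * tri (inn F) (inn G) (dinn H) x) =
   (\<integral>\<^sup>+y. (\<integral>\<^sup>+z. P x * (chi dt x * wgt dt (- 1/2) b sq x) * (inn F y * inn G z * dinn H (y + z - x)) \<partial>Gam dt) \<partial>Gam dt)"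
   unfolding tri_def mult.assoc[of "P x", symmetric]
   by (subst nn_integral_cmult[symmetric], measurable, rule nn_integral_cong, subst nn_integral_cmult[symmetric], measurable)
 qed
 also have "\<dots> = G.Lam \<Phi>" unfolding pt by (rule G.Lam_def[symmetric])
 finally show ?thesis unfolding \<Phi>_def .
qed

lemma oe_alt: "omf (ez P) = oe P" by (simp add: omf_def oe_def fun_eq_iff)

lemma main_sum_eq:
 assumes p: "w * P x = omf Q x"
 shows "main_sum Q F G H x y z u = (N12 x y z u * (w * v (1/2) z * v (1/2) u + (w * v (1/2) y * v (1/2) u + w * v (1/2) y * v (1/2) z)) +
   Rs x y z u * (w * v (1/2) y * v (1/2) z * v (1/2) u)) * (P x * F y * G z * H u)"
 unfolding main_sum_def qf_def N12_def Rs_def oe_eq[symmetric] p[symmetric] distrib_left distrib_right by (simp only: mult_ac add_ac)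

end

text \<open>Duality turns the norm into a form. If the output has the largest modulation, its
  exponent 1/2 absorbs the derivative and the test function stays without weight, which is the first
  slot of \<open>Q4_bounds\<close>. The factor 8 comes from \<open>modulation_case\<close>.\<close>

lemma tri_X:
 "\<exists>C<\<infinity>. \<forall>dt F G H. time_step dt -->
  F \<in> bG dt --> G \<in> bG dt --> H \<in> bG dt -->
  nG dt (%x. chi dt x * wgt dt (- 1/2) (1/2) sq x * time_step.tri dt (time_step.inn dt F) (time_step.inn dt G) (time_step.dinn dt H) x)
   <= C * time_step.Sn dt F G H"
proof -
 obtain A where A: "A < \<infinity>" "\<And>dt P F G H. time_step dt ==>
  P \<in> bG dt ==> F \<in> bG dt ==> G \<in> bG dt ==> H \<in> bG dt ==>
  inv_measure.Lam (Gam dt) (time_step.main_sum dt P F G H) <= A * (nG dt P * time_step.Sn dt F G H)"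
  using main_sum_bound by blast
 obtain B where B: "B < \<infinity>" "\<And>dt N F G H I. time_step dt ==> N \<in> {N1 dt, N2 dt} ==>
  F \<in> bG dt ==> G \<in> bG dt ==> H \<in> bG dt ==> I \<in> bG dt ==>
  time_step.Q4 dt N F (om1 dt G) (om1 dt H) (om1 dt I)
   <= B * nG dt F * nG dt G * nG dt H * nG dt I"
  using Q4_bounds by blast
 define C where "C = 8 * ((B + B) + A)"
 have main: "nG dt (%x. chi dt x * wgt dt (- 1/2) (1/2) sq x * time_step.tri dt (time_step.inn dt F) (time_step.inn dt G) (time_step.dinn dt H) x)
   <= C * time_step.Sn dt F G H"
  if t: "time_step dt" and m: "F \<in> bG dt" "G \<in> bG dt" "H \<in> bG dt"
  for dt F G H
 proof -
  interpret time_step dt by fact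
  note [measurable] = m
  let ?n = "nG dt"
  show ?thesis
  proof (rule G.nrm_le_dual)
   show "(%x. chi dt x * wgt dt (- 1/2) (1/2) sq x * tri (inn F) (inn G) (dinn H) x) \<in> bG dt" by measurable
   fix P :: "gf" assume P [measurable]: "P \<in> bG dt"
   have ezP: "ez P \<in> bG dt" by (rule ez_measurable[OF P])
   note me = ez_measurable[OF m(1)] ez_measurable[OF m(2)] ez_measurable[OF m(3)]
   let ?q = "%N. qf N P (oe F) (oe G) (oe H)"
   have mq: "G.meas4 (?q N)" for N by (intro meas4_qf P me)
   have ms: "G.meas4 (main_sum (ez P) F G H)" by (intro meas4_main_sum ezP m)
   have pt: "Tm x y z u * (v (1/2) x * v (1/2) y * v (1/2) z * v (1/2) u) * (P x * F y * G z * H u) <=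
    8 * ((?q (N1 dt) x y z u + ?q (N2 dt) x y z u) + main_sum (ez P) F G H x y z u)" if u: "u = y + z - x" for x y z u
   proof -
    let ?PP = "P x * F y * G z * H u"
    have p: "v (1/2) x * P x = omf (ez P) x" by (simp only: oe_eq oe_alt)
    have q: "?q N x y z u = en (N (fst x) (fst y) (fst z) (fst u)) * (v (1/2) y * v (1/2) z * v (1/2) u) * ?PP" for N
     unfolding qf_def oe_eq[symmetric] by (simp only: mult_ac)
    define n where "n = N12 x y z u"
    define r where "r = Rs x y z u"
    define a where "a = v (1/2) y * v (1/2) z * v (1/2) u"
    define b where "b = v (1/2) x * v (1/2) z * v (1/2) u + (v (1/2) x * v (1/2) y * v (1/2) u + v (1/2) x * v (1/2) y * v (1/2) z)"
    define c where "c = v (1/2) x * v (1/2) y * v (1/2) z * v (1/2) u"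
    have "Tm x y z u * c * ?PP <= (8 * n * (a + b) + r * c) * ?PP"
     using pointwise_X[OF u] unfolding n_def r_def a_def b_def c_def by (intro mult_right_mono) auto
    also have "\<dots> <= (8 * n * (a + b) + 8 * (r * c)) * ?PP"
    proof (intro mult_right_mono add_left_mono)
     show "r * c <= 8 * (r * c)" using mult_right_mono[of 1 8 "r * c"] by simp
    qed simp
    also have "\<dots> = 8 * (n * a * ?PP + (n * b + r * c) * ?PP)" by (simp only: distrib_left distrib_right mult_ac add_ac)
    also have "n * a * ?PP = ?q (N1 dt) x y z u + ?q (N2 dt) x y z u"
     unfolding q n_def N12_def a_def by (simp only: distrib_right)
    also have "(n * b + r * c) * ?PP = main_sum (ez P) F G H x y z u"
     unfolding main_sum_eq[where w = "v (1/2) x" and P = P and x = x, OF p] n_def r_def b_def c_def ..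
    finally show ?thesis unfolding c_def .
   qed
   have "(\<integral>\<^sup>+x. P x * (chi dt x * wgt dt (- 1/2) (1/2) sq x * tri (inn F) (inn G) (dinn H) x) \<partial>Gam dt) =
    G.Lam (%x y z u. Tm x y z u * (v (1/2) x * v (1/2) y * v (1/2) z * v (1/2) u) * (P x * F y * G z * H u))"
    by (rule Lam_tri[OF P m])
   also have "\<dots> <= G.Lam (%x y z u. 8 * ((?q (N1 dt) x y z u + ?q (N2 dt) x y z u) + main_sum (ez P) F G H x y z u))"
    by (rule Lam_mono_surface) (rule pt[OF refl])
   also have "\<dots> = 8 * ((G.Lam (?q (N1 dt)) + G.Lam (?q (N2 dt))) + G.Lam (main_sum (ez P) F G H))"
    unfolding G.Lam_cmult[OF meas4_add[OF meas4_add[OF mq mq] ms]] G.Lam_add[OF meas4_add[OF mq mq] ms] G.Lam_add[OF mq mq] ..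
   also have "\<dots> <= 8 * ((B * (?n P * Sn F G H) + B * (?n P * Sn F G H)) + A * (?n P * Sn F G H))"
   proof (intro mult_left_mono add_mono)
    have b: "G.Lam (?q N) <= B * (?n P * Sn F G H)" if N: "N \<in> {N1 dt, N2 dt}" for N
    proof -
     have omf: "oe Q = (%p. om dt p * ez Q p)" for Q by (simp add: oe_def fun_eq_iff)
     have "G.Lam (?q N) <= B * ?n P * ?n (ez F) * ?n (ez G) * ?n (ez H)"
      unfolding Lam_qf omf by (rule B(2)[OF t N P me(1,4,7)])
     also have "\<dots> <= B * (?n P * (?n F * ?n (ez G) * ?n (ez H)))"
      unfolding mult.assoc by (intro mult_left_mono mult_right_mono nrm_ez_le) auto
     also have "\<dots> <= B * (?n P * Sn F G H)"
      unfolding Sn_def by (intro mult_left_mono) auto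
     finally show ?thesis .
    qed
    show "G.Lam (?q (N1 dt)) <= B * (?n P * Sn F G H)" "G.Lam (?q (N2 dt)) <= B * (?n P * Sn F G H)" by (intro b, simp)+
    have "G.Lam (main_sum (ez P) F G H) <= A * (?n (ez P) * Sn F G H)" by (rule A(2)[OF t ezP m])
    also have "\<dots> <= A * (?n P * Sn F G H)" by (intro mult_left_mono mult_right_mono nrm_ez_le) auto
    finally show "G.Lam (main_sum (ez P) F G H) <= A * (?n P * Sn F G H)" .
   qed simp
   also have "\<dots> = C * Sn F G H * ?n P" unfolding C_def by (simp only: distrib_left distrib_right mult_ac)
   finally show "(\<integral>\<^sup>+x. P x * (chi dt x * wgt dt (- 1/2) (1/2) sq x * tri (inn F) (inn G) (dinn H) x) \<partial>Gam dt) <= C * Sn F G H * ?n P" .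
  qed
 qed
 have "C < \<infinity>" using A(1) B(1) by (simp add: C_def ennreal_mult_less_top)
 with main show ?thesis by blast
qed

text \<open>The test function depends on \<open>k\<close> alone. Of the output exponent 1, the part
  12/25 is the weight \<open>om dt\<close> that the form requires, and 13/25 makes the lifted test
  function square integrable on the circle, since \<open>2 * 13/25 > 1\<close>.\<close>

lemma tri_Y:
 "\<exists>C<\<infinity>. \<forall>dt F G H. time_step dt -->
  F \<in> bG dt --> G \<in> bG dt --> H \<in> bG dt -->
  nrm (cZ) (%k. \<integral>\<^sup>+s. chi dt (k, s) * wgt dt (- 1/2) 1 sq (k, s) *
   time_step.tri dt (time_step.inn dt F) (time_step.inn dt G) (time_step.dinn dt H) (k, s) \<partial>circ dt)
   <= C * time_step.Sn dt F G H"
proof -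
 obtain A where A: "A < \<infinity>" "\<And>dt P F G H. time_step dt ==>
  P \<in> bG dt ==> F \<in> bG dt ==> G \<in> bG dt ==> H \<in> bG dt ==>
  inv_measure.Lam (Gam dt) (time_step.main_sum dt P F G H) <= A * (nG dt P * time_step.Sn dt F G H)"
  using main_sum_bound by blast
 obtain B where B: "B < \<infinity>" "\<And>f g h i. inv_measure.Lam (cZ) (%k p q r. en (NY k p q r) * f k * g p * h q * i r)
   <= B * nrm (cZ) f * nrm (cZ) g * nrm (cZ) h * nrm (cZ) i"
  using Lam_NY by blast
 obtain D0 where D0: "D0 < \<infinity>" "\<And>dt c. time_step dt ==> (\<integral>\<^sup>+x. en (W dt (x + c) powr - (26/25)) \<partial>circ dt) <= D0"
  using circ_W_bound[of "26/25"] by auto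
 define D where "D = ennsqrt D0"
 have Dfin: "D < \<infinity>" unfolding D_def by (rule ennsqrt_less_top[OF D0(1)])
 define C where "C = 16 * (A * D + B * (D * D * D))"
 have main: "nrm (cZ) (%k. \<integral>\<^sup>+s. chi dt (k, s) * wgt dt (- 1/2) 1 sq (k, s) *
   time_step.tri dt (time_step.inn dt F) (time_step.inn dt G) (time_step.dinn dt H) (k, s) \<partial>circ dt)
   <= C * time_step.Sn dt F G H"
  if t: "time_step dt" and m: "F \<in> bG dt" "G \<in> bG dt" "H \<in> bG dt"
  for dt F G H
 proof -
  interpret time_step dt by fact
  let ?n = "nG dt" and ?c = "nrm (cZ)"
  have nW: "nC dt (%s. v (13/25) (k, s)) <= D" for k
  proof -
   have "(\<integral>\<^sup>+s. (v (13/25) (k, s))\<^sup>2 \<partial>circ dt) <= D0"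
    unfolding wgt_sq using D0(2)[OF t, of "sq k"] by (simp add: wgt_def)
   then show ?thesis unfolding nrm_def D_def by (rule ennsqrt_mono)
  qed
  define a where "a F p = v (27/50) p * F p" for F p
  define I where "I F k = (\<integral>\<^sup>+s. a F (k, s) \<partial>circ dt)" for F k
  have am: "a F \<in> bG dt" if [measurable]: "F \<in> bG dt" for F
   unfolding a_def by measurable
  have vm: "(%s. v (13/25) (k, s)) \<in> bC dt" for k
   by (rule Gam_Pair) measurable
  have nI: "?c (I F) <= D * ?n (ez F)" if F: "F \<in> bG dt" for F
  proof -
   have e: "ez F \<in> bG dt" by (rule ez_measurable[OF F])
   have "I F k <= D * nC dt (%s. ez F (k, s))" for k
   proof -
    have "a F p = v (13/25) p * ez F p" for p
    proof -
     have "v (27/50) p = v (13/25) p * v (1/50) p" by (simp add: wgt_mult)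
     then show ?thesis by (simp only: a_def ez_def mult.assoc)
    qed
    then have "I F k = (\<integral>\<^sup>+s. v (13/25) (k, s) * ez F (k, s) \<partial>circ dt)" by (simp only: I_def)
    also have "\<dots> <= nC dt (%s. v (13/25) (k, s)) * nC dt (%s. ez F (k, s))"
     by (rule Cauchy_Schwarz_nrm[OF vm Gam_Pair[OF e]])
    also have "\<dots> <= D * nC dt (%s. ez F (k, s))" by (rule mult_right_mono[OF nW]) simp
    finally show ?thesis .
   qed
   then have "?c (I F) <= ?c (%k. D * nC dt (%s. ez F (k, s)))" by (rule nrm_mono)
   also have "\<dots> = D * ?c (%k. nC dt (%s. ez F (k, s)))" by (rule nrm_cmult) simp
   finally show ?thesis unfolding nrm_Gam[OF e] .
  qed
  show ?thesis
  proof (rule I.nrm_le_dual)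
   fix \<psi> :: "int => ennreal"
   define P :: "gf" where "P x = \<psi> (fst x)" for x
   have P: "P \<in> bG dt" unfolding P_def by (rule int1_measurable) simp
   define Pb where "Pb x = v (13/25) x * P x" for x
   have Pb: "Pb \<in> bG dt" unfolding Pb_def using P by measurable
   have nPb: "?n Pb <= D * ?c \<psi>"
   proof -
    have "nC dt (%s. Pb (k, s)) <= D * \<psi> k" for k
    proof -
     have "nC dt (%s. Pb (k, s)) = nC dt (%s. \<psi> k * v (13/25) (k, s))"
      unfolding Pb_def P_def by (simp only: fst_conv mult.commute)
     also have "\<dots> = \<psi> k * nC dt (%s. v (13/25) (k, s))" by (rule nrm_cmult[OF vm])
     also have "\<dots> <= \<psi> k * D" by (rule mult_left_mono[OF nW]) simp
     finally show ?thesis by (simp only: mult.commute)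
    qed
    then have "?c (%k. nC dt (%s. Pb (k, s))) <= ?c (%k. D * \<psi> k)" by (rule nrm_mono)
    also have "\<dots> = D * ?c \<psi>" by (rule nrm_cmult) simp
    finally show ?thesis unfolding nrm_Gam[OF Pb] .
   qed
   let ?qY = "qf NY P (a F) (a G) (a H)"
   have mq: "G.meas4 ?qY" by (intro meas4_qf P am m)
   have ms: "G.meas4 (main_sum Pb F G H)" by (intro meas4_main_sum Pb m)
   have pt: "Tm x y z u * (v 1 x * v (1/2) y * v (1/2) z * v (1/2) u) * (P x * F y * G z * H u) <=
    16 * (main_sum Pb F G H x y z u + ?qY x y z u)" if u: "u = y + z - x" for x y z u
   proof -
    let ?PP = "P x * F y * G z * H u"
    have v1: "v 1 x = om dt x * v (13/25) x" by (simp add: wgt_mult)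
    have p: "v 1 x * P x = omf Pb x" by (simp only: v1 omf_def Pb_def mult.assoc)
    have q: "?qY x y z u = en (NY (fst x) (fst y) (fst z) (fst u)) * (v (27/50) y * v (27/50) z * v (27/50) u) * ?PP"
     unfolding qf_def a_def by (simp only: mult_ac)
    define n where "n = N12 x y z u"
    define r where "r = Rs x y z u"
    define b where "b = v 1 x * v (1/2) z * v (1/2) u + (v 1 x * v (1/2) y * v (1/2) u + v 1 x * v (1/2) y * v (1/2) z)"
    define c where "c = v 1 x * v (1/2) y * v (1/2) z * v (1/2) u"
    define d where "d = en (NY (fst x) (fst y) (fst z) (fst u))"
    define e where "e = v (27/50) y * v (27/50) z * v (27/50) u"
    have "Tm x y z u * c * ?PP <= (8 * n * b + (r * c + 16 * d * e)) * ?PP"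
     using pointwise_Y[OF u] unfolding n_def r_def b_def c_def d_def e_def by (intro mult_right_mono) auto
    also have "\<dots> <= (16 * n * b + (16 * (r * c) + 16 * d * e)) * ?PP"
    proof (intro mult_right_mono add_mono)
     show "r * c <= 16 * (r * c)" using mult_right_mono[of 1 16 "r * c"] by simp
    qed auto
    also have "\<dots> = 16 * ((n * b + r * c) * ?PP + d * e * ?PP)" by (simp only: distrib_left distrib_right mult_ac add_ac)
    also have "(n * b + r * c) * ?PP = main_sum Pb F G H x y z u"
     unfolding main_sum_eq[where w = "v 1 x" and P = P and x = x, OF p] n_def r_def b_def c_def ..
    also have "d * e * ?PP = ?qY x y z u" unfolding q d_def e_def ..
    finally show ?thesis unfolding c_def .
   qed
   \<comment> \<open>The kernel does not involve the modulations, so they are integrated out. Each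
     input enters through its integral \<open>I\<close>, bounded by Cauchy-Schwarz with the weight
     \<open>v (13/25)\<close>; the slack \<open>v (1/50)\<close> is left over.\<close>
   have LY: "G.Lam ?qY <= B * (D * D * D) * (?c \<psi> * Sn F G H)"
   proof -
    have "G.Lam ?qY = (SI k. (SI p. (SI q. en (NY k p q (p + q - k)) *
     C.Lam (%s t v w. P (k, s) * a F (p, t) * a G (q, v) * a H (p + q - k, w)))))"
     unfolding Lam_qf by (intro Q4_unfold P am m)
    also have "\<dots> = (SI k. (SI p. (SI q. en (NY k p q (p + q - k)) * \<psi> k * I F p * I G q * I H (p + q - k))))"
    proof (rule nn_integral_cong, rule nn_integral_cong, rule nn_integral_cong)
     fix k p q :: int
     note mm = Gam_Pair[OF am[OF m(1)]] Gam_Pair[OF am[OF m(2)]] Gam_Pair[OF am[OF m(3)]]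
     have c: "C.conv (%s. \<psi> k) (%w. a H (p + q - k, w)) u = \<psi> k * I H (p + q - k)" for u
     proof -
      have "C.conv (%s. \<psi> k) (%w. a H (p + q - k, w)) u = \<psi> k * (\<integral>\<^sup>+y. a H (p + q - k, u - y) \<partial>circ dt)"
       unfolding C.conv_def using mm(3)[of "p + q - k", measurable] by (intro nn_integral_cmult) measurable
      then show ?thesis unfolding I_def C.nn_integral_shift'(3)[OF mm(3)] .
     qed
     have "C.Lam (%s t v w. P (k, s) * a F (p, t) * a G (q, v) * a H (p + q - k, w)) =
      (\<integral>\<^sup>+u. C.conv (%s. P (k, s)) (%w. a H (p + q - k, w)) u * C.conv (%t. a F (p, t)) (%v. a G (q, v)) u \<partial>circ dt)"
      by (rule C.Lam_conv[OF Gam_Pair[OF P] mm(1,2,3)])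
     also have "\<dots> = (\<integral>\<^sup>+u. \<psi> k * I H (p + q - k) * C.conv (%t. a F (p, t)) (%v. a G (q, v)) u \<partial>circ dt)"
      unfolding P_def fst_conv c ..
     also have "\<dots> = \<psi> k * I H (p + q - k) * (\<integral>\<^sup>+u. C.conv (%t. a F (p, t)) (%v. a G (q, v)) u \<partial>circ dt)"
      by (rule nn_integral_cmult, rule C.conv_measurable[OF mm(1,2)])
     also have "\<dots> = \<psi> k * I H (p + q - k) * (I F p * I G q)"
      unfolding I_def C.nn_integral_conv_1[OF mm(1,2)] ..
     finally show "en (NY k p q (p + q - k)) * C.Lam (%s t v w. P (k, s) * a F (p, t) * a G (q, v) * a H (p + q - k, w)) =
      en (NY k p q (p + q - k)) * \<psi> k * I F p * I G q * I H (p + q - k)" by (simp only: mult_ac)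
    qed
    also have "\<dots> = I.Lam (%k p q r. en (NY k p q r) * \<psi> k * I F p * I G q * I H r)"
     by (rule I.Lam_def[symmetric])
    also have "\<dots> <= B * ?c \<psi> * ?c (I F) * ?c (I G) * ?c (I H)" by (rule B(2))
    also have "\<dots> <= B * ?c \<psi> * (D * ?n (ez F)) * (D * ?n (ez G)) * (D * ?n (ez H))"
     by (intro mult_mono nI m) auto
    also have "\<dots> = B * (D * D * D) * (?c \<psi> * (?n (ez F) * ?n (ez G) * ?n (ez H)))" by (simp only: mult_ac)
    also have "?n (ez F) * ?n (ez G) * ?n (ez H) <= ?n F * ?n (ez G) * ?n (ez H)"
     by (intro mult_right_mono nrm_ez_le) auto
    also have "\<dots> <= Sn F G H" unfolding Sn_def by simp
    finally show ?thesis by (simp add: mult_left_mono)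
   qed
   have "(SI k. \<psi> k * (\<integral>\<^sup>+s. chi dt (k, s) * wgt dt (- 1/2) 1 sq (k, s) * tri (inn F) (inn G) (dinn H) (k, s) \<partial>circ dt)) =
    (SI k. (\<integral>\<^sup>+s. P (k, s) * (chi dt (k, s) * wgt dt (- 1/2) 1 sq (k, s) * tri (inn F) (inn G) (dinn H) (k, s)) \<partial>circ dt))"
   proof (rule nn_integral_cong)
    fix k
    have "(%x. chi dt x * wgt dt (- 1/2) 1 sq x * tri (inn F) (inn G) (dinn H) x) \<in> bG dt" using m by measurable
    from Gam_Pair[OF this]
    show "\<psi> k * (\<integral>\<^sup>+s. chi dt (k, s) * wgt dt (- 1/2) 1 sq (k, s) * tri (inn F) (inn G) (dinn H) (k, s) \<partial>circ dt) =
     (\<integral>\<^sup>+s. P (k, s) * (chi dt (k, s) * wgt dt (- 1/2) 1 sq (k, s) * tri (inn F) (inn G) (dinn H) (k, s)) \<partial>circ dt)"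
     unfolding P_def fst_conv by (rule nn_integral_cmult[symmetric])
   qed
   also have "\<dots> = (\<integral>\<^sup>+x. P x * (chi dt x * wgt dt (- 1/2) 1 sq x * tri (inn F) (inn G) (dinn H) x) \<partial>Gam dt)"
    by (rule nn_integral_Gam[OF tau_pos, symmetric]) (use m P in measurable)
   also have "\<dots> = G.Lam (%x y z u. Tm x y z u * (v 1 x * v (1/2) y * v (1/2) z * v (1/2) u) * (P x * F y * G z * H u))"
    by (rule Lam_tri[OF P m])
   also have "\<dots> <= G.Lam (%x y z u. 16 * (main_sum Pb F G H x y z u + ?qY x y z u))"
    by (rule Lam_mono_surface) (rule pt[OF refl])
   also have "\<dots> = 16 * (G.Lam (main_sum Pb F G H) + G.Lam ?qY)"
    unfolding G.Lam_cmult[OF meas4_add[OF ms mq]] G.Lam_add[OF ms mq] ..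
   also have "\<dots> <= 16 * (A * (D * ?c \<psi> * Sn F G H) + B * (D * D * D) * (?c \<psi> * Sn F G H))"
   proof (intro mult_left_mono add_mono LY)
    have "G.Lam (main_sum Pb F G H) <= A * (?n Pb * Sn F G H)" by (rule A(2)[OF t Pb m])
    also have "\<dots> <= A * (D * ?c \<psi> * Sn F G H)" by (intro mult_left_mono mult_right_mono nPb) auto
    finally show "G.Lam (main_sum Pb F G H) <= A * (D * ?c \<psi> * Sn F G H)" .
   qed simp
   also have "\<dots> = C * Sn F G H * ?c \<psi>" unfolding C_def by (simp only: distrib_left distrib_right mult_ac)
   finally show "(SI k. \<psi> k * (\<integral>\<^sup>+s. chi dt (k, s) * wgt dt (- 1/2) 1 sq (k, s) * tri (inn F) (inn G) (dinn H) (k, s) \<partial>circ dt))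
    <= C * Sn F G H * ?c \<psi>" .
  qed simp
 qed
 have "C < \<infinity>" using A(1) B(1) Dfin by (simp add: C_def ennreal_mult_less_top)
 with main show ?thesis by blast
qed

section \<open>Convolution estimates for products without derivative\<close>

lemma (in inv_measure) nn_integral_conv_le:
 assumes [measurable]: "f \<in> borel_measurable M" "g \<in> borel_measurable M" "h \<in> borel_measurable M"
 shows "(\<integral>\<^sup>+x. h x * conv f g x \<partial>M) <= nrm M (conv h (rfl f)) * nrm M g"
proof -
 have "(\<integral>\<^sup>+x. h x * conv f g x \<partial>M) = (\<integral>\<^sup>+y. (\<integral>\<^sup>+z. f y * g z * h (y + z) \<partial>M) \<partial>M)"
  by (rule nn_integral_conv) measurable
 also have "\<dots> = (\<integral>\<^sup>+z. (\<integral>\<^sup>+y. f y * g z * h (y + z) \<partial>M) \<partial>M)"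
  by (rule nn_integral_swap) measurable
 also have "\<dots> = (\<integral>\<^sup>+z. conv h (rfl f) z * g z \<partial>M)"
 proof (rule nn_integral_cong)
  fix z
  have "(\<integral>\<^sup>+y. f y * g z * h (y + z) \<partial>M) = (\<integral>\<^sup>+y. h y * rfl f (z - y) * g z \<partial>M)"
   using nn_integral_shift[of "%y. h y * rfl f (z - y) * g z" z] by (simp add: rfl_def mult_ac)
  also have "\<dots> = conv h (rfl f) z * g z"
   unfolding conv_def rfl_def by (rule nn_integral_multc) measurable
  finally show "(\<integral>\<^sup>+y. f y * g z * h (y + z) \<partial>M) = conv h (rfl f) z * g z" .
 qed
 also have "\<dots> <= nrm M (conv h (rfl f)) * nrm M g"
  by (rule Cauchy_Schwarz_nrm) measurable
 finally show ?thesis .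
qed

text \<open>The dual form of the L4 bound: testing against \<open>P\<close> moves \<open>f\<close>
  to the side of \<open>P\<close>, where 3/8 and 12/25 are admissible exponents. Reflection of
  \<open>f\<close>, that is conjugation, is harmless by \<open>nrm_conv_rfl\<close>.\<close>

lemma out_bound:
 "\<exists>C<\<infinity>. \<forall>dt F G f. time_step dt --> F \<in> bG dt --> G \<in> bG dt -->
  f = (%p. chi dt p * om dt p * F p) \<or> f = inv_measure.rfl (%p. chi dt p * om dt p * F p) -->
  nG dt (%x. chi dt x * wgt dt 0 (3/8) sq x * cG dt f G x) <= C * (nG dt F * nG dt G)"
proof -
 obtain A where A: "A < \<infinity>" "\<And>dt F G. time_step dt ==> F \<in> bG dt ==> G \<in> bG dt ==>
  nG dt (cG dt (%p. chi dt p * wgt dt 0 (3/8) sq p * F p) (%p. chi dt p * wgt dt 0 (12/25) sq p * G p))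
   <= A * nG dt F * nG dt G"
  using L4_bound[of "3/8" "12/25"] by auto
 have main: "nG dt (%x. chi dt x * wgt dt 0 (3/8) sq x * cG dt f G x) <= A * (nG dt F * nG dt G)"
  if t: "time_step dt" and F [measurable]: "F \<in> bG dt" and [measurable]: "G \<in> bG dt"
  and f: "f = (%p. chi dt p * om dt p * F p) \<or> f = inv_measure.rfl (%p. chi dt p * om dt p * F p)" for dt F G f
 proof -
  interpret time_step dt by fact
  let ?f = "%p. chi dt p * om dt p * F p"
  have fm [measurable]: "?f \<in> bG dt" by measurable
  have fm' [measurable]: "f \<in> bG dt" using f G.rfl_measurable[OF fm] fm by blast
  show ?thesis
  proof (rule G.nrm_le_dual)
   show "(%x. chi dt x * wgt dt 0 (3/8) sq x * G.conv f G x) \<in> bG dt" by measurable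
   fix P :: "gf" assume P [measurable]: "P \<in> bG dt"
   let ?h = "%p. chi dt p * wgt dt 0 (3/8) sq p * P p"
   have "nG dt (G.conv ?h (G.rfl f)) = nG dt (G.conv ?h ?f)"
    using f
   proof
    assume "f = ?f" then show ?thesis by (simp only:) (rule G.nrm_conv_rfl, measurable)
   next
    assume "f = G.rfl ?f" then show ?thesis by (simp only: G.rfl_rfl)
   qed
   also have "\<dots> <= A * nG dt P * nG dt F" by (rule A(2)[OF t P F])
   finally have b: "nG dt (G.conv ?h (G.rfl f)) <= A * nG dt P * nG dt F" .
   have "(\<integral>\<^sup>+x. P x * (chi dt x * wgt dt 0 (3/8) sq x * G.conv f G x) \<partial>Gam dt) = (\<integral>\<^sup>+x. ?h x * G.conv f G x \<partial>Gam dt)"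
    by (simp only: mult_ac)
   also have "\<dots> <= nG dt (G.conv ?h (G.rfl f)) * nG dt G"
    by (rule G.nn_integral_conv_le) measurable
   also have "\<dots> <= A * nG dt P * nG dt F * nG dt G" by (intro mult_right_mono b) simp
   finally show "(\<integral>\<^sup>+x. P x * (chi dt x * wgt dt 0 (3/8) sq x * G.conv f G x) \<partial>Gam dt) <= A * (nG dt F * nG dt G) * nG dt P"
    by (simp only: mult_ac)
  qed
 qed
 with A(1) show ?thesis by blast
qed

lemma conv2_bound:
 "\<exists>C<\<infinity>. \<forall>dt \<theta> \<theta>' F G. time_step dt --> F \<in> bG dt --> G \<in> bG dt -->
  nG dt (cG dt (%p. wgt dt (1/2) (12/25) \<theta> p * F p) (%p. wgt dt (1/2) (12/25) \<theta>' p * G p)) <= C * (nG dt F * nG dt G)"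
 using wgt_pair_bound[of "1/2" "1/2" "12/25" "12/25"] by (simp add: mult.assoc)

text \<open>The square of each factor is a product of one with exponents 51/100, integrable over the
  group, and one with smaller exponents. So the four-fold product is at most a sum of two, each with
  two integrable factors and two left to \<open>wgt_pair_bound\<close>; Young's inequality joins
  them.\<close>

lemma conv4_bound:
 "\<exists>C<\<infinity>. \<forall>dt \<theta>1 \<theta>2 \<theta>3 \<theta>4 F G H I. time_step dt -->
  F \<in> bG dt --> G \<in> bG dt --> H \<in> bG dt --> I \<in> bG dt -->
  nG dt (cG dt
   (cG dt (%p. wgt dt (1/2) (12/25) \<theta>1 p * F p) (%p. wgt dt (1/2) (12/25) \<theta>2 p * G p))
   (cG dt (%p. wgt dt (1/2) (12/25) \<theta>3 p * H p) (%p. wgt dt (1/2) (12/25) \<theta>4 p * I p)))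
  <= C * (nG dt F * nG dt G * nG dt H * nG dt I)"
proof -
 obtain A where A: "A < \<infinity>" "\<And>dt \<theta> F. time_step dt ==> F \<in> bG dt ==>
  (\<integral>\<^sup>+p. wgt dt (51/100) (51/100) \<theta> p * F p \<partial>Gam dt) <= A * nG dt F"
  using wgt_L1_bound[of "51/100" "51/100"] by auto
 obtain B where B: "B < \<infinity>" "\<And>dt \<theta> \<theta>' F G. time_step dt ==> F \<in> bG dt ==> G \<in> bG dt ==>
  nG dt (cG dt (%p. wgt dt (49/100) (9/20) \<theta> p * F p) (%p. wgt dt (49/100) (9/20) \<theta>' p * G p)) <= B * nG dt F * nG dt G"
  using wgt_pair_bound[of "49/100" "49/100" "9/20" "9/20"] by auto
 define C where "C = 2 * (A * A * B + A * A * B)"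
 have main: "nG dt (cG dt
   (cG dt (%p. wgt dt (1/2) (12/25) \<theta>1 p * F p) (%p. wgt dt (1/2) (12/25) \<theta>2 p * G p))
   (cG dt (%p. wgt dt (1/2) (12/25) \<theta>3 p * H p) (%p. wgt dt (1/2) (12/25) \<theta>4 p * I p)))
  <= C * (nG dt F * nG dt G * nG dt H * nG dt I)"
  if t: "time_step dt" and m: "F \<in> bG dt" "G \<in> bG dt" "H \<in> bG dt" "I \<in> bG dt"
  for dt \<theta>1 \<theta>2 \<theta>3 \<theta>4 F G H I
 proof -
  interpret time_step dt by fact
  define u where "u \<theta> F p = wgt dt (1/2) (12/25) \<theta> p * F p" for \<theta> F p
  define a where "a \<theta> F p = wgt dt (51/100) (51/100) \<theta> p * F p" for \<theta> F p
  define b where "b \<theta> F p = wgt dt (49/100) (9/20) \<theta> p * F p" for \<theta> F p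
  have um: "u \<theta> F \<in> bG dt" "a \<theta> F \<in> bG dt" "b \<theta> F \<in> bG dt"
   if [measurable]: "F \<in> bG dt" for \<theta> F
   unfolding u_def a_def b_def by measurable
  have u2: "(u \<theta> F p)\<^sup>2 = a \<theta> F p * b \<theta> F p" for \<theta> F p
  proof -
   have "(wgt dt (1/2) (12/25) \<theta> p)\<^sup>2 = wgt dt (51/100) (51/100) \<theta> p * wgt dt (49/100) (9/20) \<theta> p"
    by (simp add: wgt_sq wgt_mult)
   then show ?thesis unfolding u_def a_def b_def power_mult_distrib by (simp only: power2_eq_square mult_ac)
  qed
  have amgm: "u \<theta>1 F p * u \<theta>2 G q * (u \<theta>3 H r * u \<theta>4 I s) <= a \<theta>1 F p * a \<theta>2 G q * (b \<theta>3 H r * b \<theta>4 I s) + b \<theta>1 F p * b \<theta>2 G q * (a \<theta>3 H r * a \<theta>4 I s)" (is "?L <= ?X + ?Y") for p q r s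
  proof (rule le_of_sq_le)
   have "?L\<^sup>2 = ?X * ?Y" unfolding power_mult_distrib u2 by (simp only: mult_ac)
   also have "\<dots> <= (?X + ?Y) * (?X + ?Y)" by (intro mult_mono) auto
   finally show "?L\<^sup>2 <= (?X + ?Y)\<^sup>2" by (simp only: power2_eq_square)
  qed
  let ?c = "G.conv"
  have triple: "?c (?c f1 f2) (?c f3 f4) x = (\<integral>\<^sup>+y. (\<integral>\<^sup>+p. (\<integral>\<^sup>+r. f1 p * f2 (y - p) * (f3 r * f4 (x - y - r)) \<partial>Gam dt) \<partial>Gam dt) \<partial>Gam dt)"
   if [measurable]: "f1 \<in> bG dt" "f2 \<in> bG dt" "f3 \<in> bG dt" "f4 \<in> bG dt" for f1 f2 f3 f4 x
  proof -
   have "?c (?c f1 f2) (?c f3 f4) x = (\<integral>\<^sup>+y. (\<integral>\<^sup>+p. f1 p * f2 (y - p) \<partial>Gam dt) * (\<integral>\<^sup>+r. f3 r * f4 (x - y - r) \<partial>Gam dt) \<partial>Gam dt)"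
    unfolding G.conv_def ..
   also have "\<dots> = (\<integral>\<^sup>+y. (\<integral>\<^sup>+p. f1 p * f2 (y - p) * (\<integral>\<^sup>+r. f3 r * f4 (x - y - r) \<partial>Gam dt) \<partial>Gam dt) \<partial>Gam dt)"
    by (rule nn_integral_cong, rule nn_integral_multc[symmetric]) measurable
   also have "\<dots> = (\<integral>\<^sup>+y. (\<integral>\<^sup>+p. (\<integral>\<^sup>+r. f1 p * f2 (y - p) * (f3 r * f4 (x - y - r)) \<partial>Gam dt) \<partial>Gam dt) \<partial>Gam dt)"
    by (rule nn_integral_cong, rule nn_integral_cong, rule nn_integral_cmult[symmetric]) measurable
   finally show ?thesis .
  qed
  have pt: "?c (?c (u \<theta>1 F) (u \<theta>2 G)) (?c (u \<theta>3 H) (u \<theta>4 I)) x <=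
   ?c (?c (a \<theta>1 F) (a \<theta>2 G)) (?c (b \<theta>3 H) (b \<theta>4 I)) x + ?c (?c (a \<theta>3 H) (a \<theta>4 I)) (?c (b \<theta>1 F) (b \<theta>2 G)) x" for x
  proof -
   note [measurable] = um(1)[OF m(1), of \<theta>1] um(1)[OF m(2), of \<theta>2] um(1)[OF m(3), of \<theta>3] um(1)[OF m(4), of \<theta>4]
    um(2)[OF m(1), of \<theta>1] um(2)[OF m(2), of \<theta>2] um(2)[OF m(3), of \<theta>3] um(2)[OF m(4), of \<theta>4]
    um(3)[OF m(1), of \<theta>1] um(3)[OF m(2), of \<theta>2] um(3)[OF m(3), of \<theta>3] um(3)[OF m(4), of \<theta>4]
   have "?c (?c (u \<theta>1 F) (u \<theta>2 G)) (?c (u \<theta>3 H) (u \<theta>4 I)) x <=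
    (\<integral>\<^sup>+y. (\<integral>\<^sup>+p. (\<integral>\<^sup>+r. a \<theta>1 F p * a \<theta>2 G (y - p) * (b \<theta>3 H r * b \<theta>4 I (x - y - r)) +
     b \<theta>1 F p * b \<theta>2 G (y - p) * (a \<theta>3 H r * a \<theta>4 I (x - y - r)) \<partial>Gam dt) \<partial>Gam dt) \<partial>Gam dt)"
    by (subst triple, measurable) (intro nn_integral_mono amgm)
   also have "\<dots> = ?c (?c (a \<theta>1 F) (a \<theta>2 G)) (?c (b \<theta>3 H) (b \<theta>4 I)) x + ?c (?c (b \<theta>1 F) (b \<theta>2 G)) (?c (a \<theta>3 H) (a \<theta>4 I)) x"
    by (subst (1 2) triple, measurable) (simp add: nn_integral_add)
   also have "?c (?c (b \<theta>1 F) (b \<theta>2 G)) (?c (a \<theta>3 H) (a \<theta>4 I)) x = ?c (?c (a \<theta>3 H) (a \<theta>4 I)) (?c (b \<theta>1 F) (b \<theta>2 G)) x"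
    by (rule G.conv_commute) measurable
   finally show ?thesis .
  qed
  have one: "nG dt (?c (?c (a \<theta>1 F1) (a \<theta>2 F2)) (?c (b \<theta>3 F3) (b \<theta>4 F4))) <=
   A * A * B * (nG dt F1 * nG dt F2 * (nG dt F3 * nG dt F4))"
   if m: "F1 \<in> bG dt" "F2 \<in> bG dt" "F3 \<in> bG dt" "F4 \<in> bG dt"
   for F1 F2 F3 F4 \<theta>1 \<theta>2 \<theta>3 \<theta>4
  proof -
   have "nG dt (?c (?c (a \<theta>1 F1) (a \<theta>2 F2)) (?c (b \<theta>3 F3) (b \<theta>4 F4))) <=
    (\<integral>\<^sup>+x. ?c (a \<theta>1 F1) (a \<theta>2 F2) x \<partial>Gam dt) * nG dt (?c (b \<theta>3 F3) (b \<theta>4 F4))"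
    by (intro G.nrm_conv_Young G.conv_measurable um m)
   also have "(\<integral>\<^sup>+x. ?c (a \<theta>1 F1) (a \<theta>2 F2) x \<partial>Gam dt) = (\<integral>\<^sup>+x. a \<theta>1 F1 x \<partial>Gam dt) * (\<integral>\<^sup>+x. a \<theta>2 F2 x \<partial>Gam dt)"
    by (intro G.nn_integral_conv_1 um m)
   also have "\<dots> * nG dt (?c (b \<theta>3 F3) (b \<theta>4 F4)) <= (A * nG dt F1) * (A * nG dt F2) * (B * nG dt F3 * nG dt F4)"
    unfolding a_def b_def by (intro mult_mono A(2) B(2) t m) auto
   finally show ?thesis by (simp only: mult_ac)
  qed
  have "nG dt (?c (?c (u \<theta>1 F) (u \<theta>2 G)) (?c (u \<theta>3 H) (u \<theta>4 I))) <=
   nG dt (%x. ?c (?c (a \<theta>1 F) (a \<theta>2 G)) (?c (b \<theta>3 H) (b \<theta>4 I)) x + ?c (?c (a \<theta>3 H) (a \<theta>4 I)) (?c (b \<theta>1 F) (b \<theta>2 G)) x)"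
   by (rule nrm_mono[OF pt])
  also have "\<dots> <= 2 * (nG dt (?c (?c (a \<theta>1 F) (a \<theta>2 G)) (?c (b \<theta>3 H) (b \<theta>4 I))) + nG dt (?c (?c (a \<theta>3 H) (a \<theta>4 I)) (?c (b \<theta>1 F) (b \<theta>2 G))))"
   by (intro nrm_add G.conv_measurable um m)
  also have "\<dots> <= 2 * (A * A * B * (nG dt F * nG dt G * (nG dt H * nG dt I)) +
   A * A * B * (nG dt H * nG dt I * (nG dt F * nG dt G)))"
   by (intro mult_left_mono add_mono one m) auto
  also have "\<dots> = C * (nG dt F * nG dt G * nG dt H * nG dt I)"
   unfolding C_def by (simp only: distrib_left distrib_right mult_ac)
  finally show ?thesis unfolding u_def .
 qed
 have "C < \<infinity>" using A(1) B(1) by (simp add: C_def ennreal_mult_less_top)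
 with main show ?thesis by blast
qed

section \<open>Trigonometric polynomials and their coefficients\<close>

lemma cis_has_vector_derivative:
 "((%x. cis (a * x)) has_vector_derivative (\<i> * of_real a * cis (a * x))) (at x within S)"
 unfolding has_vector_derivative_def by (auto intro!: derivative_eq_intros simp: scaleR_conv_of_real mult_ac)


lemma cis_orthogonality:
 assumes dt: "dt > 0"
 shows "has_bochner_integral lborel (%x. indicator {a..a + 2 * pi / dt} x *\<^sub>R cis (of_int n * dt * x))
  (if n = 0 then of_real (2 * pi / dt) else 0)"
proof -
 have le: "a <= a + 2 * pi / dt" using dt by simp
 show ?thesis
 proof (cases "n = 0")
  case True
  have "has_bochner_integral lborel (%x. indicator {a..a + 2 * pi / dt} x *\<^sub>R (1::complex)) (of_real (a + 2 * pi / dt) - of_real a)"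
   by (rule has_bochner_integral_FTC_Icc[OF le, where F = of_real])
    (auto intro!: derivative_eq_intros simp: has_vector_derivative_def scaleR_conv_of_real)
  then show ?thesis using True by simp
 next
  case False
  let ?F = "%x. cis (of_int n * dt * x) / (\<i> * of_real (of_int n * dt))"
  have nz: "\<i> * of_real (of_int n * dt) \<noteq> 0" using False dt by simp
  have "has_bochner_integral lborel (%x. indicator {a..a + 2 * pi / dt} x *\<^sub>R cis (of_int n * dt * x)) (?F (a + 2 * pi / dt) - ?F a)"
  proof (rule has_bochner_integral_FTC_Icc[OF le, where F = ?F])
   fix x
   have "(?F has_vector_derivative (\<i> * of_real (of_int n * dt) * cis (of_int n * dt * x)) / (\<i> * of_real (of_int n * dt))) (at x within {a..a + 2 * pi / dt})"
    by (rule has_vector_derivative_divide[OF cis_has_vector_derivative])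
   then show "(?F has_vector_derivative cis (of_int n * dt * x)) (at x within {a..a + 2 * pi / dt})"
    unfolding nonzero_mult_div_cancel_left[OF nz] .
  qed (intro continuous_intros)
  moreover have "of_int n * dt * (a + 2 * pi / dt) = of_int n * dt * a + 2 * pi * of_int n" using dt by (simp add: field_simps)
  then have "cis (of_int n * dt * (a + 2 * pi / dt)) = cis (of_int n * dt * a)" by (simp flip: cis_mult)
  ultimately show ?thesis using False by simp
 qed
qed

text \<open>The period \<open>2 * pi / dt\<close> serves twice: \<open>dt = 1\<close> gives Fourier
  coefficients on the torus, the time step gives inversion and Parseval for the transform in
  time.\<close>

lemma has_bochner_integral_trig:
 assumes dt: "dt > 0" and fin: "finite A" "finite B"
 shows "has_bochner_integral lborel (%x. indicator {a..a + 2 * pi / dt} x *\<^sub>R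
   ((\<Sum>m\<in>A. p m * cis (of_int m * dt * x)) * (\<Sum>n\<in>B. q n * cis (- (of_int n * dt * x)))))
  (of_real (2 * pi / dt) * (\<Sum>m\<in>A \<inter> B. p m * q m))"
proof -
 let ?I = "%x. indicator {a..a + 2 * pi / dt} x :: real"
 have eq: "?I x *\<^sub>R ((\<Sum>m\<in>A. p m * cis (of_int m * dt * x)) * (\<Sum>n\<in>B. q n * cis (- (of_int n * dt * x)))) =
  (\<Sum>m\<in>A. \<Sum>n\<in>B. p m * q n * (?I x *\<^sub>R cis (of_int (m - n) * dt * x)))" for x
 proof -
  have "cis (of_int (m - n) * dt * x) = cis (of_int m * dt * x) * cis (- (of_int n * dt * x))" for m n
   by (simp add: cis_mult algebra_simps)
  note c = this
  show ?thesis unfolding c sum_product scaleR_conv_of_real by (simp only: sum_distrib_left sum_distrib_right mult_ac)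
 qed
 have "has_bochner_integral lborel (%x. \<Sum>m\<in>A. \<Sum>n\<in>B. p m * q n * (?I x *\<^sub>R cis (of_int (m - n) * dt * x)))
  (\<Sum>m\<in>A. \<Sum>n\<in>B. p m * q n * (if m - n = 0 then of_real (2 * pi / dt) else 0))"
  by (intro has_bochner_integral_sum has_bochner_integral_mult_right cis_orthogonality[OF dt])
 also have "(\<Sum>m\<in>A. \<Sum>n\<in>B. p m * q n * (if m - n = 0 then of_real (2 * pi / dt) else 0)) =
  (\<Sum>m\<in>A. \<Sum>n\<in>B. if m = n then of_real (2 * pi / dt) * (p m * q m) else 0)"
  by (intro sum.cong refl) auto
 also have "\<dots> = (\<Sum>m\<in>A. if m \<in> B then of_real (2 * pi / dt) * (p m * q m) else 0)"
  using fin by (simp add: sum.delta')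
 also have "\<dots> = of_real (2 * pi / dt) * (\<Sum>m\<in>A \<inter> B. p m * q m)"
  unfolding sum_distrib_left by (rule sum.inter_restrict[OF fin(1), symmetric])
 finally show ?thesis unfolding eq .
qed

lemma Parseval_trig:
 assumes dt: "dt > 0" and fin: "finite A"
 shows "has_bochner_integral lborel (%x. indicator {a..a + 2 * pi / dt} x * (norm (\<Sum>m\<in>A. p m * cis (of_int m * dt * x)))\<^sup>2)
  (2 * pi / dt * (\<Sum>m\<in>A. (norm (p m))\<^sup>2))"
proof -
 let ?f = "%x. (\<Sum>m\<in>A. p m * cis (of_int m * dt * x))"
 have c: "(\<Sum>n\<in>A. cnj (p n) * cis (- (of_int n * dt * x))) = cnj (?f x)" for x
  by (simp add: cis_cnj)
 have n: "z * cnj z = of_real ((norm z)\<^sup>2)" for z by (rule complex_norm_square[symmetric])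
 have "has_bochner_integral lborel (%x. indicator {a..a + 2 * pi / dt} x *\<^sub>R (?f x * cnj (?f x))) (of_real (2 * pi / dt) * (\<Sum>m\<in>A \<inter> A. p m * cnj (p m)))"
  using has_bochner_integral_trig[OF dt fin fin, of a p "%m. cnj (p m)"] unfolding c .
 then have "has_bochner_integral lborel (%x. Re (indicator {a..a + 2 * pi / dt} x *\<^sub>R (?f x * cnj (?f x)))) (Re (of_real (2 * pi / dt) * (\<Sum>m\<in>A \<inter> A. p m * cnj (p m))))"
  by (rule has_bochner_integral_Re)
 then show ?thesis unfolding n by (simp add: scaleR_conv_of_real)
qed

lemma Parseval_trig':
 assumes dt: "dt > 0" and fin: "finite A"
 shows "has_bochner_integral lborel (%x. indicator {a..a + 2 * pi / dt} x * (norm (\<Sum>m\<in>A. p m * cis (- (of_int m * dt * x))))\<^sup>2)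
  (2 * pi / dt * (\<Sum>m\<in>A. (norm (p m))\<^sup>2))"
proof -
 have "norm (\<Sum>m\<in>A. p m * cis (- (of_int m * dt * x))) = norm (\<Sum>m\<in>A. cnj (p m) * cis (of_int m * dt * x))" for x
  by (subst complex_mod_cnj[symmetric]) (simp add: cis_cnj)
 then show ?thesis using Parseval_trig[OF assms, of a "%m. cnj (p m)"] by simp
qed

definition tp :: "int set => (int => complex) => real => complex" where
 "tp K c x = (\<Sum>k\<in>K. c k * cis (of_int k * x))"

lemma fourier_coeff_tp:
 assumes "finite K" shows "fc (tp K c) k = (if k \<in> K then c k else 0)"
proof -
 have "has_bochner_integral lborel (%x. indicator {- pi..- pi + 2 * pi / 1} x *\<^sub>R
   ((\<Sum>m\<in>K. c m * cis (of_int m * 1 * x)) * (\<Sum>n\<in>{k}. 1 * cis (- (of_int n * 1 * x)))))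
  (of_real (2 * pi / 1) * (\<Sum>m\<in>K \<inter> {k}. c m * 1))"
  by (rule has_bochner_integral_trig) (use assms in auto)
 then have "has_bochner_integral lborel (%x. indicator {- pi..pi} x *\<^sub>R (tp K c x * cis (- (of_int k * x))))
  (of_real (2 * pi) * (\<Sum>m\<in>K \<inter> {k}. c m))"
  by (simp add: tp_def)
 then have "(LINT x:{-pi..pi}|lborel. tp K c x * cis (- (real_of_int k * x))) = of_real (2 * pi) * (\<Sum>m\<in>K \<inter> {k}. c m)"
  unfolding set_lebesgue_integral_def by (rule has_bochner_integral_integral_eq)
 then show ?thesis by (auto simp: fourier_coeff_def)
qed

lemma fourier_coeff_0 [simp]: "fc (%x. 0) k = 0"
 by (simp add: fourier_coeff_def set_lebesgue_integral_def)

definition tpoly :: "(real => complex) => bool" where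
 "tpoly f \<longleftrightarrow> (\<exists>K c. finite K \<and> f = tp K c)"

lemma tpoly_tp: "finite K ==> tpoly (tp K c)" by (auto simp: tpoly_def)

lemma tpoly_finite: assumes "tpoly f" shows "finite {k. fc f k \<noteq> 0}"
 using assms unfolding tpoly_def
 by (auto simp: fourier_coeff_tp intro: finite_subset[rotated])

lemma tpoly_expand:
 assumes "tpoly f" "finite K" "\<And>k. k \<notin> K ==> fc f k = 0"
 shows "f = tp K (fc f)"
proof -
 obtain L c where L: "finite L" "f = tp L c" using assms(1) by (auto simp: tpoly_def)
 have "f x = tp K (fc f) x" for x
 proof -
  have fc: "fc f k = (if k \<in> L then c k else 0)" for k using L by (simp add: fourier_coeff_tp)
  have "f x = (\<Sum>k\<in>L. fc f k * cis (of_int k * x))" by (simp add: L(2) tp_def fc[unfolded L(2)])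
  also have "\<dots> = (\<Sum>k\<in>K. fc f k * cis (of_int k * x))"
   by (rule sum.same_carrier[of "K \<union> L", THEN iffD2]) (use assms(2,3) L fc in auto)
  finally show ?thesis by (simp add: tp_def)
 qed
 then show ?thesis ..
qed

lemma fourier_coeff_mult:
 assumes f: "tpoly f" and g: "tpoly g" and K: "finite K" "\<And>k. k \<notin> K ==> fc f k = 0"
 shows "tpoly (%x. f x * g x)" "fc (%x. f x * g x) k = (\<Sum>p\<in>K. fc f p * fc g (k - p))"
proof -
 define L where "L = {k. fc g k \<noteq> 0}"
 have L: "finite L" using tpoly_finite[OF g] by (simp add: L_def)
 define M where "M = (%(p, q). p + q) ` (K \<times> L)"
 have M: "finite M" using K L by (simp add: M_def)
 define e where "e j = (\<Sum>p\<in>K. fc f p * fc g (j - p))" for j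
 have "f x * g x = tp M e x" for x
 proof -
  have "f x * g x = (\<Sum>p\<in>K. \<Sum>q\<in>L. fc f p * (fc g q * cis (of_int (p + q) * x)))"
   using arg_cong[OF tpoly_expand[OF f K], of "%h. h x"] arg_cong[OF tpoly_expand[OF g L], of "%h. h x"]
   by (simp add: tp_def L_def sum_product distrib_right distrib_left mult_ac flip: cis_mult)
  also have "\<dots> = (\<Sum>p\<in>K. \<Sum>j\<in>M. fc f p * (fc g (j - p) * cis (of_int j * x)))"
  proof (rule sum.cong[OF refl])
   fix p assume p: "p \<in> K"
   have "(\<Sum>q\<in>L. fc f p * (fc g q * cis (of_int (p + q) * x))) =
    (\<Sum>j\<in>(+) p ` L. fc f p * (fc g (j - p) * cis (of_int j * x)))"
    by (subst sum.reindex) auto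
   also have "\<dots> = (\<Sum>j\<in>M. fc f p * (fc g (j - p) * cis (of_int j * x)))"
   proof (rule sum.mono_neutral_left[OF M])
    show "(+) p ` L \<subseteq> M" using p by (auto simp: M_def)
    show "\<forall>j\<in>M - (+) p ` L. fc f p * (fc g (j - p) * cis (of_int j * x)) = 0"
    proof
     fix j assume "j \<in> M - (+) p ` L"
     then have "j - p \<notin> L" by (metis DiffD2 add_diff_cancel_left' diff_add_cancel image_eqI add.commute)
     then show "fc f p * (fc g (j - p) * cis (of_int j * x)) = 0" by (simp add: L_def)
    qed
   qed
   finally show "(\<Sum>q\<in>L. fc f p * (fc g q * cis (of_int (p + q) * x))) =
    (\<Sum>j\<in>M. fc f p * (fc g (j - p) * cis (of_int j * x)))" .
  qed
  also have "\<dots> = tp M e x" unfolding tp_def e_def sum_distrib_right by (subst sum.swap) (simp only: mult_ac)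
  finally show ?thesis .
 qed
 then have eq: "(%x. f x * g x) = tp M e" ..
 show "tpoly (%x. f x * g x)" unfolding eq by (rule tpoly_tp[OF M])
 have "e k = 0" if "k \<notin> M"
 proof -
  have "fc g (k - p) = 0" if "p \<in> K" for p
  proof (rule ccontr)
   assume "fc g (k - p) \<noteq> 0"
   then have "(p, k - p) \<in> K \<times> L" using \<open>p \<in> K\<close> by (simp add: L_def)
   then have "p + (k - p) \<in> M" unfolding M_def by (metis (mono_tags, lifting) case_prod_conv image_eqI)
   then show False using \<open>k \<notin> M\<close> by simp
  qed
  then show ?thesis by (simp add: e_def)
 qed
 then show "fc (%x. f x * g x) k = (\<Sum>p\<in>K. fc f p * fc g (k - p))"
  unfolding eq fourier_coeff_tp[OF M] by (auto simp: e_def)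
qed

lemma fourier_coeff_conj_fun: "fc (conj_fun f) k = cnj (fc f (- k))"
proof -
 have "indicator {-pi..pi} x *\<^sub>R (cnj (f x) * cis (- (of_int k * x))) = cnj (indicator {-pi..pi} x *\<^sub>R (f x * cis (- (of_int (- k) * x))))" for x :: real
  by (simp add: cis_cnj)
 then have "(LINT x|lborel. indicator {-pi..pi} x *\<^sub>R (cnj (f x) * cis (- (of_int k * x)))) = cnj (LINT x|lborel. indicator {-pi..pi} x *\<^sub>R (f x * cis (- (of_int (- k) * x))))"
  by (subst Bochner_Integration.integral_cnj[symmetric]) (simp only:)
 then show ?thesis unfolding fourier_coeff_def set_lebesgue_integral_def conj_fun_def by simp
qed

lemma Proj_tp: "Proj dt f = tp (Kf dt) (fc f)"
 by (rule ext) (simp add: Proj_def tp_def Kf_def)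

lemma ddx_tp: assumes "finite K" shows "ddx (tp K c) = tp K (%k. \<i> * of_int k * c k)"
proof
 fix x
 have "(tp K c has_vector_derivative (\<Sum>k\<in>K. c k * (\<i> * of_real (of_int k) * cis (of_int k * x)))) (at x)"
  unfolding tp_def[abs_def] by (intro has_vector_derivative_sum has_vector_derivative_mult_right cis_has_vector_derivative)
 then show "ddx (tp K c) x = tp K (%k. \<i> * of_int k * c k) x"
  unfolding ddx_def by (simp add: vector_derivative_at tp_def mult_ac)
qed

lemma conj_fun_tpoly: assumes "tpoly f" shows "tpoly (conj_fun f)"
proof -
 obtain K c where K: "finite K" "f = tp K c" using assms by (auto simp: tpoly_def)
 have "conj_fun f = tp (uminus ` K) (%k. cnj (c (- k)))"
  unfolding K(2) conj_fun_def tp_def by (rule ext) (simp add: sum.reindex cis_cnj)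
 then show ?thesis using K(1) tpoly_tp by auto
qed

section \<open>The discrete space-time transform and its norms\<close>

lemma tilde_finite:
 assumes "finite S" "\<And>m. m \<notin> S ==> fc (v m) k = 0"
 shows "tilde dt v \<sigma> k = of_real dt * (\<Sum>m\<in>S. fc (v m) k * cis (- (of_int m * dt * \<sigma>)))"
proof -
 have "(\<Sum>\<^sub>\<infinity>m. fc (v m) k * cis (- (real_of_int m * dt * \<sigma>))) = (\<Sum>\<^sub>\<infinity>m\<in>S. fc (v m) k * cis (- (real_of_int m * dt * \<sigma>)))"
  by (rule infsum_cong_neutral) (use assms in auto)
 then show ?thesis using assms by (simp add: tilde_def)
qed

text \<open>Finite support in time turns the unordered infinite sum in \<open>tilde\<close> into a
  finite one.\<close>

definition fsup :: "int set => (int => real => complex) => bool" where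
 "fsup S v \<longleftrightarrow> finite S \<and> (\<forall>m. m \<notin> S --> v m = (%x. 0))"

definition gd :: "int set => (int => real => complex) => bool" where
 "gd S v \<longleftrightarrow> fsup S v \<and> (\<forall>m. tpoly (v m))"

definition tf :: "real => (int => real => complex) => gf" where
 "tf dt v p = en (norm (tilde dt v (snd p) (fst p)))"

lemma tilde_fsup: "fsup S v ==> tilde dt v \<sigma> k = of_real dt * (\<Sum>m\<in>S. fc (v m) k * cis (- (of_int m * dt * \<sigma>)))"
 by (intro tilde_finite) (auto simp: fsup_def)

context time_step begin

lemma cis_int_measurable [measurable]: "(%\<sigma>. cis (- (of_int m * dt * \<sigma>))) \<in> bC dt"
proof -
 have "cis (- (of_int m * dt * \<sigma>)) = (if m \<ge> 0 then cnj (cis (dt * \<sigma>) ^ nat m) else cis (dt * \<sigma>) ^ nat (- m))" for \<sigma>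
 proof -
  have "cis (dt * \<sigma>) ^ n = cis (real n * dt * \<sigma>)" for n by (simp only: Complex.DeMoivre mult.assoc)
  then show ?thesis by (simp add: cis_cnj del: complex_cnj_power)
 qed
 moreover have "(%\<sigma>. if m \<ge> 0 then cnj (cis (dt * \<sigma>) ^ nat m) else cis (dt * \<sigma>) ^ nat (- m)) \<in> bC dt"
  by measurable
 ultimately show ?thesis by simp
qed

lemma tilde_measurable: assumes "fsup S y" shows "(%\<sigma>. tilde dt y \<sigma> k) \<in> bC dt"
 unfolding tilde_fsup[OF assms] by measurable

lemma tf_measurable: assumes "fsup S y" shows "tf dt y \<in> bG dt"
 unfolding tf_def by (rule Gam_measurableI) (use tilde_measurable[OF assms] in simp)

text \<open>Orthogonality turns the sum over time steps into an integral over the circle, and the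
  normalisation of \<open>tilde\<close> leaves the factor \<open>1 / (2 * pi)\<close>. Taking
  absolute values makes it an inequality.\<close>

lemma tf_mult:
 assumes u: "gd S u" and w: "gd S w"
 shows "gd S (%m x. u m x * w m x)" "tf dt (%m x. u m x * w m x) p <= en (1 / (2 * pi)) * G.conv (tf dt u) (tf dt w) p"
proof -
 have S: "finite S" and fu: "fsup S u" and fw: "fsup S w" using u w by (auto simp: gd_def fsup_def)
 define K where "K = (\<Union>m\<in>S. {k. fc (u m) k \<noteq> 0})"
 have K: "finite K" using S u by (auto simp: K_def gd_def intro!: tpoly_finite)
 have K0: "fc (u m) k = 0" if "k \<notin> K" for m k
  using that fu by (cases "m \<in> S") (auto simp: K_def fsup_def)
 have fc: "fc (%x. u m x * w m x) k = (\<Sum>j\<in>K. fc (u m) j * fc (w m) (k - j))" for m k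
  by (rule fourier_coeff_mult) (use u w K K0 in \<open>auto simp: gd_def\<close>)
 show g: "gd S (%m x. u m x * w m x)"
  using u w fourier_coeff_mult(1)[OF _ _ K K0] by (auto simp: gd_def fsup_def)
 then have fp: "fsup S (%m x. u m x * w m x)" by (simp add: gd_def)
 obtain k \<sigma> where p: "p = (k, \<sigma>)" by (cases p)
 define T where "T j = of_real dt * (\<Sum>m\<in>S. fc (u m) j * fc (w m) (k - j) * cis (- (of_int m * dt * \<sigma>)))" for j
 have til: "tilde dt (%m x. u m x * w m x) \<sigma> k = (\<Sum>j\<in>K. T j)"
  unfolding tilde_fsup[OF fp] T_def fc sum_distrib_left[symmetric] sum_distrib_right by (subst sum.swap) simp
 have T: "en (norm (T j)) <= en (1 / (2 * pi)) * (\<integral>\<^sup>+s. tf dt u (j, s) * tf dt w (k - j, \<sigma> - s) \<partial>circ dt)" for j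
 proof -
  let ?I = "%s. indicator {-pi/dt..-pi/dt + 2*pi/dt} s :: real"
  have "has_bochner_integral lborel (%s. ?I s *\<^sub>R
   ((\<Sum>n\<in>S. of_real dt * fc (w n) (k - j) * cis (- (of_int n * dt * \<sigma>)) * cis (of_int n * dt * s)) *
    (\<Sum>m\<in>S. of_real dt * fc (u m) j * cis (- (of_int m * dt * s)))))
   (of_real (2 * pi / dt) * (\<Sum>m\<in>S \<inter> S. (of_real dt * fc (w m) (k - j) * cis (- (of_int m * dt * \<sigma>))) * (of_real dt * fc (u m) j)))"
   by (rule has_bochner_integral_trig[OF tau_pos S S])
  also have "(%s. ?I s *\<^sub>R
   ((\<Sum>n\<in>S. of_real dt * fc (w n) (k - j) * cis (- (of_int n * dt * \<sigma>)) * cis (of_int n * dt * s)) *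
    (\<Sum>m\<in>S. of_real dt * fc (u m) j * cis (- (of_int m * dt * s))))) =
   (%s. ?I s *\<^sub>R (tilde dt u s j * tilde dt w (\<sigma> - s) (k - j)))"
  proof
   fix s
   have "cis (- (of_int n * dt * (\<sigma> - s))) = cis (- (of_int n * dt * \<sigma>)) * cis (of_int n * dt * s)" for n
    by (simp add: cis_mult algebra_simps)
   then have a: "(\<Sum>n\<in>S. of_real dt * fc (w n) (k - j) * cis (- (of_int n * dt * \<sigma>)) * cis (of_int n * dt * s)) = tilde dt w (\<sigma> - s) (k - j)"
    unfolding tilde_fsup[OF fw] sum_distrib_left by (simp only: mult_ac)
   have b: "(\<Sum>m\<in>S. of_real dt * fc (u m) j * cis (- (of_int m * dt * s))) = tilde dt u s j"
    unfolding tilde_fsup[OF fu] sum_distrib_left by (simp only: mult_ac)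
   show "?I s *\<^sub>R
   ((\<Sum>n\<in>S. of_real dt * fc (w n) (k - j) * cis (- (of_int n * dt * \<sigma>)) * cis (of_int n * dt * s)) *
    (\<Sum>m\<in>S. of_real dt * fc (u m) j * cis (- (of_int m * dt * s)))) = ?I s *\<^sub>R (tilde dt u s j * tilde dt w (\<sigma> - s) (k - j))"
    unfolding a b by (simp only: mult.commute)
  qed
  also have "(\<Sum>m\<in>S \<inter> S. (of_real dt * fc (w m) (k - j) * cis (- (of_int m * dt * \<sigma>))) * (of_real dt * fc (u m) j)) = of_real dt * T j"
   unfolding T_def sum_distrib_left by (simp add: mult_ac)
  also have "of_real (2 * pi / dt) * (of_real dt * T j) = of_real (2 * pi) * T j" using tau_pos by simp
  finally have hb: "has_bochner_integral lborel (%s. ?I s *\<^sub>R (tilde dt u s j * tilde dt w (\<sigma> - s) (k - j))) (of_real (2 * pi) * T j)" .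
  have "-pi/dt + 2*pi/dt = pi/dt" by (simp add: add_divide_distrib[symmetric])
  have sh: "(%s. \<sigma> - s) \<in> circ dt \<rightarrow>\<^sub>M circ dt" by measurable
  have "(%s. tf dt u (j, s) * tf dt w (k - j, \<sigma> - s)) \<in> bC dt"
   by (rule borel_measurable_times_ennreal[OF Gam_Pair[OF tf_measurable[OF fu]] measurable_compose[OF sh Gam_Pair[OF tf_measurable[OF fw]]]])
  note c = nn_integral_circ[OF this]
  have "en (norm (of_real (2 * pi) * T j)) <= (\<integral>\<^sup>+s. en (norm (?I s *\<^sub>R (tilde dt u s j * tilde dt w (\<sigma> - s) (k - j)))) \<partial>lborel)"
   by (rule has_bochner_integral_norm_bound[OF hb])
  also have "\<dots> = (\<integral>\<^sup>+s. tf dt u (j, s) * tf dt w (k - j, \<sigma> - s) \<partial>circ dt)"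
   unfolding c \<open>-pi/dt + 2*pi/dt = pi/dt\<close>
   by (intro nn_integral_cong) (auto simp: tf_def norm_mult ennreal_mult split: split_indicator)
  finally have "en (1 / (2 * pi)) * en (norm (of_real (2 * pi) * T j)) <= en (1 / (2 * pi)) * (\<integral>\<^sup>+s. tf dt u (j, s) * tf dt w (k - j, \<sigma> - s) \<partial>circ dt)"
   by (intro mult_left_mono) auto
  then show ?thesis by (simp add: norm_mult flip: ennreal_mult)
 qed
 note [measurable] = tf_measurable[OF fu] tf_measurable[OF fw]
 have "tf dt (%m x. u m x * w m x) p <= (\<Sum>j\<in>K. en (norm (T j)))"
  unfolding tf_def p til fst_conv snd_conv by (subst sum_ennreal) (auto intro!: ennreal_leI norm_sum)
 also have "\<dots> <= (\<Sum>j\<in>K. en (1 / (2 * pi)) * (\<integral>\<^sup>+s. tf dt u (j, s) * tf dt w (k - j, \<sigma> - s) \<partial>circ dt))"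
  by (intro sum_mono T)
 also have "\<dots> = en (1 / (2 * pi)) * (\<integral>\<^sup>+j. (\<integral>\<^sup>+s. tf dt u (j, s) * tf dt w (k - j, \<sigma> - s) \<partial>circ dt) \<partial>count_space K)"
  by (simp only: nn_integral_count_space_finite[OF K] sum_distrib_left)
 also have "\<dots> <= en (1 / (2 * pi)) * (SI j. (\<integral>\<^sup>+s. tf dt u (j, s) * tf dt w (k - j, \<sigma> - s) \<partial>circ dt))"
  by (intro mult_left_mono) (auto simp: nn_integral_count_space_indicator intro!: nn_integral_mono split: split_indicator)
 also have "(SI j. (\<integral>\<^sup>+s. tf dt u (j, s) * tf dt w (k - j, \<sigma> - s) \<partial>circ dt)) = G.conv (tf dt u) (tf dt w) p"
  unfolding G.conv_def p by (subst nn_integral_Gam[OF tau_pos]) auto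
 finally show "tf dt (%m x. u m x * w m x) p <= en (1 / (2 * pi)) * G.conv (tf dt u) (tf dt w) p" .
qed

lemma tf_Proj:
 assumes "fsup S y"
 shows "gd S (%m. Proj dt (y m))" "tf dt (%m. Proj dt (y m)) p = chi dt p * tf dt y p"
proof -
 show g: "gd S (%m. Proj dt (y m))"
  using assms by (auto simp: gd_def fsup_def Proj_tp tpoly_tp[OF finite_Kf]) (simp add: tp_def[abs_def])
 then have f: "fsup S (%m. Proj dt (y m))" by (simp add: gd_def)
 show "tf dt (%m. Proj dt (y m)) p = chi dt p * tf dt y p"
  unfolding tf_def tilde_fsup[OF f] tilde_fsup[OF assms]
  by (auto simp: Proj_tp fourier_coeff_tp[OF finite_Kf] chi_def)
qed

lemma tf_conj_fun:
 assumes "fsup S y"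
 shows "fsup S (%m. conj_fun (y m))" "tf dt (%m. conj_fun (y m)) = G.rfl (tf dt y)"
proof -
 show f: "fsup S (%m. conj_fun (y m))"
  using assms by (auto simp: fsup_def conj_fun_def[abs_def])
 show "tf dt (%m. conj_fun (y m)) = G.rfl (tf dt y)"
 proof
  fix p :: "int \<times> real"
  have "tilde dt (%m. conj_fun (y m)) (snd p) (fst p) = cnj (tilde dt y (- snd p) (- fst p))"
   unfolding tilde_fsup[OF f] tilde_fsup[OF assms] by (simp add: fourier_coeff_conj_fun cis_cnj)
  then show "tf dt (%m. conj_fun (y m)) p = G.rfl (tf dt y) p" by (simp add: tf_def G.rfl_def)
 qed
qed

lemma tf_ddx_Proj:
 assumes "fsup S y"
 shows "gd S (%m. ddx (Proj dt (y m)))" "tf dt (%m. ddx (Proj dt (y m))) p = en \<bar>of_int (fst p)\<bar> * (chi dt p * tf dt y p)"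
proof -
 have d: "ddx (Proj dt (y m)) = tp (Kf dt) (%k. \<i> * of_int k * fc (y m) k)" for m
  unfolding Proj_tp by (rule ddx_tp[OF finite_Kf])
 show g: "gd S (%m. ddx (Proj dt (y m)))"
  unfolding d using assms by (auto simp: gd_def fsup_def tpoly_tp[OF finite_Kf]) (simp add: tp_def[abs_def])
 then have f: "fsup S (%m. ddx (Proj dt (y m)))" by (simp add: gd_def)
 have "tilde dt (%m. ddx (Proj dt (y m))) (snd p) (fst p) = (if fst p \<in> Kf dt then \<i> * of_int (fst p) * tilde dt y (snd p) (fst p) else 0)"
  unfolding tilde_fsup[OF f] tilde_fsup[OF assms]
  by (auto simp: d fourier_coeff_tp[OF finite_Kf] sum_distrib_left mult_ac)
 then show "tf dt (%m. ddx (Proj dt (y m))) p = en \<bar>of_int (fst p)\<bar> * (chi dt p * tf dt y p)"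
  unfolding tf_def by (auto simp: chi_def norm_mult ennreal_mult)
qed

text \<open>The exponents change sign because positive exponents of \<open>wgt\<close> mean
  decay.\<close>

lemma X_norm_eq:
 assumes "fsup S y" shows "X_norm dt s b y = nG dt (%p. wgt dt (- s) (- b) sq p * tf dt y p)"
proof -
 note [measurable] = tf_measurable[OF assms]
 have sqr: "(wgt dt (- s) (- b) sq (k, \<sigma>) * tf dt y (k, \<sigma>))\<^sup>2 = ennreal
    (japanese (real_of_int k) powr (2 * s) * japanese (d_tau dt (\<sigma> + (real_of_int k)\<^sup>2)) powr (2 * b) * (norm (tilde dt y \<sigma> k))\<^sup>2)" for k \<sigma>
  unfolding power_mult_distrib wgt_sq
  by (simp add: wgt_def tf_def W_def sq_def ennreal_power ennreal_mult)
 have M: "(%p. (wgt dt (- s) (- b) sq p * tf dt y p)\<^sup>2) \<in> bG dt" by measurable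
 show ?thesis
  unfolding X_norm_def nrm_def nn_integral_Gam[OF tau_pos M]
  unfolding nn_integral_circ[OF Gam_Pair[OF M]]
  unfolding sqr ..
qed

lemma Y_norm_eq:
 assumes "fsup S y"
 shows "Y_norm dt s b y = nrm (cZ) (%k. \<integral>\<^sup>+\<sigma>. wgt dt (- s) (- b) sq (k, \<sigma>) * tf dt y (k, \<sigma>) \<partial>circ dt)"
proof -
 note [measurable] = tf_measurable[OF assms]
 have sqr: "wgt dt (- s) (- b) sq (k, \<sigma>) * tf dt y (k, \<sigma>) = ennreal
    (japanese (real_of_int k) powr s * japanese (d_tau dt (\<sigma> + (real_of_int k)\<^sup>2)) powr b * norm (tilde dt y \<sigma> k))" for k \<sigma>
  by (simp add: wgt_def tf_def W_def sq_def ennreal_mult)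
 have m: "(%\<sigma>. wgt dt (- s) (- b) sq (k, \<sigma>) * tf dt y (k, \<sigma>)) \<in> bC dt" for k
  using Gam_Pair[of "%p. wgt dt (- s) (- b) sq p * tf dt y p"] by measurable
 show ?thesis
  unfolding Y_norm_def nrm_def nn_integral_circ[OF m] unfolding sqr ..
qed

end

section \<open>The gain from a short time window\<close>

definition grid :: "real => real => int set" where
 "grid dt T1 = {m. \<bar>real_of_int m * dt\<bar> <= 2 * T1}"

text \<open>There are at most \<open>4 * T1 / dt + 1\<close> grid points, and
  \<open>dt <= 2 * T1\<close> bounds the summand 1 by \<open>2 * T1 / dt\<close>.\<close>

lemma grid_card:
 assumes "0 < dt" "dt <= 2 * T1"
 shows "finite (grid dt T1)" "real (card (grid dt T1)) * dt <= 6 * T1"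
proof -
 let ?n = "\<lfloor>2 * T1 / dt\<rfloor>"
 have n: "?n \<ge> 0" using assms by simp
 have sub: "grid dt T1 \<subseteq> {- ?n..?n}"
 proof
  fix m assume "m \<in> grid dt T1"
  then have "\<bar>real_of_int m\<bar> <= 2 * T1 / dt" using assms by (simp add: grid_def abs_mult field_simps)
  then have "real_of_int m <= 2 * T1 / dt" "real_of_int (- m) <= 2 * T1 / dt" by auto
  then have "m <= ?n" "- m <= ?n" unfolding le_floor_iff by auto
  then show "m \<in> {- ?n..?n}" by auto
 qed
 show "finite (grid dt T1)" by (rule finite_subset[OF sub]) simp
 have "card (grid dt T1) <= card {- ?n..?n}" by (rule card_mono[OF _ sub]) simp
 also have "real (card {- ?n..?n}) = 2 * real_of_int ?n + 1" using n by simp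
 also have "\<dots> <= 2 * (2 * T1 / dt) + 2 * T1 / dt" using assms by (intro add_mono mult_left_mono) auto
 finally have "real (card (grid dt T1)) <= 2 * (2 * T1 / dt) + 2 * T1 / dt" by simp
 then show "real (card (grid dt T1)) * dt <= 6 * T1" using assms by (simp add: field_simps)
qed

lemma fsup_grid: "0 < dt ==> dt <= 2 * T1 ==> supported_on_grid dt T1 w ==> fsup (grid dt T1) w"
 unfolding fsup_def using grid_card(1) by (auto simp: grid_def supported_on_grid_def fun_eq_iff)

context time_step begin

lemma tf_Parseval:
 assumes "fsup S y"
 shows "(\<integral>\<^sup>+\<sigma>. (tf dt y (k, \<sigma>))\<^sup>2 \<partial>circ dt) = en (2 * pi / dt * (\<Sum>m\<in>S. (norm (of_real dt * fc (y m) k))\<^sup>2))"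
proof -
 have S: "finite S" using assms by (simp add: fsup_def)
 have eq: "(tf dt y (k, \<sigma>))\<^sup>2 = en ((norm (\<Sum>m\<in>S. of_real dt * fc (y m) k * cis (- (of_int m * dt * \<sigma>))))\<^sup>2)" for \<sigma>
  unfolding tf_def tilde_fsup[OF assms] fst_conv snd_conv sum_distrib_left by (simp add: ennreal_power mult.assoc)
 have m: "(%\<sigma>. (tf dt y (k, \<sigma>))\<^sup>2) \<in> bC dt"
  by (intro borel_measurable_power_ennreal Gam_Pair tf_measurable[OF assms])
 have e: "-pi/dt + 2*pi/dt = pi/dt" by (simp add: add_divide_distrib[symmetric])
 let ?g = "%\<sigma>. indicator {-pi/dt..pi/dt} \<sigma> * (norm (\<Sum>m\<in>S. of_real dt * fc (y m) k * cis (- (of_int m * dt * \<sigma>))))\<^sup>2"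
 have hb: "has_bochner_integral lborel ?g (2 * pi / dt * (\<Sum>m\<in>S. (norm (of_real dt * fc (y m) k))\<^sup>2))"
  using Parseval_trig'[OF tau_pos S, of "-pi/dt" "%m. of_real dt * fc (y m) k"] unfolding e .
 have "(\<integral>\<^sup>+\<sigma>. (tf dt y (k, \<sigma>))\<^sup>2 \<partial>circ dt) = (\<integral>\<^sup>+\<sigma>. en (?g \<sigma>) \<partial>lborel)"
  unfolding nn_integral_circ[OF m] unfolding eq by (intro nn_integral_cong) (auto split: split_indicator)
 also have "\<dots> = en (integral\<^sup>L lborel ?g)"
  by (rule nn_integral_eq_integral) (use hb in \<open>auto simp: has_bochner_integral_iff\<close>)
 finally show ?thesis using has_bochner_integral_integral_eq[OF hb] by simp
qed

text \<open>The uncertainty principle: the transform at a point is a sum over the time steps in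
  \<open>S\<close>, so Cauchy-Schwarz and Parseval bound its square by \<open>card S * dt\<close>
  times its integrated square, up to \<open>2 * pi\<close>. On the grid \<open>card S * dt\<close>
  is \<open>O(T1)\<close>.\<close>

lemma tf_sup:
 assumes "fsup S y"
 shows "(tf dt y (k, \<sigma>))\<^sup>2 <= en (real (card S) * dt / (2 * pi)) * (\<integral>\<^sup>+s. (tf dt y (k, s))\<^sup>2 \<partial>circ dt)"
proof -
 let ?c = "%m. norm (of_real dt * fc (y m) k)"
 have "norm (tilde dt y \<sigma> k) <= (\<Sum>m\<in>S. ?c m)"
  unfolding tilde_fsup[OF assms] sum_distrib_left by (rule order_trans[OF norm_sum]) (simp add: norm_mult)
 then have "(norm (tilde dt y \<sigma> k))\<^sup>2 <= (\<Sum>m\<in>S. ?c m)\<^sup>2" by (intro power_mono) auto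
 also have "\<dots> <= (\<Sum>m\<in>S. (?c m)\<^sup>2) * card S" by (rule sum_squared_le_sum_of_squares)
 also have "\<dots> = (real (card S) * dt / (2 * pi)) * (2 * pi / dt * (\<Sum>m\<in>S. (?c m)\<^sup>2))" using tau_pos by simp
 finally have "en ((norm (tilde dt y \<sigma> k))\<^sup>2) <= en (real (card S) * dt / (2 * pi)) * en (2 * pi / dt * (\<Sum>m\<in>S. (?c m)\<^sup>2))"
  using tau_pos by (subst ennreal_mult[symmetric]) (auto intro!: ennreal_leI mult_nonneg_nonneg divide_nonneg_pos sum_nonneg)
 then show ?thesis unfolding tf_Parseval[OF assms] by (simp add: tf_def ennreal_power)
qed

end

text \<open>A sequence supported in a time window of length \<open>O(T1)\<close> has a transform that is
 almost constant at scales below \<open>1/T1\<close>; the modulation weight there is small in measure.\<close>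

lemma modulation_gain:
 "\<exists>C<\<infinity>. \<forall>dt T1 a y. time_step dt --> 0 < T1 --> T1 <= 1 --> dt <= 2 * T1 --> fsup (grid dt T1) y -->
  nG dt (%p. wgt dt a (-12/25) sq p * tf dt y p) <= C * Tg T1 * nG dt (%p. wgt dt a (-1/2) sq p * tf dt y p)"
proof -
 obtain A where A: "A < \<infinity>" "\<And>dt c. time_step dt ==> (\<integral>\<^sup>+x. en (W dt (x + c) powr - 2) \<partial>circ dt) <= A"
  using circ_W_bound[of 2] by auto
 have main: "nG dt (%p. wgt dt a (-12/25) sq p * tf dt y p) <= ennsqrt (1 + A) * Tg T1 * nG dt (%p. wgt dt a (-1/2) sq p * tf dt y p)"
  if t: "time_step dt" and T1: "0 < T1" "T1 <= 1" "dt <= 2 * T1" and y: "fsup (grid dt T1) y" for dt T1 a y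
 proof -
  interpret time_step dt by fact
  note fm [measurable] = tf_measurable[OF y]
  define f where "f = tf dt y"
  have f [measurable]: "f \<in> bG dt" unfolding f_def by (rule fm)
  have fk [measurable]: "(%\<sigma>. f (k, \<sigma>)) \<in> bC dt" for k by (rule Gam_Pair[OF f])
  have wk [measurable]: "(%\<sigma>. wgt dt a b sq (k, \<sigma>)) \<in> bC dt" for a b k by (rule Gam_Pair) measurable
  \<comment> \<open>Above the threshold \<open>T1 powr (-1/4)\<close> the exponent 24/25 saves 1/25
    against 1, hence the factor \<open>T1 powr (1/100)\<close>. Below it the weight is traded for
    the integrable \<open>w powr (-2)\<close> at the cost of \<open>T1 powr (-74/100)\<close>. The
    norm is a square root, so 1/100 ends up as 1/200.\<close>
  have pw: "w powr (24/25) <= T1 powr (1/100) * w powr 1 + T1 powr (-74/100) * w powr (-2)" if w: "w \<ge> 1" for w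
  proof (cases "T1 powr (-1/4) <= w")
   case True
   have "w powr (24/25) = w powr 1 * w powr (-1/25)" using w by (simp only: powr_add[symmetric]) simp
   also have "\<dots> <= w powr 1 * (T1 powr (-1/4)) powr (-1/25)"
    using True T1 w by (intro mult_left_mono powr_mono2') auto
   also have "(T1 powr (-1/4)) powr (-1/25) = T1 powr (1/100)" unfolding powr_powr by simp
   finally have "w powr (24/25) <= T1 powr (1/100) * w powr 1" by (simp only: mult.commute)
   then show ?thesis using powr_ge_zero[of T1 "-74/100"] powr_ge_zero[of w "-2"] by (smt (verit) mult_nonneg_nonneg)
  next
   case False
   have "w powr (24/25) = w powr (74/25) * w powr (-2)" using w by (simp only: powr_add[symmetric]) simp
   also have "\<dots> <= (T1 powr (-1/4)) powr (74/25) * w powr (-2)"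
    using False T1 w by (intro mult_right_mono powr_mono2) auto
   also have "(T1 powr (-1/4)) powr (74/25) = T1 powr (-74/100)" unfolding powr_powr by simp
   finally show ?thesis using powr_ge_zero[of T1 "1/100"] powr_ge_zero[of w "1"] by (smt (verit) mult_nonneg_nonneg)
  qed
  have pe: "wgt dt 0 (-24/25) sq p <= en (T1 powr (1/100)) * wgt dt 0 (-1) sq p + en (T1 powr (-74/100)) * wgt dt 0 2 sq p" for p
  proof -
   let ?w = "W dt (snd p + sq (fst p))"
   have "en (?w powr (24/25)) <= en (T1 powr (1/100) * ?w powr 1 + T1 powr (-74/100) * ?w powr (-2))"
    by (rule ennreal_leI[OF pw[OF W_ge_1]])
   also have "\<dots> = en (T1 powr (1/100)) * en (?w powr 1) + en (T1 powr (-74/100)) * en (?w powr (-2))"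
    by (simp only: ennreal_plus ennreal_mult powr_ge_zero mult_nonneg_nonneg)
   finally show ?thesis unfolding wgt_def by (simp del: powr_one)
  qed
  have one: "(\<integral>\<^sup>+\<sigma>. wgt dt 0 (-24/25) sq (k, \<sigma>) * (f (k, \<sigma>))\<^sup>2 \<partial>circ dt) <= (1 + A) * en (T1 powr (1/100)) * (\<integral>\<^sup>+\<sigma>. wgt dt 0 (-1) sq (k, \<sigma>) * (f (k, \<sigma>))\<^sup>2 \<partial>circ dt)" for k
  proof -
   let ?B = "\<integral>\<^sup>+\<sigma>. wgt dt 0 (-1) sq (k, \<sigma>) * (f (k, \<sigma>))\<^sup>2 \<partial>circ dt"
   have fB: "(\<integral>\<^sup>+\<sigma>. (f (k, \<sigma>))\<^sup>2 \<partial>circ dt) <= ?B"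
    by (intro nn_integral_mono) (use wgt_mono[of 0 0 "-1" 0 dt sq] mult_right_mono in fastforce)
   have sup: "(f (k, \<sigma>))\<^sup>2 <= en T1 * ?B" for \<sigma>
   proof -
    have "real (card (grid dt T1)) * dt <= T1 * (2 * pi)"
    proof -
     have "T1 * 6 <= T1 * (2 * pi)" using T1(1) pi_gt3 by (intro mult_left_mono) auto
     then show ?thesis using grid_card(2)[OF tau_pos T1(3)] by simp
    qed
    then have "real (card (grid dt T1)) * dt / (2 * pi) <= T1" by (simp add: field_simps)
    then show ?thesis using tf_sup[OF y, of k \<sigma>] fB unfolding f_def[symmetric]
     by (elim order_trans) (intro mult_mono ennreal_leI, auto)
   qed
   have low: "(\<integral>\<^sup>+\<sigma>. wgt dt 0 2 sq (k, \<sigma>) * (f (k, \<sigma>))\<^sup>2 \<partial>circ dt) <= A * (en T1 * ?B)"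
   proof -
    have "(\<integral>\<^sup>+\<sigma>. wgt dt 0 2 sq (k, \<sigma>) * (f (k, \<sigma>))\<^sup>2 \<partial>circ dt) <= (\<integral>\<^sup>+\<sigma>. wgt dt 0 2 sq (k, \<sigma>) * (en T1 * ?B) \<partial>circ dt)"
     by (intro nn_integral_mono mult_left_mono sup) simp
    also have "\<dots> = (\<integral>\<^sup>+\<sigma>. wgt dt 0 2 sq (k, \<sigma>) \<partial>circ dt) * (en T1 * ?B)"
     by (rule nn_integral_multc) measurable
    also have "\<dots> <= A * (en T1 * ?B)"
     by (intro mult_right_mono) (use A(2)[OF t, of "sq k"] in \<open>simp_all add: wgt_def\<close>)
    finally show ?thesis .
   qed
   have "(\<integral>\<^sup>+\<sigma>. wgt dt 0 (-24/25) sq (k, \<sigma>) * (f (k, \<sigma>))\<^sup>2 \<partial>circ dt) <=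
    (\<integral>\<^sup>+\<sigma>. en (T1 powr (1/100)) * (wgt dt 0 (-1) sq (k, \<sigma>) * (f (k, \<sigma>))\<^sup>2) +
     en (T1 powr (-74/100)) * (wgt dt 0 2 sq (k, \<sigma>) * (f (k, \<sigma>))\<^sup>2) \<partial>circ dt)"
    unfolding mult.assoc[symmetric] distrib_right[symmetric] by (intro nn_integral_mono mult_right_mono pe) simp
   also have "\<dots> = en (T1 powr (1/100)) * ?B + en (T1 powr (-74/100)) * (\<integral>\<^sup>+\<sigma>. wgt dt 0 2 sq (k, \<sigma>) * (f (k, \<sigma>))\<^sup>2 \<partial>circ dt)"
    by (simp add: nn_integral_add nn_integral_cmult)
   also have "\<dots> <= en (T1 powr (1/100)) * ?B + en (T1 powr (-74/100)) * (A * (en T1 * ?B))"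
    by (intro add_left_mono mult_left_mono low) simp
   also have "\<dots> = en (T1 powr (1/100)) * ?B + en (T1 powr (-74/100)) * en T1 * (A * ?B)" by (simp only: mult_ac)
   \<comment> \<open>The supremum bound contributes a full factor \<open>T1\<close>, which outweighs
     the loss of 74/100; the surplus over 1/100 is discarded.\<close>
   also have "en (T1 powr (-74/100)) * en T1 = en (T1 powr (26/100))"
   proof -
    have "en (T1 powr (-74/100)) * en (T1 powr 1) = en (T1 powr (-74/100 + 1))"
     by (simp only: powr_add ennreal_mult powr_ge_zero)
    then show ?thesis using T1(1) by simp
   qed
   also have "en (T1 powr (1/100)) * ?B + en (T1 powr (26/100)) * (A * ?B) <= en (T1 powr (1/100)) * ?B + en (T1 powr (1/100)) * (A * ?B)"
    using T1 by (intro add_left_mono mult_right_mono ennreal_leI powr_mono') auto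
   also have "\<dots> = (1 + A) * en (T1 powr (1/100)) * ?B" unfolding distrib_right mult_1_left by (simp only: mult_ac)
   finally show ?thesis .
  qed
  have split: "(\<integral>\<^sup>+p. (wgt dt a b sq p * f p)\<^sup>2 \<partial>Gam dt) = (SI k. en (J (of_int k) powr (- 2 * a)) * (\<integral>\<^sup>+\<sigma>. wgt dt 0 (2 * b) sq (k, \<sigma>) * (f (k, \<sigma>))\<^sup>2 \<partial>circ dt))" for b
  proof -
   have "(wgt dt a b sq (k, \<sigma>) * f (k, \<sigma>))\<^sup>2 = en (J (of_int k) powr (- 2 * a)) * (wgt dt 0 (2 * b) sq (k, \<sigma>) * (f (k, \<sigma>))\<^sup>2)" for k \<sigma>
    unfolding power_mult_distrib wgt_sq by (simp add: wgt_def ennreal_mult mult.assoc)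
   then show ?thesis by (subst nn_integral_Gam[OF tau_pos], measurable) (simp add: nn_integral_cmult)
  qed
  have "(\<integral>\<^sup>+p. (wgt dt a (-12/25) sq p * f p)\<^sup>2 \<partial>Gam dt) <=
   (SI k. (1 + A) * en (T1 powr (1/100)) * (en (J (of_int k) powr (- 2 * a)) * (\<integral>\<^sup>+\<sigma>. wgt dt 0 (-1) sq (k, \<sigma>) * (f (k, \<sigma>))\<^sup>2 \<partial>circ dt)))"
   unfolding split
  proof (rule nn_integral_mono)
   fix k
   have "en (J (of_int k) powr (- 2 * a)) * (\<integral>\<^sup>+\<sigma>. wgt dt 0 (-24/25) sq (k, \<sigma>) * (f (k, \<sigma>))\<^sup>2 \<partial>circ dt) <=
    en (J (of_int k) powr (- 2 * a)) * ((1 + A) * en (T1 powr (1/100)) * (\<integral>\<^sup>+\<sigma>. wgt dt 0 (-1) sq (k, \<sigma>) * (f (k, \<sigma>))\<^sup>2 \<partial>circ dt))"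
    by (intro mult_left_mono one) simp
   then show "en (J (of_int k) powr (- 2 * a)) * (\<integral>\<^sup>+\<sigma>. wgt dt 0 (2 * (-12/25)) sq (k, \<sigma>) * (f (k, \<sigma>))\<^sup>2 \<partial>circ dt) <=
    (1 + A) * en (T1 powr (1/100)) * (en (J (of_int k) powr (- 2 * a)) * (\<integral>\<^sup>+\<sigma>. wgt dt 0 (-1) sq (k, \<sigma>) * (f (k, \<sigma>))\<^sup>2 \<partial>circ dt))"
    by (simp add: mult_ac)
  qed
  also have "\<dots> = (1 + A) * en (T1 powr (1/100)) * (\<integral>\<^sup>+p. (wgt dt a (-1/2) sq p * f p)\<^sup>2 \<partial>Gam dt)"
   unfolding split by (subst sum_const_M) simp
  finally have "(\<integral>\<^sup>+p. (wgt dt a (-12/25) sq p * f p)\<^sup>2 \<partial>Gam dt) <= (1 + A) * en (T1 powr (1/100)) * (\<integral>\<^sup>+p. (wgt dt a (-1/2) sq p * f p)\<^sup>2 \<partial>Gam dt)" .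
  from ennsqrt_mono[OF this] have "nG dt (%p. wgt dt a (-12/25) sq p * f p) <= ennsqrt (1 + A) * ennsqrt (en (T1 powr (1/100))) * nG dt (%p. wgt dt a (-1/2) sq p * f p)"
   unfolding nrm_def ennsqrt_mult .
  also have "ennsqrt (en (T1 powr (1/100))) = Tg T1"
   using T1(1) by (simp add: ennsqrt_ennreal powr_half_sqrt[symmetric] powr_powr)
  finally show ?thesis unfolding f_def .
 qed
 moreover have "ennsqrt (1 + A) < \<infinity>" using A(1) by (intro ennsqrt_less_top) simp
 ultimately show ?thesis by blast
qed

section \<open>Fractional derivatives and the trilinear estimate\<close>

lemma J_powr_add:
 assumes "s \<ge> 0" shows "J (x + y) powr s <= 2 powr s * (J x powr s + J y powr s)"
proof -
 have "J (x + y) powr s <= (2 * max (J x) (J y)) powr s"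
  using japanese_add[of x y] assms by (intro powr_mono2) auto
 also have "\<dots> = 2 powr s * max (J x) (J y) powr s" by (simp add: powr_mult)
 also have "max (J x) (J y) powr s <= J x powr s + J y powr s" by (simp add: max_def)
 finally show ?thesis by simp
qed

context time_step begin

definition Jm :: "real => (gf) => gf" where
 "Jm s f p = wgt dt (- s) 0 sq p * f p"

lemma Jm_measurable [measurable (raw)]:
 assumes [measurable]: "f \<in> bG dt" shows "Jm s f \<in> bG dt"
 unfolding Jm_def by measurable

lemma Jm_le: assumes "s \<ge> 0"
 shows "wgt dt (- s) 0 sq (p + q) <= en (2 powr s) * (wgt dt (- s) 0 sq p + wgt dt (- s) 0 sq q)"
 using J_powr_add[OF assms, of "of_int (fst p)" "of_int (fst q)"]
 by (simp add: wgt_def ennreal_leI flip: ennreal_plus ennreal_mult)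

lemma Jm_uminus: "wgt dt (- s) 0 sq (- p) = wgt dt (- s) 0 sq p"
 by (simp add: wgt_def japanese_minus)

text \<open>A Leibniz rule for nonnegative transforms: the bracket is subadditive, so derivatives of
  a product fall on one factor or the other.\<close>

lemma Jm_conv:
 assumes s: "s \<ge> 0" and [measurable]: "f \<in> bG dt" "g \<in> bG dt"
 shows "Jm s (G.conv f g) x <= en (2 powr s) * (G.conv (Jm s f) g x + G.conv f (Jm s g) x)"
proof -
 have "Jm s (G.conv f g) x = (\<integral>\<^sup>+y. wgt dt (- s) 0 sq (y + (x - y)) * (f y * g (x - y)) \<partial>Gam dt)"
  unfolding Jm_def G.conv_def by (subst nn_integral_cmult[symmetric]) auto
 also have "\<dots> <= (\<integral>\<^sup>+y. en (2 powr s) * (wgt dt (- s) 0 sq y + wgt dt (- s) 0 sq (x - y)) * (f y * g (x - y)) \<partial>Gam dt)"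
  by (intro nn_integral_mono mult_right_mono Jm_le s) simp
 also have "\<dots> = (\<integral>\<^sup>+y. en (2 powr s) * (Jm s f y * g (x - y) + f y * Jm s g (x - y)) \<partial>Gam dt)"
  unfolding Jm_def by (simp only: distrib_left distrib_right mult_ac)
 also have "\<dots> = en (2 powr s) * (G.conv (Jm s f) g x + G.conv f (Jm s g) x)"
  unfolding G.conv_def Jm_def by (subst nn_integral_cmult, measurable, subst nn_integral_add, measurable)
 finally show ?thesis .
qed

lemma tri_eq_conv:
 assumes [measurable]: "f \<in> bG dt" "g \<in> bG dt" "h \<in> bG dt"
 shows "tri f g h x = G.conv (G.conv f g) (G.rfl h) x"
proof -
 have m: "(%u. G.rfl h (x - u)) \<in> bG dt" unfolding G.rfl_def by measurable
 have "G.conv (G.conv f g) (G.rfl h) x = (\<integral>\<^sup>+u. G.rfl h (x - u) * G.conv f g u \<partial>Gam dt)"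
  unfolding G.conv_def[of "G.conv f g"] by (simp only: mult.commute)
 also have "\<dots> = tri f g h x" unfolding tri_def by (subst G.nn_integral_conv[OF _ _ m]) (auto simp: G.rfl_def algebra_simps)
 finally show ?thesis by simp
qed

lemma Jm_tri:
 assumes s: "s \<ge> 0" and m [measurable]: "f \<in> bG dt" "g \<in> bG dt" "h \<in> bG dt"
 shows "Jm s (tri f g h) x <= en (4 powr s) * (tri (Jm s f) g h x + (tri f (Jm s g) h x + tri f g (Jm s h) x))"
proof -
 let ?c = "en (2 powr s)"
 have c: "1 <= ?c" using s by (simp add: ennreal_ge_1 ge_one_powr_ge_zero)
 have [measurable]: "(%y. G.rfl h (x - y)) \<in> bG dt" unfolding G.rfl_def by measurable
 have r: "Jm s (G.rfl h) = G.rfl (Jm s h)" by (simp add: fun_eq_iff Jm_def G.rfl_def Jm_uminus)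
 have "Jm s (tri f g h) x = Jm s (G.conv (G.conv f g) (G.rfl h)) x" by (simp add: Jm_def tri_eq_conv)
 also have "\<dots> <= ?c * (G.conv (Jm s (G.conv f g)) (G.rfl h) x + G.conv (G.conv f g) (Jm s (G.rfl h)) x)"
  by (rule Jm_conv[OF s]) measurable
 also have "G.conv (Jm s (G.conv f g)) (G.rfl h) x <= G.conv (%p. ?c * (G.conv (Jm s f) g p + G.conv f (Jm s g) p)) (G.rfl h) x"
  by (intro G.conv_mono Jm_conv s m order_refl)
 also have "\<dots> = ?c * (G.conv (G.conv (Jm s f) g) (G.rfl h) x + G.conv (G.conv f (Jm s g)) (G.rfl h) x)"
  unfolding G.conv_def[of "%p. _ * _ p"] G.conv_def[of "G.conv _ _"] mult.assoc distrib_right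
  by (subst nn_integral_cmult, measurable) (simp add: nn_integral_add)
 also have "?c * (?c * (G.conv (G.conv (Jm s f) g) (G.rfl h) x + G.conv (G.conv f (Jm s g)) (G.rfl h) x) + G.conv (G.conv f g) (Jm s (G.rfl h)) x) <=
  ?c * (?c * (G.conv (G.conv (Jm s f) g) (G.rfl h) x + G.conv (G.conv f (Jm s g)) (G.rfl h) x) + ?c * G.conv (G.conv f g) (Jm s (G.rfl h)) x)"
  using mult_right_mono[OF c, of "G.conv (G.conv f g) (Jm s (G.rfl h)) x"] by (intro mult_left_mono add_left_mono) auto
 also have "\<dots> = ?c * ?c * (tri (Jm s f) g h x + (tri f (Jm s g) h x + tri f g (Jm s h) x))"
  unfolding r by (subst (1 2 3) tri_eq_conv, measurable) (simp only: distrib_left mult.assoc add.assoc)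
 also have "?c * ?c = en (4 powr s)"
  using powr_mult[of 2 2 s] by (simp flip: ennreal_mult)
 finally show ?thesis by (simp add: mult_left_mono add_mono)
qed

lemma conv_left_commute:
 assumes [measurable]: "f \<in> bG dt" "g \<in> bG dt" "h \<in> bG dt"
 shows "G.conv f (G.conv g h) = G.conv g (G.conv f h)"
proof -
 have "G.conv f g = G.conv g f" by (rule ext, rule G.conv_commute) measurable
 note c = this
 show ?thesis
 proof
  fix x
  have "G.conv f (G.conv g h) x = G.conv (G.conv f g) h x" by (rule G.conv_assoc[symmetric]) measurable
  also have "\<dots> = G.conv g (G.conv f h) x" unfolding c by (rule G.conv_assoc) measurable
  finally show "G.conv f (G.conv g h) x = G.conv g (G.conv f h) x" .
 qed
qed

end

context time_step begin

text \<open>The L2 density of the \<open>X\<close> norm of order \<open>s\<close> and modulation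
  exponent 1/2.\<close>

definition Fn :: "real => (int => real => complex) => gf" where
 "Fn s y p = wgt dt (- s) (-1/2) sq p * tf dt y p"

lemma Fn_measurable: "fsup S y ==> Fn s y \<in> bG dt"
 unfolding Fn_def using tf_measurable by measurable

lemma nrm_Fn: "fsup S y ==> nG dt (Fn s y) = Xs dt s y"
 unfolding Fn_def by (simp add: X_norm_eq)

lemma inn_Fn: "inn (Fn s y) = (%p. chi dt p * (wgt dt (1/2 - s) 0 sq p * tf dt y p))"
proof
 fix p
 have "wgt dt (1/2) (1/2) sq p * wgt dt (- s) (-1/2) sq p = wgt dt (1/2 - s) 0 sq p" by (simp add: wgt_mult)
 then show "inn (Fn s y) p = chi dt p * (wgt dt (1/2 - s) 0 sq p * tf dt y p)"
  unfolding inn_def Fn_def by (metis mult.assoc)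
qed

text \<open>The derivatives beyond order 1/2, placed on one factor, replace its density of order 1/2
  by the one of order \<open>s\<close>.\<close>

lemma Jm_inn: "Jm (s - 1/2) (inn (Fn (1/2) y)) = inn (Fn s y)" "Jm (s - 1/2) (dinn (Fn (1/2) y)) = dinn (Fn s y)"
 unfolding Jm_def dinn_def inn_Fn fun_eq_iff by (simp_all add: mult_ac)

lemma ez_Fn: "ez (Fn s y) = (%p. wgt dt (- s) (-12/25) sq p * tf dt y p)"
proof
 fix p
 have "wgt dt 0 (1/50) sq p * wgt dt (- s) (-1/2) sq p = wgt dt (- s) (-12/25) sq p" by (simp add: wgt_mult)
 then show "ez (Fn s y) p = wgt dt (- s) (-12/25) sq p * tf dt y p"
  unfolding ez_def Fn_def by (metis mult.assoc)
qed

text \<open>Each term of \<open>Sn\<close> keeps the slack of at least one of the first two inputs,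
  which is enough for one factor \<open>g\<close>.\<close>

lemma Sn_le:
 assumes "nG dt (ez F) <= g * nG dt F" "nG dt (ez G) <= g * nG dt G"
 shows "Sn F G H <= 3 * g * (nG dt F * nG dt G * nG dt H)"
proof -
 let ?n = "nG dt"
 let ?P = "g * (?n F * ?n G * ?n H)"
 have "?n F * ?n (ez G) * ?n (ez H) <= ?n F * (g * ?n G) * ?n H" by (intro mult_mono assms nrm_ez_le) auto
 moreover have "?n (ez F) * ?n G * ?n (ez H) <= (g * ?n F) * ?n G * ?n H" by (intro mult_mono assms nrm_ez_le) auto
 moreover have "?n (ez F) * ?n (ez G) * ?n H <= (g * ?n F) * ?n G * ?n H" by (intro mult_mono assms nrm_ez_le) auto
 ultimately have "Sn F G H <= ?n F * (g * ?n G) * ?n H + ((g * ?n F) * ?n G * ?n H + (g * ?n F) * ?n G * ?n H)"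
  unfolding Sn_def by (intro add_mono)
 also have "\<dots> = ?P + (?P + ?P)" by (simp only: mult_ac)
 also have "\<dots> = 3 * ?P" by (metis mult_2 add.commute numeral_Bit1 numeral_One one_add_one distrib_right mult_1_left)
 finally show ?thesis by (simp only: mult.assoc)
qed

text \<open>\<open>N\<close> stands for either part of the output norm; monotonicity, subadditivity
  up to 2 and homogeneity are what both parts share. \<open>Jm_tri\<close> distributes
  \<open>s - 1/2\<close> derivatives, and each resulting term takes its gain from
  \<open>Sn_le\<close>.\<close>

lemma trilinear_core:
 assumes s: "s \<ge> 1/2" and f: "fsup S u1" "fsup S u2" "fsup S u3"
  and N_mono: "\<And>f g. (\<And>x. f x <= g x) ==> N f <= N g"
  and N_add: "\<And>f g. f \<in> bG dt ==> g \<in> bG dt ==> N (%x. f x + g x) <= 2 * (N f + N g)"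
  and N_cmult: "\<And>c f. f \<in> bG dt ==> N (%x. c * f x) = c * N f"
  and bd: "\<And>F G H. F \<in> bG dt ==> G \<in> bG dt ==> H \<in> bG dt ==>
   N (tri (inn F) (inn G) (dinn H)) <= C * Sn F G H"
  and gain: "\<And>s y. fsup S y ==> nG dt (ez (Fn s y)) <= g * nG dt (Fn s y)"
 shows "N (Jm (s - 1/2) (tri (inn (Fn (1/2) u1)) (inn (Fn (1/2) u2)) (dinn (Fn (1/2) u3)))) <=
  en (4 powr (s - 1/2)) * 4 * (C * (3 * g)) *
  (mixt (Xs dt s) (Xh dt) u1 u2 u3)"
proof -
 note Fn_measurable[OF f(1), measurable] Fn_measurable[OF f(2), measurable] Fn_measurable[OF f(3), measurable]
 have dm [measurable]: "dinn (Fn s u3) \<in> bG dt" for s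
  unfolding dinn_def by (intro borel_measurable_times_ennreal int1_measurable inn_measurable Fn_measurable[OF f(3)]) measurable
 let ?c = "en (4 powr (s - 1/2))"
 let ?t = "%s1 s2 s3. tri (inn (Fn s1 u1)) (inn (Fn s2 u2)) (dinn (Fn s3 u3))"
 have b: "N (?t s1 s2 s3) <= C * (3 * g) * (X_norm dt s1 (1/2) u1 * X_norm dt s2 (1/2) u2 * X_norm dt s3 (1/2) u3)" for s1 s2 s3
 proof -
  have "N (?t s1 s2 s3) <= C * Sn (Fn s1 u1) (Fn s2 u2) (Fn s3 u3)" by (rule bd) measurable
  also have "\<dots> <= C * (3 * g * (nG dt (Fn s1 u1) * nG dt (Fn s2 u2) * nG dt (Fn s3 u3)))"
   by (intro mult_left_mono Sn_le gain f) simp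
  finally show ?thesis unfolding nrm_Fn[OF f(1)] nrm_Fn[OF f(2)] nrm_Fn[OF f(3)] by (simp only: mult.assoc)
 qed
 have "N (Jm (s - 1/2) (?t (1/2) (1/2) (1/2))) <= N (%x. ?c * (?t s (1/2) (1/2) x + (?t (1/2) s (1/2) x + ?t (1/2) (1/2) s x)))"
  by (rule N_mono, rule order_trans[OF Jm_tri]) (use s in \<open>simp_all add: Jm_inn\<close>, measurable)
 also have "\<dots> = ?c * N (%x. ?t s (1/2) (1/2) x + (?t (1/2) s (1/2) x + ?t (1/2) (1/2) s x))"
  by (rule N_cmult) measurable
 also have "\<dots> <= ?c * (2 * (N (?t s (1/2) (1/2)) + 2 * (N (?t (1/2) s (1/2)) + N (?t (1/2) (1/2) s))))"
 proof (intro mult_left_mono)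
  have "N (%x. ?t s (1/2) (1/2) x + (?t (1/2) s (1/2) x + ?t (1/2) (1/2) s x)) <= 2 * (N (?t s (1/2) (1/2)) + N (%x. ?t (1/2) s (1/2) x + ?t (1/2) (1/2) s x))"
   by (rule N_add) measurable
  also have "N (%x. ?t (1/2) s (1/2) x + ?t (1/2) (1/2) s x) <= 2 * (N (?t (1/2) s (1/2)) + N (?t (1/2) (1/2) s))"
   by (rule N_add) measurable
  finally show "N (%x. ?t s (1/2) (1/2) x + (?t (1/2) s (1/2) x + ?t (1/2) (1/2) s x)) <= 2 * (N (?t s (1/2) (1/2)) + 2 * (N (?t (1/2) s (1/2)) + N (?t (1/2) (1/2) s)))"
   by (simp add: mult_left_mono add_mono)
 qed simp
 also have "\<dots> <= ?c * (2 * (2 * N (?t s (1/2) (1/2)) + 2 * (N (?t (1/2) s (1/2)) + N (?t (1/2) (1/2) s))))"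
  using mult_right_mono[of 1 2 "N (?t s (1/2) (1/2))"] by (intro mult_left_mono add_right_mono) auto
 also have "\<dots> = ?c * 4 * (N (?t s (1/2) (1/2)) + (N (?t (1/2) s (1/2)) + N (?t (1/2) (1/2) s)))"
  by (simp add: distrib_left mult.assoc[symmetric])
 also have "\<dots> <= ?c * 4 * (C * (3 * g) * (Xs dt s u1 * Xh dt u2 * Xh dt u3) +
  (C * (3 * g) * (Xh dt u1 * Xs dt s u2 * Xh dt u3) +
   C * (3 * g) * (Xh dt u1 * Xh dt u2 * Xs dt s u3)))"
  by (intro mult_left_mono add_mono b) simp
 finally show ?thesis unfolding distrib_left[symmetric] mult.assoc .
qed

lemma chi_uminus: "chi dt (- p) = chi dt p" by (simp add: chi_def Kf_minus)

lemma rfl_chi_tf: "G.rfl (%p. chi dt p * tf dt y p) = (%p. chi dt p * G.rfl (tf dt y) p)"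
 by (simp add: fun_eq_iff G.rfl_def chi_uminus)

lemma chi_tf_measurable: "fsup S y ==> (%p. chi dt p * tf dt y p) \<in> bG dt"
 using tf_measurable by measurable

lemma tf_mult_le:
 assumes "gd S u" "gd S w" "\<And>p. tf dt u p <= a * F p" "\<And>p. tf dt w p <= b * G p"
  and [measurable]: "F \<in> bG dt" "G \<in> bG dt"
 shows "tf dt (%m x. u m x * w m x) p <= en (1 / (2 * pi)) * a * b * G.conv F G p"
proof -
 have "tf dt (%m x. u m x * w m x) p <= en (1 / (2 * pi)) * G.conv (tf dt u) (tf dt w) p"
  by (rule tf_mult(2)[OF assms(1,2)])
 also have "\<dots> <= en (1 / (2 * pi)) * G.conv (%p. a * F p) (%p. b * G p) p"
  by (intro mult_left_mono G.conv_mono assms) simp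
 also have "G.conv (%p. a * F p) (%p. b * G p) p = (\<integral>\<^sup>+y. a * b * (F y * G (p - y)) \<partial>Gam dt)"
  unfolding G.conv_def by (simp only: mult_ac)
 also have "\<dots> = a * b * G.conv F G p" unfolding G.conv_def by (rule nn_integral_cmult) measurable
 finally show ?thesis by (simp only: mult.assoc)
qed

lemma tf_trilinear_out:
 assumes f: "fsup S u1" "fsup S u2" "fsup S u3"
 shows "fsup S (%n x. Proj dt (u1 n) x * Proj dt (u2 n) x * ddx (Proj dt (conj_fun (u3 n))) x)"
  "fsup S (%n. Proj dt (%x. Proj dt (u1 n) x * Proj dt (u2 n) x * ddx (Proj dt (conj_fun (u3 n))) x))"
  "tf dt (%n. Proj dt (%x. Proj dt (u1 n) x * Proj dt (u2 n) x * ddx (Proj dt (conj_fun (u3 n))) x)) p <=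
   en (1 / (2 * pi)) ^ 2 * (chi dt p * tri (inn (Fn (1/2) u1)) (inn (Fn (1/2) u2)) (dinn (Fn (1/2) u3)) p)"
proof -
 note c = tf_conj_fun[OF f(3)]
 note P = tf_Proj[OF f(1)] tf_Proj[OF f(2)] tf_ddx_Proj[OF c(1)]
 have i: "inn (Fn (1/2) y) = (%p. chi dt p * tf dt y p)" for y by (simp add: inn_Fn)
 note Fn_measurable[OF f(1), measurable] Fn_measurable[OF f(2), measurable] Fn_measurable[OF f(3), measurable]
 have dm [measurable]: "dinn (Fn (1/2) u3) \<in> bG dt"
  unfolding dinn_def by (intro borel_measurable_times_ennreal int1_measurable inn_measurable Fn_measurable[OF f(3)]) measurable
 have d: "en \<bar>of_int (fst p)\<bar> * (chi dt p * G.rfl (tf dt u3) p) = G.rfl (dinn (Fn (1/2) u3)) p" for p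
  unfolding dinn_def i G.rfl_def by (simp add: chi_uminus)
 have g12: "gd S (%n x. Proj dt (u1 n) x * Proj dt (u2 n) x)" by (rule tf_mult(1)[OF P(1,3)])
 show f0: "fsup S (%n x. Proj dt (u1 n) x * Proj dt (u2 n) x * ddx (Proj dt (conj_fun (u3 n))) x)"
  using tf_mult(1)[OF g12 P(5)] by (simp add: gd_def)
 show "fsup S (%n. Proj dt (%x. Proj dt (u1 n) x * Proj dt (u2 n) x * ddx (Proj dt (conj_fun (u3 n))) x))"
  using tf_Proj(1)[OF f0] by (simp add: gd_def)
 have 12: "tf dt (%n x. Proj dt (u1 n) x * Proj dt (u2 n) x) p <= en (1 / (2 * pi)) * 1 * 1 * G.conv (inn (Fn (1/2) u1)) (inn (Fn (1/2) u2)) p" for p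
  by (rule tf_mult_le[OF P(1,3)]) (simp_all add: P i chi_tf_measurable[OF f(1)] chi_tf_measurable[OF f(2)])
 have "tf dt (%n x. Proj dt (u1 n) x * Proj dt (u2 n) x * ddx (Proj dt (conj_fun (u3 n))) x) p <=
  en (1 / (2 * pi)) * (en (1 / (2 * pi)) * 1 * 1) * 1 * G.conv (G.conv (inn (Fn (1/2) u1)) (inn (Fn (1/2) u2))) (G.rfl (dinn (Fn (1/2) u3))) p"
  by (rule tf_mult_le[OF g12 P(5) 12]) (simp_all add: P c d)
 also have "\<dots> = en (1 / (2 * pi)) ^ 2 * tri (inn (Fn (1/2) u1)) (inn (Fn (1/2) u2)) (dinn (Fn (1/2) u3)) p"
  by (subst tri_eq_conv, measurable) (simp only: power2_eq_square mult_1_right mult.assoc)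
 finally have "chi dt p * tf dt (%n x. Proj dt (u1 n) x * Proj dt (u2 n) x * ddx (Proj dt (conj_fun (u3 n))) x) p <=
  chi dt p * (en (1 / (2 * pi)) ^ 2 * tri (inn (Fn (1/2) u1)) (inn (Fn (1/2) u2)) (dinn (Fn (1/2) u3)) p)"
  by (rule mult_left_mono) simp
 then show "tf dt (%n. Proj dt (%x. Proj dt (u1 n) x * Proj dt (u2 n) x * ddx (Proj dt (conj_fun (u3 n))) x)) p <=
   en (1 / (2 * pi)) ^ 2 * (chi dt p * tri (inn (Fn (1/2) u1)) (inn (Fn (1/2) u2)) (dinn (Fn (1/2) u3)) p)"
  unfolding tf_Proj(2)[OF f0] by (simp only: mult_ac)
qed

end

lemma trilinear_estimate:
 assumes s: "s \<ge> 1/2"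
 shows "\<exists>C<\<infinity>. \<forall>dt T1 u1 u2 u3. time_step dt --> 0 < T1 --> T1 <= 1 --> dt <= 2 * T1 -->
  fsup (grid dt T1) u1 --> fsup (grid dt T1) u2 --> fsup (grid dt T1) u3 -->
  Z_norm dt s (-1/2) (%n. Proj dt (%x. Proj dt (u1 n) x * Proj dt (u2 n) x * ddx (Proj dt (conj_fun (u3 n))) x)) <=
  C * Tg T1 *
  (mixt (Xs dt s) (Xh dt) u1 u2 u3)"
proof -
 obtain A where A: "A < \<infinity>" "\<And>dt F G H. time_step dt ==>
  F \<in> bG dt ==> G \<in> bG dt ==> H \<in> bG dt ==>
  nG dt (%x. chi dt x * wgt dt (- 1/2) (1/2) sq x * time_step.tri dt (time_step.inn dt F) (time_step.inn dt G) (time_step.dinn dt H) x)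
   <= A * time_step.Sn dt F G H"
  using tri_X by auto
 obtain B where B: "B < \<infinity>" "\<And>dt F G H. time_step dt ==>
  F \<in> bG dt ==> G \<in> bG dt ==> H \<in> bG dt ==>
  nrm (cZ) (%k. \<integral>\<^sup>+s. chi dt (k, s) * wgt dt (- 1/2) 1 sq (k, s) *
   time_step.tri dt (time_step.inn dt F) (time_step.inn dt G) (time_step.dinn dt H) (k, s) \<partial>circ dt)
   <= B * time_step.Sn dt F G H"
  using tri_Y by auto
 obtain P where P: "P < \<infinity>" "\<And>dt T1 a y. time_step dt ==> 0 < T1 ==> T1 <= 1 ==> dt <= 2 * T1 ==> fsup (grid dt T1) y ==>
  nG dt (%p. wgt dt a (-12/25) sq p * tf dt y p) <= P * Tg T1 * nG dt (%p. wgt dt a (-1/2) sq p * tf dt y p)"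
  using modulation_gain by auto
 define K where "K = en (1 / (2 * pi)) ^ 2 * (en (4 powr (s - 1/2)) * 4 * (A * 3) * P) + en (1 / (2 * pi)) ^ 2 * (en (4 powr (s - 1/2)) * 4 * (B * 3) * P)"
 have main: "Z_norm dt s (-1/2) (%n. Proj dt (%x. Proj dt (u1 n) x * Proj dt (u2 n) x * ddx (Proj dt (conj_fun (u3 n))) x)) <=
  K * Tg T1 *
  (mixt (Xs dt s) (Xh dt) u1 u2 u3)"
  if t: "time_step dt" and T: "0 < T1" "T1 <= 1" "dt <= 2 * T1" and f: "fsup (grid dt T1) u1" "fsup (grid dt T1) u2" "fsup (grid dt T1) u3"
  for dt T1 u1 u2 u3
 proof -
  interpret time_step dt by fact
  let ?out = "%n. Proj dt (%x. Proj dt (u1 n) x * Proj dt (u2 n) x * ddx (Proj dt (conj_fun (u3 n))) x)"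
  let ?T = "tri (inn (Fn (1/2) u1)) (inn (Fn (1/2) u2)) (dinn (Fn (1/2) u3))"
  let ?k = "en (1 / (2 * pi)) ^ 2"
  let ?X = "Xs dt s u1 * Xh dt u2 * Xh dt u3 +
  (Xh dt u1 * Xs dt s u2 * Xh dt u3 +
   Xh dt u1 * Xh dt u2 * Xs dt s u3)"
  note o = tf_trilinear_out[OF f]
  note Fn_measurable[OF f(1), measurable] Fn_measurable[OF f(2), measurable] Fn_measurable[OF f(3), measurable]
  have dm [measurable]: "dinn (Fn (1/2) u3) \<in> bG dt"
   unfolding dinn_def by (intro borel_measurable_times_ennreal int1_measurable inn_measurable Fn_measurable[OF f(3)]) measurable
  have Tm [measurable]: "Jm (s - 1/2) ?T \<in> bG dt" by measurable
  have gain: "nG dt (ez (Fn s y)) <= P * Tg T1 * nG dt (Fn s y)" if "fsup (grid dt T1) y" for s y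
   using P(2)[OF t T that, of "- s"] unfolding ez_Fn Fn_def .
  have w: "wgt dt (- s) b sq p = wgt dt (-1/2) b sq p * wgt dt (- (s - 1/2)) 0 sq p" for p b by (simp add: wgt_mult)
  have pt: "wgt dt (- s) b sq p * tf dt ?out p <= ?k * (chi dt p * wgt dt (-1/2) b sq p * Jm (s - 1/2) ?T p)" for p b
  proof -
   have "wgt dt (- s) b sq p * tf dt ?out p <= wgt dt (- s) b sq p * (?k * (chi dt p * ?T p))"
    by (intro mult_left_mono o(3)) simp
   then show ?thesis unfolding w Jm_def by (simp only: mult_ac)
  qed
  have X: "X_norm dt s (-1/2) ?out <= ?k * (en (4 powr (s - 1/2)) * 4 * (A * (3 * (P * Tg T1))) * ?X)"
  proof -
   define N where "N f = nG dt (%x. chi dt x * wgt dt (- 1/2) (1/2) sq x * f x)" for f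
   have "X_norm dt s (-1/2) ?out = nG dt (%p. wgt dt (- s) (1/2) sq p * tf dt ?out p)" by (simp add: X_norm_eq[OF o(2)])
   also have "\<dots> <= nG dt (%p. ?k * (chi dt p * wgt dt (-1/2) (1/2) sq p * Jm (s - 1/2) ?T p))"
    by (intro nrm_mono pt)
   also have "\<dots> = ?k * N (Jm (s - 1/2) ?T)" unfolding N_def by (rule nrm_cmult) measurable
   also have "N (Jm (s - 1/2) ?T) <= en (4 powr (s - 1/2)) * 4 * (A * (3 * (P * Tg T1))) * ?X"
   proof (rule trilinear_core[OF s f])
    show "N f <= N g" if "\<And>x. f x <= g x" for f g unfolding N_def by (intro nrm_mono mult_left_mono that) simp
    show "N (%x. f x + g x) <= 2 * (N f + N g)" if [measurable]: "f \<in> bG dt" "g \<in> bG dt" for f g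
     unfolding N_def distrib_left[of "chi dt _ * wgt dt _ _ _ _"] by (rule nrm_add) measurable
    show "N (%x. c * f x) = c * N f" if [measurable]: "f \<in> bG dt" for f c
     unfolding N_def mult.left_commute[of _ c] by (rule nrm_cmult) measurable
    show "N (tri (inn F) (inn G) (dinn H)) <= A * Sn F G H" if "F \<in> bG dt" "G \<in> bG dt" "H \<in> bG dt" for F G H
     unfolding N_def by (rule A(2)[OF t that])
   qed (rule gain)
   finally show ?thesis by (simp add: mult_left_mono)
  qed
  have Y: "Y_norm dt s (-1) ?out <= ?k * (en (4 powr (s - 1/2)) * 4 * (B * (3 * (P * Tg T1))) * ?X)"
  proof -
   define N where "N f = nrm (cZ) (%k. \<integral>\<^sup>+s. chi dt (k, s) * wgt dt (- 1/2) 1 sq (k, s) * f (k, s) \<partial>circ dt)" for f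
   have gp: "(%\<sigma>. chi dt (k, \<sigma>) * wgt dt (- 1/2) 1 sq (k, \<sigma>) * f (k, \<sigma>)) \<in> bC dt"
    if [measurable]: "f \<in> bG dt" for f k
    using Gam_Pair[of "%p. chi dt p * wgt dt (- 1/2) 1 sq p * f p"] by measurable
   have N_cm: "N (%x. c * f x) = c * N f" if m: "f \<in> bG dt" for f c
    unfolding N_def mult.left_commute[of _ c] nn_integral_cmult[OF gp[OF m]] by (rule nrm_cmult) simp
   have N_mono: "N f <= N g" if "\<And>x. f x <= g x" for f g
    unfolding N_def by (intro nrm_mono nn_integral_mono mult_left_mono that) simp
   have "Y_norm dt s (-1) ?out = nrm (cZ) (%k. \<integral>\<^sup>+\<sigma>. wgt dt (- s) 1 sq (k, \<sigma>) * tf dt ?out (k, \<sigma>) \<partial>circ dt)" by (simp add: Y_norm_eq[OF o(2)])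
   also have "\<dots> <= nrm (cZ) (%k. \<integral>\<^sup>+\<sigma>. ?k * (chi dt (k, \<sigma>) * wgt dt (-1/2) 1 sq (k, \<sigma>) * Jm (s - 1/2) ?T (k, \<sigma>)) \<partial>circ dt)"
    by (intro nrm_mono nn_integral_mono pt)
   also have "\<dots> = N (%x. ?k * Jm (s - 1/2) ?T x)" unfolding N_def by (simp only: mult.left_commute[of _ ?k])
   also have "\<dots> = ?k * N (Jm (s - 1/2) ?T)" by (rule N_cm[OF Tm])
   also have "N (Jm (s - 1/2) ?T) <= en (4 powr (s - 1/2)) * 4 * (B * (3 * (P * Tg T1))) * ?X"
   proof (rule trilinear_core[OF s f])
    show "N (%x. f x + g x) <= 2 * (N f + N g)" if m: "f \<in> bG dt" "g \<in> bG dt" for f g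
     unfolding N_def distrib_left[of "chi dt _ * wgt dt _ _ _ _"] nn_integral_add[OF gp[OF m(1)] gp[OF m(2)]] by (rule nrm_add) auto
    show "N (tri (inn F) (inn G) (dinn H)) <= B * Sn F G H" if "F \<in> bG dt" "G \<in> bG dt" "H \<in> bG dt" for F G H
     unfolding N_def by (rule B(2)[OF t that])
   qed (rule N_mono N_cm gain, assumption)+
   finally show ?thesis by (simp add: mult_left_mono)
  qed
  have "Z_norm dt s (-1/2) ?out = X_norm dt s (-1/2) ?out + Y_norm dt s (-1) ?out" by (simp add: Z_norm_def)
  also have "\<dots> <= ?k * (en (4 powr (s - 1/2)) * 4 * (A * (3 * (P * Tg T1))) * ?X) +
   ?k * (en (4 powr (s - 1/2)) * 4 * (B * (3 * (P * Tg T1))) * ?X)" by (intro add_mono X Y)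
  also have "\<dots> = K * Tg T1 * ?X"
   unfolding K_def distrib_right by (simp only: mult_ac)
  finally show ?thesis .
 qed
 moreover have "K < \<infinity>" using A(1) B(1) P(1) by (simp add: K_def ennreal_mult_less_top power_less_top_ennreal)
 ultimately show ?thesis by blast
qed

section \<open>The cubic and quintic estimates\<close>

context time_step begin

text \<open>The functional behind the output norm with modulation exponent -3/8; derivatives are
  applied separately by \<open>Jm\<close>.\<close>

definition En :: "(gf) => ennreal" where
 "En f = nG dt (%x. chi dt x * wgt dt 0 (3/8) sq x * f x)"

lemma En_mono: "(\<And>x. f x <= g x) ==> En f <= En g"
 unfolding En_def by (intro nrm_mono mult_left_mono) auto

lemma En_cmult: assumes [measurable]: "f \<in> bG dt" shows "En (%x. c * f x) = c * En f"
 unfolding En_def mult.left_commute[of _ c] by (rule nrm_cmult) measurable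

lemma En_add:
 assumes [measurable]: "f \<in> bG dt" "g \<in> bG dt"
 shows "En (%x. f x + g x) <= 2 * (En f + En g)"
 unfolding En_def distrib_left[of "chi dt _ * wgt dt _ _ _ _"] by (rule nrm_add) measurable

lemma En_Jm_conv:
 assumes s: "s \<ge> 0" and [measurable]: "f \<in> bG dt" "g \<in> bG dt"
 shows "En (Jm s (G.conv f g)) <= 2 * en (2 powr s) * (En (G.conv (Jm s f) g) + En (G.conv f (Jm s g)))"
proof -
 have "En (Jm s (G.conv f g)) <= En (%x. en (2 powr s) * (G.conv (Jm s f) g x + G.conv f (Jm s g) x))"
  by (intro En_mono Jm_conv s) measurable
 also have "\<dots> = en (2 powr s) * En (%x. G.conv (Jm s f) g x + G.conv f (Jm s g) x)"
  by (rule En_cmult) measurable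
 also have "\<dots> <= en (2 powr s) * (2 * (En (G.conv (Jm s f) g) + En (G.conv f (Jm s g))))"
  by (intro mult_left_mono En_add) auto
 finally show ?thesis by (simp only: mult_ac)
qed

lemma conv_assoc':
 assumes "f \<in> bG dt" "g \<in> bG dt" "h \<in> bG dt"
 shows "G.conv (G.conv f g) h = G.conv f (G.conv g h)"
 by (intro ext G.conv_assoc assms)

lemma conv_commute':
 assumes "f \<in> bG dt" "g \<in> bG dt"
 shows "G.conv f g = G.conv g f"
 by (intro ext G.conv_commute assms)

text \<open>Peels one factor off a nested convolution. \<open>h\<close> collects the factors already
  passed; the derivatives fall on \<open>f\<close>, which ends the branch, or on \<open>g\<close>,
  where the step can be repeated.\<close>

lemma En_conv_Jm_conv:
 assumes s: "s \<ge> 0" and m [measurable]: "h \<in> bG dt" "f \<in> bG dt" "g \<in> bG dt"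
 shows "En (G.conv h (Jm s (G.conv f g))) <= 2 * en (2 powr s) * (En (G.conv (Jm s f) (G.conv h g)) + En (G.conv (G.conv h f) (Jm s g)))"
proof -
 have e: "G.conv (Jm s f) (G.conv h g) = G.conv h (G.conv (Jm s f) g)"
  by (rule conv_left_commute) measurable
 have e': "G.conv (G.conv h f) (Jm s g) = G.conv h (G.conv f (Jm s g))"
  by (rule conv_assoc') measurable
 have "G.conv h (Jm s (G.conv f g)) x <= en (2 powr s) * (G.conv h (G.conv (Jm s f) g) x + G.conv h (G.conv f (Jm s g)) x)" for x
 proof -
  have "G.conv h (Jm s (G.conv f g)) x <= G.conv h (%x. en (2 powr s) * (G.conv (Jm s f) g x + G.conv f (Jm s g) x)) x"
   by (intro G.conv_mono order_refl Jm_conv s m)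
  also have "\<dots> = (\<integral>\<^sup>+y. en (2 powr s) * (h y * G.conv (Jm s f) g (x - y) + h y * G.conv f (Jm s g) (x - y)) \<partial>Gam dt)"
   unfolding G.conv_def[of h] by (simp only: distrib_left mult_ac)
  also have "\<dots> = en (2 powr s) * (G.conv h (G.conv (Jm s f) g) x + G.conv h (G.conv f (Jm s g)) x)"
  proof -
   have a: "(%y. h y * w (x - y)) \<in> bG dt" if [measurable]: "w \<in> bG dt" for w by measurable
   have b: "G.conv (Jm s f) g \<in> bG dt" "G.conv f (Jm s g) \<in> bG dt" by measurable
   show ?thesis unfolding G.conv_def[of h]
    by (subst nn_integral_cmult, intro borel_measurable_add a b, subst nn_integral_add, intro a b, intro a b, rule refl)
  qed
  finally show ?thesis .
 qed
 then have "En (G.conv h (Jm s (G.conv f g))) <= En (%x. en (2 powr s) * (G.conv h (G.conv (Jm s f) g) x + G.conv h (G.conv f (Jm s g)) x))"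
  by (rule En_mono)
 also have "\<dots> = en (2 powr s) * En (%x. G.conv h (G.conv (Jm s f) g) x + G.conv h (G.conv f (Jm s g)) x)"
  by (rule En_cmult) measurable
 also have "\<dots> <= en (2 powr s) * (2 * (En (G.conv h (G.conv (Jm s f) g)) + En (G.conv h (G.conv f (Jm s g)))))"
  by (intro mult_left_mono En_add) auto
 finally show ?thesis unfolding e e' by (simp only: mult_ac)
qed

text \<open>Conjugation reflects the transform, and the convolution bounds do not distinguish a
  factor from its reflection; this predicate treats both alike.\<close>

definition lk :: "(int => real => complex) => (gf) => bool" where
 "lk y g \<longleftrightarrow> g = (%p. chi dt p * tf dt y p) \<or> g = G.rfl (%p. chi dt p * tf dt y p)"

lemma lk_measurable: "fsup S y ==> lk y g ==> g \<in> bG dt"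
 unfolding lk_def using chi_tf_measurable G.rfl_measurable by blast

lemma lk_Proj: "fsup S y ==> lk y (tf dt (%n. Proj dt (y n)))"
 unfolding lk_def by (simp add: fun_eq_iff tf_Proj)

lemma lk_Proj_conj: "fsup S y ==> lk y (tf dt (%n. Proj dt (conj_fun (y n))))"
 unfolding lk_def rfl_chi_tf by (simp add: fun_eq_iff tf_Proj[OF tf_conj_fun(1)] tf_conj_fun(2))

lemma lk_Jm:
 assumes "lk y g"
 shows "Jm s g = (%p. chi dt p * wgt dt 0 (12/25) sq p * (wgt dt (- s) (-12/25) sq p * tf dt y p)) \<or>
  Jm s g = G.rfl (%p. chi dt p * wgt dt 0 (12/25) sq p * (wgt dt (- s) (-12/25) sq p * tf dt y p))"
proof -
 have w: "chi dt p * wgt dt 0 (12/25) sq p * (wgt dt (- s) (-12/25) sq p * f) = wgt dt (- s) 0 sq p * (chi dt p * f)" for p f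
 proof -
  have "wgt dt 0 (12/25) sq p * wgt dt (- s) (-12/25) sq p = wgt dt (- s) 0 sq p" by (simp add: wgt_mult)
  then show ?thesis by (metis mult.assoc mult.commute)
 qed
 have "Jm s (G.rfl h) = G.rfl (Jm s h)" for h by (simp add: fun_eq_iff Jm_def G.rfl_def Jm_uminus)
 then show ?thesis using assms unfolding lk_def w Jm_def[abs_def] by auto
qed

lemma lk_form:
 assumes "fsup S y" "lk y g"
 shows "\<exists>\<theta> F. g = (%p. wgt dt (1/2) (12/25) \<theta> p * F p) \<and> F \<in> bG dt \<and> nG dt F <= Xh dt y"
proof -
 define F where "F p = wgt dt (-1/2) (-12/25) sq p * (chi dt p * tf dt y p)" for p
 note [measurable] = tf_measurable[OF assms(1)]
 have [measurable]: "F \<in> bG dt" unfolding F_def by measurable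
 have FX: "nG dt F <= Xh dt y"
  unfolding nrm_Fn[OF assms(1), symmetric] F_def Fn_def
  by (intro nrm_mono mult_mono wgt_mono) (auto simp: chi_def)
 have e: "(%p. chi dt p * tf dt y p) = (%p. wgt dt (1/2) (12/25) sq p * F p)"
 proof
  fix p
  show "chi dt p * tf dt y p = wgt dt (1/2) (12/25) sq p * F p"
   using wgt_cancel[of dt "1/2" "12/25" sq p "chi dt p * tf dt y p"] by (simp add: F_def)
 qed
 show ?thesis using assms(2) unfolding lk_def
 proof
  assume "g = (%p. chi dt p * tf dt y p)"
  then show ?thesis unfolding e using FX by (intro exI[of _ sq] exI[of _ F]) auto
 next
  assume "g = G.rfl (%p. chi dt p * tf dt y p)"
  then have "g = (%p. wgt dt (1/2) (12/25) (%k. - sq (- k)) p * G.rfl F p)"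
   unfolding e rfl_mult rfl_wgt .
  moreover have "nG dt (G.rfl F) <= Xh dt y" using FX G.nrm_rfl[of F] by simp
  ultimately show ?thesis by (intro exI[of _ "%k. - sq (- k)"] exI[of _ "G.rfl F"]) auto
 qed
qed

lemma X_norm_out_le:
 assumes f: "fsup S q" and le: "\<And>p. tf dt q p <= c * F p" and [measurable]: "F \<in> bG dt"
 shows "fsup S (%n. Proj dt (q n))" "X_norm dt s (-3/8) (%n. Proj dt (q n)) <= c * En (Jm s F)"
proof -
 show f': "fsup S (%n. Proj dt (q n))" using tf_Proj(1)[OF f] by (simp add: gd_def)
 have "X_norm dt s (-3/8) (%n. Proj dt (q n)) = nG dt (%p. wgt dt (- s) (3/8) sq p * (chi dt p * tf dt q p))"
  by (simp add: X_norm_eq[OF f'] tf_Proj[OF f])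
 also have "\<dots> <= nG dt (%p. c * (chi dt p * wgt dt 0 (3/8) sq p * Jm s F p))"
 proof (rule nrm_mono)
  fix p
  have w: "wgt dt (- s) (3/8) sq p = wgt dt 0 (3/8) sq p * wgt dt (- s) 0 sq p" by (simp add: wgt_mult)
  have "wgt dt (- s) (3/8) sq p * (chi dt p * tf dt q p) <= wgt dt (- s) (3/8) sq p * (chi dt p * (c * F p))"
   by (intro mult_left_mono le) auto
  then show "wgt dt (- s) (3/8) sq p * (chi dt p * tf dt q p) <= c * (chi dt p * wgt dt 0 (3/8) sq p * Jm s F p)"
   unfolding w Jm_def by (simp only: mult_ac)
 qed
 also have "\<dots> = c * En (Jm s F)" unfolding En_def by (rule nrm_cmult) measurable
 finally show "X_norm dt s (-3/8) (%n. Proj dt (q n)) <= c * En (Jm s F)" .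
qed

end

text \<open>The differentiated factor is paired with the output by \<open>out_bound\<close> and
  yields the power of \<open>T1\<close>. The other factors enter only through the L2 norm of their
  product, so one bound serves the cubic and the quintic term.\<close>

lemma factor_bound:
 "\<exists>C<\<infinity>. \<forall>dt T1 s y g H. time_step dt --> 0 < T1 --> T1 <= 1 --> dt <= 2 * T1 --> fsup (grid dt T1) y --> time_step.lk dt y g -->
  H \<in> bG dt -->
  time_step.En dt (cG dt (time_step.Jm dt s g) H) <= C * Tg T1 * (Xs dt s y * nG dt H)"
proof -
 obtain A where A: "A < \<infinity>" "\<forall>dt F G f. time_step dt --> F \<in> bG dt --> G \<in> bG dt -->
  f = (%p. chi dt p * om dt p * F p) \<or> f = inv_measure.rfl (%p. chi dt p * om dt p * F p) -->
  nG dt (%x. chi dt x * wgt dt 0 (3/8) sq x * cG dt f G x) <= A * (nG dt F * nG dt G)"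
  using out_bound by (elim exE conjE) (rule that)
 obtain P where P: "P < \<infinity>" "\<And>dt T1 a y. time_step dt ==> 0 < T1 ==> T1 <= 1 ==> dt <= 2 * T1 ==> fsup (grid dt T1) y ==>
  nG dt (%p. wgt dt a (-12/25) sq p * tf dt y p) <= P * Tg T1 * nG dt (%p. wgt dt a (-1/2) sq p * tf dt y p)"
  using modulation_gain by auto
 have "time_step.En dt (cG dt (time_step.Jm dt s g) H) <= A * P * Tg T1 * (Xs dt s y * nG dt H)"
  if t: "time_step dt" and T: "0 < T1" "T1 <= 1" "dt <= 2 * T1" and f: "fsup (grid dt T1) y" and g: "time_step.lk dt y g"
   and H: "H \<in> bG dt" for dt T1 s y g H
 proof -
  interpret time_step dt by fact
  note [measurable] = tf_measurable[OF f]
  have "En (G.conv (Jm s g) H) <= A * (nG dt (%p. wgt dt (- s) (-12/25) sq p * tf dt y p) * nG dt H)"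
   unfolding En_def by (rule A(2)[rule_format, OF t _ H lk_Jm[OF g]]) measurable
  also have "\<dots> <= A * ((P * Tg T1 * Xs dt s y) * nG dt H)"
   unfolding nrm_Fn[OF f, symmetric] Fn_def by (intro mult_left_mono mult_right_mono P(2) t T f) auto
  finally show ?thesis by (simp only: mult_ac)
 qed
 moreover have "A * P < \<infinity>" using A(1) P(1) by (simp add: ennreal_mult_less_top)
 ultimately show ?thesis by blast
qed

lemma nested_sum3: fixes K a b c :: ennreal assumes "1 <= K" shows "K * (a + K * (b + c)) <= K ^ 2 * (a + (b + c))"
proof -
 have "K * (a + K * (b + c)) <= K * (K * a + K * (b + c))"
  using mult_right_mono[OF assms, of a] by (intro mult_left_mono add_right_mono) auto
 then show ?thesis by (simp add: power2_eq_square distrib_left mult.assoc)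
qed

lemma nested_sum5: fixes K a b c d e :: ennreal assumes "1 <= K"
 shows "K * (a + K * (b + K * (c + K * (d + e)))) <= K ^ 4 * (a + (b + (c + (d + e))))"
proof -
 have K3: "K <= K ^ 3" "K^2 <= K^3" using power_increasing[of 1 3 K] power_increasing[of 2 3 K] assms by auto
 have K1: "1 <= K^3" using one_le_power[OF assms] .
 have "a + K * (b + K * (c + K * (d + e))) = 1 * a + (K * b + (K^2 * c + K^3 * (d + e)))"
  by (simp add: power2_eq_square power3_eq_cube distrib_left mult.assoc)
 also have "\<dots> <= K^3 * a + (K^3 * b + (K^3 * c + K^3 * (d + e)))"
  by (intro add_mono mult_right_mono K3 K1 order_refl) auto
 also have "\<dots> = K^3 * (a + (b + (c + (d + e))))" by (simp only: distrib_left)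
 finally have "K * (a + K * (b + K * (c + K * (d + e)))) <= K * (K^3 * (a + (b + (c + (d + e)))))" by (rule mult_left_mono) simp
 also have "\<dots> = K ^ 4 * (a + (b + (c + (d + e))))" by (simp add: eval_nat_numeral mult.assoc)
 finally show ?thesis .
qed

lemma cubic_estimate:
 assumes s: "s \<ge> 0"
 shows "\<exists>C<\<infinity>. \<forall>dt T1 u1 u2 u3. time_step dt --> 0 < T1 --> T1 <= 1 --> dt <= 2 * T1 -->
  fsup (grid dt T1) u1 --> fsup (grid dt T1) u2 --> fsup (grid dt T1) u3 -->
  X_norm dt s (-3/8) (%n. Proj dt (%x. Proj dt (conj_fun (u1 n)) x * Proj dt (u2 n) x * Proj dt (u3 n) x)) <=
  C * Tg T1 *
  (mix3 (Xs dt s) (Xh dt) u1 u2 u3)"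
proof -
 obtain A where A: "A < \<infinity>" "\<And>dt T1 s y g H. time_step dt ==> 0 < T1 ==> T1 <= 1 ==> dt <= 2 * T1 ==> fsup (grid dt T1) y ==> time_step.lk dt y g ==>
  H \<in> bG dt ==>
  time_step.En dt (cG dt (time_step.Jm dt s g) H) <= A * Tg T1 * (Xs dt s y * nG dt H)"
  using factor_bound by auto
 obtain B where B: "B < \<infinity>" "\<And>dt \<theta> \<theta>' F G. time_step dt ==> F \<in> bG dt ==> G \<in> bG dt ==>
  nG dt (cG dt (%p. wgt dt (1/2) (12/25) \<theta> p * F p) (%p. wgt dt (1/2) (12/25) \<theta>' p * G p)) <= B * (nG dt F * nG dt G)"
  using conv2_bound by auto
 define K where "K = 2 * en (2 powr s)"
 define C where "C = en (1 / (2 * pi)) ^ 2 * K ^ 2 * (A * B)"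
 have K1: "1 <= K"
 proof -
  have "en 1 <= en (2 * 2 powr s)" using s ge_one_powr_ge_zero[of 2 s] by (intro ennreal_leI) auto
  then show ?thesis by (simp add: K_def ennreal_mult)
 qed
 have "X_norm dt s (-3/8) (%n. Proj dt (%x. Proj dt (conj_fun (u1 n)) x * Proj dt (u2 n) x * Proj dt (u3 n) x)) <=
  C * Tg T1 *
  (mix3 (Xs dt s) (Xh dt) u1 u2 u3)"
  if t: "time_step dt" and T: "0 < T1" "T1 <= 1" "dt <= 2 * T1" and f: "fsup (grid dt T1) u1" "fsup (grid dt T1) u2" "fsup (grid dt T1) u3"
  for dt T1 u1 u2 u3
 proof -
  interpret time_step dt by fact
  define g1 g2 g3 where g: "g1 = tf dt (%n. Proj dt (conj_fun (u1 n)))" "g2 = tf dt (%n. Proj dt (u2 n))" "g3 = tf dt (%n. Proj dt (u3 n))"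
  have l: "lk u1 g1" "lk u2 g2" "lk u3 g3" unfolding g by (rule lk_Proj_conj[OF f(1)] lk_Proj[OF f(2)] lk_Proj[OF f(3)])+
  note m [measurable] = lk_measurable[OF f(1) l(1)] lk_measurable[OF f(2) l(2)] lk_measurable[OF f(3) l(3)]
  note P = tf_Proj(1)[OF tf_conj_fun(1)[OF f(1)]] tf_Proj(1)[OF f(2)] tf_Proj(1)[OF f(3)]
  note Q = tf_mult(1)[OF P(1,2)]
  have fo: "fsup (grid dt T1) (%n x. Proj dt (conj_fun (u1 n)) x * Proj dt (u2 n) x * Proj dt (u3 n) x)"
   using tf_mult(1)[OF Q P(3)] by (simp add: gd_def)
  let ?k = "en (1 / (2 * pi))"
  have 1: "tf dt (%n x. Proj dt (conj_fun (u1 n)) x * Proj dt (u2 n) x) p <= ?k * 1 * 1 * G.conv g1 g2 p" for p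
   by (rule tf_mult_le[OF P(1,2)]) (use m in \<open>simp_all add: g\<close>)
  have 2: "tf dt (%n x. Proj dt (conj_fun (u1 n)) x * Proj dt (u2 n) x * Proj dt (u3 n) x) p <= ?k * (?k * 1 * 1) * 1 * G.conv (G.conv g1 g2) g3 p" for p
   by (rule tf_mult_le[OF Q P(3) 1]) (use m in \<open>simp_all add: g(3)\<close>)
  have pr: "nG dt (G.conv h h') <= B * (Xh dt y * Xh dt y')"
   if y: "fsup (grid dt T1) y" "lk y h" "fsup (grid dt T1) y'" "lk y' h'" for y h y' h'
  proof -
   obtain \<theta> F where F: "h = (%p. wgt dt (1/2) (12/25) \<theta> p * F p)" "F \<in> bG dt" "nG dt F <= Xh dt y"
    using lk_form[OF y(1,2)] by (elim exE conjE) (rule that)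
   obtain \<theta>' F' where F': "h' = (%p. wgt dt (1/2) (12/25) \<theta>' p * F' p)" "F' \<in> bG dt" "nG dt F' <= Xh dt y'"
    using lk_form[OF y(3,4)] by (elim exE conjE) (rule that)
   have "nG dt (G.conv h h') <= B * (nG dt F * nG dt F')" unfolding F(1) F'(1) by (rule B(2)[OF t F(2) F'(2)])
   also have "\<dots> <= B * (Xh dt y * Xh dt y')" by (intro mult_left_mono mult_mono F(3) F'(3)) auto
   finally show ?thesis .
  qed
  have tm: "En (G.conv (Jm s h) (G.conv h' h'')) <= A * B * Tg T1 * (Xs dt s y * (Xh dt y' * Xh dt y''))"
   if y: "fsup (grid dt T1) y" "lk y h" "fsup (grid dt T1) y'" "lk y' h'" "fsup (grid dt T1) y''" "lk y'' h''" for y h y' h' y'' h''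
  proof -
   have "En (G.conv (Jm s h) (G.conv h' h'')) <= A * Tg T1 * (Xs dt s y * nG dt (G.conv h' h''))"
    by (rule A(2)[OF t T y(1,2)]) (intro G.conv_measurable lk_measurable[OF y(3,4)] lk_measurable[OF y(5,6)])
   also have "\<dots> <= A * Tg T1 * (Xs dt s y * (B * (Xh dt y' * Xh dt y'')))"
    by (intro mult_left_mono pr y) auto
   finally show ?thesis by (simp only: mult_ac)
  qed
  have e: "G.conv (G.conv g1 g2) g3 = G.conv g1 (G.conv g2 g3)" "G.conv (G.conv g1 g2) (Jm s g3) = G.conv (Jm s g3) (G.conv g1 g2)"
   by (rule conv_assoc' conv_commute', measurable)+
  have "En (Jm s (G.conv g1 (G.conv g2 g3))) <= K * (En (G.conv (Jm s g1) (G.conv g2 g3)) + En (G.conv g1 (Jm s (G.conv g2 g3))))"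
   unfolding K_def by (rule En_Jm_conv[OF s]) measurable
  also have "\<dots> <= K * (En (G.conv (Jm s g1) (G.conv g2 g3)) + K * (En (G.conv (Jm s g2) (G.conv g1 g3)) + En (G.conv (Jm s g3) (G.conv g1 g2))))"
   unfolding e(2)[symmetric] unfolding K_def by (intro mult_left_mono add_left_mono En_conv_Jm_conv[OF s] m) auto
  also have "\<dots> <= K ^ 2 * (En (G.conv (Jm s g1) (G.conv g2 g3)) + (En (G.conv (Jm s g2) (G.conv g1 g3)) + En (G.conv (Jm s g3) (G.conv g1 g2))))"
   by (rule nested_sum3[OF K1])
  also have "\<dots> <= K ^ 2 * (A * B * Tg T1 * (Xs dt s u1 * (Xh dt u2 * Xh dt u3)) +
   (A * B * Tg T1 * (Xs dt s u2 * (Xh dt u1 * Xh dt u3)) +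
   A * B * Tg T1 * (Xs dt s u3 * (Xh dt u1 * Xh dt u2))))"
   by (intro mult_left_mono add_mono tm f l) simp
  finally have fin: "En (Jm s (G.conv (G.conv g1 g2) g3)) <= K ^ 2 * (A * B * Tg T1 *
   (mix3 (Xs dt s) (Xh dt) u1 u2 u3))"
   unfolding e(1) distrib_left[symmetric] .
  have "X_norm dt s (-3/8) (%n. Proj dt (%x. Proj dt (conj_fun (u1 n)) x * Proj dt (u2 n) x * Proj dt (u3 n) x)) <= ?k * (?k * 1 * 1) * 1 * En (Jm s (G.conv (G.conv g1 g2) g3))"
   by (rule X_norm_out_le(2)[OF fo 2]) measurable
  also have "\<dots> <= ?k * (?k * 1 * 1) * 1 * (K ^ 2 * (A * B * Tg T1 *
   (mix3 (Xs dt s) (Xh dt) u1 u2 u3)))"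
   by (rule mult_left_mono[OF fin]) simp
  finally show ?thesis unfolding C_def by (simp only: power2_eq_square mult_1_left mult_1_right mult_ac)
 qed
 moreover have "C < \<infinity>" using A(1) B(1) by (simp add: C_def K_def ennreal_mult_less_top power_less_top_ennreal)
 ultimately show ?thesis by blast
qed

text \<open>The Leibniz rule is applied four times. In each of the five terms the differentiated
  factor goes to \<open>factor_bound\<close> and the other four to
  \<open>conv4_bound\<close>.\<close>

lemma quintic_estimate:
 assumes s: "s \<ge> 0"
 shows "\<exists>C<\<infinity>. \<forall>dt T1 u1 u2 u3 u4 u5. time_step dt --> 0 < T1 --> T1 <= 1 --> dt <= 2 * T1 -->
  fsup (grid dt T1) u1 --> fsup (grid dt T1) u2 --> fsup (grid dt T1) u3 --> fsup (grid dt T1) u4 --> fsup (grid dt T1) u5 -->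
  X_norm dt s (-3/8) (%n. Proj dt (%x. Proj dt (conj_fun (u1 n)) x * Proj dt (conj_fun (u2 n)) x * (Proj dt (u3 n) x * Proj dt (u4 n) x * Proj dt (u5 n) x))) <=
  C * Tg T1 *
  (mix5 (Xs dt s) (Xh dt) u1 u2 u3 u4 u5)"
proof -
 obtain A where A: "A < \<infinity>" "\<And>dt T1 s y g H. time_step dt ==> 0 < T1 ==> T1 <= 1 ==> dt <= 2 * T1 ==> fsup (grid dt T1) y ==> time_step.lk dt y g ==>
  H \<in> bG dt ==>
  time_step.En dt (cG dt (time_step.Jm dt s g) H) <= A * Tg T1 * (Xs dt s y * nG dt H)"
  using factor_bound by auto
 obtain B where B: "B < \<infinity>" "\<forall>dt \<theta>1 \<theta>2 \<theta>3 \<theta>4 F G H I. time_step dt -->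
  F \<in> bG dt --> G \<in> bG dt --> H \<in> bG dt --> I \<in> bG dt -->
  nG dt (cG dt
   (cG dt (%p. wgt dt (1/2) (12/25) \<theta>1 p * F p) (%p. wgt dt (1/2) (12/25) \<theta>2 p * G p))
   (cG dt (%p. wgt dt (1/2) (12/25) \<theta>3 p * H p) (%p. wgt dt (1/2) (12/25) \<theta>4 p * I p)))
  <= B * (nG dt F * nG dt G * nG dt H * nG dt I)"
  using conv4_bound by (elim exE conjE) (rule that)
 define K where "K = 2 * en (2 powr s)"
 define C where "C = en (1 / (2 * pi)) ^ 4 * K ^ 4 * (A * B)"
 have K1: "1 <= K"
 proof -
  have "en 1 <= en (2 * 2 powr s)" using s ge_one_powr_ge_zero[of 2 s] by (intro ennreal_leI) auto
  then show ?thesis by (simp add: K_def ennreal_mult)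
 qed
 have "X_norm dt s (-3/8) (%n. Proj dt (%x. Proj dt (conj_fun (u1 n)) x * Proj dt (conj_fun (u2 n)) x * (Proj dt (u3 n) x * Proj dt (u4 n) x * Proj dt (u5 n) x))) <=
  C * Tg T1 *
  (mix5 (Xs dt s) (Xh dt) u1 u2 u3 u4 u5)"
  if t: "time_step dt" and T: "0 < T1" "T1 <= 1" "dt <= 2 * T1"
   and f: "fsup (grid dt T1) u1" "fsup (grid dt T1) u2" "fsup (grid dt T1) u3" "fsup (grid dt T1) u4" "fsup (grid dt T1) u5"
  for dt T1 u1 u2 u3 u4 u5
 proof -
  interpret time_step dt by fact
  define g1 g2 g3 g4 g5 where g: "g1 = tf dt (%n. Proj dt (conj_fun (u1 n)))" "g2 = tf dt (%n. Proj dt (conj_fun (u2 n)))"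
   "g3 = tf dt (%n. Proj dt (u3 n))" "g4 = tf dt (%n. Proj dt (u4 n))" "g5 = tf dt (%n. Proj dt (u5 n))"
  have l: "lk u1 g1" "lk u2 g2" "lk u3 g3" "lk u4 g4" "lk u5 g5"
   unfolding g by (rule lk_Proj_conj[OF f(1)] lk_Proj_conj[OF f(2)] lk_Proj[OF f(3)] lk_Proj[OF f(4)] lk_Proj[OF f(5)])+
  note m = lk_measurable[OF f(1) l(1)] lk_measurable[OF f(2) l(2)] lk_measurable[OF f(3) l(3)] lk_measurable[OF f(4) l(4)] lk_measurable[OF f(5) l(5)]
  note mm = m G.conv_measurable Jm_measurable
  note P = tf_Proj(1)[OF tf_conj_fun(1)[OF f(1)]] tf_Proj(1)[OF tf_conj_fun(1)[OF f(2)]] tf_Proj(1)[OF f(3)] tf_Proj(1)[OF f(4)] tf_Proj(1)[OF f(5)]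
  note Q = tf_mult(1)[OF P(1,2)] tf_mult(1)[OF tf_mult(1)[OF P(3,4)] P(5)]
  have fo: "fsup (grid dt T1) (%n x. Proj dt (conj_fun (u1 n)) x * Proj dt (conj_fun (u2 n)) x * (Proj dt (u3 n) x * Proj dt (u4 n) x * Proj dt (u5 n) x))"
   using tf_mult(1)[OF Q] by (simp add: gd_def)
  let ?k = "en (1 / (2 * pi))"
  have 1: "tf dt (%n x. Proj dt (conj_fun (u1 n)) x * Proj dt (conj_fun (u2 n)) x) p <= ?k * 1 * 1 * G.conv g1 g2 p" for p
   by (rule tf_mult_le[OF P(1,2) _ _ m(1,2)]) (simp_all add: g)
  have 2: "tf dt (%n x. Proj dt (u3 n) x * Proj dt (u4 n) x) p <= ?k * 1 * 1 * G.conv g3 g4 p" for p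
   by (rule tf_mult_le[OF P(3,4) _ _ m(3,4)]) (simp_all add: g)
  have 3: "tf dt (%n x. Proj dt (u3 n) x * Proj dt (u4 n) x * Proj dt (u5 n) x) p <= ?k * (?k * 1 * 1) * 1 * G.conv (G.conv g3 g4) g5 p" for p
   by (rule tf_mult_le[OF tf_mult(1)[OF P(3,4)] P(5) 2 _ G.conv_measurable[OF m(3,4)] m(5)]) (simp add: g(5))
  have 4: "tf dt (%n x. Proj dt (conj_fun (u1 n)) x * Proj dt (conj_fun (u2 n)) x * (Proj dt (u3 n) x * Proj dt (u4 n) x * Proj dt (u5 n) x)) p
   <= ?k * (?k * 1 * 1) * (?k * (?k * 1 * 1) * 1) * G.conv (G.conv g1 g2) (G.conv (G.conv g3 g4) g5) p" for p
   by (rule tf_mult_le[OF Q 1 3]) (intro mm)+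
  have pr: "nG dt (G.conv (G.conv h1 h2) (G.conv h3 h4)) <= B * (Xh dt y1 * Xh dt y2 * (Xh dt y3 * Xh dt y4))"
   if y: "fsup (grid dt T1) y1" "lk y1 h1" "fsup (grid dt T1) y2" "lk y2 h2" "fsup (grid dt T1) y3" "lk y3 h3" "fsup (grid dt T1) y4" "lk y4 h4"
   for h1 y1 h2 y2 h3 y3 h4 y4
  proof -
   obtain \<theta>1 F1 where F1: "h1 = (%p. wgt dt (1/2) (12/25) \<theta>1 p * F1 p)" "F1 \<in> bG dt" "nG dt F1 <= Xh dt y1"
    using lk_form[OF y(1,2)] by (elim exE conjE) (rule that)
   obtain \<theta>2 F2 where F2: "h2 = (%p. wgt dt (1/2) (12/25) \<theta>2 p * F2 p)" "F2 \<in> bG dt" "nG dt F2 <= Xh dt y2"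
    using lk_form[OF y(3,4)] by (elim exE conjE) (rule that)
   obtain \<theta>3 F3 where F3: "h3 = (%p. wgt dt (1/2) (12/25) \<theta>3 p * F3 p)" "F3 \<in> bG dt" "nG dt F3 <= Xh dt y3"
    using lk_form[OF y(5,6)] by (elim exE conjE) (rule that)
   obtain \<theta>4 F4 where F4: "h4 = (%p. wgt dt (1/2) (12/25) \<theta>4 p * F4 p)" "F4 \<in> bG dt" "nG dt F4 <= Xh dt y4"
    using lk_form[OF y(7,8)] by (elim exE conjE) (rule that)
   have "nG dt (G.conv (G.conv h1 h2) (G.conv h3 h4)) <= B * (nG dt F1 * nG dt F2 * nG dt F3 * nG dt F4)"
    unfolding F1(1) F2(1) F3(1) F4(1) by (rule B(2)[rule_format, OF t F1(2) F2(2) F3(2) F4(2)])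
   also have "\<dots> <= B * (Xh dt y1 * Xh dt y2 * Xh dt y3 * Xh dt y4)"
    by (intro mult_left_mono mult_mono F1(3) F2(3) F3(3) F4(3)) auto
   finally show ?thesis by (simp only: mult.assoc)
  qed
  have tm: "En (G.conv (Jm s h) (G.conv (G.conv h1 h2) (G.conv h3 h4))) <= A * B * Tg T1 *
   (Xs dt s y * (Xh dt y1 * Xh dt y2 * (Xh dt y3 * Xh dt y4)))"
   if y0: "fsup (grid dt T1) y" "lk y h" and y: "fsup (grid dt T1) y1" "lk y1 h1" "fsup (grid dt T1) y2" "lk y2 h2" "fsup (grid dt T1) y3" "lk y3 h3" "fsup (grid dt T1) y4" "lk y4 h4"
   for h y h1 y1 h2 y2 h3 y3 h4 y4
  proof -
   have "En (G.conv (Jm s h) (G.conv (G.conv h1 h2) (G.conv h3 h4))) <= A * Tg T1 * (Xs dt s y * nG dt (G.conv (G.conv h1 h2) (G.conv h3 h4)))"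
    by (rule A(2)[OF t T y0]) (intro G.conv_measurable lk_measurable[OF y(1,2)] lk_measurable[OF y(3,4)] lk_measurable[OF y(5,6)] lk_measurable[OF y(7,8)])
   also have "\<dots> <= A * Tg T1 * (Xs dt s y * (B * (Xh dt y1 * Xh dt y2 * (Xh dt y3 * Xh dt y4))))"
    by (intro mult_left_mono pr y) auto
   finally show ?thesis by (simp only: mult_ac)
  qed
  let ?a = "G.conv (Jm s g1) (G.conv (G.conv g2 g3) (G.conv g4 g5))"
  let ?b = "G.conv (Jm s g2) (G.conv (G.conv g1 g3) (G.conv g4 g5))"
  let ?c = "G.conv (Jm s g3) (G.conv (G.conv g1 g2) (G.conv g4 g5))"
  let ?d = "G.conv (Jm s g4) (G.conv (G.conv g1 g2) (G.conv g3 g5))"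
  let ?e = "G.conv (Jm s g5) (G.conv (G.conv g1 g2) (G.conv g3 g4))"
  have e0: "G.conv (G.conv g1 g2) (G.conv (G.conv g3 g4) g5) = G.conv g1 (G.conv g2 (G.conv g3 (G.conv g4 g5)))"
   by (subst conv_assoc'[of g3], (intro mm)+, subst conv_assoc'[of g1], (intro mm)+, rule refl)
  have e1: "G.conv g2 (G.conv g3 (G.conv g4 g5)) = G.conv (G.conv g2 g3) (G.conv g4 g5)"
   and e2: "G.conv g1 (G.conv g3 (G.conv g4 g5)) = G.conv (G.conv g1 g3) (G.conv g4 g5)"
   and e4: "G.conv (G.conv (G.conv g1 g2) g3) g5 = G.conv (G.conv g1 g2) (G.conv g3 g5)"
   and e5: "G.conv (G.conv (G.conv g1 g2) g3) g4 = G.conv (G.conv g1 g2) (G.conv g3 g4)"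
   by (rule conv_assoc' conv_assoc'[symmetric]; intro mm)+
  have 5: "En (G.conv (G.conv (G.conv g1 g2) g3) (Jm s (G.conv g4 g5))) <= K * (En ?d + En ?e)"
   using En_conv_Jm_conv[OF s, of "G.conv (G.conv g1 g2) g3" g4 g5]
   unfolding K_def[symmetric] e4 e5 conv_commute'[OF G.conv_measurable[OF G.conv_measurable[OF m(1,2)] G.conv_measurable[OF m(3,4)]] Jm_measurable[OF m(5)]]
   by (simp add: mm)
  have "En (G.conv (G.conv g1 g2) (Jm s (G.conv g3 (G.conv g4 g5)))) <= K * (En ?c + En (G.conv (G.conv (G.conv g1 g2) g3) (Jm s (G.conv g4 g5))))"
   unfolding K_def by (rule En_conv_Jm_conv[OF s]) (intro mm)+
  also have "\<dots> <= K * (En ?c + K * (En ?d + En ?e))" by (intro mult_left_mono add_left_mono 5) simp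
  finally have 6: "En (G.conv (G.conv g1 g2) (Jm s (G.conv g3 (G.conv g4 g5)))) <= K * (En ?c + K * (En ?d + En ?e))" .
  have "En (G.conv g1 (Jm s (G.conv g2 (G.conv g3 (G.conv g4 g5))))) <= K * (En ?b + En (G.conv (G.conv g1 g2) (Jm s (G.conv g3 (G.conv g4 g5)))))"
   unfolding K_def e2[symmetric] by (rule En_conv_Jm_conv[OF s]) (intro mm)+
  also have "\<dots> <= K * (En ?b + K * (En ?c + K * (En ?d + En ?e)))" by (intro mult_left_mono add_left_mono 6) simp
  finally have 7: "En (G.conv g1 (Jm s (G.conv g2 (G.conv g3 (G.conv g4 g5))))) <= K * (En ?b + K * (En ?c + K * (En ?d + En ?e)))" .
  have "En (Jm s (G.conv g1 (G.conv g2 (G.conv g3 (G.conv g4 g5))))) <= K * (En ?a + En (G.conv g1 (Jm s (G.conv g2 (G.conv g3 (G.conv g4 g5))))))"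
   unfolding K_def e1[symmetric] by (rule En_Jm_conv[OF s]) (intro mm)+
  also have "\<dots> <= K * (En ?a + K * (En ?b + K * (En ?c + K * (En ?d + En ?e))))" by (intro mult_left_mono add_left_mono 7) simp
  also have "\<dots> <= K ^ 4 * (En ?a + (En ?b + (En ?c + (En ?d + En ?e))))" by (rule nested_sum5[OF K1])
  also have "\<dots> <= K ^ 4 * (A * B * Tg T1 *
   (Xs dt s u1 * (Xh dt u2 * Xh dt u3 * (Xh dt u4 * Xh dt u5))) + (A * B * Tg T1 *
   (Xs dt s u2 * (Xh dt u1 * Xh dt u3 * (Xh dt u4 * Xh dt u5))) + (A * B * Tg T1 *
   (Xs dt s u3 * (Xh dt u1 * Xh dt u2 * (Xh dt u4 * Xh dt u5))) + (A * B * Tg T1 *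
   (Xs dt s u4 * (Xh dt u1 * Xh dt u2 * (Xh dt u3 * Xh dt u5))) + A * B * Tg T1 *
   (Xs dt s u5 * (Xh dt u1 * Xh dt u2 * (Xh dt u3 * Xh dt u4)))))))"
   by (intro mult_left_mono add_mono tm f l) simp
  finally have fin: "En (Jm s (G.conv (G.conv g1 g2) (G.conv (G.conv g3 g4) g5))) <= K ^ 4 * (A * B * Tg T1 *
  (mix5 (Xs dt s) (Xh dt) u1 u2 u3 u4 u5))"
   unfolding e0 distrib_left[symmetric] .
  have "X_norm dt s (-3/8) (%n. Proj dt (%x. Proj dt (conj_fun (u1 n)) x * Proj dt (conj_fun (u2 n)) x * (Proj dt (u3 n) x * Proj dt (u4 n) x * Proj dt (u5 n) x))) <=
   ?k * (?k * 1 * 1) * (?k * (?k * 1 * 1) * 1) * En (Jm s (G.conv (G.conv g1 g2) (G.conv (G.conv g3 g4) g5)))"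
   by (rule X_norm_out_le(2)[OF fo 4]) (intro mm)
  also have "\<dots> <= ?k * (?k * 1 * 1) * (?k * (?k * 1 * 1) * 1) * (K ^ 4 * (A * B * Tg T1 *
  (mix5 (Xs dt s) (Xh dt) u1 u2 u3 u4 u5)))"
   by (rule mult_left_mono[OF fin]) simp
  also have "\<dots> = C * Tg T1 *
  (mix5 (Xs dt s) (Xh dt) u1 u2 u3 u4 u5)"
  proof -
   have "?k * (?k * 1 * 1) * (?k * (?k * 1 * 1) * 1) * (K ^ 4 * (A * B * t * Z)) = ?k ^ 4 * K ^ 4 * (A * B) * t * Z" for t Z
    by (simp add: power4_eq_xxxx mult_ac)
   then show ?thesis unfolding C_def .
  qed
  finally show ?thesis .
 qed
 moreover have "C < \<infinity>" using A(1) B(1) by (simp add: C_def K_def ennreal_mult_less_top power_less_top_ennreal)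
 ultimately show ?thesis by blast
qed

section \<open>Scalar sequences in time and squared Sobolev norms\<close>

lemma fourier_coeff_const: "fc (%x. c) k = (if k = 0 then c else 0)" and tpoly_const: "tpoly (%x. c)"
proof -
 have e: "(%x. c) = tp {0} (%_. c)" by (simp add: tp_def fun_eq_iff)
 show "tpoly (%x. c)" unfolding e by (rule tpoly_tp) simp
 show "fc (%x. c) k = (if k = 0 then c else 0)" unfolding e by (subst fourier_coeff_tp) auto
qed

context time_step begin

text \<open>A scalar sequence is regarded as a sequence of constant functions on the torus, so that
  the product rule \<open>tf_mult\<close> carries over.\<close>

definition ft :: "(int => complex) => real => ennreal" where
 "ft a \<sigma> = tf dt (%n x. a n) (0, \<sigma>)"

lemma const_gd: "finite S ==> (\<And>n. n \<notin> S ==> a n = 0) ==> gd S (%n x. a n)"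
 by (auto simp: gd_def fsup_def tpoly_const)

lemma ft_measurable [measurable (raw)]: "finite S ==> (\<And>n. n \<notin> S ==> a n = 0) ==> ft a \<in> bC dt"
 unfolding ft_def using Gam_Pair[OF tf_measurable, of S "%n x. a n" 0] const_gd[of S a] by (simp add: gd_def)

lemma tilde_const: "finite S ==> (\<And>n. n \<notin> S ==> a n = 0) ==> tilde dt (%n x. a n) \<sigma> 0 = of_real dt * (\<Sum>n\<in>S. a n * cis (- (of_int n * dt * \<sigma>)))"
 by (subst tilde_finite[of S]) (auto simp: fourier_coeff_const)

lemma ft_mult:
 assumes S: "finite S" and a: "\<And>n. n \<notin> S ==> a n = 0" and b: "\<And>n. n \<notin> S ==> b n = 0"
 shows "ft (%n. a n * b n) \<sigma> <= C.conv (ft a) (ft b) \<sigma>"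
proof -
 note ga = const_gd[OF S a] and gb = const_gd[OF S b]
 have f: "fsup S (%n x. a n)" "fsup S (%n x. b n)" using ga gb by (simp_all add: gd_def)
 note [measurable] = tf_measurable[OF f(1)] tf_measurable[OF f(2)]
 have z: "tf dt (%n x. a n) (k, s) = 0" if "k \<noteq> 0" for k s
  using that by (simp add: tf_def tilde_fsup[OF f(1)] fourier_coeff_const)
 have le1: "en (1 / (2 * pi)) <= en 1" using pi_gt3 by (intro ennreal_leI) (simp add: field_simps)
 have "ft (%n. a n * b n) \<sigma> <= en (1 / (2 * pi)) * G.conv (tf dt (%n x. a n)) (tf dt (%n x. b n)) (0, \<sigma>)"
  unfolding ft_def by (rule tf_mult(2)[OF ga gb])
 also have "\<dots> <= en 1 * G.conv (tf dt (%n x. a n)) (tf dt (%n x. b n)) (0, \<sigma>)"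
  by (rule mult_right_mono[OF le1]) simp
 also have "\<dots> = (SI k. (\<integral>\<^sup>+s. tf dt (%n x. a n) (k, s) * tf dt (%n x. b n) ((0, \<sigma>) - (k, s)) \<partial>circ dt))"
  unfolding G.conv_def by (subst nn_integral_Gam[OF tau_pos]) auto
 also have "\<dots> = (\<Sum>k\<in>{0}. (\<integral>\<^sup>+s. tf dt (%n x. a n) (k, s) * tf dt (%n x. b n) ((0, \<sigma>) - (k, s)) \<partial>circ dt))"
  by (rule nn_integral_count_space') (auto simp: z)
 also have "\<dots> = C.conv (ft a) (ft b) \<sigma>" by (simp add: C.conv_def ft_def)
 finally show ?thesis .
qed

lemma ft_add:
 assumes S: "finite S" and a: "\<And>n. n \<notin> S ==> a n = 0" and b: "\<And>n. n \<notin> S ==> b n = 0"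
 shows "ft (%n. a n + b n) \<sigma> <= ft a \<sigma> + ft b \<sigma>"
proof -
 have "tilde dt (%n x. a n + b n) \<sigma> 0 = tilde dt (%n x. a n) \<sigma> 0 + tilde dt (%n x. b n) \<sigma> 0"
  by (subst (1 2 3) tilde_const[OF S]) (auto simp: a b distrib_right sum.distrib distrib_left)
 then show ?thesis unfolding ft_def tf_def fst_conv snd_conv
  by (simp add: ennreal_leI norm_triangle_ineq flip: ennreal_plus)
qed

text \<open>At modulation 0 the transform of a nonnegative sequence is its sum over time, which
  turns time sums of products into values of convolutions.\<close>

lemma ft_0:
 assumes S: "finite S" and a: "\<And>n. n \<notin> S ==> a n = 0" and nn: "\<And>n. a n \<ge> (0::real)"
 shows "ft (%n. of_real (a n)) 0 = en (dt * (\<Sum>n\<in>S. a n))"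
proof -
 have "tilde dt (%n x. of_real (a n)) 0 0 = of_real (dt * (\<Sum>n\<in>S. a n))"
  by (subst tilde_const[OF S]) (auto simp: a)
 then show ?thesis using tau_pos nn unfolding ft_def tf_def fst_conv snd_conv
  by (simp only: norm_of_real) (simp add: sum_nonneg)
qed

text \<open>A Sobolev norm of order \<open>\<gamma>\<close> in time, on the transform side.\<close>

definition wn :: "real => (real => ennreal) => ennreal" where
 "wn \<gamma> f = nC dt (%\<sigma>. en (W dt \<sigma> powr \<gamma>) * f \<sigma>)"

lemma wn_mono: "(\<And>\<sigma>. f \<sigma> <= g \<sigma>) ==> wn \<gamma> f <= wn \<gamma> g"
 unfolding wn_def by (intro nrm_mono mult_left_mono) auto

lemma nrm_le_wn: assumes "\<gamma> \<ge> 0" shows "nC dt f <= wn \<gamma> f"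
 unfolding wn_def
proof (rule nrm_mono)
 fix x show "f x <= en (W dt x powr \<gamma>) * f x"
  using mult_right_mono[of 1 "en (W dt x powr \<gamma>)" "f x"] assms by (simp add: ge_one_powr_ge_zero W_ge_1 ennreal_ge_1)
qed

lemma wn_add:
 assumes [measurable]: "f \<in> bC dt" "g \<in> bC dt"
 shows "wn \<gamma> (%x. f x + g x) <= 2 * (wn \<gamma> f + wn \<gamma> g)"
 unfolding wn_def distrib_left[of "en _"] by (rule nrm_add) measurable

lemma W_powr_cancel: "en (W dt x powr - a) * (en (W dt x powr a) * f) = f"
proof -
 have "en (W dt x powr - a) * en (W dt x powr a) = 1"
  by (subst ennreal_mult[symmetric]) (auto simp flip: powr_add)
 then show ?thesis by (metis mult.assoc mult_1_left)
qed

text \<open>Minkowski's inequality, obtained by duality and exchange of sum and integral.\<close>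

lemma nrm_sum_le:
 fixes g :: "int => real => ennreal"
 assumes [measurable]: "\<And>k. g k \<in> bC dt"
 shows "nC dt (%\<sigma>. \<integral>\<^sup>+k. g k \<sigma> \<partial>cZ) <= (SI k. nC dt (g k))"
proof (rule C.nrm_le_dual)
 have "(%p. g (fst p) (snd p)) \<in> bG dt" by (rule Gam_measurableI) simp
 then have "(%x. g (snd x) (fst x)) \<in> borel_measurable (circ dt \<Otimes>\<^sub>M cZ)"
  unfolding Gam_def using measurable_compose[OF measurable_pair_swap'] by (auto simp: split_beta')
 then show "(%\<sigma>. \<integral>\<^sup>+k. g k \<sigma> \<partial>cZ) \<in> bC dt"
  by (intro I.borel_measurable_nn_integral) (simp add: split_beta')
 fix F :: "real => ennreal" assume F [measurable]: "F \<in> bC dt"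
 have "(\<integral>\<^sup>+\<sigma>. F \<sigma> * (SI k. g k \<sigma>) \<partial>circ dt) = (\<integral>\<^sup>+\<sigma>. (SI k. F \<sigma> * g k \<sigma>) \<partial>circ dt)"
  by (simp only: sum_const_M)
 also have "\<dots> = (SI k. (\<integral>\<^sup>+\<sigma>. F \<sigma> * g k \<sigma> \<partial>circ dt))"
  by (rule nn_integral_circ_sum) measurable
 also have "\<dots> <= (SI k. nC dt F * nC dt (g k))"
  by (intro nn_integral_mono Cauchy_Schwarz_nrm) measurable
 finally show "(\<integral>\<^sup>+\<sigma>. F \<sigma> * (SI k. g k \<sigma>) \<partial>circ dt) <= (SI k. nC dt (g k)) * nC dt F"
  by (simp only: sum_const_M mult.commute)
qed

definition ys :: "real => (int => real => complex) => int => real" where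
 "ys s u n = (\<Sum>k\<in>Kf dt. J (of_int k) powr (2 * s) * (norm (fc (u n) k))\<^sup>2)"

lemma ys_nonneg: "ys s u n \<ge> 0" unfolding ys_def by (intro sum_nonneg) simp

lemma ys_0: "fsup S u ==> n \<notin> S ==> ys s u n = 0"
 by (simp add: ys_def fsup_def)

text \<open>\<open>ys s u\<close> is the zero coefficient of \<open>U\<close> times its conjugate,
  where \<open>U\<close> is the projection of \<open>u\<close> after \<open>s\<close> derivatives.
  Its time transform is thus dominated by a sum over \<open>k\<close> of autocorrelations.\<close>

lemma ft_ys:
 assumes f: "fsup S u"
 shows "ft (%n. of_real (ys s u n)) \<sigma> <=
  (SI k. C.conv (%\<sigma>. Jm s (%p. chi dt p * tf dt u p) (k, \<sigma>)) (C.rfl (%\<sigma>. Jm s (%p. chi dt p * tf dt u p) (k, \<sigma>))) \<sigma>)"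
proof -
 have S: "finite S" using f by (simp add: fsup_def)
 define U where "U n = tp (Kf dt) (%k. of_real (J (of_int k) powr s) * fc (u n) k)" for n
 have U: "gd S U" using f by (auto simp: gd_def U_def tpoly_tp[OF finite_Kf] fsup_def) (simp add: tp_def[abs_def])
 then have fU: "fsup S U" by (simp add: gd_def)
 have fcU: "fc (U n) k = (if k \<in> Kf dt then of_real (J (of_int k) powr s) * fc (u n) k else 0)" for n k
  unfolding U_def by (rule fourier_coeff_tp[OF finite_Kf])
 have cU: "gd S (%n. conj_fun (U n))" using U tf_conj_fun(1)[OF fU] conj_fun_tpoly by (auto simp: gd_def)
 have tU: "tf dt U p = Jm s (%p. chi dt p * tf dt u p) p" for p
 proof -
  have "tilde dt U (snd p) (fst p) = (if fst p \<in> Kf dt then of_real (J (of_int (fst p)) powr s) * tilde dt u (snd p) (fst p) else 0)"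
   unfolding tilde_fsup[OF fU] tilde_fsup[OF f] fcU by (auto simp: sum_distrib_left mult_ac)
  then show ?thesis by (auto simp: tf_def Jm_def chi_def wgt_def norm_mult ennreal_mult)
 qed
 note [measurable] = tf_measurable[OF fU]
 have fc: "fc (%x. U n x * conj_fun (U n) x) 0 = of_real (ys s u n)" for n
 proof -
  have "fc (%x. U n x * conj_fun (U n) x) 0 = (\<Sum>p\<in>Kf dt. fc (U n) p * fc (conj_fun (U n)) (0 - p))"
   by (rule fourier_coeff_mult(2)) (use U cU finite_Kf in \<open>auto simp: gd_def fcU\<close>)
  also have "\<dots> = (\<Sum>p\<in>Kf dt. of_real (J (of_int p) powr (2 * s) * (norm (fc (u n) p))\<^sup>2))"
  proof (rule sum.cong[OF refl])
   fix p assume p: "p \<in> Kf dt"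
   have "z * cnj z = of_real ((norm z)\<^sup>2)" for z by (rule complex_norm_square[symmetric])
   then have "fc (U n) p * fc (conj_fun (U n)) (0 - p) = of_real ((norm (fc (U n) p))\<^sup>2)"
    by (simp add: fourier_coeff_conj_fun)
   also have "(norm (fc (U n) p))\<^sup>2 = (J (of_int p) powr s)\<^sup>2 * (norm (fc (u n) p))\<^sup>2"
    using p by (simp add: fcU norm_mult power_mult_distrib)
   also have "(J (of_int p) powr s)\<^sup>2 = J (of_int p) powr (2 * s)" by (simp only: power2_eq_square mult_2 powr_add)
   finally show "fc (U n) p * fc (conj_fun (U n)) (0 - p) = of_real (J (of_int p) powr (2 * s) * (norm (fc (u n) p))\<^sup>2)" .
  qed
  finally show ?thesis by (simp add: ys_def)
 qed
 have fp: "fsup S (%n x. U n x * conj_fun (U n) x)" using tf_mult(1)[OF U cU] by (simp add: gd_def)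
 have "ft (%n. of_real (ys s u n)) \<sigma> = tf dt (%n x. U n x * conj_fun (U n) x) (0, \<sigma>)"
  unfolding ft_def tf_def fst_conv snd_conv tilde_fsup[OF fp] fc
  by (subst tilde_const[OF S]) (simp_all add: ys_0[OF f])
 also have "\<dots> <= en (1 / (2 * pi)) * G.conv (tf dt U) (tf dt (%n. conj_fun (U n))) (0, \<sigma>)"
  by (rule tf_mult(2)[OF U cU])
 also have "\<dots> <= 1 * G.conv (tf dt U) (tf dt (%n. conj_fun (U n))) (0, \<sigma>)"
 proof (rule mult_right_mono)
  have "en (1 / (2 * pi)) <= en 1" using pi_gt3 by (intro ennreal_leI) (simp add: field_simps)
  then show "en (1 / (2 * pi)) <= 1" by simp
 qed simp
 also have "\<dots> = (SI k. (\<integral>\<^sup>+s. tf dt U (k, s) * tf dt U (- ((0, \<sigma>) - (k, s))) \<partial>circ dt))"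
  unfolding G.conv_def tf_conj_fun(2)[OF fU] G.rfl_def by (subst nn_integral_Gam[OF tau_pos]) auto
 also have "\<dots> = (SI k. C.conv (%\<sigma>. Jm s (%p. chi dt p * tf dt u p) (k, \<sigma>)) (C.rfl (%\<sigma>. Jm s (%p. chi dt p * tf dt u p) (k, \<sigma>))) \<sigma>)"
  unfolding C.conv_def C.rfl_def tU by simp
 finally show ?thesis .
qed

text \<open>Modulation exponent 0 makes the norm blind to phases, and \<open>D\<close> depends on
  time only, so Parseval reduces everything to a sum over time steps.\<close>

lemma X_norm_scalar:
 assumes f: "fsup S u"
 shows "(X_norm dt s 0 (%n x. of_real (D n) * Proj dt (u n) x))\<^sup>2 = en (2 * pi * (dt * (\<Sum>n\<in>S. (D n)\<^sup>2 * ys s u n)))"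
proof -
 let ?o = "%n x. of_real (D n) * Proj dt (u n) x"
 have o: "?o n = tp (Kf dt) (%k. of_real (D n) * fc (u n) k)" for n
  unfolding Proj_tp tp_def[abs_def] by (simp add: sum_distrib_left mult.assoc)
 have fo: "fsup S ?o" using f unfolding fsup_def o by (auto simp: tp_def[abs_def])
 have fc: "fc (?o n) k = (if k \<in> Kf dt then of_real (D n) * fc (u n) k else 0)" for n k
  unfolding o by (rule fourier_coeff_tp[OF finite_Kf])
 note [measurable] = tf_measurable[OF fo]
 have fk: "(%\<sigma>. (tf dt ?o (k, \<sigma>))\<^sup>2) \<in> bC dt" for k
  by (intro borel_measurable_power_ennreal Gam_Pair tf_measurable[OF fo])
 have w: "(wgt dt (- s) 0 sq (k, \<sigma>) * tf dt ?o (k, \<sigma>))\<^sup>2 = en (J (of_int k) powr (2 * s)) * (tf dt ?o (k, \<sigma>))\<^sup>2" for k \<sigma>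
  unfolding power_mult_distrib wgt_sq by (simp add: wgt_def)
 have "(X_norm dt s 0 ?o)\<^sup>2 = (SI k. (\<integral>\<^sup>+\<sigma>. en (J (of_int k) powr (2 * s)) * (tf dt ?o (k, \<sigma>))\<^sup>2 \<partial>circ dt))"
  unfolding X_norm_eq[OF fo] nrm_sq by (subst nn_integral_Gam[OF tau_pos], measurable) (simp add: w)
 also have "\<dots> = (SI k. en (J (of_int k) powr (2 * s)) * en (2 * pi / dt * (\<Sum>m\<in>S. (norm (of_real dt * fc (?o m) k))\<^sup>2)))"
  unfolding nn_integral_cmult[OF fk] tf_Parseval[OF fo] ..
 also have "\<dots> = (\<Sum>k\<in>Kf dt. en (J (of_int k) powr (2 * s)) * en (2 * pi / dt * (\<Sum>m\<in>S. (norm (of_real dt * fc (?o m) k))\<^sup>2)))"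
  by (rule nn_integral_count_space'[OF finite_Kf]) (auto simp: fc)
 also have "\<dots> = (\<Sum>k\<in>Kf dt. en (2 * pi * dt * (\<Sum>m\<in>S. (D m)\<^sup>2 * (J (of_int k) powr (2 * s) * (norm (fc (u m) k))\<^sup>2))))"
 proof (rule sum.cong[OF refl])
  fix k assume k: "k \<in> Kf dt"
  have "(norm (of_real dt * fc (?o m) k))\<^sup>2 = dt\<^sup>2 * ((D m)\<^sup>2 * (norm (fc (u m) k))\<^sup>2)" for m
   unfolding fc if_P[OF k] by (simp add: norm_mult power_mult_distrib)
  then have "J (of_int k) powr (2 * s) * (2 * pi / dt * (\<Sum>m\<in>S. (norm (of_real dt * fc (?o m) k))\<^sup>2)) =
   2 * pi * dt * (\<Sum>m\<in>S. (D m)\<^sup>2 * (J (of_int k) powr (2 * s) * (norm (fc (u m) k))\<^sup>2))"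
   using tau_pos by (simp add: sum_distrib_left power2_eq_square mult_ac)
  moreover have "0 <= 2 * pi / dt * (\<Sum>m\<in>S. (norm (of_real dt * fc (?o m) k))\<^sup>2)"
   using tau_pos by (intro mult_nonneg_nonneg sum_nonneg) auto
  ultimately show "en (J (of_int k) powr (2 * s)) * en (2 * pi / dt * (\<Sum>m\<in>S. (norm (of_real dt * fc (?o m) k))\<^sup>2)) =
   en (2 * pi * dt * (\<Sum>m\<in>S. (D m)\<^sup>2 * (J (of_int k) powr (2 * s) * (norm (fc (u m) k))\<^sup>2)))"
   by (simp only: ennreal_mult[symmetric] powr_ge_zero)
 qed
 also have "\<dots> = en (\<Sum>k\<in>Kf dt. 2 * pi * dt * (\<Sum>m\<in>S. (D m)\<^sup>2 * (J (of_int k) powr (2 * s) * (norm (fc (u m) k))\<^sup>2)))"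
  using tau_pos by (intro sum_ennreal mult_nonneg_nonneg sum_nonneg) auto
 also have "(\<Sum>k\<in>Kf dt. 2 * pi * dt * (\<Sum>m\<in>S. (D m)\<^sup>2 * (J (of_int k) powr (2 * s) * (norm (fc (u m) k))\<^sup>2))) =
  2 * pi * (dt * (\<Sum>n\<in>S. (D n)\<^sup>2 * ys s u n))"
  unfolding ys_def sum_distrib_left by (subst sum.swap) (simp only: mult.assoc)
 finally show ?thesis .
qed

lemma sum_ys_le:
 assumes f: "fsup S u"
 shows "en (2 * pi * (dt * (\<Sum>n\<in>S. ys s u n))) <= (nG dt (ez (Fn s u)))\<^sup>2"
proof -
 have p: "(%n x. of_real 1 * Proj dt (u n) x) = (%n. Proj dt (u n))" by simp
 have "en (2 * pi * (dt * (\<Sum>n\<in>S. ys s u n))) = (X_norm dt s 0 (%n. Proj dt (u n)))\<^sup>2"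
  using X_norm_scalar[OF f, of s "%_. 1"] unfolding p by simp
 also have "X_norm dt s 0 (%n. Proj dt (u n)) <= nG dt (ez (Fn s u))"
 proof -
  have fp: "fsup S (%n. Proj dt (u n))" using tf_Proj(1)[OF f] by (simp add: gd_def)
  show ?thesis unfolding X_norm_eq[OF fp] tf_Proj(2)[OF f] ez_Fn
   by (intro nrm_mono mult_mono wgt_mono) (auto simp: chi_def)
 qed
 finally show ?thesis by (simp add: power_mono)
qed

end

lemma wn_conv:
 assumes "2 * \<alpha> + 2 * \<beta> - 2 * \<gamma> > 1" "0 <= \<gamma>" "\<gamma> <= \<alpha>" "\<gamma> <= \<beta>"
 shows "\<exists>C<\<infinity>. \<forall>dt f g. time_step dt --> f \<in> bC dt --> g \<in> bC dt -->
  time_step.wn dt \<gamma> (inv_measure.conv (circ dt) f g) <= C * (time_step.wn dt \<alpha> f * time_step.wn dt \<beta> g)"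
proof -
 obtain A where A: "A < \<infinity>" "\<forall>dt a b F G. time_step dt --> F \<in> bC dt --> G \<in> bC dt -->
  nC dt (%x. en (W dt (x + a + b) powr \<gamma>) *
   inv_measure.conv (circ dt) (%y. en (W dt (y + a) powr - \<alpha>) * F y) (%y. en (W dt (y + b) powr - \<beta>) * G y) x)
   <= A * nC dt F * nC dt G"
  using circ_pair_decay[OF assms] by (elim exE conjE) (rule that)
 have "time_step.wn dt \<gamma> (inv_measure.conv (circ dt) f g) <= A * (time_step.wn dt \<alpha> f * time_step.wn dt \<beta> g)"
  if t: "time_step dt" and [measurable]: "f \<in> bC dt" "g \<in> bC dt" for dt f g
 proof -
  interpret time_step dt by fact
  have F: "(%\<sigma>. en (W dt \<sigma> powr \<alpha>) * f \<sigma>) \<in> bC dt" "(%\<sigma>. en (W dt \<sigma> powr \<beta>) * g \<sigma>) \<in> bC dt"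
   by measurable
  show ?thesis
   using A(2)[rule_format, OF t F, of 0 0] unfolding add_0_right W_powr_cancel wn_def by (simp only: mult.assoc)
 qed
 with A(1) show ?thesis by blast
qed

text \<open>In the autocorrelation at \<open>k\<close> the phases \<open>k\<^sup>2\<close> and
  \<open>- k\<^sup>2\<close> cancel, so the weight depends on the modulation alone. Two factors of
  order 12/25 allow any order below 23/50; 455/1000 is such a number and still suffices for
  \<open>time_products\<close>.\<close>

lemma ys_bound:
 "\<exists>C<\<infinity>. \<forall>dt S u s. time_step dt --> fsup S u -->
  time_step.wn dt (455/1000) (time_step.ft dt (%n. of_real (time_step.ys dt s u n))) <= C * (nG dt (time_step.ez dt (time_step.Fn dt s u)))\<^sup>2"
proof -
 have num: "(1::real) < 2 * (12/25) + 2 * (12/25) - 2 * (455/1000)" "(0::real) <= 455/1000" "(455/1000::real) <= 12/25" by simp_all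
 obtain A where A: "A < \<infinity>" "\<forall>dt a b F G. time_step dt --> F \<in> bC dt --> G \<in> bC dt -->
  nC dt (%x. en (W dt (x + a + b) powr (455/1000)) *
   inv_measure.conv (circ dt) (%y. en (W dt (y + a) powr - (12/25)) * F y) (%y. en (W dt (y + b) powr - (12/25)) * G y) x)
   <= A * nC dt F * nC dt G"
  using circ_pair_decay[OF num(1,2,3,3)] by (elim exE conjE) (rule that)
 have "time_step.wn dt (455/1000) (time_step.ft dt (%n. of_real (time_step.ys dt s u n))) <= A * (nG dt (time_step.ez dt (time_step.Fn dt s u)))\<^sup>2"
  if t: "time_step dt" and f: "fsup S u" for dt S u s
 proof -
  interpret time_step dt by fact
  define q where "q k \<sigma> = Jm s (%p. chi dt p * tf dt u p) (k, \<sigma>)" for k \<sigma>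
  define F where "F k \<sigma> = en (W dt (\<sigma> + sq k) powr (12/25)) * q k \<sigma>" for k \<sigma>
  have q [measurable]: "q k \<in> bC dt" for k
   unfolding q_def[abs_def] by (intro Gam_Pair Jm_measurable chi_tf_measurable[OF f])
  have F [measurable]: "F k \<in> bC dt" for k unfolding F_def[abs_def] by measurable
  have one: "nC dt (%\<sigma>. en (W dt \<sigma> powr (455/1000)) * C.conv (q k) (C.rfl (q k)) \<sigma>) <= A * (nC dt (F k))\<^sup>2" for k
  proof -
   have e1: "(%y. en (W dt (y + sq k) powr - (12/25)) * F k y) = q k"
    unfolding F_def W_powr_cancel ..
   have e2: "(%y. en (W dt (y + (- sq k)) powr - (12/25)) * C.rfl (F k) y) = C.rfl (q k)"
   proof
    fix y
    have "W dt (- y + sq k) = W dt (y + (- sq k))" using W_minus[of dt "y + (- sq k)"] by simp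
    then show "en (W dt (y + (- sq k)) powr - (12/25)) * C.rfl (F k) y = C.rfl (q k) y"
     unfolding C.rfl_def F_def by (simp only: W_powr_cancel)
   qed
   have "nC dt (%x. en (W dt (x + sq k + (- sq k)) powr (455/1000)) * C.conv (q k) (C.rfl (q k)) x) <= A * nC dt (F k) * nC dt (C.rfl (F k))"
    using A(2)[rule_format, where a="sq k" and b="- sq k", OF t F[of k] C.rfl_measurable[OF F[of k]]] unfolding e1 e2 .
   then show ?thesis by (simp add: C.nrm_rfl power2_eq_square mult.assoc)
  qed
  have "wn (455/1000) (ft (%n. of_real (ys s u n))) <= nC dt (%\<sigma>. en (W dt \<sigma> powr (455/1000)) * (SI k. C.conv (q k) (C.rfl (q k)) \<sigma>))"
   unfolding wn_def q_def by (intro nrm_mono mult_left_mono ft_ys[OF f]) simp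
  also have "\<dots> = nC dt (%\<sigma>. (SI k. en (W dt \<sigma> powr (455/1000)) * C.conv (q k) (C.rfl (q k)) \<sigma>))"
   by (simp only: sum_const_M)
  also have "\<dots> <= (SI k. nC dt (%\<sigma>. en (W dt \<sigma> powr (455/1000)) * C.conv (q k) (C.rfl (q k)) \<sigma>))"
   by (rule nrm_sum_le) measurable
  also have "\<dots> <= (SI k. A * (nC dt (F k))\<^sup>2)" by (intro nn_integral_mono one)
  also have "\<dots> = A * (SI k. (nC dt (F k))\<^sup>2)" by (rule sum_const_M)
  also have "\<dots> <= A * (SI k. (\<integral>\<^sup>+\<sigma>. (ez (Fn s u) (k, \<sigma>))\<^sup>2 \<partial>circ dt))"
   unfolding nrm_sq
  proof (intro mult_left_mono nn_integral_mono power_mono)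
   fix k \<sigma>
   have "F k \<sigma> = chi dt (k, \<sigma>) * ez (Fn s u) (k, \<sigma>)"
    unfolding F_def q_def ez_Fn Jm_def wgt_def by (simp add: ennreal_mult mult_ac)
   then show "F k \<sigma> <= ez (Fn s u) (k, \<sigma>)" by (simp add: chi_def)
  qed auto
  also have "(SI k. (\<integral>\<^sup>+\<sigma>. (ez (Fn s u) (k, \<sigma>))\<^sup>2 \<partial>circ dt)) = (nG dt (ez (Fn s u)))\<^sup>2"
   unfolding nrm_sq ez_Fn using tf_measurable[OF f] by (intro nn_integral_Gam[OF tau_pos, symmetric]) measurable
  finally show ?thesis .
 qed
 with A(1) show ?thesis by blast
qed

text \<open>Pairs of order 455/1000 multiply to order 2/5, pairs of order 2/5 to order 0, and the
  last factor is paired by Cauchy-Schwarz. \<open>b\<close> occurs to the powers 1 and 3 because the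
  squared energy difference has these degrees in the sum of the squared norms.\<close>

lemma time_products:
 "\<exists>C<\<infinity>. \<forall>dt S a b c. time_step dt --> finite S --> (\<forall>n. n \<notin> S --> a n = 0 \<and> b n = 0 \<and> c n = 0) -->
  time_step.ft dt (%n. a n * b n * c n) 0 <=
   C * (time_step.wn dt (455/1000) (time_step.ft dt a) * time_step.wn dt (455/1000) (time_step.ft dt b) * time_step.wn dt (455/1000) (time_step.ft dt c)) \<and>
  time_step.ft dt (%n. a n * b n * (b n * b n) * c n) 0 <=
   C * (time_step.wn dt (455/1000) (time_step.ft dt a) * time_step.wn dt (455/1000) (time_step.ft dt b) ^ 3 * time_step.wn dt (455/1000) (time_step.ft dt c))"
proof -
 have num: "(1::real) < 2 * (455/1000) + 2 * (455/1000) - 2 * (2/5)" "(0::real) <= 2/5" "(2/5::real) <= 455/1000"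
  "(1::real) < 2 * (2/5) + 2 * (2/5) - 2 * 0" "(0::real) <= 0" by simp_all
 obtain A where A: "A < \<infinity>" "\<forall>dt f g. time_step dt --> f \<in> bC dt --> g \<in> bC dt -->
  time_step.wn dt (2/5) (inv_measure.conv (circ dt) f g) <= A * (time_step.wn dt (455/1000) f * time_step.wn dt (455/1000) g)"
  using wn_conv[OF num(1,2,3,3)] by (elim exE conjE) (rule that)
 obtain B where B: "B < \<infinity>" "\<forall>dt f g. time_step dt --> f \<in> bC dt --> g \<in> bC dt -->
  time_step.wn dt 0 (inv_measure.conv (circ dt) f g) <= B * (time_step.wn dt (2/5) f * time_step.wn dt (2/5) g)"
  using wn_conv[OF num(4,5,2,2)] by (elim exE conjE) (rule that)
 define C where "C = A + B * A * A"
 have "time_step.ft dt (%n. a n * b n * c n) 0 <=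
   C * (time_step.wn dt (455/1000) (time_step.ft dt a) * time_step.wn dt (455/1000) (time_step.ft dt b) * time_step.wn dt (455/1000) (time_step.ft dt c)) \<and>
  time_step.ft dt (%n. a n * b n * (b n * b n) * c n) 0 <=
   C * (time_step.wn dt (455/1000) (time_step.ft dt a) * time_step.wn dt (455/1000) (time_step.ft dt b) ^ 3 * time_step.wn dt (455/1000) (time_step.ft dt c))"
  if t: "time_step dt" and S: "finite S" and z: "\<forall>n. n \<notin> S --> a n = 0 \<and> b n = 0 \<and> c n = 0" for dt S a b c
 proof -
  interpret time_step dt by fact
  let ?w = "wn (455/1000)"
  have m: "ft f \<in> bC dt" if "\<And>n. n \<notin> S ==> f n = 0" for f by (rule ft_measurable[OF S that])
  have two: "wn (2/5) (ft (%n. f n * g n)) <= A * (?w (ft f) * ?w (ft g))"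
   if "\<And>n. n \<notin> S ==> f n = 0" "\<And>n. n \<notin> S ==> g n = 0" for f g
   by (rule order_trans[OF wn_mono[OF ft_mult[OF S that]] A(2)[rule_format, OF t m[OF that(1)] m[OF that(2)]]])
  have last: "ft (%n. f n * g n) 0 <= nC dt (ft f) * ?w (ft g)"
   if z': "\<And>n. n \<notin> S ==> f n = 0" "\<And>n. n \<notin> S ==> g n = 0" for f g
  proof -
   have mg: "ft g \<in> bC dt" by (rule m) (rule z'(2))
   have e: "nC dt (C.rfl (ft g)) = nC dt (ft g)" using mg by (simp add: C.nrm_rfl)
   have "ft (%n. f n * g n) 0 <= (\<integral>\<^sup>+y. ft f y * C.rfl (ft g) y \<partial>circ dt)"
    using ft_mult[OF S z', where \<sigma>=0] by (simp add: C.conv_def C.rfl_def)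
   also have "\<dots> <= nC dt (ft f) * nC dt (C.rfl (ft g))"
    by (intro Cauchy_Schwarz_nrm C.rfl_measurable m z')
   also have "\<dots> <= nC dt (ft f) * ?w (ft g)"
    unfolding e by (intro mult_left_mono nrm_le_wn) auto
   finally show ?thesis .
  qed
  have za: "\<And>n. n \<notin> S ==> a n = 0" and zb: "\<And>n. n \<notin> S ==> b n = 0" and zc: "\<And>n. n \<notin> S ==> c n = 0" using z by auto
  have CA: "A <= C" "B * A * A <= C" by (simp_all add: C_def)
  have "ft (%n. a n * b n * c n) 0 <= nC dt (ft (%n. a n * b n)) * ?w (ft c)"
   by (rule last) (simp_all add: za zc)
  also have "\<dots> <= wn (2/5) (ft (%n. a n * b n)) * ?w (ft c)" by (intro mult_right_mono nrm_le_wn) auto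
  also have "\<dots> <= A * (?w (ft a) * ?w (ft b)) * ?w (ft c)" by (intro mult_right_mono two za zb) auto
  also have "\<dots> <= C * (?w (ft a) * ?w (ft b)) * ?w (ft c)" by (intro mult_right_mono CA) auto
  finally have 1: "ft (%n. a n * b n * c n) 0 <= C * (?w (ft a) * ?w (ft b) * ?w (ft c))" by (simp only: mult.assoc)
  have "nC dt (ft (%n. a n * b n * (b n * b n))) <= wn 0 (ft (%n. a n * b n * (b n * b n)))" by (rule nrm_le_wn) simp
  also have "\<dots> <= wn 0 (C.conv (ft (%n. a n * b n)) (ft (%n. b n * b n)))" by (intro wn_mono ft_mult[OF S]) (simp_all add: za zb)
  also have "\<dots> <= B * (wn (2/5) (ft (%n. a n * b n)) * wn (2/5) (ft (%n. b n * b n)))" by (intro B(2)[rule_format] t m) (simp_all add: za zb)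
  also have "\<dots> <= B * ((A * (?w (ft a) * ?w (ft b))) * (A * (?w (ft b) * ?w (ft b))))" by (intro mult_left_mono mult_mono two za zb) auto
  finally have 2: "nC dt (ft (%n. a n * b n * (b n * b n))) <= B * ((A * (?w (ft a) * ?w (ft b))) * (A * (?w (ft b) * ?w (ft b))))" .
  have "ft (%n. a n * b n * (b n * b n) * c n) 0 <= nC dt (ft (%n. a n * b n * (b n * b n))) * ?w (ft c)"
   by (rule last) (simp_all add: za zc)
  also have "\<dots> <= B * ((A * (?w (ft a) * ?w (ft b))) * (A * (?w (ft b) * ?w (ft b)))) * ?w (ft c)" by (rule mult_right_mono[OF 2]) simp
  also have "\<dots> = (B * A * A) * (?w (ft a) * ?w (ft b) ^ 3 * ?w (ft c))" by (simp add: power3_eq_cube mult_ac)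
  also have "\<dots> <= C * (?w (ft a) * ?w (ft b) ^ 3 * ?w (ft c))" by (intro mult_right_mono CA) auto
  finally show ?thesis using 1 by blast
 qed
 moreover have "C < \<infinity>" using A(1) B(1) by (simp add: C_def ennreal_mult_less_top)
 ultimately show ?thesis by blast
qed

section \<open>Mass and energy at a fixed time\<close>

lemma tpoly_lin:
 assumes "tpoly f" "tpoly g"
 shows "tpoly (%x. a * f x + b * g x)" "fc (%x. a * f x + b * g x) k = a * fc f k + b * fc g k"
proof -
 define K where "K = {k. fc f k \<noteq> 0} \<union> {k. fc g k \<noteq> 0}"
 have K: "finite K" using assms by (auto simp: K_def tpoly_finite)
 have f: "f = tp K (fc f)" by (rule tpoly_expand[OF assms(1) K]) (simp add: K_def)
 have g: "g = tp K (fc g)" by (rule tpoly_expand[OF assms(2) K]) (simp add: K_def)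
 have e: "(%x. a * f x + b * g x) = tp K (%k. a * fc f k + b * fc g k)"
  using arg_cong[OF f, of "%h. h _"] arg_cong[OF g, of "%h. h _"]
  by (simp add: fun_eq_iff tp_def sum_distrib_left distrib_right sum.distrib mult.assoc)
 show "tpoly (%x. a * f x + b * g x)" unfolding e by (rule tpoly_tp[OF K])
 show "fc (%x. a * f x + b * g x) k = a * fc f k + b * fc g k"
  unfolding e fourier_coeff_tp[OF K] by (auto simp: K_def)
qed

lemma tpoly_add: "tpoly f ==> tpoly g ==> tpoly (%x. f x + g x)"
 and tpoly_diff: "tpoly f ==> tpoly g ==> tpoly (%x. f x - g x)"
 and tpoly_cmult: "tpoly f ==> tpoly (%x. a * f x)"
 and fourier_coeff_add: "tpoly f ==> tpoly g ==> fc (%x. f x + g x) k = fc f k + fc g k"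
 and fourier_coeff_diff: "tpoly f ==> tpoly g ==> fc (%x. f x - g x) k = fc f k - fc g k"
 using tpoly_lin[of f g 1 1] tpoly_lin[of f g 1 "-1"] tpoly_lin[of f f a 0] by simp_all

lemma tpoly_mult: "tpoly f ==> tpoly g ==> tpoly (%x. f x * g x)"
 by (rule fourier_coeff_mult(1)[OF _ _ tpoly_finite]) auto

lemma tpoly_cnj: "tpoly f ==> tpoly (%x. cnj (f x))"
 using conj_fun_tpoly[of f] by (simp add: conj_fun_def[abs_def])

lemma fourier_coeff_cnj: "fc (%x. cnj (f x)) k = cnj (fc f (- k))"
 using fourier_coeff_conj_fun[of f k] by (simp add: conj_fun_def[abs_def])

lemma ddx_tpoly:
 assumes "tpoly f" shows "tpoly (ddx f)" "fc (ddx f) k = \<i> * of_int k * fc f k"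
proof -
 define K where "K = {k. fc f k \<noteq> 0}"
 have K: "finite K" using tpoly_finite[OF assms] by (simp add: K_def)
 have f: "f = tp K (fc f)" by (rule tpoly_expand[OF assms K]) (simp add: K_def)
 have e: "ddx f = tp K (%k. \<i> * of_int k * fc f k)" by (subst f) (rule ddx_tp[OF K])
 show "tpoly (ddx f)" unfolding e by (rule tpoly_tp[OF K])
 show "fc (ddx f) k = \<i> * of_int k * fc f k"
  unfolding e fourier_coeff_tp[OF K] by (auto simp: K_def)
qed

lemma tpoly_eqI: assumes "tpoly f" "tpoly g" "\<And>k. fc f k = fc g k" shows "f = g"
proof -
 have "finite {k. fc f k \<noteq> 0}" by (rule tpoly_finite[OF assms(1)])
 then have "f = tp {k. fc f k \<noteq> 0} (fc f)" "g = tp {k. fc f k \<noteq> 0} (fc g)"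
  by (auto intro!: tpoly_expand assms(1,2) simp: assms(3))
 moreover have "fc f = fc g" using assms(3) by (simp add: fun_eq_iff)
 ultimately show ?thesis by metis
qed

lemma tpoly_integral:
 assumes "tpoly f"
 shows "has_bochner_integral lborel (%x. indicator {a..a + 2 * pi} x *\<^sub>R f x) (of_real (2 * pi) * fc f 0)"
proof -
 define K where "K = {k. fc f k \<noteq> 0}"
 have K: "finite K" using tpoly_finite[OF assms] by (simp add: K_def)
 have f: "f x = (\<Sum>m\<in>K. fc f m * cis (of_int m * 1 * x))" for x
  using arg_cong[OF tpoly_expand[OF assms K], of "%h. h x"] by (simp add: tp_def K_def)
 have s: "(\<Sum>m\<in>K \<inter> {0}. fc f m * 1) = fc f 0"
  by (cases "0 \<in> K") (auto simp: K_def)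
 have "has_bochner_integral lborel (%x. indicator {a..a + 2 * pi / 1} x *\<^sub>R
   ((\<Sum>m\<in>K. fc f m * cis (of_int m * 1 * x)) * (\<Sum>n\<in>{0}. 1 * cis (- (of_int n * 1 * x)))))
  (of_real (2 * pi / 1) * (\<Sum>m\<in>K \<inter> {0}. fc f m * 1))"
  by (rule has_bochner_integral_trig) (use K in auto)
 then show ?thesis unfolding f[symmetric] s by simp
qed

lemma tpoly_integral_Re:
 assumes "tpoly f" "\<And>x. g x = Re (f x)"
 shows "(LINT x:{a..a + 2 * pi}|lborel. g x) = 2 * pi * Re (fc f 0)"
proof -
 have "has_bochner_integral lborel (%x. Re (indicator {a..a + 2 * pi} x *\<^sub>R f x)) (Re (of_real (2 * pi) * fc f 0))"
  by (rule has_bochner_integral_Re[OF tpoly_integral[OF assms(1)]])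
 then show ?thesis unfolding set_lebesgue_integral_def by (simp add: has_bochner_integral_integral_eq assms(2))
qed

definition l2 :: "(real => complex) => ennreal" where
 "l2 f = nrm (cZ) (%k. en (norm (fc f k)))"

definition Hh :: "(real => complex) => ennreal" where
 "Hh f = nrm (cZ) (%k. en (J (of_int k) powr (1/2)) * en (norm (fc f k)))"

lemma nrm_count_uminus: "nrm (cZ) (%k::int. f (- k)) = nrm (cZ) f"
proof -
 interpret I: inv_measure "cZ" by (rule inv_measure_int)
 show ?thesis using I.nrm_rfl[of f] by (simp add: I.rfl_def[abs_def])
qed

lemma l2_cnj: "l2 (%x. cnj (f x)) = l2 f"
 using nrm_count_uminus[of "%k. en (norm (fc f k))"] by (simp add: l2_def fourier_coeff_cnj)

lemma Hh_cnj: "Hh (%x. cnj (f x)) = Hh f"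
 using nrm_count_uminus[of "%k. en (J (of_int k) powr (1/2)) * en (norm (fc f k))"]
 by (simp add: Hh_def fourier_coeff_cnj japanese_minus)

lemma l2_add: assumes "tpoly f" "tpoly g" shows "l2 (%x. f x + g x) <= 2 * (l2 f + l2 g)"
proof -
 have "l2 (%x. f x + g x) <= nrm (cZ) (%k. en (norm (fc f k)) + en (norm (fc g k)))"
  unfolding l2_def fourier_coeff_add[OF assms]
  by (intro nrm_mono) (simp add: ennreal_leI norm_triangle_ineq flip: ennreal_plus)
 also have "\<dots> <= 2 * (l2 f + l2 g)" unfolding l2_def by (rule nrm_add) auto
 finally show ?thesis .
qed

lemma fourier_coeff_mult_le:
 assumes "tpoly f" "tpoly g"
 shows "en (norm (fc (%x. f x * g x) k)) <=
  (SI p. en (norm (fc f p)) * en (norm (fc g (k - p))))"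
proof -
 define K where "K = {k. fc f k \<noteq> 0}"
 have K: "finite K" using tpoly_finite[OF assms(1)] by (simp add: K_def)
 have "norm (fc (%x. f x * g x) k) <= (\<Sum>p\<in>K. norm (fc f p) * norm (fc g (k - p)))"
  unfolding fourier_coeff_mult(2)[OF assms K, unfolded K_def, simplified]
  by (rule order_trans[OF norm_sum]) (simp add: norm_mult K_def)
 then have "en (norm (fc (%x. f x * g x) k)) <= (\<Sum>p\<in>K. en (norm (fc f p)) * en (norm (fc g (k - p))))"
  by (simp add: ennreal_leI flip: ennreal_mult)
 also have "\<dots> = (SI p. en (norm (fc f p)) * en (norm (fc g (k - p))))"
  by (rule nn_integral_count_space'[OF K, symmetric]) (auto simp: K_def)
 finally show ?thesis .
qed

lemma fourier_coeff_0_le: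
 assumes "tpoly f" "tpoly g"
 shows "en (norm (fc (%x. f x * g x) 0)) <= l2 f * l2 g"
proof -
 have "en (norm (fc (%x. f x * g x) 0)) <=
  (SI p. en (norm (fc f p)) * en (norm (fc g (- p))))"
  using fourier_coeff_mult_le[OF assms, of 0] by simp
 also have "\<dots> <= l2 f * nrm (cZ) (%p. en (norm (fc g (- p))))"
  unfolding l2_def by (rule Cauchy_Schwarz_nrm) auto
 finally show ?thesis unfolding l2_def nrm_count_uminus[of "%k. en (norm (fc g k))"] .
qed

text \<open>The derivative is split evenly, half an order for each factor.\<close>

lemma kinetic_le:
 assumes "tpoly f" "tpoly g"
 shows "en (norm (fc (%x. cnj (ddx f x) * g x) 0)) <= Hh f * Hh g"
proof -
 have "en (norm (fc (%x. cnj (ddx f x) * g x) 0)) <=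
  (SI p. en (norm (fc (%x. cnj (ddx f x)) p)) * en (norm (fc g (- p))))"
  using fourier_coeff_mult_le[OF tpoly_cnj[OF ddx_tpoly(1)[OF assms(1)]] assms(2), of 0] by simp
 also have "\<dots> <= (SI p. (en (J (of_int (- p)) powr (1/2)) * en (norm (fc f (- p)))) *
  (en (J (of_int (- p)) powr (1/2)) * en (norm (fc g (- p)))))"
 proof (rule nn_integral_mono)
  fix p :: int
  have "J (of_int (- p)) powr (1/2) * J (of_int (- p)) powr (1/2) = J (of_int (- p))"
   by (simp only: powr_add[symmetric]) simp
  then have "\<bar>real_of_int p\<bar> <= J (of_int (- p)) powr (1/2) * J (of_int (- p)) powr (1/2)"
   using norm_le_japanese[of "real_of_int (- p)"] by simp
  then have "\<bar>real_of_int p\<bar> * norm (fc f (- p)) * norm (fc g (- p)) <=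
   (J (of_int (- p)) powr (1/2) * J (of_int (- p)) powr (1/2)) * norm (fc f (- p)) * norm (fc g (- p))"
   by (intro mult_right_mono) auto
  then show "en (norm (fc (%x. cnj (ddx f x)) p)) * en (norm (fc g (- p))) <=
   (en (J (of_int (- p)) powr (1/2)) * en (norm (fc f (- p)))) *
  (en (J (of_int (- p)) powr (1/2)) * en (norm (fc g (- p))))"
   by (simp add: fourier_coeff_cnj ddx_tpoly[OF assms(1)] norm_mult ennreal_leI mult_ac flip: ennreal_mult)
 qed
 also have "\<dots> <= nrm (cZ) (%p. en (J (of_int (- p)) powr (1/2)) * en (norm (fc f (- p)))) *
  nrm (cZ) (%p. en (J (of_int (- p)) powr (1/2)) * en (norm (fc g (- p))))"
  by (rule Cauchy_Schwarz_nrm) auto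
 also have "\<dots> = Hh f * Hh g"
  unfolding Hh_def nrm_count_uminus[of "%p. en (J (of_int p) powr (1/2)) * en (norm (fc _ p))"] ..
 finally show ?thesis .
qed

text \<open>The Sobolev product estimate on the torus. The weighted Cauchy-Schwarz bound leaves a
  sum of two shifted inverse brackets, which converges uniformly in the shift.\<close>

lemma l2_mult_le:
 "\<exists>C<\<infinity>. \<forall>f g. tpoly f --> tpoly g --> l2 (%x. f x * g x) <= C * (Hh f * Hh g)"
proof -
 interpret I: inv_measure "cZ" by (rule inv_measure_int)
 obtain A where A: "A < \<infinity>" "\<And>x y. (SI k. en (J (of_int k - x) powr - 1 * J (of_int k - y) powr - 1)) <= A"
  using sum_J_J_bound[of 1 1] by (auto simp del: powr_one)
 have "l2 (%x. f x * g x) <= ennsqrt A * (Hh f * Hh g)" if t: "tpoly f" "tpoly g" for f g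
 proof -
  define a where "a k = en (J (of_int k) powr (-1/2))" for k :: int
  define F where "F f k = en (J (of_int k) powr (1/2)) * en (norm (fc f k))" for f k
  have aF: "a k * F f k = en (norm (fc f k))" for f k
  proof -
   have "en (J (of_int k) powr (-1/2)) * en (J (of_int k) powr (1/2)) = 1"
    by (subst ennreal_mult[symmetric]) (auto simp flip: powr_add)
   then show ?thesis unfolding a_def F_def mult.assoc[symmetric] by simp
  qed
  have "(a k)\<^sup>2 = en (J (of_int k) powr - 1)" for k
   unfolding a_def power2_eq_square by (subst ennreal_mult[symmetric]) (simp_all del: powr_one flip: powr_add)
  note a2 = this
  have s: "(SI y. (a y)\<^sup>2 * (a (x - y))\<^sup>2) <= A" for x
  proof -
   have "(a y)\<^sup>2 * (a (x - y))\<^sup>2 = en (J (of_int y - 0) powr - 1 * J (of_int y - of_int x) powr - 1)" for y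
   proof -
    have j: "J (of_int (x - y)) = J (of_int y - of_int x)" using japanese_minus[of "real_of_int y - of_int x"] by simp
    show ?thesis unfolding a2 j by (simp only: diff_0_right ennreal_mult powr_ge_zero)
   qed
   then show ?thesis using A(2)[of 0 "of_int x"] by (simp only:)
  qed
  have "l2 (%x. f x * g x) <= nrm (cZ) (I.conv (%k. a k * F f k) (%k. a k * F g k))"
   unfolding l2_def aF I.conv_def by (intro nrm_mono fourier_coeff_mult_le t)
  also have "\<dots> = nrm (cZ) (%x. 1 * I.conv (%k. a k * F f k) (%k. a k * F g k) x)" by simp
  also have "\<dots> <= ennsqrt A * nrm (cZ) (F f) * nrm (cZ) (F g)"
   by (rule I.nrm_conv_le) (use s in auto)
  finally show ?thesis unfolding Hh_def F_def[abs_def] by (simp only: mult.assoc)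
 qed
 moreover have "ennsqrt A < \<infinity>" by (rule ennsqrt_less_top[OF A(1)])
 ultimately show ?thesis by blast
qed

definition mass :: "(real => complex) => real" where
 "mass f = Re (fc (%x. f x * cnj (f x)) 0)"

text \<open>A complex trigonometric polynomial whose real part is the integrand of
  \<open>psi\<close>, since \<open>Re (- 2 * \<i> * z)\<close> is \<open>2 * Im z\<close>. The
  integral becomes a zero coefficient.\<close>

definition enden :: "(real => complex) => real => complex" where
 "enden f = (%x. (-2 * \<i>) * (cnj (ddx f x) * f x) + (-1/2) * ((f x * cnj (f x)) * (f x * cnj (f x))))"

lemma psi_eq:
 assumes "tpoly (w n)" "tpoly (w 0)"
 shows "psi w n = Re (fc (enden (w n)) 0) + (mass (w 0))\<^sup>2"
proof -
 have nz: "z * cnj z = of_real ((norm z)\<^sup>2)" for z by (rule complex_norm_square[symmetric])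
 have t: "tpoly (enden (w n))" unfolding enden_def
  by (intro tpoly_add tpoly_cmult tpoly_mult tpoly_cnj ddx_tpoly assms)
 have "2 * Im (cnj (ddx (w n) \<theta>) * w n \<theta>) - 1/2 * (norm (w n \<theta>)) ^ 4 = Re (enden (w n) \<theta>)" for \<theta>
 proof -
  have "Re ((-2 * \<i>) * z) = 2 * Im z" for z by simp
  moreover have "(norm (w n \<theta>))\<^sup>2 * (norm (w n \<theta>))\<^sup>2 = norm (w n \<theta>) ^ 4" by (simp flip: power_add)
  ultimately show ?thesis unfolding enden_def nz plus_complex.sel of_real_mult[symmetric] by simp
 qed
 from tpoly_integral_Re[OF t this, of 0]
 have 1: "(LINT \<theta>:{0..2 * pi}|lborel. 2 * Im (cnj (ddx (w n) \<theta>) * w n \<theta>) - 1/2 * (norm (w n \<theta>)) ^ 4) = 2 * pi * Re (fc (enden (w n)) 0)"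
  by simp
 have t0: "tpoly (%x. w 0 x * cnj (w 0 x))" by (intro tpoly_mult tpoly_cnj assms)
 have 2: "(LINT x:{-pi..pi}|lborel. (norm (w 0 x))\<^sup>2) = 2 * pi * mass (w 0)"
  using tpoly_integral_Re[OF t0, of "%x. (norm (w 0 x))\<^sup>2" "-pi"] unfolding nz by (simp add: mass_def nz)
 have "(LINT x:{-pi..pi}|lborel. (norm (w 0 x))\<^sup>2) \<ge> 0"
  unfolding set_lebesgue_integral_def by (intro Bochner_Integration.integral_nonneg) auto
 then have "(L2_norm (w 0))\<^sup>2 = 2 * pi * mass (w 0)" unfolding L2_norm_def 2 by simp
 then show ?thesis unfolding psi_def 1 by simp
qed

text \<open>A difference of squares is factorised twice: once for the squared masses and once for
  the squared moduli inside the mass.\<close>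

lemma mass_diff:
 assumes t: "tpoly f" "tpoly g"
 shows "en \<bar>(mass f)\<^sup>2 - (mass g)\<^sup>2\<bar> <= l2 (%x. f x - g x) * (l2 f + l2 g) * ((l2 f)\<^sup>2 + (l2 g)\<^sup>2)"
proof -
 note ti = tpoly_add tpoly_diff tpoly_mult tpoly_cnj t
 let ?d = "%x. f x - g x"
 have m: "en \<bar>mass h\<bar> <= (l2 h)\<^sup>2" if "tpoly h" for h
 proof -
  have "en \<bar>mass h\<bar> <= en (norm (fc (%x. h x * cnj (h x)) 0))"
   unfolding mass_def by (intro ennreal_leI abs_Re_le_cmod)
  also have "\<dots> <= l2 h * l2 (%x. cnj (h x))" by (intro fourier_coeff_0_le that tpoly_cnj)
  finally show ?thesis by (simp add: l2_cnj power2_eq_square)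
 qed
 have "en \<bar>mass f - mass g\<bar> <= l2 ?d * (l2 f + l2 g)"
 proof -
  have "mass f - mass g = Re (fc (%x. f x * cnj (f x) - g x * cnj (g x)) 0)"
   unfolding mass_def by (subst fourier_coeff_diff) (intro ti | simp)+
  also have "(%x. f x * cnj (f x) - g x * cnj (g x)) = (%x. ?d x * cnj (f x) + g x * cnj (?d x))"
   by (simp add: fun_eq_iff algebra_simps)
  also have "fc (%x. ?d x * cnj (f x) + g x * cnj (?d x)) 0 = fc (%x. ?d x * cnj (f x)) 0 + fc (%x. g x * cnj (?d x)) 0"
   by (intro fourier_coeff_add ti)
  finally have "\<bar>mass f - mass g\<bar> <= norm (fc (%x. ?d x * cnj (f x)) 0) + norm (fc (%x. g x * cnj (?d x)) 0)"
   by (metis abs_Re_le_cmod norm_triangle_ineq order_trans)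
  then have "en \<bar>mass f - mass g\<bar> <= en (norm (fc (%x. ?d x * cnj (f x)) 0)) + en (norm (fc (%x. g x * cnj (?d x)) 0))"
   by (simp add: ennreal_leI flip: ennreal_plus)
  also have "\<dots> <= l2 ?d * l2 (%x. cnj (f x)) + l2 g * l2 (%x. cnj (?d x))"
   by (intro add_mono fourier_coeff_0_le ti)
  finally show ?thesis unfolding l2_cnj by (simp add: distrib_left distrib_right mult.commute)
 qed
 moreover have "en \<bar>mass f + mass g\<bar> <= (l2 f)\<^sup>2 + (l2 g)\<^sup>2"
 proof -
  have "en \<bar>mass f + mass g\<bar> <= en \<bar>mass f\<bar> + en \<bar>mass g\<bar>"
   by (simp add: ennreal_leI abs_triangle_ineq flip: ennreal_plus)
  also have "\<dots> <= (l2 f)\<^sup>2 + (l2 g)\<^sup>2" by (intro add_mono m t)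
  finally show ?thesis .
 qed
 ultimately have "en \<bar>mass f - mass g\<bar> * en \<bar>mass f + mass g\<bar> <= l2 ?d * (l2 f + l2 g) * ((l2 f)\<^sup>2 + (l2 g)\<^sup>2)"
  by (rule mult_mono) auto
 moreover have "\<bar>(mass f)\<^sup>2 - (mass g)\<^sup>2\<bar> = \<bar>mass f - mass g\<bar> * \<bar>mass f + mass g\<bar>"
  by (simp add: abs_mult[symmetric] power2_eq_square algebra_simps)
 ultimately show ?thesis by (simp add: ennreal_mult)
qed

text \<open>Both terms are polarised with \<open>d = f - g\<close>. The kinetic difference is
  \<open>cnj (ddx d) * f + cnj (ddx g) * d\<close>; the quartic one is \<open>P * Q\<close>, the
  difference times the sum of the squared moduli. So \<open>Hh d\<close> factors out of each
  bound.\<close>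

lemma energy_diff:
 "\<exists>C<\<infinity>. \<forall>f g. tpoly f --> tpoly g -->
  en \<bar>Re (fc (enden f) 0) - Re (fc (enden g) 0)\<bar> <=
   C * (Hh (%x. f x - g x) * (Hh f + Hh g) * (1 + ((Hh f)\<^sup>2 + (Hh g)\<^sup>2)))"
proof -
 obtain A where A: "A < \<infinity>" "\<And>f g. tpoly f ==> tpoly g ==> l2 (%x. f x * g x) <= A * (Hh f * Hh g)"
  using l2_mult_le by blast
 define C where "C = 2 + 4 * A * A"
 have "en \<bar>Re (fc (enden f) 0) - Re (fc (enden g) 0)\<bar> <=
   C * (Hh (%x. f x - g x) * (Hh f + Hh g) * (1 + ((Hh f)\<^sup>2 + (Hh g)\<^sup>2)))" if t: "tpoly f" "tpoly g" for f g
 proof -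
  note ti = tpoly_add tpoly_diff tpoly_cmult tpoly_mult tpoly_cnj ddx_tpoly(1) t
  define d where "d x = f x - g x" for x
  have td: "tpoly d" unfolding d_def by (intro ti)
  note ti = ti td
  define P where "P x = d x * cnj (f x) + g x * cnj (d x)" for x
  define Q where "Q x = f x * cnj (f x) + g x * cnj (g x)" for x
  have tP: "tpoly P" "tpoly Q" unfolding P_def Q_def by (intro ti)+
  have dd: "ddx d x = ddx f x - ddx g x" for x
  proof -
   have "ddx d = (%x. ddx f x - ddx g x)"
   proof (rule tpoly_eqI)
    fix k
    have "fc (%x. ddx f x - ddx g x) k = fc (ddx f) k - fc (ddx g) k"
     by (intro fourier_coeff_diff ti)
    moreover have "fc d k = fc f k - fc g k"
     unfolding d_def[abs_def] by (intro fourier_coeff_diff t)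
    ultimately show "fc (ddx d) k = fc (%x. ddx f x - ddx g x) k"
     by (simp add: ddx_tpoly(2)[OF td] ddx_tpoly(2)[OF t(1)] ddx_tpoly(2)[OF t(2)] right_diff_distrib)
   qed (intro ti)+
   then show ?thesis by simp
  qed
  let ?K = "%x. cnj (ddx d x) * f x" let ?L = "%x. cnj (ddx g x) * d x"
  have eq: "(%x. enden f x - enden g x) = (%x. (-2 * \<i>) * (?K x + ?L x) + (-1/2) * (P x * Q x))"
   unfolding enden_def dd P_def Q_def d_def by (simp add: fun_eq_iff algebra_simps)
  have te: "tpoly (enden h)" if "tpoly h" for h unfolding enden_def
   by (intro tpoly_add tpoly_cmult tpoly_mult tpoly_cnj ddx_tpoly that)
  have "fc (enden f) 0 - fc (enden g) 0 = fc (%x. enden f x - enden g x) 0"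
   by (intro fourier_coeff_diff[symmetric] te t)
  also have "\<dots> = (-2 * \<i>) * (fc ?K 0 + fc ?L 0) + (-1/2) * fc (%x. P x * Q x) 0"
  proof -
   have "tpoly ?K" "tpoly ?L" "tpoly (%x. P x * Q x)" by (intro ti tP)+
   then show ?thesis unfolding eq by (simp only: tpoly_lin(2)[OF tpoly_add] fourier_coeff_add)
  qed
  finally have fe: "fc (enden f) 0 - fc (enden g) 0 = (-2 * \<i>) * (fc ?K 0 + fc ?L 0) + (-1/2) * fc (%x. P x * Q x) 0" .
  have "\<bar>Re (fc (enden f) 0) - Re (fc (enden g) 0)\<bar> <= norm (fc (enden f) 0 - fc (enden g) 0)"
   using abs_Re_le_cmod[of "fc (enden f) 0 - fc (enden g) 0"] by simp
  also have "\<dots> <= norm ((-2 * \<i>) * (fc ?K 0 + fc ?L 0)) + norm ((-1/2) * fc (%x. P x * Q x) 0)"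
   unfolding fe by (rule norm_triangle_ineq)
  also have "\<dots> <= 2 * (norm (fc ?K 0) + norm (fc ?L 0)) + norm (fc (%x. P x * Q x) 0)"
  proof -
   have n: "norm ((-2 * \<i>) * x) = 2 * norm x" "norm ((-1/2) * x) = norm x / 2" for x :: complex by (simp_all add: norm_mult)
   have tr: "2 * x + y / 2 <= 2 * (p + q) + y" if "x <= p + q" "0 <= y" for x y p q :: real using that by simp
   show ?thesis unfolding n by (rule tr[OF norm_triangle_ineq norm_ge_zero])
  qed
  finally have "en \<bar>Re (fc (enden f) 0) - Re (fc (enden g) 0)\<bar> <=
   2 * (en (norm (fc ?K 0)) + en (norm (fc ?L 0))) + en (norm (fc (%x. P x * Q x) 0))"
   by (simp add: ennreal_leI ennreal_numeral[symmetric] del: ennreal_numeral flip: ennreal_plus ennreal_mult)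
  also have "\<dots> <= 2 * (Hh d * Hh f + Hh g * Hh d) + l2 P * l2 Q"
   by (intro add_mono mult_left_mono kinetic_le fourier_coeff_0_le ti tP) simp
  also have "\<dots> <= 2 * (Hh d * Hh f + Hh g * Hh d) + (2 * (A * (Hh d * Hh f) + A * (Hh g * Hh d))) * (2 * (A * (Hh f * Hh f) + A * (Hh g * Hh g)))"
  proof (intro add_left_mono mult_mono)
   have "l2 P <= 2 * (l2 (%x. d x * cnj (f x)) + l2 (%x. g x * cnj (d x)))" unfolding P_def by (intro l2_add ti)
   also have "\<dots> <= 2 * (A * (Hh d * Hh (%x. cnj (f x))) + A * (Hh g * Hh (%x. cnj (d x))))" by (intro mult_left_mono add_mono A(2) ti) auto
   finally show "l2 P <= 2 * (A * (Hh d * Hh f) + A * (Hh g * Hh d))" unfolding Hh_cnj .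
   have "l2 Q <= 2 * (l2 (%x. f x * cnj (f x)) + l2 (%x. g x * cnj (g x)))" unfolding Q_def by (intro l2_add ti)
   also have "\<dots> <= 2 * (A * (Hh f * Hh (%x. cnj (f x))) + A * (Hh g * Hh (%x. cnj (g x))))" by (intro mult_left_mono add_mono A(2) ti) auto
   finally show "l2 Q <= 2 * (A * (Hh f * Hh f) + A * (Hh g * Hh g))" unfolding Hh_cnj .
  qed auto
  also have "\<dots> = 2 * (Hh d * (Hh f + Hh g)) + 4 * A * A * (Hh d * (Hh f + Hh g) * ((Hh f)\<^sup>2 + (Hh g)\<^sup>2))"
  proof -
   have e1: "Hh d * Hh f + Hh g * Hh d = Hh d * (Hh f + Hh g)" by (simp only: distrib_left mult.commute[of "Hh g"])
   have e2: "A * (Hh d * Hh f) + A * (Hh g * Hh d) = A * (Hh d * (Hh f + Hh g))" by (simp only: distrib_left mult.commute[of "Hh g"])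
   have e3: "A * (Hh f * Hh f) + A * (Hh g * Hh g) = A * ((Hh f)\<^sup>2 + (Hh g)\<^sup>2)" by (simp only: power2_eq_square distrib_left)
   have e4: "2 * (A * x) * (2 * (A * y)) = 4 * A * A * (x * y)" for x y
   proof -
    have "2 * (A * x) * (2 * (A * y)) = (2 * 2) * (A * A * (x * y))" by (simp only: mult_ac)
    then show ?thesis by (simp add: mult.assoc)
   qed
   show ?thesis unfolding e1 e2 e3 e4 ..
  qed
  also have "\<dots> <= C * (Hh d * (Hh f + Hh g)) + C * (Hh d * (Hh f + Hh g) * ((Hh f)\<^sup>2 + (Hh g)\<^sup>2))"
   by (intro add_mono mult_right_mono) (auto simp: C_def)
  finally show ?thesis unfolding d_def[abs_def] by (simp only: distrib_left mult_1_right mult.assoc)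
 qed
 moreover have "C < \<infinity>" using A(1) by (simp add: C_def ennreal_mult_less_top)
 ultimately show ?thesis by blast
qed

text \<open>Before projection the functions are merely integrable over a period, and this is what
  makes the coefficient additive.\<close>

lemma fourier_coeff_diff_torus:
 assumes "torus_fun f" "torus_fun g"
 shows "fc (%x. f x - g x) k = fc f k - fc g k"
proof -
 have i: "integrable lborel (%x. indicator {-pi..pi} x *\<^sub>R (h x * cis (- (of_int k * x))))" if "torus_fun h" for h
 proof -
  have h: "integrable lborel (%x. indicator {-pi..pi} x *\<^sub>R h x)" using that by (simp add: torus_fun_def set_integrable_def)
  have hm [measurable]: "(%x. indicator {-pi..pi} x *\<^sub>R h x) \<in> borel_measurable lborel" by (rule borel_measurable_integrable[OF h])
  have cm [measurable]: "(%x. cis (- (of_int k * x))) \<in> borel_measurable lborel"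
   using measurable_compose[OF _ cis_borel, of "%x. - (of_int k * x)" lborel] by simp
  have "integrable lborel (%x. (indicator {-pi..pi} x *\<^sub>R h x) * cis (- (of_int k * x)))"
   by (rule Bochner_Integration.integrable_bound[OF h]) (measurable, simp add: norm_mult)
  then show ?thesis by simp
 qed
 have "(%x. indicator {-pi..pi} x *\<^sub>R ((f x - g x) * cis (- (of_int k * x)))) =
  (%x. indicator {-pi..pi} x *\<^sub>R (f x * cis (- (of_int k * x))) - indicator {-pi..pi} x *\<^sub>R (g x * cis (- (of_int k * x))))"
  by (simp add: fun_eq_iff left_diff_distrib scaleR_diff_right)
 then show ?thesis
  unfolding fourier_coeff_def set_lebesgue_integral_def
  by (simp only: Bochner_Integration.integral_diff[OF i[OF assms(1)] i[OF assms(2)]] right_diff_distrib)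
qed

lemma Proj_diff:
 assumes "torus_fun f" "torus_fun g"
 shows "Proj dt (%x. f x - g x) = (%x. Proj dt f x - Proj dt g x)"
 unfolding Proj_def fourier_coeff_diff_torus[OF assms] by (simp add: left_diff_distrib sum_subtractf fun_eq_iff)

section \<open>The estimate for the functional \<open>psi\<close>\<close>

context time_step begin

lemma fourier_coeff_Proj: "fc (Proj dt f) k = (if k \<in> Kf dt then fc f k else 0)"
 unfolding Proj_tp by (rule fourier_coeff_tp[OF finite_Kf])

lemma tpoly_Proj: "tpoly (Proj dt f)"
 unfolding Proj_tp by (rule tpoly_tp[OF finite_Kf])

lemma Hh_Proj: "Hh (Proj dt (u n)) = en (sqrt (ys (1/2) u n))"
proof -
 have "(Hh (Proj dt (u n)))\<^sup>2 = (SI k. en (if k \<in> Kf dt then J (of_int k) powr (2 * (1/2)) * (norm (fc (u n) k))\<^sup>2 else 0))"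
  unfolding Hh_def nrm_sq
 proof (rule nn_integral_cong)
  fix k
  have "(J (of_int k) powr (1/2))\<^sup>2 = J (of_int k) powr (2 * (1/2))" by (simp only: power2_eq_square mult_2 powr_add)
  then show "(en (J (of_int k) powr (1/2)) * en (norm (fc (Proj dt (u n)) k)))\<^sup>2 =
   en (if k \<in> Kf dt then J (of_int k) powr (2 * (1/2)) * (norm (fc (u n) k))\<^sup>2 else 0)"
   by (simp only: fourier_coeff_Proj ennreal_mult[symmetric] powr_ge_zero norm_ge_zero ennreal_power mult_nonneg_nonneg power_mult_distrib split: if_split) simp
 qed
 also have "\<dots> = (\<Sum>k\<in>Kf dt. en (if k \<in> Kf dt then J (of_int k) powr (2 * (1/2)) * (norm (fc (u n) k))\<^sup>2 else 0))"
  by (rule nn_integral_count_space'[OF finite_Kf]) auto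
 also have "\<dots> = en (ys (1/2) u n)"
  unfolding ys_def by (subst sum_ennreal) (auto intro!: arg_cong[of _ _ ennreal] sum.cong)
 finally have "ennsqrt ((Hh (Proj dt (u n)))\<^sup>2) = ennsqrt (en (ys (1/2) u n))" by simp
 then show ?thesis by (simp add: ennsqrt_ennreal ys_nonneg)
qed

text \<open>Fourier inversion: \<open>2 * pi\<close> times the coefficient at time 0 is the integral
  of the transform over the circle. The \<open>Y\<close> part of the norm is made for this, as
  modulation exponent 1/2 in \<open>X\<close> just fails to control a single time.\<close>

lemma l2_Proj_0:
 assumes f: "fsup S u" shows "l2 (Proj dt (u 0)) <= Y_norm dt 0 0 u"
proof -
 have S: "finite S" using f by (simp add: fsup_def)
 have e: "-pi/dt + 2*pi/dt = pi/dt" by (simp add: add_divide_distrib[symmetric])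
 have "en (norm (fc (Proj dt (u 0)) k)) <= (\<integral>\<^sup>+\<sigma>. tf dt u (k, \<sigma>) \<partial>circ dt)" for k
 proof -
  have "has_bochner_integral lborel (%x. indicator {-pi/dt..-pi/dt + 2 * pi / dt} x *\<^sub>R
   ((\<Sum>m\<in>{0}. 1 * cis (of_int m * dt * x)) * (\<Sum>n\<in>S. (of_real dt * fc (u n) k) * cis (- (of_int n * dt * x)))))
   (of_real (2 * pi / dt) * (\<Sum>m\<in>{0} \<inter> S. 1 * (of_real dt * fc (u m) k)))"
   by (rule has_bochner_integral_trig[OF tau_pos]) (use S in auto)
  also have "(%x. indicator {-pi/dt..-pi/dt + 2 * pi / dt} x *\<^sub>R
   ((\<Sum>m\<in>{0}. 1 * cis (of_int m * dt * x)) * (\<Sum>n\<in>S. (of_real dt * fc (u n) k) * cis (- (of_int n * dt * x))))) =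
   (%x. indicator {-pi/dt..pi/dt} x *\<^sub>R tilde dt u x k)"
   unfolding e tilde_fsup[OF f] by (simp add: sum_distrib_left mult.assoc)
  also have "of_real (2 * pi / dt) * (\<Sum>m\<in>{0} \<inter> S. 1 * (of_real dt * fc (u m) k)) = of_real (2 * pi) * fc (u 0) k"
   using tau_pos f by (cases "0 \<in> S") (simp_all add: fsup_def)
  finally have hb: "has_bochner_integral lborel (%x. indicator {-pi/dt..pi/dt} x *\<^sub>R tilde dt u x k) (of_real (2 * pi) * fc (u 0) k)" .
  have "norm (fc (Proj dt (u 0)) k) <= (2 * pi) * norm (fc (u 0) k)"
   using pi_gt3 mult_right_mono[of 1 "2 * pi" "norm (fc (u 0) k)"] by (simp add: fourier_coeff_Proj)
  then have "en (norm (fc (Proj dt (u 0)) k)) <= en (norm (of_real (2 * pi) * fc (u 0) k))"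
   by (intro ennreal_leI) (simp add: norm_mult)
  also have "\<dots> <= (\<integral>\<^sup>+x. en (norm (indicator {-pi/dt..pi/dt} x *\<^sub>R tilde dt u x k)) \<partial>lborel)"
   by (rule has_bochner_integral_norm_bound[OF hb])
  also have "\<dots> = (\<integral>\<^sup>+\<sigma>. tf dt u (k, \<sigma>) \<partial>circ dt)"
   unfolding nn_integral_circ[OF Gam_Pair[OF tf_measurable[OF f]]]
   by (intro nn_integral_cong) (auto simp: tf_def split: split_indicator)
  finally show ?thesis .
 qed
 then show ?thesis unfolding l2_def Y_norm_eq[OF f] by (intro nrm_mono) simp
qed

lemma ennreal_sum_sq: fixes a b :: ennreal shows "a\<^sup>2 + b\<^sup>2 <= (a + b)\<^sup>2"
 by (simp add: power2_sum)

end

text \<open>The difference of the functionals is a scalar depending on time, so the output norm is a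
  sum over time steps. The energy part enters as a product of squared norms at each time; the mass
  part is constant in time and needs only values at time 0.\<close>

lemma psi_estimate:
 fixes s :: real
 shows "\<exists>C<\<infinity>. \<forall>dt T1 u1 u2 u3. time_step dt --> 0 < T1 --> T1 <= 1 --> dt <= 2 * T1 -->
  fsup (grid dt T1) u1 --> fsup (grid dt T1) u2 --> fsup (grid dt T1) u3 --> (\<forall>n. torus_fun (u1 n)) --> (\<forall>n. torus_fun (u2 n)) -->
  X_norm dt s 0 (%n x. of_real (psi (%m. Proj dt (u1 m)) n - psi (%m. Proj dt (u2 m)) n) * Proj dt (u3 n) x) <=
  C * Tg T1 * (1 + XZ_norm dt u1 + XZ_norm dt u2) ^ 3 * XZ_norm dt (%n x. u1 n x - u2 n x) * Xs dt s u3"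
proof -
 obtain A where A: "A < \<infinity>" "\<And>f g. tpoly f ==> tpoly g ==>
  en \<bar>Re (fc (enden f) 0) - Re (fc (enden g) 0)\<bar> <=
   A * (Hh (%x. f x - g x) * (Hh f + Hh g) * (1 + ((Hh f)\<^sup>2 + (Hh g)\<^sup>2)))"
  using energy_diff by blast
 obtain B where B: "B < \<infinity>" "\<forall>dt S a b c. time_step dt --> finite S --> (\<forall>n. n \<notin> S --> a n = 0 \<and> b n = 0 \<and> c n = 0) -->
  time_step.ft dt (%n. a n * b n * c n) 0 <=
   B * (time_step.wn dt (455/1000) (time_step.ft dt a) * time_step.wn dt (455/1000) (time_step.ft dt b) * time_step.wn dt (455/1000) (time_step.ft dt c)) \<and>
  time_step.ft dt (%n. a n * b n * (b n * b n) * c n) 0 <=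
   B * (time_step.wn dt (455/1000) (time_step.ft dt a) * time_step.wn dt (455/1000) (time_step.ft dt b) ^ 3 * time_step.wn dt (455/1000) (time_step.ft dt c))"
  using time_products by (elim exE conjE) (rule that)
 obtain Y where Y: "Y < \<infinity>" "\<forall>dt S u s. time_step dt --> fsup S u -->
  time_step.wn dt (455/1000) (time_step.ft dt (%n. of_real (time_step.ys dt s u n))) <= Y * (nG dt (time_step.ez dt (time_step.Fn dt s u)))\<^sup>2"
  using ys_bound by (elim exE conjE) (rule that)
 obtain P where P: "P < \<infinity>" "\<And>dt T1 a y. time_step dt ==> 0 < T1 ==> T1 <= 1 ==> dt <= 2 * T1 ==> fsup (grid dt T1) y ==>
  nG dt (%p. wgt dt a (-12/25) sq p * tf dt y p) <= P * Tg T1 * nG dt (%p. wgt dt a (-1/2) sq p * tf dt y p)"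
  using modulation_gain by auto
 define a where "a = enn2real A"
 have Aa: "A = en a" "a \<ge> 0" using A(1) by (simp_all add: a_def)
 define K where "K = en (16 * pi * a\<^sup>2) * (B * (2 * Y * Y * Y) + B * (8 * Y * Y * Y * Y * Y)) + 2"
 have "X_norm dt s 0 (%n x. of_real (psi (%m. Proj dt (u1 m)) n - psi (%m. Proj dt (u2 m)) n) * Proj dt (u3 n) x) <=
  ennsqrt K * P * Tg T1 * (1 + XZ_norm dt u1 + XZ_norm dt u2) ^ 3 * XZ_norm dt (%n x. u1 n x - u2 n x) * Xs dt s u3"
  if t: "time_step dt" and T: "0 < T1" "T1 <= 1" "dt <= 2 * T1"
   and f: "fsup (grid dt T1) u1" "fsup (grid dt T1) u2" "fsup (grid dt T1) u3" and tor: "\<forall>n. torus_fun (u1 n)" "\<forall>n. torus_fun (u2 n)" for dt T1 u1 u2 u3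
 proof -
  interpret time_step dt by fact
  define S where "S = grid dt T1"
  note f = f[folded S_def]
  have S: "finite S" using f(1) by (simp add: fsup_def)
  define d where "d n x = u1 n x - u2 n x" for n x
  have fd: "fsup S d" using f by (auto simp: fsup_def d_def fun_eq_iff)
  have Pd: "(%x. Proj dt (u1 n) x - Proj dt (u2 n) x) = Proj dt (d n)" for n
   unfolding d_def[abs_def] using Proj_diff[of "u1 n" "u2 n" dt] tor by simp
  let ?w = "wn (455/1000)"
  define D where "D n = psi (%m. Proj dt (u1 m)) n - psi (%m. Proj dt (u2 m)) n" for n
  define y1 y2 yd yg where y: "y1 = ys (1/2) u1" "y2 = ys (1/2) u2" "yd = ys (1/2) d" "yg = ys s u3"
  define z where "z n = y1 n + y2 n" for n
  have nn: "y1 n \<ge> 0" "y2 n \<ge> 0" "yd n \<ge> 0" "yg n \<ge> 0" "z n \<ge> 0" for n unfolding z_def y by (simp_all add: ys_nonneg)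
  have z0: "y1 n = 0" "y2 n = 0" "yd n = 0" "yg n = 0" "z n = 0" if "n \<notin> S" for n
   unfolding z_def y using that f fd by (simp_all add: ys_0)
  define mu where "mu = \<bar>(mass (Proj dt (u1 0)))\<^sup>2 - (mass (Proj dt (u2 0)))\<^sup>2\<bar>"
  have Dle: "\<bar>D n\<bar> <= a * (sqrt (yd n) * (sqrt (y1 n) + sqrt (y2 n)) * (1 + z n)) + mu" for n
  proof -
   have "en \<bar>Re (fc (enden (Proj dt (u1 n))) 0) - Re (fc (enden (Proj dt (u2 n))) 0)\<bar> <=
    en a * (en (sqrt (yd n)) * (en (sqrt (y1 n)) + en (sqrt (y2 n))) * (1 + ((en (sqrt (y1 n)))\<^sup>2 + (en (sqrt (y2 n)))\<^sup>2)))"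
    using A(2)[OF tpoly_Proj tpoly_Proj, of "u1 n" "u2 n"] unfolding Pd Hh_Proj y Aa(1) .
   also have "\<dots> = en (a * (sqrt (yd n) * (sqrt (y1 n) + sqrt (y2 n)) * (1 + z n)))"
    using nn Aa(2) by (simp add: ennreal_power z_def ennreal_1[symmetric] del: ennreal_1 flip: ennreal_plus ennreal_mult)
   finally have "\<bar>Re (fc (enden (Proj dt (u1 n))) 0) - Re (fc (enden (Proj dt (u2 n))) 0)\<bar> <= a * (sqrt (yd n) * (sqrt (y1 n) + sqrt (y2 n)) * (1 + z n))"
    using nn Aa(2) by (subst (asm) ennreal_le_iff) auto
   then show ?thesis
    unfolding D_def mu_def psi_eq[of "%m. Proj dt (u1 m)", OF tpoly_Proj tpoly_Proj] psi_eq[of "%m. Proj dt (u2 m)", OF tpoly_Proj tpoly_Proj]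
    by linarith
  qed
  \<comment> \<open>The factor 8 collects three factors 2, one each for the square of the full
    bound, of the sum of the roots and of \<open>1 + z n\<close>.\<close>
  have D2: "(D n)\<^sup>2 <= 8 * a\<^sup>2 * (yd n * z n + yd n * z n * (z n * z n)) + 2 * mu\<^sup>2" for n
  proof -
   let ?p = "sqrt (yd n) * (sqrt (y1 n) + sqrt (y2 n)) * (1 + z n)"
   have ab: "(p + q)\<^sup>2 <= 2 * p\<^sup>2 + 2 * q\<^sup>2" for p q :: real using sum_squares_ge_zero[of "p - q" 0] by (simp add: power2_eq_square algebra_simps)
   have "(D n)\<^sup>2 = \<bar>D n\<bar>\<^sup>2" by simp
   also have "\<dots> <= (a * ?p + mu)\<^sup>2" by (rule power_mono[OF Dle]) simp
   also have "\<dots> <= 2 * (a * ?p)\<^sup>2 + 2 * mu\<^sup>2" by (rule ab)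
   also have "(a * ?p)\<^sup>2 = a\<^sup>2 * (yd n * (sqrt (y1 n) + sqrt (y2 n))\<^sup>2 * (1 + z n)\<^sup>2)"
    using nn by (simp add: power_mult_distrib)
   also have "\<dots> <= a\<^sup>2 * (yd n * (2 * z n) * (2 * 1\<^sup>2 + 2 * (z n)\<^sup>2))"
   proof (intro mult_left_mono mult_mono ab)
    show "(sqrt (y1 n) + sqrt (y2 n))\<^sup>2 <= 2 * z n" using ab[of "sqrt (y1 n)" "sqrt (y2 n)"] nn by (simp add: z_def)
   qed (use nn in auto)
   finally show ?thesis by (simp add: power2_eq_square algebra_simps)
  qed
  define Q where "Q = 1 + XZ_norm dt u1 + XZ_norm dt u2"
  define R where "R = XZ_norm dt d"
  define Eg where "Eg = nG dt (ez (Fn s u3))"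
  have Q1: "1 <= Q" by (simp add: Q_def add.assoc)
  have XQ: "Xh dt u1 + Xh dt u2 <= Q"
  proof -
   have "Xh dt u1 + Xh dt u2 <= XZ_norm dt u1 + XZ_norm dt u2" by (intro add_mono) (simp_all add: XZ_norm_def)
   also have "\<dots> <= 1 + (XZ_norm dt u1 + XZ_norm dt u2)" by simp
   finally show ?thesis by (simp add: Q_def add.assoc)
  qed
  have YZ: "Y_norm dt 0 0 u <= XZ_norm dt u" for u
  proof -
   have "XZ_norm dt u = (Xh dt u + X_norm dt 0 (1/2) u) + Y_norm dt 0 0 u" by (simp add: XZ_norm_def Z_norm_def add.assoc)
   then show ?thesis by simp
  qed
  have lQ: "l2 (Proj dt (u1 0)) + l2 (Proj dt (u2 0)) <= Q"
  proof -
   have "l2 (Proj dt (u1 0)) + l2 (Proj dt (u2 0)) <= XZ_norm dt u1 + XZ_norm dt u2"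
    by (rule add_mono[OF order_trans[OF l2_Proj_0[OF f(1)] YZ] order_trans[OF l2_Proj_0[OF f(2)] YZ]])
   also have "\<dots> <= 1 + (XZ_norm dt u1 + XZ_norm dt u2)" by simp
   finally show ?thesis by (simp add: Q_def add.assoc)
  qed
  have R: "Xh dt d <= R" "l2 (Proj dt (d 0)) <= R"
   using order_trans[OF l2_Proj_0[OF fd] YZ] by (simp_all add: R_def XZ_norm_def)
  have wy: "?w (ft (%n. of_real (ys (1/2) u n))) <= Y * (Xh dt u)\<^sup>2" if "fsup S u" for u
  proof -
   have "?w (ft (%n. of_real (ys (1/2) u n))) <= Y * (nG dt (ez (Fn (1/2) u)))\<^sup>2" by (rule Y(2)[rule_format, OF t that])
   also have "\<dots> <= Y * (nG dt (Fn (1/2) u))\<^sup>2" by (intro mult_left_mono power_mono nrm_ez_le) auto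
   finally show ?thesis unfolding nrm_Fn[OF that] .
  qed
  have wd: "?w (ft (%n. of_real (yd n))) <= Y * R\<^sup>2"
   unfolding y by (rule order_trans[OF wy[OF fd]]) (intro mult_left_mono power_mono R, auto)
  have wg: "?w (ft (%n. of_real (yg n))) <= Y * Eg\<^sup>2"
   unfolding y Eg_def by (rule Y(2)[rule_format, OF t f(3)])
  have wz: "?w (ft (%n. of_real (z n))) <= 2 * (Y * Q\<^sup>2)"
  proof -
   have m: "ft (%n. of_real (y1 n)) \<in> bC dt" "ft (%n. of_real (y2 n)) \<in> bC dt"
    by (rule ft_measurable[OF S], simp add: z0)+
   have "?w (ft (%n. of_real (z n))) <= ?w (%\<sigma>. ft (%n. of_real (y1 n)) \<sigma> + ft (%n. of_real (y2 n)) \<sigma>)"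
    unfolding z_def of_real_add by (intro wn_mono ft_add[OF S]) (simp_all add: z0)
   also have "\<dots> <= 2 * (?w (ft (%n. of_real (y1 n))) + ?w (ft (%n. of_real (y2 n))))" by (rule wn_add[OF m])
   also have "\<dots> <= 2 * (Y * (Xh dt u1)\<^sup>2 + Y * (Xh dt u2)\<^sup>2)"
    unfolding y by (intro mult_left_mono add_mono wy f) simp
   also have "\<dots> = 2 * (Y * ((Xh dt u1)\<^sup>2 + (Xh dt u2)\<^sup>2))" by (simp only: distrib_left)
   also have "\<dots> <= 2 * (Y * Q\<^sup>2)"
    by (intro mult_left_mono order_trans[OF ennreal_sum_sq] power_mono XQ) auto
   finally show ?thesis .
  qed
  \<comment> \<open>The summand 1 in \<open>Q\<close> makes \<open>Q\<close> at least 1, so the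
    lower-order term is covered by the higher one.\<close>
  have Q6: "Q\<^sup>2 <= Q ^ 6" using Q1 by (intro power_increasing) auto
  let ?G = "(Q ^ 3 * R * Eg)\<^sup>2"
  have G: "?G = Q ^ 6 * (R\<^sup>2 * Eg\<^sup>2)" by (simp add: power_mult_distrib mult.assoc flip: power_mult)
  have t3: "en (dt * (\<Sum>n\<in>S. yd n * z n * yg n)) <= B * (2 * Y * Y * Y) * ?G"
  proof -
   have "en (dt * (\<Sum>n\<in>S. yd n * z n * yg n)) = ft (%n. of_real (yd n) * of_real (z n) * of_real (yg n)) 0"
    unfolding of_real_mult[symmetric] by (rule ft_0[OF S, symmetric]) (simp_all add: z0 nn)
   also have "\<dots> <= B * (?w (ft (%n. of_real (yd n))) * ?w (ft (%n. of_real (z n))) * ?w (ft (%n. of_real (yg n))))"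
    by (rule conjunct1[OF B(2)[rule_format, OF t S]]) (simp add: z0)
   also have "\<dots> <= B * ((Y * R\<^sup>2) * (2 * (Y * Q\<^sup>2)) * (Y * Eg\<^sup>2))"
    by (intro mult_left_mono mult_mono wd wz wg) auto
   also have "\<dots> = B * (2 * Y * Y * Y) * (Q\<^sup>2 * (R\<^sup>2 * Eg\<^sup>2))" by (simp only: mult_ac)
   also have "\<dots> <= B * (2 * Y * Y * Y) * (Q ^ 6 * (R\<^sup>2 * Eg\<^sup>2))" by (intro mult_left_mono mult_right_mono Q6) auto
   finally show ?thesis unfolding G .
  qed
  have t5: "en (dt * (\<Sum>n\<in>S. yd n * z n * (z n * z n) * yg n)) <= B * (8 * Y * Y * Y * Y * Y) * ?G"
  proof -
   have "en (dt * (\<Sum>n\<in>S. yd n * z n * (z n * z n) * yg n)) = ft (%n. of_real (yd n) * of_real (z n) * (of_real (z n) * of_real (z n)) * of_real (yg n)) 0"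
    unfolding of_real_mult[symmetric] by (rule ft_0[OF S, symmetric]) (simp_all add: z0 nn)
   also have "\<dots> <= B * (?w (ft (%n. of_real (yd n))) * ?w (ft (%n. of_real (z n))) ^ 3 * ?w (ft (%n. of_real (yg n))))"
    by (rule conjunct2[OF B(2)[rule_format, OF t S]]) (simp add: z0)
   also have "\<dots> <= B * ((Y * R\<^sup>2) * (2 * (Y * Q\<^sup>2)) ^ 3 * (Y * Eg\<^sup>2))"
    by (intro mult_left_mono mult_mono power_mono wd wz wg) auto
   also have "(2 * (Y * Q\<^sup>2)) ^ 3 = 8 * (Y * Y * Y) * Q ^ 6" by (simp add: power_mult_distrib power3_eq_cube[of Y] mult.assoc flip: power_mult)
   finally show ?thesis unfolding G by (simp only: mult_ac)
  qed
  have mu: "en mu <= R * Q ^ 3"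
  proof -
   have "en mu <= l2 (Proj dt (d 0)) * (l2 (Proj dt (u1 0)) + l2 (Proj dt (u2 0))) * ((l2 (Proj dt (u1 0)))\<^sup>2 + (l2 (Proj dt (u2 0)))\<^sup>2)"
    using mass_diff[OF tpoly_Proj tpoly_Proj, of "u1 0" "u2 0"] unfolding Pd mu_def .
   also have "\<dots> <= R * Q * Q\<^sup>2"
    by (intro mult_mono R lQ order_trans[OF ennreal_sum_sq] power_mono) auto
   finally show ?thesis by (simp add: power2_eq_square power3_eq_cube mult.assoc)
  qed
  have mu0: "mu \<ge> 0" by (simp add: mu_def)
  have tm: "en (2 * mu\<^sup>2) * en (2 * pi * (dt * (\<Sum>n\<in>S. yg n))) <= 2 * ?G"
  proof -
   have "en (2 * mu\<^sup>2) = 2 * (en mu)\<^sup>2" using mu0 by (simp add: ennreal_mult ennreal_power)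
   also have "\<dots> <= 2 * (R * Q ^ 3)\<^sup>2" by (intro mult_left_mono power_mono mu) auto
   finally have "en (2 * mu\<^sup>2) * en (2 * pi * (dt * (\<Sum>n\<in>S. yg n))) <= (2 * (R * Q ^ 3)\<^sup>2) * Eg\<^sup>2"
    unfolding Eg_def y by (intro mult_mono sum_ys_le f) auto
   also have "\<dots> = 2 * ?G" by (simp only: power_mult_distrib mult_ac)
   finally show ?thesis .
  qed
  have "(X_norm dt s 0 (%n x. of_real (D n) * Proj dt (u3 n) x))\<^sup>2 = en (2 * pi * (dt * (\<Sum>n\<in>S. (D n)\<^sup>2 * yg n)))"
   unfolding y by (rule X_norm_scalar[OF f(3)])
  also have "\<dots> <= en (16 * pi * a\<^sup>2 * (dt * (\<Sum>n\<in>S. yd n * z n * yg n) + dt * (\<Sum>n\<in>S. yd n * z n * (z n * z n) * yg n)) + 2 * mu\<^sup>2 * (2 * pi * (dt * (\<Sum>n\<in>S. yg n))))"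
  proof (rule ennreal_leI)
   have "(\<Sum>n\<in>S. (D n)\<^sup>2 * yg n) <= (\<Sum>n\<in>S. (8 * a\<^sup>2 * (yd n * z n + yd n * z n * (z n * z n)) + 2 * mu\<^sup>2) * yg n)"
    by (intro sum_mono mult_right_mono D2 nn)
   also have "\<dots> = 8 * a\<^sup>2 * ((\<Sum>n\<in>S. yd n * z n * yg n) + (\<Sum>n\<in>S. yd n * z n * (z n * z n) * yg n)) + 2 * mu\<^sup>2 * (\<Sum>n\<in>S. yg n)"
    unfolding sum.distrib[symmetric] sum_distrib_left by (intro sum.cong refl) (simp add: algebra_simps)
   finally have "2 * pi * (dt * (\<Sum>n\<in>S. (D n)\<^sup>2 * yg n)) <= 2 * pi * (dt * (8 * a\<^sup>2 * ((\<Sum>n\<in>S. yd n * z n * yg n) + (\<Sum>n\<in>S. yd n * z n * (z n * z n) * yg n)) + 2 * mu\<^sup>2 * (\<Sum>n\<in>S. yg n)))"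
    using tau_pos by (intro mult_left_mono) auto
   then show "2 * pi * (dt * (\<Sum>n\<in>S. (D n)\<^sup>2 * yg n)) <= 16 * pi * a\<^sup>2 * (dt * (\<Sum>n\<in>S. yd n * z n * yg n) + dt * (\<Sum>n\<in>S. yd n * z n * (z n * z n) * yg n)) + 2 * mu\<^sup>2 * (2 * pi * (dt * (\<Sum>n\<in>S. yg n)))"
    by (simp add: algebra_simps)
  qed
  also have "\<dots> = en (16 * pi * a\<^sup>2) * (en (dt * (\<Sum>n\<in>S. yd n * z n * yg n)) + en (dt * (\<Sum>n\<in>S. yd n * z n * (z n * z n) * yg n))) +
   en (2 * mu\<^sup>2) * en (2 * pi * (dt * (\<Sum>n\<in>S. yg n)))"
  proof -
   have s: "0 <= dt * (\<Sum>n\<in>S. yd n * z n * yg n)" "0 <= dt * (\<Sum>n\<in>S. yd n * z n * (z n * z n) * yg n)" "0 <= 2 * pi * (dt * (\<Sum>n\<in>S. yg n))"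
    using tau_pos nn by (auto intro!: mult_nonneg_nonneg sum_nonneg)
   have e: "en (x * (p + q) + m * r) = en x * (en p + en q) + en m * en r"
    if "0 <= x" "0 <= p" "0 <= q" "0 <= m" "0 <= r" for x p q m r
    using that by (simp add: ennreal_plus ennreal_mult)
   show ?thesis by (rule e) (use s in auto)
  qed
  also have "\<dots> <= en (16 * pi * a\<^sup>2) * (B * (2 * Y * Y * Y) * ?G + B * (8 * Y * Y * Y * Y * Y) * ?G) + 2 * ?G"
   by (intro add_mono mult_left_mono t3 t5 tm) simp
  also have "\<dots> = K * ?G" unfolding K_def distrib_right mult.assoc ..
  finally have "ennsqrt ((X_norm dt s 0 (%n x. of_real (D n) * Proj dt (u3 n) x))\<^sup>2) <= ennsqrt (K * ?G)" by (rule ennsqrt_mono)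
  then have "X_norm dt s 0 (%n x. of_real (D n) * Proj dt (u3 n) x) <= ennsqrt K * (Q ^ 3 * R * Eg)"
   unfolding ennsqrt_mult[of K] ennsqrt_of_sq .
  \<comment> \<open>Only the factor from \<open>u3\<close> is converted into a power of
    \<open>T1\<close>; the others have already been bounded by their full norms.\<close>
  also have "\<dots> <= ennsqrt K * (Q ^ 3 * R * (P * Tg T1 * Xs dt s u3))"
  proof (intro mult_left_mono)
   show "Eg <= P * Tg T1 * Xs dt s u3"
    using P(2)[OF t T f(3)[unfolded S_def], of "- s"] unfolding Eg_def ez_Fn nrm_Fn[OF f(3), symmetric] Fn_def .
  qed auto
  also have "\<dots> = ennsqrt K * P * Tg T1 * Q ^ 3 * R * Xs dt s u3" by (simp only: mult_ac)
  finally show ?thesis unfolding D_def Q_def R_def d_def[abs_def] .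
 qed
 moreover have "ennsqrt K * P < \<infinity>"
 proof -
  have "K < \<infinity>" using B(1) Y(1) by (simp add: K_def ennreal_mult_less_top)
  then show ?thesis using P(1) ennsqrt_less_top by (simp add: ennreal_mult_less_top)
 qed
 ultimately show ?thesis by blast
qed

section \<open>Assembly of the four estimates\<close>

lemma sum_prod_3:
 fixes f g :: "nat => ennreal"
 shows "(\<Sum>k\<in>{1..3}. f k * (\<Prod>j\<in>{1..3} - {k}. g j)) = f 1 * g 2 * g 3 + (g 1 * f 2 * g 3 + g 1 * g 2 * f 3)"
  "(\<Sum>k\<in>{3..5}. f k * (\<Prod>j\<in>{3..5} - {k}. g j)) = f 3 * (g 4 * g 5) + (f 4 * (g 3 * g 5) + f 5 * (g 3 * g 4))"
proof -
 have s: "{1..3} = {1, 2, 3::nat}" "{3..5} = {3, 4, 5::nat}" by auto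
 have d: "{1, 2, 3} - {1::nat} = {2, 3}" "{1, 2, 3} - {2::nat} = {1, 3}" "{1, 2, 3} - {3::nat} = {1, 2}"
  "{3, 4, 5} - {3::nat} = {4, 5}" "{3, 4, 5} - {4::nat} = {3, 5}" "{3, 4, 5} - {5::nat} = {3, 4}" by auto
 have "(\<Sum>k\<in>{1, 2, 3}. F k) = F 1 + (F 2 + F 3)" "(\<Sum>k\<in>{3, 4, 5}. F k) = F 3 + (F 4 + F 5)" for F :: "nat => ennreal" by simp_all
 note e = this
 have p: "(\<Prod>j\<in>{x, y}. g j) = g x * g y" if "x \<noteq> y" for x y using that by simp
 show "(\<Sum>k\<in>{1..3}. f k * (\<Prod>j\<in>{1..3} - {k}. g j)) = f 1 * g 2 * g 3 + (g 1 * f 2 * g 3 + g 1 * g 2 * f 3)"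
  unfolding s e d by (subst (1 2 3) p) (simp, simp, simp, simp only: mult_ac)
 show "(\<Sum>k\<in>{3..5}. f k * (\<Prod>j\<in>{3..5} - {k}. g j)) = f 3 * (g 4 * g 5) + (f 4 * (g 3 * g 5) + f 5 * (g 3 * g 4))"
  unfolding s e d by (subst (1 2 3) p) simp_all
qed

lemma sum_prod_5:
 fixes f g :: "nat => ennreal"
 shows "(\<Sum>k\<in>{1..5}. f k * (\<Prod>j\<in>{1..5} - {k}. g j)) =
  f 1 * (g 2 * g 3 * (g 4 * g 5)) + (f 2 * (g 1 * g 3 * (g 4 * g 5)) + (f 3 * (g 1 * g 2 * (g 4 * g 5)) +
  (f 4 * (g 1 * g 2 * (g 3 * g 5)) + f 5 * (g 1 * g 2 * (g 3 * g 4)))))"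
proof -
 have s: "{1..5} = {1, 2, 3, 4, 5::nat}" by auto
 have d: "{1, 2, 3, 4, 5} - {1::nat} = {2, 3, 4, 5}" "{1, 2, 3, 4, 5} - {2::nat} = {1, 3, 4, 5}" "{1, 2, 3, 4, 5} - {3::nat} = {1, 2, 4, 5}"
  "{1, 2, 3, 4, 5} - {4::nat} = {1, 2, 3, 5}" "{1, 2, 3, 4, 5} - {5::nat} = {1, 2, 3, 4}" by auto
 have "(\<Sum>k\<in>{1, 2, 3, 4, 5}. F k) = F 1 + (F 2 + (F 3 + (F 4 + F 5)))" for F :: "nat => ennreal" by simp
 note e = this
 have p: "(\<Prod>j\<in>{x, y, z, w}. g j) = g x * g y * (g z * g w)" if "x \<noteq> y" "x \<noteq> z" "x \<noteq> w" "y \<noteq> z" "y \<noteq> w" "z \<noteq> w" for x y z w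
  using that by (simp add: mult.assoc)
 show ?thesis unfolding s e d by (subst (1 2 3 4 5) p) simp_all
qed

lemma prod_3_5: "(\<Prod>j\<in>{3..5::nat}. f j) = f 3 * f 4 * (f 5 :: complex)"
proof -
 have s: "{3..5} = {3, 4, 5::nat}" by auto
 show ?thesis unfolding s by (simp add: mult.assoc)
qed

theorem theorem5p2:
  fixes s :: real
  assumes "s \<ge> 1/2"
  shows "\<exists>\<epsilon>>0. \<exists>C>0. \<forall>T1 \<tau> (v :: nat \<Rightarrow> int \<Rightarrow> real \<Rightarrow> complex).
    0 < T1 \<longrightarrow> T1 \<le> 1 \<longrightarrow> 0 < \<tau> \<longrightarrow> \<tau> \<le> 1 \<longrightarrow> \<tau> \<le> 2 * T1 \<longrightarrow>
    (\<forall>j\<in>{1..5}. (\<forall>n. torus_fun (v j n)) \<and> supported_on_grid \<tau> T1 (v j)) \<longrightarrow>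
      Z_norm \<tau> s (-1/2)
        (\<lambda>n. Proj \<tau> (\<lambda>x. Proj \<tau> (v 1 n) x * Proj \<tau> (v 2 n) x * ddx (Proj \<tau> (conj_fun (v 3 n))) x))
      \<le> ennreal (C * T1 powr \<epsilon>) *
          (\<Sum>k\<in>{1..3}. X_norm \<tau> s (1/2) (v k) * (\<Prod>j\<in>{1..3} - {k}. X_norm \<tau> (1/2) (1/2) (v j)))
    \<and> X_norm \<tau> s (-3/8)
        (\<lambda>n. Proj \<tau> (\<lambda>x. Proj \<tau> (conj_fun (v 1 n)) x * Proj \<tau> (conj_fun (v 2 n)) x
                          * (\<Prod>j\<in>{3..5}. Proj \<tau> (v j n) x)))
      \<le> ennreal (C * T1 powr \<epsilon>) *
          (\<Sum>k\<in>{1..5}. X_norm \<tau> s (1/2) (v k) * (\<Prod>j\<in>{1..5} - {k}. X_norm \<tau> (1/2) (1/2) (v j)))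
    \<and> X_norm \<tau> s (-3/8)
        (\<lambda>n. Proj \<tau> (\<lambda>x. Proj \<tau> (conj_fun (v 3 n)) x * Proj \<tau> (v 4 n) x * Proj \<tau> (v 5 n) x))
      \<le> ennreal (C * T1 powr \<epsilon>) *
          (\<Sum>k\<in>{3..5}. X_norm \<tau> s (1/2) (v k) * (\<Prod>j\<in>{3..5} - {k}. X_norm \<tau> (1/2) (1/2) (v j)))
    \<and> X_norm \<tau> s 0
        (\<lambda>n x. of_real (psi (\<lambda>m. Proj \<tau> (v 1 m)) n - psi (\<lambda>m. Proj \<tau> (v 2 m)) n) * Proj \<tau> (v 3 n) x)
      \<le> ennreal (C * T1 powr \<epsilon>) * (1 + XZ_norm \<tau> (v 1) + XZ_norm \<tau> (v 2)) ^ 3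
          * XZ_norm \<tau> (\<lambda>n x. v 1 n x - v 2 n x) * X_norm \<tau> s (1/2) (v 3)"
proof -
 have s0: "s \<ge> 0" using assms by simp
 obtain A1 where A1: "A1 < \<infinity>" "\<forall>dt T1 u1 u2 u3. time_step dt --> 0 < T1 --> T1 <= 1 --> dt <= 2 * T1 -->
  fsup (grid dt T1) u1 --> fsup (grid dt T1) u2 --> fsup (grid dt T1) u3 -->
  Z_norm dt s (-1/2) (%n. Proj dt (%x. Proj dt (u1 n) x * Proj dt (u2 n) x * ddx (Proj dt (conj_fun (u3 n))) x)) <=
  A1 * Tg T1 *
  (mixt (Xs dt s) (Xh dt) u1 u2 u3)"
  using trilinear_estimate[OF assms] by (elim exE conjE) (rule that)
 obtain A2 where A2: "A2 < \<infinity>" "\<forall>dt T1 u1 u2 u3 u4 u5. time_step dt --> 0 < T1 --> T1 <= 1 --> dt <= 2 * T1 -->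
  fsup (grid dt T1) u1 --> fsup (grid dt T1) u2 --> fsup (grid dt T1) u3 --> fsup (grid dt T1) u4 --> fsup (grid dt T1) u5 -->
  X_norm dt s (-3/8) (%n. Proj dt (%x. Proj dt (conj_fun (u1 n)) x * Proj dt (conj_fun (u2 n)) x * (Proj dt (u3 n) x * Proj dt (u4 n) x * Proj dt (u5 n) x))) <=
  A2 * Tg T1 *
  (mix5 (Xs dt s) (Xh dt) u1 u2 u3 u4 u5)"
  using quintic_estimate[OF s0] by (elim exE conjE) (rule that)
 obtain A3 where A3: "A3 < \<infinity>" "\<forall>dt T1 u1 u2 u3. time_step dt --> 0 < T1 --> T1 <= 1 --> dt <= 2 * T1 -->
  fsup (grid dt T1) u1 --> fsup (grid dt T1) u2 --> fsup (grid dt T1) u3 -->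
  X_norm dt s (-3/8) (%n. Proj dt (%x. Proj dt (conj_fun (u1 n)) x * Proj dt (u2 n) x * Proj dt (u3 n) x)) <=
  A3 * Tg T1 *
  (mix3 (Xs dt s) (Xh dt) u1 u2 u3)"
  using cubic_estimate[OF s0] by (elim exE conjE) (rule that)
 obtain A4 where A4: "A4 < \<infinity>" "\<forall>dt T1 u1 u2 u3. time_step dt --> 0 < T1 --> T1 <= 1 --> dt <= 2 * T1 -->
  fsup (grid dt T1) u1 --> fsup (grid dt T1) u2 --> fsup (grid dt T1) u3 --> (\<forall>n. torus_fun (u1 n)) --> (\<forall>n. torus_fun (u2 n)) -->
  X_norm dt s 0 (%n x. of_real (psi (%m. Proj dt (u1 m)) n - psi (%m. Proj dt (u2 m)) n) * Proj dt (u3 n) x) <=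
  A4 * Tg T1 * (1 + XZ_norm dt u1 + XZ_norm dt u2) ^ 3 * XZ_norm dt (%n x. u1 n x - u2 n x) * Xs dt s u3"
  using psi_estimate[of s] by (elim exE conjE) (rule that)
 \<comment> \<open>One constant for all four estimates; the summand 1 keeps it positive.\<close>
 define C where "C = 1 + enn2real A1 + enn2real A2 + enn2real A3 + enn2real A4"
 have C0: "C > 0" unfolding C_def using enn2real_nonneg[of A1] enn2real_nonneg[of A2] enn2real_nonneg[of A3] enn2real_nonneg[of A4] by linarith
 have AC: "A1 <= en C" "A2 <= en C" "A3 <= en C" "A4 <= en C"
 proof -
  have "A <= en C" if "A < \<infinity>" "enn2real A <= C" for A
   using that ennreal_leI[OF that(2)] by simp
  then show "A1 <= en C" "A2 <= en C" "A3 <= en C" "A4 <= en C"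
   using A1(1) A2(1) A3(1) A4(1) by (simp_all add: C_def)
 qed
 have up: "A * en t <= en (C * t)" if "A <= en C" "0 <= t" for A t
  using mult_right_mono[OF that(1), of "en t"] that(2) C0 by (simp add: ennreal_mult)
 show ?thesis
 proof (intro exI conjI allI impI)
  show "(1/200::real) > 0" "C > 0" using C0 by simp_all
  fix T1 dt :: real and v :: "nat => int => real => complex"
  assume T: "0 < T1" "T1 <= 1" and dt: "0 < dt" "dt <= 1" and T': "dt <= 2 * T1"
   and v: "\<forall>j\<in>{1..5}. (\<forall>n. torus_fun (v j n)) \<and> supported_on_grid dt T1 (v j)"
  have ts: "time_step dt" by (rule time_step.intro) (use dt in auto)
  have f: "fsup (grid dt T1) (v 1)" "fsup (grid dt T1) (v 2)" "fsup (grid dt T1) (v 3)" "fsup (grid dt T1) (v 4)" "fsup (grid dt T1) (v 5)"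
   by (intro fsup_grid[OF dt(1) T'] conjunct2[OF v[rule_format]]; simp)+
  have tor: "\<forall>n. torus_fun (v 1 n)" "\<forall>n. torus_fun (v 2 n)"
   by (intro conjunct1[OF v[rule_format]]; simp)+
  let ?t = "T1 powr (1/200)"
  show "Z_norm dt s (-1/2) (%n. Proj dt (%x. Proj dt (v 1 n) x * Proj dt (v 2 n) x * ddx (Proj dt (conj_fun (v 3 n))) x))
   <= en (C * ?t) * (\<Sum>k\<in>{1..3}. Xs dt s (v k) * (\<Prod>j\<in>{1..3} - {k}. Xh dt (v j)))"
   unfolding sum_prod_3
   by (rule order_trans[OF A1(2)[rule_format, OF ts T T' f(1-3)] mult_right_mono[OF up[OF AC(1)]]]) auto
  show "X_norm dt s (-3/8) (%n. Proj dt (%x. Proj dt (conj_fun (v 1 n)) x * Proj dt (conj_fun (v 2 n)) x * (\<Prod>j\<in>{3..5}. Proj dt (v j n) x)))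
   <= en (C * ?t) * (\<Sum>k\<in>{1..5}. Xs dt s (v k) * (\<Prod>j\<in>{1..5} - {k}. Xh dt (v j)))"
   unfolding sum_prod_5 prod_3_5
   by (rule order_trans[OF A2(2)[rule_format, OF ts T T' f] mult_right_mono[OF up[OF AC(2)]]]) auto
  show "X_norm dt s (-3/8) (%n. Proj dt (%x. Proj dt (conj_fun (v 3 n)) x * Proj dt (v 4 n) x * Proj dt (v 5 n) x))
   <= en (C * ?t) * (\<Sum>k\<in>{3..5}. Xs dt s (v k) * (\<Prod>j\<in>{3..5} - {k}. Xh dt (v j)))"
   unfolding sum_prod_3
   by (rule order_trans[OF A3(2)[rule_format, OF ts T T' f(3-5)] mult_right_mono[OF up[OF AC(3)]]]) auto
  show "X_norm dt s 0 (%n x. of_real (psi (%m. Proj dt (v 1 m)) n - psi (%m. Proj dt (v 2 m)) n) * Proj dt (v 3 n) x)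
   <= en (C * ?t) * (1 + XZ_norm dt (v 1) + XZ_norm dt (v 2)) ^ 3 * XZ_norm dt (%n x. v 1 n x - v 2 n x) * Xs dt s (v 3)"
   by (rule order_trans[OF A4(2)[rule_format, OF ts T T' f(1-3) tor[rule_format]]])
    (intro mult_right_mono up[OF AC(4)], auto)
 qed
qed

end
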